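(* Let $T$ be a tree with at least two vertices as well as a unary vertex $r$ at the root, and let $p:X\to Y$ be an inner Kan fibration between $\infty$-operads. Let $f:\Lambda^r[T]\to X$ and $g:\Omega[T]\to Y$ be maps of dendroidal sets such that $pf$ is the restriction of $g$ to $\Lambda^r[T]$, and such that $f(r)$ is weakly invertible in $X$. Then there exists a map $h:\Omega[T]\to X$ with $ph=g$ and $h|_{\Lambda^r[T]}=f$.
   Context: $\Omega$ is the category of trees: objects are non-empty finite non-planar rooted trees (vertices may have any number $\geq 0$ of inputs; outer edges are the leaves and the root edge); each tree $T$ generates a free coloured symmetric operad, again denoted $T$, with colours the edges and generating operations the vertices, and morphisms of $\Omega$ are morphisms of operads. Dendroidal sets are presheaves of sets on $\Omega$; $\Omega[T]$ is represented by $T$. Elementary faces of $T$: for an inner edge $e$, the inner face $\partial_e:T/e\to T$ ($T/e$ contracts $e$); for a vertex $v$ all but one of whose incident edges are outer, the outer face $\partial_v:T/v\to T$ ($T/v$ removes $v$ and the outer edges incident to it). For an inner edge $e$, the inner horn $\Lambda^e[T]\subset\Omega[T]$ is the union of the images of all elementary faces other than $\partial_e$. If $r$ is a unary vertex at the root (i.e. $r$ is the vertex whose output is the root edge and it has exactly one input edge) and $T$ has at least two vertices, $\Lambda^r[T]\subset\Omega[T]$ is the union of the images of all elementary faces other than the outer face $\partial_r$ (which removes $r$ and the root edge). Inner Kan fibrations are the maps with the right lifting property with respect to all inner horn inclusions; $X$ is an $\infty$-operad if the map from $X$ to the terminal dendroidal set is an inner Kan fibration. The functor $i:\Delta\to\Omega$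 sends $[n]$ to the linear tree with edges $0$ (leaf), …, $n$ (root), and $i^*$ is restriction of presheaves along $i$. For an $\infty$-operad $X$, a $1$-simplex $\Delta[1]\to i^*(X)$ (equivalently a map $\Omega[i[1]]\to X$) is weakly invertible if the corresponding morphism of the category $\tau(i^*(X))$ is an isomorphism, where $\tau:\mathrm{sSet}\to\mathrm{Cat}$ is left adjoint to the nerve. The vertex $r$ defines a map $\Omega[i[1]]\to\Lambda^r[T]$ (the subtree consisting of $r$ and its two edges), and $f(r)$ is its composite with $f$. *)

theory Defs
  imports Main "HOL-Library.FuncSet" "HOL-Combinatorics.Permutations"
begin

section \<open>Categories, functors and presheaves\<close>

text \<open>
  \<open>Comp C a b c g f\<close> is the composite \<open>g \<circ> f\<close> of \<open>f : a \<rightarrow> b\<close> and \<open>g : b \<rightarrow> c\<close>; hom sets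
  attached to different pairs of objects need not be disjoint.
\<close>

record ('o, 'm) cat =
  Ob :: "'o set"
  Hom :: "'o \<Rightarrow> 'o \<Rightarrow> 'm set"
  Id :: "'o \<Rightarrow> 'm"
  Comp :: "'o \<Rightarrow> 'o \<Rightarrow> 'o \<Rightarrow> 'm \<Rightarrow> 'm \<Rightarrow> 'm"

definition category :: "('o, 'm) cat \<Rightarrow> bool" where
  "category C \<longleftrightarrow>
     (\<forall>a\<in>Ob C. Id C a \<in> Hom C a a) \<and>
     (\<forall>a\<in>Ob C. \<forall>b\<in>Ob C. \<forall>c\<in>Ob C. \<forall>f\<in>Hom C a b. \<forall>g\<in>Hom C b c.
        Comp C a b c g f \<in> Hom C a c) \<and>
     (\<forall>a\<in>Ob C. \<forall>b\<in>Ob C. \<forall>f\<in>Hom C a b.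
        Comp C a a b f (Id C a) = f \<and> Comp C a b b (Id C b) f = f) \<and>
     (\<forall>a\<in>Ob C. \<forall>b\<in>Ob C. \<forall>c\<in>Ob C. \<forall>d\<in>Ob C.
        \<forall>f\<in>Hom C a b. \<forall>g\<in>Hom C b c. \<forall>h\<in>Hom C c d.
        Comp C a c d h (Comp C a b c g f) = Comp C a b d (Comp C b c d h g) f)"

definition is_isomorphism :: "('o, 'm) cat \<Rightarrow> 'o \<Rightarrow> 'o \<Rightarrow> 'm \<Rightarrow> bool" where
  "is_isomorphism C a b f \<longleftrightarrow>
     f \<in> Hom C a b \<and>
     (\<exists>g\<in>Hom C b a. Comp C a b a g f = Id C a \<and> Comp C b a b f g = Id C b)"

definition is_functor ::
    "('o, 'm) cat \<Rightarrow> ('p, 'n) cat \<Rightarrow> ('o \<Rightarrow> 'p) \<Rightarrow> ('o \<Rightarrow> 'o \<Rightarrow> 'm \<Rightarrow> 'n) \<Rightarrow> bool" where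
  "is_functor C D F\<^sub>0 F\<^sub>1 \<longleftrightarrow>
     (\<forall>a\<in>Ob C. F\<^sub>0 a \<in> Ob D) \<and>
     (\<forall>a\<in>Ob C. \<forall>b\<in>Ob C. \<forall>f\<in>Hom C a b. F\<^sub>1 a b f \<in> Hom D (F\<^sub>0 a) (F\<^sub>0 b)) \<and>
     (\<forall>a\<in>Ob C. F\<^sub>1 a a (Id C a) = Id D (F\<^sub>0 a)) \<and>
     (\<forall>a\<in>Ob C. \<forall>b\<in>Ob C. \<forall>c\<in>Ob C. \<forall>f\<in>Hom C a b. \<forall>g\<in>Hom C b c.
        F\<^sub>1 a c (Comp C a b c g f) = Comp D (F\<^sub>0 a) (F\<^sub>0 b) (F\<^sub>0 c) (F\<^sub>1 b c g) (F\<^sub>1 a b f))"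

text \<open>For \<open>f : a \<rightarrow> b\<close>, the map \<open>Restr X a b f\<close> goes from \<open>Cell X b\<close> to \<open>Cell X a\<close>.\<close>

record ('o, 'm, 'x) psh =
  Cell :: "'o \<Rightarrow> 'x set"
  Restr :: "'o \<Rightarrow> 'o \<Rightarrow> 'm \<Rightarrow> 'x \<Rightarrow> 'x"

definition presheaf :: "('o, 'm) cat \<Rightarrow> ('o, 'm, 'x) psh \<Rightarrow> bool" where
  "presheaf C X \<longleftrightarrow>
     (\<forall>a\<in>Ob C. \<forall>b\<in>Ob C. \<forall>f\<in>Hom C a b. \<forall>x\<in>Cell X b. Restr X a b f x \<in> Cell X a) \<and>
     (\<forall>a\<in>Ob C. \<forall>x\<in>Cell X a. Restr X a a (Id C a) x = x) \<and>
     (\<forall>a\<in>Ob C. \<forall>b\<in>Ob C. \<forall>c\<in>Ob C. \<forall>f\<in>Hom C a b. \<forall>g\<in>Hom C b c. \<forall>x\<in>Cell X c.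
        Restr X a c (Comp C a b c g f) x = Restr X a b f (Restr X b c g x))"

definition presheaf_map ::
    "('o, 'm) cat \<Rightarrow> ('o, 'm, 'x) psh \<Rightarrow> ('o, 'm, 'y) psh \<Rightarrow> ('o \<Rightarrow> 'x \<Rightarrow> 'y) \<Rightarrow> bool" where
  "presheaf_map C X Y \<phi> \<longleftrightarrow>
     (\<forall>a\<in>Ob C. \<forall>x\<in>Cell X a. \<phi> a x \<in> Cell Y a) \<and>
     (\<forall>a\<in>Ob C. \<forall>b\<in>Ob C. \<forall>f\<in>Hom C a b. \<forall>x\<in>Cell X b.
        \<phi> a (Restr X a b f x) = Restr Y a b f (\<phi> b x))"

definition representable :: "('o, 'm) cat \<Rightarrow> 'o \<Rightarrow> ('o, 'm, 'm) psh" where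
  "representable C c =
     \<lparr>Cell = (\<lambda>a. Hom C a c), Restr = (\<lambda>a b f x. Comp C a b c x f)\<rparr>"

definition terminal_psh :: "('o, 'm, unit) psh" where
  "terminal_psh = \<lparr>Cell = (\<lambda>a. UNIV), Restr = (\<lambda>a b f x. x)\<rparr>"

definition pullback_psh ::
    "('o \<Rightarrow> 'p) \<Rightarrow> ('o \<Rightarrow> 'o \<Rightarrow> 'm \<Rightarrow> 'n) \<Rightarrow> ('p, 'n, 'x) psh \<Rightarrow> ('o, 'm, 'x) psh" where
  "pullback_psh F\<^sub>0 F\<^sub>1 X =
     \<lparr>Cell = (\<lambda>a. Cell X (F\<^sub>0 a)), Restr = (\<lambda>a b f. Restr X (F\<^sub>0 a) (F\<^sub>0 b) (F\<^sub>1 a b f))\<rparr>"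

definition right_lifting ::
    "('o, 'm) cat \<Rightarrow> ('o, 'm, 'a) psh \<Rightarrow> ('o, 'm, 'b) psh \<Rightarrow> ('o \<Rightarrow> 'a \<Rightarrow> 'b) \<Rightarrow>
     ('o, 'm, 'x) psh \<Rightarrow> ('o, 'm, 'y) psh \<Rightarrow> ('o \<Rightarrow> 'x \<Rightarrow> 'y) \<Rightarrow> bool" where
  "right_lifting C A B j X Y p \<longleftrightarrow>
     (\<forall>u v. presheaf_map C A X u \<longrightarrow> presheaf_map C B Y v \<longrightarrow>
        (\<forall>c\<in>Ob C. \<forall>x\<in>Cell A c. p c (u c x) = v c (j c x)) \<longrightarrow>
        (\<exists>h. presheaf_map C B X h \<and>
           (\<forall>c\<in>Ob C. \<forall>x\<in>Cell B c. p c (h c x) = v c x) \<and>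
           (\<forall>c\<in>Ob C. \<forall>x\<in>Cell A c. h c (j c x) = u c x)))"


section \<open>Simplicial sets, the nerve and its left adjoint\<close>

definition Delta :: "(nat, nat \<Rightarrow> nat) cat" where
  "Delta =
     \<lparr>Ob = UNIV,
      Hom = (\<lambda>m n. {\<alpha> \<in> {..m} \<rightarrow>\<^sub>E {..n}. mono_on {..m} \<alpha>}),
      Id = (\<lambda>n. \<lambda>i\<in>{..n}. i),
      Comp = (\<lambda>k m n \<beta> \<alpha>. compose {..k} \<beta> \<alpha>)\<rparr>"

type_synonym 'x sset = "(nat, nat \<Rightarrow> nat, 'x) psh"

definition ord_cat :: "nat \<Rightarrow> (nat, unit) cat" where
  "ord_cat n =
     \<lparr>Ob = {..n}, Hom = (\<lambda>i j. if i \<le> j then {()} else {}),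
      Id = (\<lambda>i. ()), Comp = (\<lambda>i j k g f. ())\<rparr>"

text \<open>
  An \<open>n\<close>-simplex of the nerve is a functor \<open>[n] \<rightarrow> D\<close>.  So that each functor occurs only once,
  its values outside \<open>[n]\<close> are normalised to \<open>undefined\<close>.
\<close>

definition truncate_functor ::
    "nat \<Rightarrow> (nat \<Rightarrow> 'o) \<times> (nat \<Rightarrow> nat \<Rightarrow> unit \<Rightarrow> 'm) \<Rightarrow>
     (nat \<Rightarrow> 'o) \<times> (nat \<Rightarrow> nat \<Rightarrow> unit \<Rightarrow> 'm)" where
  "truncate_functor n F =
     (\<lambda>i\<in>{..n}. fst F i, \<lambda>i j u. if i \<le> j \<and> j \<le> n then snd F i j u else undefined)"

definition nerve ::
    "('o, 'm) cat \<Rightarrow> ((nat \<Rightarrow> 'o) \<times> (nat \<Rightarrow> nat \<Rightarrow> unit \<Rightarrow> 'm)) sset" where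
  "nerve D =
     \<lparr>Cell = (\<lambda>n. {F. is_functor (ord_cat n) D (fst F) (snd F) \<and> truncate_functor n F = F}),
      Restr = (\<lambda>m n \<alpha> F.
        truncate_functor m (\<lambda>i. fst F (\<alpha> i), \<lambda>i j u. snd F (\<alpha> i) (\<alpha> j) u))\<rparr>"

definition svertex :: "'x sset \<Rightarrow> nat \<Rightarrow> nat \<Rightarrow> 'x \<Rightarrow> 'x" where
  "svertex S n i s = Restr S 0 n (\<lambda>k\<in>{..0}. i) s"

definition sedge :: "'x sset \<Rightarrow> nat \<Rightarrow> nat \<Rightarrow> nat \<Rightarrow> 'x \<Rightarrow> 'x" where
  "sedge S n i j s = Restr S 1 n (\<lambda>k\<in>{..1}. if k = 0 then i else j) s"

text \<open>
  The left adjoint \<open>\<tau>\<close> of the nerve, by generators and relations: the free category on the graph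
  of vertices and edges of \<open>S\<close>, modulo \<open>s\<^sub>0 z = id\<close> for vertices \<open>z\<close> and
  \<open>d\<^sub>1 s = d\<^sub>0 s \<circ> d\<^sub>2 s\<close> for 2-simplices \<open>s\<close>.  Paths are listed in the order in which they are
  traversed.  The adjunction is theorem \<open>tau_universal\<close> below.
\<close>

fun spath :: "'x sset \<Rightarrow> 'x \<Rightarrow> 'x list \<Rightarrow> 'x \<Rightarrow> bool" where
  "spath S x [] y \<longleftrightarrow> x \<in> Cell S 0 \<and> x = y"
| "spath S x (u # us) y \<longleftrightarrow>
     u \<in> Cell S 1 \<and> svertex S 1 0 u = x \<and> spath S (svertex S 1 1 u) us y"

inductive tau_eq :: "'x sset \<Rightarrow> 'x \<Rightarrow> 'x \<Rightarrow> 'x list \<Rightarrow> 'x list \<Rightarrow> bool" for S x y where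
  refl: "spath S x us y \<Longrightarrow> tau_eq S x y us us"
| sym: "tau_eq S x y us vs \<Longrightarrow> tau_eq S x y vs us"
| trans: "tau_eq S x y us vs \<Longrightarrow> tau_eq S x y vs ws \<Longrightarrow> tau_eq S x y us ws"
| degenerate: "z \<in> Cell S 0 \<Longrightarrow> spath S x (us @ [sedge S 0 0 0 z] @ vs) y \<Longrightarrow>
    tau_eq S x y (us @ [sedge S 0 0 0 z] @ vs) (us @ vs)"
| triangle: "s \<in> Cell S 2 \<Longrightarrow> spath S x (us @ [sedge S 2 0 1 s, sedge S 2 1 2 s] @ vs) y \<Longrightarrow>
    tau_eq S x y (us @ [sedge S 2 0 1 s, sedge S 2 1 2 s] @ vs) (us @ [sedge S 2 0 2 s] @ vs)"

definition tau_class :: "'x sset \<Rightarrow> 'x \<Rightarrow> 'x \<Rightarrow> 'x list \<Rightarrow> 'x list set" where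
  "tau_class S x y us = {vs. tau_eq S x y us vs}"

definition tau :: "'x sset \<Rightarrow> ('x, 'x list set) cat" where
  "tau S =
     \<lparr>Ob = Cell S 0,
      Hom = (\<lambda>x y. {tau_class S x y us | us. spath S x us y}),
      Id = (\<lambda>x. tau_class S x x []),
      Comp = (\<lambda>x y z Q P. \<Union>p\<in>P. \<Union>q\<in>Q. tau_class S x z (p @ q))\<rparr>"

definition tau_mor :: "'x sset \<Rightarrow> 'x \<Rightarrow> 'x list set" where
  "tau_mor S u = tau_class S (svertex S 1 0 u) (svertex S 1 1 u) [u]"


section \<open>Coloured symmetric operads\<close>

text \<open>
  \<open>Compose P p [q\<^sub>1, \<dots>, q\<^sub>n]\<close> is the full composite \<open>p \<circ> (q\<^sub>1, \<dots>, q\<^sub>n)\<close>; \<open>Act P \<sigma> p\<close> is the right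
  action of a permutation \<open>\<sigma>\<close> of the input positions \<open>0, \<dots>, n - 1\<close>.
\<close>

record ('c, 'o) opd =
  Colours :: "'c set"
  Ops :: "'o set"
  Inputs :: "'o \<Rightarrow> 'c list"
  Output :: "'o \<Rightarrow> 'c"
  Unit :: "'c \<Rightarrow> 'o"
  Compose :: "'o \<Rightarrow> 'o list \<Rightarrow> 'o"
  Act :: "(nat \<Rightarrow> nat) \<Rightarrow> 'o \<Rightarrow> 'o"

definition composable :: "('c, 'o) opd \<Rightarrow> 'o \<Rightarrow> 'o list \<Rightarrow> bool" where
  "composable P p qs \<longleftrightarrow> p \<in> Ops P \<and> set qs \<subseteq> Ops P \<and> map (Output P) qs = Inputs P p"

text \<open>
  In the equivariance axiom, the inputs of the composite of \<open>p\<close> with \<open>qs\<close> are labelled by pairs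
  \<open>(i, j)\<close>, standing for the \<open>j\<close>-th input of the \<open>i\<close>-th operation in \<open>qs\<close>.  The permutation \<open>\<rho>\<close>
  rearranging these labels as prescribed is the block permutation determined by \<open>\<sigma>\<close> and \<open>\<tau>s\<close>.
\<close>

definition input_labels :: "('c, 'o) opd \<Rightarrow> 'o list \<Rightarrow> (nat \<times> nat) list list" where
  "input_labels P qs = map (\<lambda>i. map (Pair i) [0..<length (Inputs P (qs ! i))]) [0..<length qs]"

definition symmetric_operad :: "('c, 'o) opd \<Rightarrow> bool" where
  "symmetric_operad P \<longleftrightarrow>
     (\<forall>p\<in>Ops P. set (Inputs P p) \<subseteq> Colours P \<and> Output P p \<in> Colours P) \<and>
     (\<forall>c\<in>Colours P. Unit P c \<in> Ops P \<and> Inputs P (Unit P c) = [c] \<and> Output P (Unit P c) = c) \<and>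
     (\<forall>p qs. composable P p qs \<longrightarrow>
        Compose P p qs \<in> Ops P \<and>
        Inputs P (Compose P p qs) = concat (map (Inputs P) qs) \<and>
        Output P (Compose P p qs) = Output P p) \<and>
     (\<forall>p\<in>Ops P. \<forall>\<sigma>. \<sigma> permutes {..<length (Inputs P p)} \<longrightarrow>
        Act P \<sigma> p \<in> Ops P \<and>
        Inputs P (Act P \<sigma> p) = permute_list \<sigma> (Inputs P p) \<and>
        Output P (Act P \<sigma> p) = Output P p) \<and>
     (\<forall>p\<in>Ops P. Compose P p (map (Unit P) (Inputs P p)) = p \<and>
        Compose P (Unit P (Output P p)) [p] = p) \<and>
     (\<forall>p qs rss. composable P p qs \<longrightarrow> list_all2 (composable P) qs rss \<longrightarrow>
        Compose P (Compose P p qs) (concat rss) = Compose P p (map2 (Compose P) qs rss)) \<and>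
     (\<forall>p\<in>Ops P. Act P id p = p) \<and>
     (\<forall>p\<in>Ops P. \<forall>\<sigma> \<tau>. \<sigma> permutes {..<length (Inputs P p)} \<longrightarrow>
        \<tau> permutes {..<length (Inputs P p)} \<longrightarrow> Act P (\<sigma> \<circ> \<tau>) p = Act P \<tau> (Act P \<sigma> p)) \<and>
     (\<forall>p qs \<sigma> \<tau>s \<rho>. composable P p qs \<longrightarrow> \<sigma> permutes {..<length qs} \<longrightarrow>
        list_all2 (\<lambda>\<tau> q. \<tau> permutes {..<length (Inputs P q)}) \<tau>s qs \<longrightarrow>
        \<rho> permutes {..<length (concat (input_labels P qs))} \<longrightarrow>
        permute_list \<rho> (concat (input_labels P qs)) =
          concat (permute_list \<sigma> (map2 permute_list \<tau>s (input_labels P qs))) \<longrightarrow>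
        Compose P (Act P \<sigma> p) (permute_list \<sigma> (map2 (Act P) \<tau>s qs)) =
          Act P \<rho> (Compose P p qs))"

definition operad_map ::
    "('c, 'o) opd \<Rightarrow> ('d, 'p) opd \<Rightarrow> ('c \<Rightarrow> 'd) \<Rightarrow> ('o \<Rightarrow> 'p) \<Rightarrow> bool" where
  "operad_map P Q f\<^sub>0 f\<^sub>1 \<longleftrightarrow>
     (\<forall>c\<in>Colours P. f\<^sub>0 c \<in> Colours Q) \<and>
     (\<forall>p\<in>Ops P. f\<^sub>1 p \<in> Ops Q \<and>
        Inputs Q (f\<^sub>1 p) = map f\<^sub>0 (Inputs P p) \<and> Output Q (f\<^sub>1 p) = f\<^sub>0 (Output P p)) \<and>
     (\<forall>c\<in>Colours P. f\<^sub>1 (Unit P c) = Unit Q (f\<^sub>0 c)) \<and>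
     (\<forall>p qs. composable P p qs \<longrightarrow> f\<^sub>1 (Compose P p qs) = Compose Q (f\<^sub>1 p) (map f\<^sub>1 qs)) \<and>
     (\<forall>p\<in>Ops P. \<forall>\<sigma>. \<sigma> permutes {..<length (Inputs P p)} \<longrightarrow>
        f\<^sub>1 (Act P \<sigma> p) = Act Q \<sigma> (f\<^sub>1 p))"


section \<open>Trees and the category \<open>\<Omega>\<close>\<close>

text \<open>
  A vertex is the pair of its set of inputs and its output.  Since every edge is the output of at
  most one vertex, different vertices are different pairs.  Taking natural numbers as edges
  loses nothing up to isomorphism of trees, and makes \<open>\<Omega>\<close> a small category.
\<close>

type_synonym vert = "nat set \<times> nat"

record tree =
  edges :: "nat set"
  verts :: "vert set"
  root :: nat

definition is_tree :: "tree \<Rightarrow> bool" where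
  "is_tree T \<longleftrightarrow>
     finite (edges T) \<and> root T \<in> edges T \<and>
     (\<forall>(I, e)\<in>verts T. I \<subseteq> edges T \<and> e \<in> edges T \<and> root T \<notin> I) \<and>
     (\<forall>v\<in>verts T. \<forall>w\<in>verts T. snd v = snd w \<longrightarrow> v = w) \<and>
     (\<forall>v\<in>verts T. \<forall>w\<in>verts T. fst v \<inter> fst w \<noteq> {} \<longrightarrow> v = w) \<and>
     (\<forall>e\<in>edges T. (e, root T) \<in> {(a, b). \<exists>I. (I, b) \<in> verts T \<and> a \<in> I}\<^sup>*)"

text \<open>
  The signatures of the operations of the free operad on \<open>T\<close>: what the vertices (with their inputs
  listed in any order) generate.  In this free operad there is at most one operation of each
  signature, so operations can be identified with their signatures; see
  \<open>tree_operad_free\<close> below for the universal property.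
\<close>

inductive_set tree_ops :: "tree \<Rightarrow> (nat list \<times> nat) set" for T where
  unit: "e \<in> edges T \<Longrightarrow> ([e], e) \<in> tree_ops T"
| vert: "(set es, e) \<in> verts T \<Longrightarrow> distinct es \<Longrightarrow> (es, e) \<in> tree_ops T"
| compose: "(map snd qs, e) \<in> tree_ops T \<Longrightarrow> \<forall>q\<in>set qs. q \<in> tree_ops T \<Longrightarrow>
    (concat (map fst qs), e) \<in> tree_ops T"
| act: "(es, e) \<in> tree_ops T \<Longrightarrow> \<sigma> permutes {..<length es} \<Longrightarrow>
    (permute_list \<sigma> es, e) \<in> tree_ops T"

definition tree_operad :: "tree \<Rightarrow> (nat, nat list \<times> nat) opd" where
  "tree_operad T =
     \<lparr>Colours = edges T, Ops = tree_ops T, Inputs = fst, Output = snd,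
      Unit = (\<lambda>e. ([e], e)),
      Compose = (\<lambda>p qs. (concat (map fst qs), snd p)),
      Act = (\<lambda>\<sigma> p. (permute_list \<sigma> (fst p), snd p))\<rparr>"

type_synonym tree_mor = "(nat \<Rightarrow> nat) \<times> (nat list \<times> nat \<Rightarrow> nat list \<times> nat)"

definition Omega :: "(tree, tree_mor) cat" where
  "Omega =
     \<lparr>Ob = {T. is_tree T},
      Hom = (\<lambda>S T. {(f\<^sub>0, f\<^sub>1). operad_map (tree_operad S) (tree_operad T) f\<^sub>0 f\<^sub>1 \<and>
                      f\<^sub>0 \<in> extensional (edges S) \<and> f\<^sub>1 \<in> extensional (tree_ops S)}),
      Id = (\<lambda>T. (\<lambda>e\<in>edges T. e, \<lambda>p\<in>tree_ops T. p)),
      Comp = (\<lambda>R S T g f. (compose (edges R) (fst g) (fst f), compose (tree_ops R) (snd g) (snd f)))\<rparr>"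

type_synonym 'x dset = "(tree, tree_mor, 'x) psh"

abbreviation dendroidal_set :: "'x dset \<Rightarrow> bool" where
  "dendroidal_set \<equiv> presheaf Omega"

abbreviation dendroidal_map :: "'x dset \<Rightarrow> 'y dset \<Rightarrow> (tree \<Rightarrow> 'x \<Rightarrow> 'y) \<Rightarrow> bool" where
  "dendroidal_map \<equiv> presheaf_map Omega"

text \<open>The map of trees given by a map \<open>f\<close> on edges, whose effect on operations is forced.\<close>

definition edge_mor :: "tree \<Rightarrow> (nat \<Rightarrow> nat) \<Rightarrow> tree_mor" where
  "edge_mor S f = (\<lambda>e\<in>edges S. f e, \<lambda>p\<in>tree_ops S. (map f (fst p), f (snd p)))"


section \<open>Faces and horns\<close>

definition leaves :: "tree \<Rightarrow> nat set" where
  "leaves T = edges T - snd ` verts T"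

definition inner_edges :: "tree \<Rightarrow> nat set" where
  "inner_edges T = edges T - leaves T - {root T}"

definition incident :: "vert \<Rightarrow> nat set" where
  "incident v = insert (snd v) (fst v)"

text \<open>
  All but one of the edges incident to an outer vertex are outer.  For a corolla this yields no
  vertex: its faces, the inclusions of its edges, play no role for the horns considered here.
\<close>

definition outer_verts :: "tree \<Rightarrow> vert set" where
  "outer_verts T = {v \<in> verts T. card (incident v \<inter> inner_edges T) = 1}"

definition contract :: "tree \<Rightarrow> nat \<Rightarrow> tree" where
  "contract T e =
     \<lparr>edges = edges T - {e},
      verts = {v \<in> verts T. e \<notin> incident v} \<union>
              {(fst w - {e} \<union> fst v, snd w) | v w.
                 v \<in> verts T \<and> w \<in> verts T \<and> snd v = e \<and> e \<in> fst w},
      root = root T\<rparr>"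

definition prune :: "tree \<Rightarrow> vert \<Rightarrow> tree" where
  "prune T v =
     \<lparr>edges = edges T - (incident v - inner_edges T),
      verts = verts T - {v},
      root = (if snd v = root T then the_elem (incident v \<inter> inner_edges T) else root T)\<rparr>"

datatype face = Inner nat | Outer vert

definition faces :: "tree \<Rightarrow> face set" where
  "faces T = Inner ` inner_edges T \<union> Outer ` outer_verts T"

fun face_tree :: "tree \<Rightarrow> face \<Rightarrow> tree" where
  "face_tree T (Inner e) = contract T e"
| "face_tree T (Outer v) = prune T v"

definition face_map :: "tree \<Rightarrow> face \<Rightarrow> tree_mor" where
  "face_map T d = edge_mor (face_tree T d) (\<lambda>e. e)"

text \<open>The union, in \<open>\<Omega>[T]\<close>, of the images of all elementary faces other than \<open>d\<close>.\<close>

definition horn :: "tree \<Rightarrow> face \<Rightarrow> tree_mor dset" where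
  "horn T d =
     \<lparr>Cell = (\<lambda>S. \<Union>d'\<in>faces T - {d}.
        {Comp Omega S (face_tree T d') T (face_map T d') \<alpha> | \<alpha>. \<alpha> \<in> Hom Omega S (face_tree T d')}),
      Restr = Restr (representable Omega T)\<rparr>"

definition inner_kan_fibration :: "'x dset \<Rightarrow> 'y dset \<Rightarrow> (tree \<Rightarrow> 'x \<Rightarrow> 'y) \<Rightarrow> bool" where
  "inner_kan_fibration X Y p \<longleftrightarrow>
     dendroidal_map X Y p \<and>
     (\<forall>T e. is_tree T \<longrightarrow> e \<in> inner_edges T \<longrightarrow>
        right_lifting Omega (horn T (Inner e)) (representable Omega T) (\<lambda>S x. x) X Y p)"

definition infinity_operad :: "'x dset \<Rightarrow> bool" where
  "infinity_operad X \<longleftrightarrow>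
     dendroidal_set X \<and> inner_kan_fibration X terminal_psh (\<lambda>S x. ())"


section \<open>Underlying simplicial sets and weakly invertible 1-simplices\<close>

definition linear_tree :: "nat \<Rightarrow> tree" where
  "linear_tree n = \<lparr>edges = {..n}, verts = {({k}, Suc k) | k. k < n}, root = n\<rparr>"

definition underlying_sset :: "'x dset \<Rightarrow> 'x sset" where
  "underlying_sset = pullback_psh linear_tree (\<lambda>m n \<alpha>. edge_mor (linear_tree m) \<alpha>)"

text \<open>
  A map \<open>k : \<Omega>[i[1]] \<rightarrow> X\<close> corresponds, by the Yoneda lemma, to the 1-simplex \<open>k(id)\<close> of \<open>i\<^sup>*X\<close>.
\<close>

definition weakly_invertible :: "'x dset \<Rightarrow> (tree \<Rightarrow> tree_mor \<Rightarrow> 'x) \<Rightarrow> bool" where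
  "weakly_invertible X k \<longleftrightarrow>
     (let S = underlying_sset X; u = k (linear_tree 1) (Id Omega (linear_tree 1))
      in is_isomorphism (tau S) (svertex S 1 0 u) (svertex S 1 1 u) (tau_mor S u))"

text \<open>For a unary vertex \<open>r\<close>, the map \<open>\<Omega>[i[1]] \<rightarrow> \<Omega>[T]\<close> whose image is the subtree on \<open>r\<close>.\<close>

definition unary_vertex_map :: "tree \<Rightarrow> vert \<Rightarrow> tree \<Rightarrow> tree_mor \<Rightarrow> tree_mor" where
  "unary_vertex_map T r S \<alpha> =
     Comp Omega S (linear_tree 1) T
       (edge_mor (linear_tree 1) (\<lambda>k. if k = 0 then the_elem (fst r) else snd r)) \<alpha>"


section \<open>The adjunction between \<open>\<tau>\<close> and the nerve\<close>

lemma psh_Delta: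
  assumes "presheaf Delta S"
  shows psh_cell: "\<And>m n \<alpha> x. \<alpha> \<in> {..m} \<rightarrow>\<^sub>E {..n} \<Longrightarrow> mono_on {..m} \<alpha> \<Longrightarrow> x \<in> Cell S n \<Longrightarrow> Restr S m n \<alpha> x \<in> Cell S m"
    and psh_id: "\<And>n x. x \<in> Cell S n \<Longrightarrow> Restr S n n (\<lambda>i\<in>{..n}. i) x = x"
    and psh_comp: "\<And>k m n \<alpha> \<beta> x. \<alpha> \<in> {..k} \<rightarrow>\<^sub>E {..m} \<Longrightarrow> mono_on {..k} \<alpha> \<Longrightarrow> \<beta> \<in> {..m} \<rightarrow>\<^sub>E {..n} \<Longrightarrow> mono_on {..m} \<beta> \<Longrightarrow> x \<in> Cell S n \<Longrightarrow>
      Restr S k m \<alpha> (Restr S m n \<beta> x) = Restr S k n (compose {..k} \<beta> \<alpha>) x"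
  using assms unfolding presheaf_def Delta_def by simp_all

lemma vmap: "i \<le> n \<Longrightarrow> (\<lambda>k\<in>{..0::nat}. i) \<in> {..0} \<rightarrow>\<^sub>E {..n} \<and> mono_on {..0} (\<lambda>k\<in>{..0::nat}. i)" for i n :: nat
  by (auto simp: mono_on_def)

lemma emap: "i \<le> j \<Longrightarrow> j \<le> n \<Longrightarrow> (\<lambda>k\<in>{..1::nat}. if k = 0 then i else j) \<in> {..1} \<rightarrow>\<^sub>E {..n} \<and> mono_on {..1} (\<lambda>k\<in>{..1::nat}. if k = 0 then i else j)" for i n :: nat
  by (auto simp: mono_on_def)

context
  fixes S :: "'x sset"
  assumes S: "presheaf Delta S"
begin

lemma svertex_cell: "s \<in> Cell S n \<Longrightarrow> i \<le> n \<Longrightarrow> svertex S n i s \<in> Cell S 0"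
  unfolding svertex_def using psh_cell[OF S] vmap by blast

lemma sedge_cell: "s \<in> Cell S n \<Longrightarrow> i \<le> j \<Longrightarrow> j \<le> n \<Longrightarrow> sedge S n i j s \<in> Cell S 1"
  unfolding sedge_def using psh_cell[OF S] emap by blast

lemma svertex_restr:
  assumes "s \<in> Cell S n" "\<alpha> \<in> {..m} \<rightarrow>\<^sub>E {..n}" "mono_on {..m} \<alpha>" "i \<le> m"
  shows "svertex S m i (Restr S m n \<alpha> s) = svertex S n (\<alpha> i) s"
proof -
  have "compose {..0} \<alpha> (\<lambda>k\<in>{..0::nat}. i) = (\<lambda>k\<in>{..0::nat}. \<alpha> i)"
    by (auto simp: compose_def)
  then show ?thesis unfolding svertex_def
    using psh_comp[OF S _ _ assms(2,3,1)] vmap[OF assms(4)] by (metis (no_types, lifting))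
qed

lemma sedge_restr:
  assumes "s \<in> Cell S n" "\<alpha> \<in> {..m} \<rightarrow>\<^sub>E {..n}" "mono_on {..m} \<alpha>" "i \<le> j" "j \<le> m"
  shows "sedge S m i j (Restr S m n \<alpha> s) = sedge S n (\<alpha> i) (\<alpha> j) s"
proof -
  have "compose {..1} \<alpha> (\<lambda>k\<in>{..1::nat}. if k = 0 then i else j) = (\<lambda>k\<in>{..1::nat}. if k = 0 then \<alpha> i else \<alpha> j)"
    by (auto simp: compose_def)
  then show ?thesis unfolding sedge_def
    using psh_comp[OF S _ _ assms(2,3,1)] emap[OF assms(4,5)] by (metis (no_types, lifting))
qed

lemma svertex_sedge:
  assumes "s \<in> Cell S n" "i \<le> j" "j \<le> n"
  shows "svertex S 1 0 (sedge S n i j s) = svertex S n i s" "svertex S 1 1 (sedge S n i j s) = svertex S n j s"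
  using svertex_restr[OF assms(1), of "\<lambda>k\<in>{..1}. if k = 0 then i else j" 1 0] 
    svertex_restr[OF assms(1), of "\<lambda>k\<in>{..1}. if k = 0 then i else j" 1 1] emap[OF assms(2,3)]
  by (simp_all add: sedge_def)

lemma sedge_svertex:
  assumes "s \<in> Cell S n" "i \<le> n"
  shows "sedge S 0 0 0 (svertex S n i s) = sedge S n i i s"
  using sedge_restr[OF assms(1), of "\<lambda>k\<in>{..0}. i" 0 0 0] vmap[OF assms(2)]
  by (simp add: svertex_def)

lemma sedge_id: "u \<in> Cell S 1 \<Longrightarrow> sedge S 1 0 1 u = u"
proof -
  have "(\<lambda>k\<in>{..1::nat}. if k = 0 then 0 else 1) = (\<lambda>i\<in>{..1::nat}. i)" by (auto simp: restrict_def)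
  then show "u \<in> Cell S 1 \<Longrightarrow> sedge S 1 0 1 u = u" unfolding sedge_def using psh_id[OF S, of u 1] by simp
qed

lemma svertex_id: "x \<in> Cell S 0 \<Longrightarrow> svertex S 0 0 x = x"
proof -
  have "(\<lambda>k\<in>{..0::nat}. 0) = (\<lambda>i\<in>{..0::nat}. i)" by (auto simp: restrict_def)
  then show "x \<in> Cell S 0 \<Longrightarrow> svertex S 0 0 x = x" unfolding svertex_def using psh_id[OF S, of x 0] by simp
qed

lemma spath_ends: "spath S x us y \<Longrightarrow> x \<in> Cell S 0 \<and> y \<in> Cell S 0"
  by (induction us arbitrary: x) (auto simp: svertex_cell)

lemma spath_append: "spath S x (us @ vs) y \<longleftrightarrow> (\<exists>z. spath S x us z \<and> spath S z vs y)"
  by (induction us arbitrary: x) (auto simp: spath_ends)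

lemma tau_eq_spath: "tau_eq S x y us vs \<Longrightarrow> spath S x us y \<and> spath S x vs y"
proof (induction rule: tau_eq.induct)
  case (degenerate z us vs)
  have "svertex S 1 0 (sedge S 0 0 0 z) = z" "svertex S 1 1 (sedge S 0 0 0 z) = z"
    using svertex_sedge[OF degenerate(1), of 0 0] svertex_id[OF degenerate(1)] by auto
  then show ?case using degenerate by (auto simp: spath_append)
next
  case (triangle s us vs)
  have s2: "s \<in> Cell S 2" by fact
  note vs = svertex_sedge[OF s2, of 0 1] svertex_sedge[OF s2, of 1 2] svertex_sedge[OF s2, of 0 2] 
  show ?case using triangle vs sedge_cell[OF s2, of 0 2] by (auto simp: spath_append)
qed auto

lemma tau_eq_append: "tau_eq S x y us us' \<Longrightarrow> spath S y ws z \<Longrightarrow> tau_eq S x z (us @ ws) (us' @ ws)"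
proof (induction rule: tau_eq.induct)
  case (refl us) then show ?case by (meson spath_append tau_eq.refl)
next
  case (sym us vs) then show ?case by (meson tau_eq.sym)
next
  case (trans us vs ws') then show ?case by (meson tau_eq.trans)
next
  case (degenerate z' us vs)
  then have "spath S x (us @ [sedge S 0 0 0 z'] @ (vs @ ws)) z"
    by (auto simp: spath_append)
  from tau_eq.degenerate[OF degenerate(1) this] show ?case by simp
next
  case (triangle s us vs)
  then have "spath S x (us @ [sedge S 2 0 1 s, sedge S 2 1 2 s] @ (vs @ ws)) z"
    by (auto simp: spath_append)
  from tau_eq.triangle[OF triangle(1) this] show ?case by simp
qed

lemma tau_eq_prepend: "tau_eq S x y us us' \<Longrightarrow> spath S w ws x \<Longrightarrow> tau_eq S w y (ws @ us) (ws @ us')"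
proof (induction rule: tau_eq.induct)
  case (refl us) then show ?case by (meson spath_append tau_eq.refl)
next
  case (sym us vs) then show ?case by (meson tau_eq.sym)
next
  case (trans us vs ws') then show ?case by (meson tau_eq.trans)
next
  case (degenerate z' us vs)
  then have "spath S w ((ws @ us) @ [sedge S 0 0 0 z'] @ vs) y"
    by (auto simp: spath_append)
  from tau_eq.degenerate[OF degenerate(1) this] show ?case by simp
next
  case (triangle s us vs)
  then have "spath S w ((ws @ us) @ [sedge S 2 0 1 s, sedge S 2 1 2 s] @ vs) y"
    by (auto simp: spath_append)
  from tau_eq.triangle[OF triangle(1) this] show ?case by simp
qed

lemma tau_class_eq: "spath S x us y \<Longrightarrow> tau_class S x y us = tau_class S x y vs \<longleftrightarrow> tau_eq S x y us vs"
  unfolding tau_class_def by (auto intro: tau_eq.intros dest: tau_eq.sym tau_eq.trans)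

lemma tau_comp:
  assumes "spath S x us y" "spath S y vs z"
  shows "Comp (tau S) x y z (tau_class S y z vs) (tau_class S x y us) = tau_class S x z (us @ vs)"
proof -
  have *: "tau_class S x z (p @ q) = tau_class S x z (us @ vs)"
    if "p \<in> tau_class S x y us" "q \<in> tau_class S y z vs" for p q
  proof -
    from that have pq: "tau_eq S x y us p" "tau_eq S y z vs q" by (auto simp: tau_class_def)
    have "tau_eq S x z (us @ vs) (p @ vs)" using pq assms tau_eq_append by blast
    moreover have "tau_eq S x z (p @ vs) (p @ q)" using pq tau_eq_prepend tau_eq_spath by blast
    ultimately have "tau_eq S x z (us @ vs) (p @ q)" by (rule tau_eq.trans)
    then show ?thesis unfolding tau_class_def by (blast intro: tau_eq.trans tau_eq.sym)
  qed
  have "us \<in> tau_class S x y us" "vs \<in> tau_class S y z vs" using assms by (auto simp: tau_class_def tau_eq.refl)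
  then have "(\<Union>p\<in>tau_class S x y us. \<Union>q\<in>tau_class S y z vs. tau_class S x z (p @ q)) = tau_class S x z (us @ vs)"
    using * by blast
  then show ?thesis by (simp add: tau_def)
qed

lemma tau_HomE:
  assumes "f \<in> Hom (tau S) x y" obtains us where "f = tau_class S x y us" "spath S x us y"
  using assms by (auto simp: tau_def)

lemma tau_HomI: "spath S x us y \<Longrightarrow> tau_class S x y us \<in> Hom (tau S) x y"
  by (auto simp: tau_def)

lemma tau_Id: "Id (tau S) x = tau_class S x x []" by (simp add: tau_def)

lemma tau_Ob: "Ob (tau S) = Cell S 0" by (simp add: tau_def)

theorem category_tau: "category (tau S)"
  unfolding category_def
proof (intro conjI ballI)
  fix a assume "a \<in> Ob (tau S)" then show "Id (tau S) a \<in> Hom (tau S) a a"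
    unfolding tau_Id by (intro tau_HomI) (simp add: tau_Ob)
next
  fix a b c f g assume "f \<in> Hom (tau S) a b" "g \<in> Hom (tau S) b c"
  then show "Comp (tau S) a b c g f \<in> Hom (tau S) a c"
    by (elim tau_HomE) (auto simp: tau_comp spath_append intro!: tau_HomI)
next
  fix a b f assume ab: "a \<in> Ob (tau S)" "b \<in> Ob (tau S)" and "f \<in> Hom (tau S) a b"
  then obtain us where us: "f = tau_class S a b us" "spath S a us b" by (elim tau_HomE)
  show "Comp (tau S) a a b f (Id (tau S) a) = f" "Comp (tau S) a b b (Id (tau S) b) f = f"
    unfolding us(1) tau_Id using us ab by (subst tau_comp; simp add: tau_Ob)+
next
  fix a b c d f g h assume "f \<in> Hom (tau S) a b" "g \<in> Hom (tau S) b c" "h \<in> Hom (tau S) c d"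
  then obtain us vs ws where us: "f = tau_class S a b us" "spath S a us b"
    and vs: "g = tau_class S b c vs" "spath S b vs c" and ws: "h = tau_class S c d ws" "spath S c ws d" 
    by (meson tau_HomE)
  have "spath S a (us @ vs) c" "spath S b (vs @ ws) d" using us vs ws spath_append by blast+
  then show "Comp (tau S) a c d h (Comp (tau S) a b c g f) = Comp (tau S) a b d (Comp (tau S) b c d h g) f"
    using us vs ws by (simp add: tau_comp)
qed


end

definition tau_unit :: "'x sset \<Rightarrow> nat \<Rightarrow> 'x \<Rightarrow> (nat \<Rightarrow> 'x) \<times> (nat \<Rightarrow> nat \<Rightarrow> unit \<Rightarrow> 'x list set)" where
  "tau_unit S n s =
     truncate_functor n (\<lambda>i. svertex S n i s, \<lambda>i j u. tau_mor S (sedge S n i j s))"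

definition nerve_map :: "('o \<Rightarrow> 'p) \<Rightarrow> ('o \<Rightarrow> 'o \<Rightarrow> 'm \<Rightarrow> 'n) \<Rightarrow> nat \<Rightarrow>
    (nat \<Rightarrow> 'o) \<times> (nat \<Rightarrow> nat \<Rightarrow> unit \<Rightarrow> 'm) \<Rightarrow> (nat \<Rightarrow> 'p) \<times> (nat \<Rightarrow> nat \<Rightarrow> unit \<Rightarrow> 'n)" where
  "nerve_map F\<^sub>0 F\<^sub>1 n G =
     truncate_functor n (\<lambda>i. F\<^sub>0 (fst G i), \<lambda>i j u. F\<^sub>1 (fst G i) (fst G j) (snd G i j u))"

lemma truncate_truncate [simp]: "truncate_functor n (truncate_functor n F) = truncate_functor n F"
  by (auto simp: truncate_functor_def fun_eq_iff)

lemma fst_truncate: "i \<le> n \<Longrightarrow> fst (truncate_functor n F) i = fst F i"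
  and snd_truncate: "i \<le> j \<Longrightarrow> j \<le> n \<Longrightarrow> snd (truncate_functor n F) i j u = snd F i j u"
  by (simp_all add: truncate_functor_def)

lemma truncate_eqI: "(\<And>i. i \<le> n \<Longrightarrow> fst F i = fst G i) \<Longrightarrow>
    (\<And>i j u. i \<le> j \<Longrightarrow> j \<le> n \<Longrightarrow> snd F i j u = snd G i j u) \<Longrightarrow>
    truncate_functor n F = truncate_functor n G"
  by (auto simp: truncate_functor_def fun_eq_iff)

lemma is_functor_ord: "is_functor (ord_cat n) D (fst F) (snd F) \<longleftrightarrow>
   (\<forall>i\<le>n. fst F i \<in> Ob D) \<and> (\<forall>i j. i \<le> j \<longrightarrow> j \<le> n \<longrightarrow> snd F i j () \<in> Hom D (fst F i) (fst F j)) \<and>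
   (\<forall>i\<le>n. snd F i i () = Id D (fst F i)) \<and>
   (\<forall>i j k. i \<le> j \<longrightarrow> j \<le> k \<longrightarrow> k \<le> n \<longrightarrow>
      snd F i k () = Comp D (fst F i) (fst F j) (fst F k) (snd F j k ()) (snd F i j ()))"
  (is "_ \<longleftrightarrow> ?A \<and> ?B \<and> ?C \<and> ?E")
proof -
  let ?o = "ord_cat n"
  have o: "Ob ?o = {..n}" "\<And>i j. Hom ?o i j = (if i \<le> j then {()} else {})" "\<And>i. Id ?o i = ()"
    "\<And>i j k f g. Comp ?o i j k g f = ()" by (auto simp: ord_cat_def)
  have B: "(\<forall>a\<in>{..n}. \<forall>b\<in>{..n}. \<forall>f\<in>Hom ?o a b. snd F a b f \<in> Hom D (fst F a) (fst F b)) \<longleftrightarrow> ?B"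
    unfolding o(2) by (auto split: if_splits)
  have E: "(\<forall>a\<in>{..n}. \<forall>b\<in>{..n}. \<forall>c\<in>{..n}. \<forall>f\<in>Hom ?o a b. \<forall>g\<in>Hom ?o b c.
      snd F a c () = Comp D (fst F a) (fst F b) (fst F c) (snd F b c g) (snd F a b f)) \<longleftrightarrow> ?E" (is "?L \<longleftrightarrow> _")
  proof
    assume L: ?L show ?E
    proof (intro allI impI)
      fix i j k assume "i \<le> j" "j \<le> k" "k \<le> n"
      then show "snd F i k () = Comp D (fst F i) (fst F j) (fst F k) (snd F j k ()) (snd F i j ())"
        using L[rule_format, of i j k "()" "()"] by (simp add: o)
    qed
  next
    assume E: ?E
    show ?L
    proof (intro ballI)
      fix i j k u v assume "i \<in> {..n}" "j \<in> {..n}" "k \<in> {..n}" "u \<in> Hom ?o i j" "v \<in> Hom ?o j k"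
      then have "i \<le> j" "j \<le> k" "k \<le> n" by (auto simp: o split: if_splits)
      from E[rule_format, OF this]
      show "snd F i k () = Comp D (fst F i) (fst F j) (fst F k) (snd F j k v) (snd F i j u)" by simp
    qed
  qed
  have A: "(\<forall>a\<in>{..n}. Q a) \<longleftrightarrow> (\<forall>i\<le>n. Q i)" for Q by auto
  show ?thesis unfolding is_functor_def o(1) o(3) o(4) B E unfolding A ..
qed

lemma is_functor_truncate:
  assumes "is_functor (ord_cat n) D (fst F) (snd F)"
  shows "is_functor (ord_cat n) D (fst (truncate_functor n F)) (snd (truncate_functor n F))"
proof -
  note * = assms[unfolded is_functor_ord]
  note A = conjunct1[OF *] and B = conjunct1[OF conjunct2[OF *]]
    and C = conjunct1[OF conjunct2[OF conjunct2[OF *]]] and E = conjunct2[OF conjunct2[OF conjunct2[OF *]]]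
  show ?thesis
    unfolding is_functor_ord
  proof (intro conjI allI impI)
    fix i j k assume "i \<le> j" "j \<le> k" "k \<le> n"
    then show "snd (truncate_functor n F) i k () =
        Comp D (fst (truncate_functor n F) i) (fst (truncate_functor n F) j) (fst (truncate_functor n F) k)
          (snd (truncate_functor n F) j k ()) (snd (truncate_functor n F) i j ())"
      using E[rule_format, of i j k] by (simp add: fst_truncate snd_truncate)
  qed (simp_all add: fst_truncate snd_truncate A B C)
qed

lemma nerve_cellD:
  assumes "F \<in> Cell (nerve D) n"
  shows "i \<le> n \<Longrightarrow> fst F i \<in> Ob D"
    "i \<le> j \<Longrightarrow> j \<le> n \<Longrightarrow> snd F i j () \<in> Hom D (fst F i) (fst F j)"
    "i \<le> n \<Longrightarrow> snd F i i () = Id D (fst F i)"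
    "i \<le> j \<Longrightarrow> j \<le> k \<Longrightarrow> k \<le> n \<Longrightarrow>
      snd F i k () = Comp D (fst F i) (fst F j) (fst F k) (snd F j k ()) (snd F i j ())"
    "truncate_functor n F = F"
proof -
  have F: "is_functor (ord_cat n) D (fst F) (snd F)" "truncate_functor n F = F"
    using assms unfolding nerve_def by auto
  note * = F(1)[unfolded is_functor_ord]
  show "i \<le> n \<Longrightarrow> fst F i \<in> Ob D"
    "i \<le> j \<Longrightarrow> j \<le> n \<Longrightarrow> snd F i j () \<in> Hom D (fst F i) (fst F j)"
    "i \<le> n \<Longrightarrow> snd F i i () = Id D (fst F i)"
    "i \<le> j \<Longrightarrow> j \<le> k \<Longrightarrow> k \<le> n \<Longrightarrow>
      snd F i k () = Comp D (fst F i) (fst F j) (fst F k) (snd F j k ()) (snd F i j ())"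
    "truncate_functor n F = F"
    subgoal using * by blast
    subgoal using * by blast
    subgoal using * by blast
    subgoal using * by meson
    subgoal by (rule F(2))
    done
qed

theorem presheaf_nerve: "presheaf Delta (nerve D)"
  unfolding presheaf_def
proof (intro conjI ballI)
  fix m n \<alpha> F assume "\<alpha> \<in> Hom Delta m n" and F: "F \<in> Cell (nerve D) n"
  then have \<alpha>: "\<And>i. i \<le> m \<Longrightarrow> \<alpha> i \<le> n" "\<And>i j. i \<le> j \<Longrightarrow> j \<le> m \<Longrightarrow> \<alpha> i \<le> \<alpha> j"
    by (auto simp: Delta_def mono_on_def)
  let ?G = "(\<lambda>i. fst F (\<alpha> i), \<lambda>i j u. snd F (\<alpha> i) (\<alpha> j) u)"
  have "is_functor (ord_cat m) D (fst ?G) (snd ?G)"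
    unfolding is_functor_ord unfolding fst_conv snd_conv
  proof (intro conjI allI impI)
    fix i j k assume "i \<le> j" "j \<le> k" "k \<le> m"
    then have "\<alpha> i \<le> \<alpha> j" "\<alpha> j \<le> \<alpha> k" "\<alpha> k \<le> n" using \<alpha> by auto
    from nerve_cellD(4)[OF F this]
    show "snd F (\<alpha> i) (\<alpha> k) () = Comp D (fst F (\<alpha> i)) (fst F (\<alpha> j)) (fst F (\<alpha> k))
        (snd F (\<alpha> j) (\<alpha> k) ()) (snd F (\<alpha> i) (\<alpha> j) ())" .
  qed (simp_all add: nerve_cellD(1-3)[OF F] \<alpha>)
  from is_functor_truncate[OF this] show "Restr (nerve D) m n \<alpha> F \<in> Cell (nerve D) m"
    by (simp add: nerve_def)
next
  fix n F assume F: "F \<in> Cell (nerve D) n"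
  have "Restr (nerve D) n n (Id Delta n) F = truncate_functor n F"
    unfolding nerve_def Delta_def by (auto intro!: truncate_eqI)
  then show "Restr (nerve D) n n (Id Delta n) F = F" using nerve_cellD(5)[OF F] by simp
next
  fix k m n \<alpha> \<beta> F assume "\<alpha> \<in> Hom Delta k m" "\<beta> \<in> Hom Delta m n"
  then have "\<And>i. i \<le> k \<Longrightarrow> \<alpha> i \<le> m" "\<And>i j. i \<le> j \<Longrightarrow> j \<le> k \<Longrightarrow> \<alpha> i \<le> \<alpha> j"
    by (auto simp: Delta_def mono_on_def)
  then show "Restr (nerve D) k n (Comp Delta k m n \<beta> \<alpha>) F =
      Restr (nerve D) k m \<alpha> (Restr (nerve D) m n \<beta> F)"
    unfolding nerve_def Delta_def
    by (auto intro!: truncate_eqI simp: fst_truncate snd_truncate compose_def)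
qed

lemma spath_sedge:
  assumes "presheaf Delta S" "s \<in> Cell S n" "i \<le> j" "j \<le> n"
  shows "spath S (svertex S n i s) [sedge S n i j s] (svertex S n j s)"
  using svertex_sedge[OF assms] sedge_cell[OF assms] svertex_cell[OF assms(1,2,4)] by simp

lemma tau_unit_cell:
  assumes S: "presheaf Delta S" and s: "s \<in> Cell S n"
  shows "tau_unit S n s \<in> Cell (nerve (tau S)) n"
proof -
  note sv = svertex_cell[OF S s] and ss = svertex_sedge[OF S s] and sp = spath_sedge[OF S s]
  let ?G = "(\<lambda>i. svertex S n i s, \<lambda>i j u. tau_mor S (sedge S n i j s))
     :: (nat \<Rightarrow> 'a) \<times> (nat \<Rightarrow> nat \<Rightarrow> unit \<Rightarrow> 'a list set)"
  have "is_functor (ord_cat n) (tau S) (fst ?G) (snd ?G)"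
    unfolding is_functor_ord
  proof (intro conjI allI impI; (unfold fst_conv snd_conv)?)
    fix i assume i: "i \<le> n"
    show "svertex S n i s \<in> Ob (tau S)" using sv[OF i] by (simp add: tau_Ob[OF S])
    let ?v = "svertex S n i s"
    have "tau_eq S ?v ?v ([] @ [sedge S 0 0 0 ?v] @ []) ([] @ [])"
      using sv i sp[of i i] by (intro tau_eq.degenerate) (simp_all only: sedge_svertex[OF S s i], auto)
    then show "tau_mor S (sedge S n i i s) = Id (tau S) ?v"
      unfolding tau_mor_def ss(1)[OF order_refl i] ss(2)[OF order_refl i] tau_Id[OF S]
      using sp[of i i] i by (subst tau_class_eq[OF S]) (auto simp: sedge_svertex[OF S s i])
  next
    fix i j assume ij: "i \<le> j" "j \<le> n"
    show "tau_mor S (sedge S n i j s) \<in> Hom (tau S) (svertex S n i s) (svertex S n j s)"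
      unfolding tau_mor_def ss[OF ij] using sp[OF ij] by (rule tau_HomI[OF S])
  next
    fix i j k assume ijk: "i \<le> j" "j \<le> k" "k \<le> n"
    then have jn: "j \<le> n" and ik: "i \<le> k" by auto
    let ?a = "\<lambda>t\<in>{..2::nat}. if t = 0 then i else if t = 1 then j else k"
    have a: "?a \<in> {..2} \<rightarrow>\<^sub>E {..n}" "mono_on {..2} ?a" using ijk by (auto simp: mono_on_def)
    let ?t = "Restr S 2 n ?a s"
    have t: "?t \<in> Cell S 2" using psh_cell[OF S a s] .
    note r = sedge_restr[OF S s a]
    have e: "sedge S 2 0 1 ?t = sedge S n i j s" "sedge S 2 1 2 ?t = sedge S n j k s"
      "sedge S 2 0 2 ?t = sedge S n i k s" using r[of 0 1] r[of 1 2] r[of 0 2] by simp_all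
    have p: "spath S (svertex S n i s) ([sedge S n i j s] @ [sedge S n j k s]) (svertex S n k s)"
      using spath_append[OF S] sp ijk jn by blast
    have "tau_eq S (svertex S n i s) (svertex S n k s) ([] @ [sedge S 2 0 1 ?t, sedge S 2 1 2 ?t] @ [])
        ([] @ [sedge S 2 0 2 ?t] @ [])"
      by (rule tau_eq.triangle[OF t]) (use p in \<open>simp only: e, simp\<close>)
    then have "tau_class S (svertex S n i s) (svertex S n k s) [sedge S n i j s, sedge S n j k s] =
        tau_class S (svertex S n i s) (svertex S n k s) [sedge S n i k s]"
      using p tau_class_eq[OF S p] by (simp only: e append.simps)
    then show "tau_mor S (sedge S n i k s) = Comp (tau S) (svertex S n i s) (svertex S n j s) (svertex S n k s)
         (tau_mor S (sedge S n j k s)) (tau_mor S (sedge S n i j s))"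
      unfolding tau_mor_def ss[OF ijk(1) jn] ss[OF ijk(2,3)] ss[OF ik ijk(3)]
      by (subst tau_comp[OF S sp[OF ijk(1) jn] sp[OF ijk(2,3)]]) simp
  qed
  from is_functor_truncate[OF this] show ?thesis by (simp add: nerve_def tau_unit_def)
qed

theorem tau_unit_map:
  assumes S: "presheaf Delta S"
  shows "presheaf_map Delta S (nerve (tau S)) (tau_unit S)"
  unfolding presheaf_map_def
proof (intro conjI ballI)
  fix n s assume "s \<in> Cell S n" then show "tau_unit S n s \<in> Cell (nerve (tau S)) n"
    by (rule tau_unit_cell[OF S])
next
  fix m n \<alpha> s assume "\<alpha> \<in> Hom Delta m n" and s: "s \<in> Cell S n"
  then have \<alpha>: "\<alpha> \<in> {..m} \<rightarrow>\<^sub>E {..n}" "mono_on {..m} \<alpha>" by (auto simp: Delta_def)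
  then have \<alpha>': "\<And>i. i \<le> m \<Longrightarrow> \<alpha> i \<le> n" "\<And>i j. i \<le> j \<Longrightarrow> j \<le> m \<Longrightarrow> \<alpha> i \<le> \<alpha> j"
    by (auto simp: mono_on_def)
  show "tau_unit S m (Restr S m n \<alpha> s) = Restr (nerve (tau S)) m n \<alpha> (tau_unit S n s)"
    unfolding tau_unit_def nerve_def
    by (auto intro!: truncate_eqI
        simp: fst_truncate snd_truncate \<alpha>' svertex_restr[OF S s \<alpha>] sedge_restr[OF S s \<alpha>])
qed

fun path_value :: "'x sset \<Rightarrow> ('o, 'm) cat \<Rightarrow> ('x \<Rightarrow> 'o) \<Rightarrow> ('x \<Rightarrow> 'm) \<Rightarrow> 'x \<Rightarrow> 'x list \<Rightarrow> 'x \<Rightarrow> 'm" where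
  "path_value S D F E x [] y = Id D (F x)"
| "path_value S D F E x (u # us) y =
     Comp D (F x) (F (svertex S 1 1 u)) (F y) (path_value S D F E (svertex S 1 1 u) us y) (E u)"

theorem tau_universal:
  fixes D :: "('o, 'm) cat"
  assumes S: "presheaf Delta S" and D: "category D" and \<phi>: "presheaf_map Delta S (nerve D) \<phi>"
  shows "\<exists>F\<^sub>0 F\<^sub>1. is_functor (tau S) D F\<^sub>0 F\<^sub>1 \<and>
      (\<forall>n. \<forall>s\<in>Cell S n. nerve_map F\<^sub>0 F\<^sub>1 n (tau_unit S n s) = \<phi> n s) \<and>
      (\<forall>G\<^sub>0 G\<^sub>1. is_functor (tau S) D G\<^sub>0 G\<^sub>1 \<longrightarrow>
        (\<forall>n. \<forall>s\<in>Cell S n. nerve_map G\<^sub>0 G\<^sub>1 n (tau_unit S n s) = \<phi> n s) \<longrightarrow>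
        (\<forall>x\<in>Ob (tau S). G\<^sub>0 x = F\<^sub>0 x) \<and>
        (\<forall>x\<in>Ob (tau S). \<forall>y\<in>Ob (tau S). \<forall>m\<in>Hom (tau S) x y. G\<^sub>1 x y m = F\<^sub>1 x y m))"
proof -
  define F where "F x = fst (\<phi> 0 x) 0" for x
  define E where "E u = snd (\<phi> 1 u) 0 1 ()" for u
  have Dc: "\<And>a b c f g. a \<in> Ob D \<Longrightarrow> b \<in> Ob D \<Longrightarrow> c \<in> Ob D \<Longrightarrow> f \<in> Hom D a b \<Longrightarrow> g \<in> Hom D b c \<Longrightarrow> Comp D a b c g f \<in> Hom D a c"
    and Di: "\<And>a. a \<in> Ob D \<Longrightarrow> Id D a \<in> Hom D a a"
    and Dl: "\<And>a b f. a \<in> Ob D \<Longrightarrow> b \<in> Ob D \<Longrightarrow> f \<in> Hom D a b \<Longrightarrow> Comp D a a b f (Id D a) = f"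
    and Dr: "\<And>a b f. a \<in> Ob D \<Longrightarrow> b \<in> Ob D \<Longrightarrow> f \<in> Hom D a b \<Longrightarrow> Comp D a b b (Id D b) f = f"
    and Da: "\<And>a b c d f g h. a \<in> Ob D \<Longrightarrow> b \<in> Ob D \<Longrightarrow> c \<in> Ob D \<Longrightarrow> d \<in> Ob D \<Longrightarrow> f \<in> Hom D a b \<Longrightarrow> g \<in> Hom D b c \<Longrightarrow> h \<in> Hom D c d \<Longrightarrow>
       Comp D a c d h (Comp D a b c g f) = Comp D a b d (Comp D b c d h g) f"
    using D unfolding category_def by blast+
  have \<phi>c: "\<And>n s. s \<in> Cell S n \<Longrightarrow> \<phi> n s \<in> Cell (nerve D) n"
    using \<phi> unfolding presheaf_map_def by (simp add: Delta_def)
  have \<phi>r: "\<And>m n \<alpha> s. \<alpha> \<in> {..m} \<rightarrow>\<^sub>E {..n} \<Longrightarrow> mono_on {..m} \<alpha> \<Longrightarrow> s \<in> Cell S n \<Longrightarrow>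
      \<phi> m (Restr S m n \<alpha> s) = Restr (nerve D) m n \<alpha> (\<phi> n s)"
    using \<phi> unfolding presheaf_map_def by (simp add: Delta_def)
  have fv: "fst (\<phi> n s) i = F (svertex S n i s)" if "s \<in> Cell S n" "i \<le> n" for n s i
    unfolding F_def svertex_def using \<phi>r[of "\<lambda>k\<in>{..0}. i" 0 n s] vmap[OF that(2)] that
    by (simp add: nerve_def fst_truncate)
  have se: "snd (\<phi> n s) i j () = E (sedge S n i j s)" if "s \<in> Cell S n" "i \<le> j" "j \<le> n" for n s i j
    unfolding E_def sedge_def using \<phi>r[of "\<lambda>k\<in>{..1}. if k = 0 then i else j" 1 n s] emap[OF that(2,3)] that
    by (simp add: nerve_def snd_truncate)
  have FO: "F x \<in> Ob D" if "x \<in> Cell S 0" for x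
    using nerve_cellD(1)[OF \<phi>c[OF that], of 0] by (simp add: F_def)
  have EH: "E u \<in> Hom D (F (svertex S 1 0 u)) (F (svertex S 1 1 u))" if "u \<in> Cell S 1" for u
    using nerve_cellD(2)[OF \<phi>c[OF that], of 0 1] fv[OF that, of 0] fv[OF that, of 1] by (simp add: E_def)
  let ?P = "path_value S D F E"
  have ends: "x \<in> Cell S 0" "y \<in> Cell S 0" if "spath S x us y" for x y us
    using spath_ends[OF S that] by auto
  have PH: "?P x us y \<in> Hom D (F x) (F y)" if "spath S x us y" for x us y
    using that
  proof (induction us arbitrary: x)
    case Nil then show ?case using FO Di by auto
  next
    case (Cons u us)
    then have u: "u \<in> Cell S 1" "x = svertex S 1 0 u" and p: "spath S (svertex S 1 1 u) us y" by auto
    show ?case using Cons.IH[OF p] EH[OF u(1)] ends[OF p] ends[OF Cons.prems] u(2)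
      by (auto intro!: Dc FO)
  qed
  have PA: "?P x (us @ vs) z = Comp D (F x) (F y) (F z) (?P y vs z) (?P x us y)"
    if "spath S x us y" "spath S y vs z" for x us y vs z
    using that
  proof (induction us arbitrary: x)
    case Nil then show ?case using PH[OF Nil(2)] ends[OF Nil(2)] by (auto intro!: Dl[symmetric] FO)
  next
    case (Cons u us)
    then have u: "u \<in> Cell S 1" "x = svertex S 1 0 u" and p: "spath S (svertex S 1 1 u) us y" by auto
    show ?case using Cons.IH[OF p] EH[OF u(1)] ends[OF p] ends[OF Cons.prems(1)] u(2) Cons.prems(2) ends[OF Cons.prems(2)] PH[OF p] PH[OF Cons.prems(2)]
      by (auto intro!: Da[symmetric] FO)
  qed
  have P1: "?P x [u] y = E u" if "spath S x [u] y" for x u y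
    using that EH[of u] ends[OF that] by (auto intro!: Dr FO)
  have PE: "?P x us y = ?P x vs y" if "tau_eq S x y us vs" for x y us vs
    using that
  proof (induction rule: tau_eq.induct)
    case (degenerate z us vs)
    then obtain a b where p: "spath S x us a" "spath S a [sedge S 0 0 0 z] b" "spath S b vs y"
      by (metis spath_append[OF S])
    have z: "svertex S 0 0 z = z" using svertex_id[OF S degenerate(1)] .
    have [simp]: "a = z" "b = z"
      using p(2) svertex_sedge[OF S degenerate(1), of 0 0] z by auto
    have "E (sedge S 0 0 0 z) = Id D (F z)"
      using se[OF degenerate(1), of 0 0] nerve_cellD(3)[OF \<phi>c[OF degenerate(1)], of 0] by (simp add: F_def)
    then have e: "?P z [sedge S 0 0 0 z] z = Id D (F z)" using P1[OF p(2)] by simp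
    have p': "spath S z ([sedge S 0 0 0 z] @ vs) y" using spath_append[OF S] p by auto
    have "?P z ([sedge S 0 0 0 z] @ vs) y = ?P z vs y"
      using PA[OF p(2,3)] e Dl[OF FO FO PH[OF p(3)]] ends[OF p(3)] by simp
    then show ?case using PA[OF p(1)[simplified] p'] PA[of x us z vs y] p by simp
  next
    case (triangle s us vs)
    let ?e = "\<lambda>i j. sedge S 2 i j s"
    obtain a b where p: "spath S x us a" "spath S a [?e 0 1, ?e 1 2] b" "spath S b vs y"
      using triangle(2) by (metis spath_append[OF S])
    have v: "svertex S 1 0 (?e 0 1) = svertex S 2 0 s" "svertex S 1 1 (?e 0 1) = svertex S 2 1 s"
      "svertex S 1 0 (?e 1 2) = svertex S 2 1 s" "svertex S 1 1 (?e 1 2) = svertex S 2 2 s"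
      "svertex S 1 0 (?e 0 2) = svertex S 2 0 s" "svertex S 1 1 (?e 0 2) = svertex S 2 2 s"
      using svertex_sedge[OF S triangle(1)] by simp_all
    have [simp]: "a = svertex S 2 0 s" "b = svertex S 2 2 s" using p(2) v by auto
    have q: "spath S a [?e 0 1] (svertex S 2 1 s)" "spath S (svertex S 2 1 s) [?e 1 2] b" "spath S a [?e 0 2] b"
      using spath_sedge[OF S triangle(1), of 0 1] spath_sedge[OF S triangle(1), of 1 2]
        spath_sedge[OF S triangle(1), of 0 2] by (simp_all del: spath.simps)
    note c = nerve_cellD(4)[OF \<phi>c[OF triangle(1)], of 0 1 2]
    have "?P a ([?e 0 1] @ [?e 1 2]) b = ?P a [?e 0 2] b"
      unfolding PA[OF q(1,2)] P1[OF q(1)] P1[OF q(2)] P1[OF q(3)]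
      using c se[OF triangle(1)] fv[OF triangle(1)] by simp
    then have m: "?P a [?e 0 1, ?e 1 2] b = ?P a [?e 0 2] b" by simp
    have "?P a ([?e 0 1, ?e 1 2] @ vs) y = ?P a ([?e 0 2] @ vs) y"
      by (simp only: PA[OF p(2,3)] PA[OF q(3) p(3)] m)
    moreover have "spath S a ([?e 0 1, ?e 1 2] @ vs) y" "spath S a ([?e 0 2] @ vs) y"
      using p q(3) by (metis spath_append[OF S])+
    ultimately show ?case by (simp only: PA[OF p(1)])
  qed auto
  define F1 where "F1 x y m = ?P x (SOME us. us \<in> m) y" for x y and m :: "'a list set"
  have F1c: "F1 x y (tau_class S x y us) = ?P x us y" if "spath S x us y" for x y us
  proof -
    have "us \<in> tau_class S x y us" using that by (simp add: tau_class_def tau_eq.refl)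
    then have "(SOME vs. vs \<in> tau_class S x y us) \<in> tau_class S x y us" by (rule someI)
    then show ?thesis unfolding F1_def using PE by (auto simp: tau_class_def)
  qed
  have fun1: "is_functor (tau S) D F F1"
    unfolding is_functor_def
  proof (intro conjI ballI)
    fix x assume x: "x \<in> Ob (tau S)"
    then show "F x \<in> Ob D" using FO by (simp add: tau_Ob[OF S])
    show "F1 x x (Id (tau S) x) = Id D (F x)"
      using x F1c[of x "[]" x] by (simp add: tau_Id[OF S] tau_Ob[OF S])
  next
    fix x y m assume "m \<in> Hom (tau S) x y"
    then show "F1 x y m \<in> Hom D (F x) (F y)"
      by (elim tau_HomE[OF S]) (simp add: F1c PH)
  next
    fix x y z f g assume "f \<in> Hom (tau S) x y" "g \<in> Hom (tau S) y z"
    then obtain us vs where us: "f = tau_class S x y us" "spath S x us y"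
      and vs: "g = tau_class S y z vs" "spath S y vs z" by (meson tau_HomE[OF S])
    have "spath S x (us @ vs) z" using us vs spath_append[OF S] by blast
    then show "F1 x z (Comp (tau S) x y z g f) = Comp D (F x) (F y) (F z) (F1 y z g) (F1 x y f)"
      using us vs by (simp add: tau_comp[OF S] F1c PA)
  qed
  have F1e: "F1 (svertex S n i s) (svertex S n j s) (tau_mor S (sedge S n i j s)) = E (sedge S n i j s)"
    if "s \<in> Cell S n" "i \<le> j" "j \<le> n" for n s i j
    using F1c[OF spath_sedge[OF S that]] P1[OF spath_sedge[OF S that]] svertex_sedge[OF S that]
    by (simp add: tau_mor_def)
  have nm: "nerve_map F F1 n (tau_unit S n s) = \<phi> n s" if s: "s \<in> Cell S n" for n s
  proof -
    have "nerve_map F F1 n (tau_unit S n s) = truncate_functor n (\<phi> n s)"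
      unfolding nerve_map_def tau_unit_def
      by (intro truncate_eqI) (simp_all add: fst_truncate snd_truncate fv[OF s] se[OF s] F1e[OF s])
    then show ?thesis using nerve_cellD(5)[OF \<phi>c[OF s]] by simp
  qed
  have uniq: "(\<forall>x\<in>Ob (tau S). G\<^sub>0 x = F x) \<and>
        (\<forall>x\<in>Ob (tau S). \<forall>y\<in>Ob (tau S). \<forall>m\<in>Hom (tau S) x y. G\<^sub>1 x y m = F1 x y m)"
    if G: "is_functor (tau S) D G\<^sub>0 G\<^sub>1"
      and n: "\<forall>n. \<forall>s\<in>Cell S n. nerve_map G\<^sub>0 G\<^sub>1 n (tau_unit S n s) = \<phi> n s" for G\<^sub>0 G\<^sub>1
  proof -
    have 0: "G\<^sub>0 x = F x" if x: "x \<in> Cell S 0" for x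
    proof -
      have "fst (nerve_map G\<^sub>0 G\<^sub>1 0 (tau_unit S 0 x)) 0 = G\<^sub>0 x"
        by (simp add: nerve_map_def tau_unit_def fst_truncate svertex_id[OF S x])
      then show ?thesis using n x by (simp add: F_def)
    qed
    have 1: "G\<^sub>1 (svertex S 1 0 u) (svertex S 1 1 u) (tau_mor S u) = E u" if u: "u \<in> Cell S 1" for u
    proof -
      have "snd (nerve_map G\<^sub>0 G\<^sub>1 1 (tau_unit S 1 u)) 0 1 () =
          G\<^sub>1 (svertex S 1 0 u) (svertex S 1 1 u) (tau_mor S u)"
        using sedge_id[OF S u] by (simp add: nerve_map_def tau_unit_def fst_truncate snd_truncate)
      then show ?thesis using n u by (simp add: E_def)
    qed
    have 2: "G\<^sub>1 x y (tau_class S x y us) = ?P x us y" if "spath S x us y" for x us y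
      using that
    proof (induction us arbitrary: x)
      case Nil
      then have "x \<in> Ob (tau S)" "x = y" by (auto simp: tau_Ob[OF S])
      then show ?case using G 0[of x] unfolding is_functor_def by (simp add: tau_Id[OF S] tau_Ob[OF S])
    next
      case (Cons u us)
      then have u: "u \<in> Cell S 1" "x = svertex S 1 0 u" and p: "spath S (svertex S 1 1 u) us y" by auto
      have q: "spath S x [u] (svertex S 1 1 u)" using u svertex_cell[OF S u(1)] by simp
      have o: "x \<in> Ob (tau S)" "svertex S 1 1 u \<in> Ob (tau S)" "y \<in> Ob (tau S)"
        using ends[OF p] ends[OF q] by (auto simp: tau_Ob[OF S])
      have "G\<^sub>1 x y (Comp (tau S) x (svertex S 1 1 u) y (tau_class S (svertex S 1 1 u) y us) (tau_class S x (svertex S 1 1 u) [u]))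
        = Comp D (G\<^sub>0 x) (G\<^sub>0 (svertex S 1 1 u)) (G\<^sub>0 y) (G\<^sub>1 (svertex S 1 1 u) y (tau_class S (svertex S 1 1 u) y us))
            (G\<^sub>1 x (svertex S 1 1 u) (tau_class S x (svertex S 1 1 u) [u]))"
        using G o tau_HomI[OF S p] tau_HomI[OF S q] unfolding is_functor_def by blast
      then show ?case
        using Cons.IH[OF p] 1[OF u(1)] 0 o u(2) unfolding tau_comp[OF S q p]
        by (simp add: tau_mor_def tau_Ob[OF S])
    qed
    show ?thesis using 0 2 by (auto simp: tau_Ob[OF S] F1c elim!: tau_HomE[OF S])
  qed
  show ?thesis using fun1 nm uniq by blast
qed


section \<open>The operad of a tree is free on its vertices\<close>

lemma permute_transport:
  assumes Ls: "map length Ls = map length labs"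
    and labs: "labs = map (\<lambda>i. map (Pair i) [0..<length (Ls ! i)]) [0..<length Ls]"
    and \<sigma>: "\<sigma> permutes {..<length Ls}"
    and \<tau>s: "list_all2 (\<lambda>\<tau> L. \<tau> permutes {..<length L}) \<tau>s Ls"
    and \<rho>: "\<rho> permutes {..<length (concat labs)}"
      "permute_list \<rho> (concat labs) = concat (permute_list \<sigma> (map2 permute_list \<tau>s labs))"
  shows "permute_list \<rho> (concat Ls) = concat (permute_list \<sigma> (map2 permute_list \<tau>s Ls))"
proof -
  define g where "g = (\<lambda>(i, j). Ls ! i ! j)"
  have g: "map (map g) labs = Ls"
    by (rule nth_equalityI) (auto simp: labs g_def intro!: nth_equalityI)
  have len: "length labs = length Ls" using Ls by (metis length_map)
  have l\<tau>: "length \<tau>s = length Ls" using \<tau>s by (rule list_all2_lengthD)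
  have m: "map2 permute_list \<tau>s Ls = map (map g) (map2 permute_list \<tau>s labs)"
  proof (rule nth_equalityI)
    fix i assume "i < length (map2 permute_list \<tau>s Ls)"
    then have i: "i < length Ls" "i < length labs" "i < length \<tau>s" using len l\<tau> by auto
    have "length (Ls ! i) = length (labs ! i)" using arg_cong[OF Ls, of "\<lambda>l. l ! i"] i by simp
    then have "\<tau>s ! i permutes {..<length (labs ! i)}" using list_all2_nthD[OF \<tau>s i(3)] by simp
    from permute_list_map[OF this, of g]
    have "permute_list (\<tau>s ! i) (map g (labs ! i)) = map g (permute_list (\<tau>s ! i) (labs ! i))" .
    moreover have "map g (labs ! i) = Ls ! i" using arg_cong[OF g, of "\<lambda>l. l ! i"] i by simp
    ultimately show "map2 permute_list \<tau>s Ls ! i = map (map g) (map2 permute_list \<tau>s labs) ! i"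
      using i by simp
  qed (use len l\<tau> in simp)
  have "permute_list \<rho> (concat Ls) = permute_list \<rho> (map g (concat labs))"
    using g by (simp add: map_concat)
  also have "\<dots> = map g (permute_list \<rho> (concat labs))" by (rule permute_list_map[OF \<rho>(1)])
  also have "\<dots> = concat (map (map g) (permute_list \<sigma> (map2 permute_list \<tau>s labs)))"
    using \<rho>(2) by (simp add: map_concat)
  also have "\<dots> = concat (permute_list \<sigma> (map (map g) (map2 permute_list \<tau>s labs)))"
    by (subst permute_list_map[symmetric]) (use \<sigma> len l\<tau> in simp_all)
  finally show ?thesis using m by simp
qed

lemma tree_ops_colours:
  assumes "is_tree T" "p \<in> tree_ops T"
  shows "set (fst p) \<subseteq> edges T \<and> snd p \<in> edges T"
  using assms(2)
proof (induction rule: tree_ops.induct)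
  case (vert es e) then show ?case using assms(1) unfolding is_tree_def by fastforce
qed auto

lemma input_labels_tree:
  "input_labels (tree_operad T) qs =
   map (\<lambda>i. map (Pair i) [0..<length (map fst qs ! i)]) [0..<length (map fst qs)]"
  by (auto simp: input_labels_def tree_operad_def)

lemma concat_map_fst_concat: "concat (map fst (concat rss)) = concat (map (\<lambda>rs. concat (map fst rs)) rss)"
  by (induction rss) auto

theorem symmetric_operad_tree:
  assumes "is_tree T"
  shows "symmetric_operad (tree_operad T)"
proof -
  let ?P = "tree_operad T"
  have comp: "(concat (map fst qs), snd p) \<in> tree_ops T" if "composable ?P p qs" for p qs
    using that tree_ops.compose[of qs "snd p" T] unfolding composable_def tree_operad_def
    by (cases p) auto
  have equi: "Compose ?P (Act ?P \<sigma> p) (permute_list \<sigma> (map2 (Act ?P) \<tau>s qs)) = Act ?P \<rho> (Compose ?P p qs)"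
    if c: "composable ?P p qs" and \<sigma>: "\<sigma> permutes {..<length qs}"
      and \<tau>s: "list_all2 (\<lambda>\<tau> q. \<tau> permutes {..<length (Inputs ?P q)}) \<tau>s qs"
      and \<rho>: "\<rho> permutes {..<length (concat (input_labels ?P qs))}"
        "permute_list \<rho> (concat (input_labels ?P qs)) =
          concat (permute_list \<sigma> (map2 permute_list \<tau>s (input_labels ?P qs)))"
    for p qs \<sigma> \<tau>s \<rho>
  proof -
    have "permute_list \<rho> (concat (map fst qs)) = concat (permute_list \<sigma> (map2 permute_list \<tau>s (map fst qs)))"
      by (rule permute_transport[OF _ input_labels_tree _ _ \<rho>])
        (use \<sigma> \<tau>s in \<open>auto simp: input_labels_def tree_operad_def list_all2_map2 intro!: nth_equalityI\<close>)
    moreover have "map2 permute_list \<tau>s (map fst qs) = map fst (map2 (Act ?P) \<tau>s qs)"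
      by (simp add: tree_operad_def zip_map2 comp_def case_prod_unfold)
    moreover have "permute_list \<sigma> (map fst (map2 (Act ?P) \<tau>s qs)) = map fst (permute_list \<sigma> (map2 (Act ?P) \<tau>s qs))"
      using \<sigma> list_all2_lengthD[OF \<tau>s] by (intro permute_list_map) simp
    ultimately show ?thesis by (simp add: tree_operad_def)
  qed
  have assoc: "map fst (map2 (Compose ?P) qs rss) = map (concat \<circ> map fst) rss" if "length qs = length rss" for qs rss
    using that by (induction rule: list_induct2) (auto simp: tree_operad_def)
  show ?thesis
    unfolding symmetric_operad_def
  proof (intro conjI ballI allI impI)
    fix p qs rss assume "composable ?P p qs" and r: "list_all2 (composable ?P) qs rss"
    then have "length qs = length rss" by (rule_tac list_all2_lengthD)
    from assoc[OF this]
    show "Compose ?P (Compose ?P p qs) (concat rss) = Compose ?P p (map2 (Compose ?P) qs rss)"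
      unfolding tree_operad_def by (simp add: concat_map_fst_concat comp_def)
  next
    fix p qs \<sigma> \<tau>s \<rho>
    assume "composable ?P p qs" "\<sigma> permutes {..<length qs}"
      "list_all2 (\<lambda>\<tau> q. \<tau> permutes {..<length (Inputs ?P q)}) \<tau>s qs"
      "\<rho> permutes {..<length (concat (input_labels ?P qs))}"
      "permute_list \<rho> (concat (input_labels ?P qs)) =
        concat (permute_list \<sigma> (map2 permute_list \<tau>s (input_labels ?P qs)))"
    then show "Compose ?P (Act ?P \<sigma> p) (permute_list \<sigma> (map2 (Act ?P) \<tau>s qs)) = Act ?P \<rho> (Compose ?P p qs)"
      by (rule equi)
  next
    fix p assume "p \<in> Ops ?P"
    then show "set (Inputs ?P p) \<subseteq> Colours ?P" "Output ?P p \<in> Colours ?P"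
      using tree_ops_colours[OF assms, of p] by (auto simp: tree_operad_def)
    show "Compose ?P p (map (Unit ?P) (Inputs ?P p)) = p"
      by (simp add: tree_operad_def comp_def)
  qed (auto simp: tree_operad_def comp[unfolded tree_operad_def, simplified] permute_list_compose
      intro: tree_ops.intros)
qed

text \<open>
  The value, in an operad \<open>P\<close>, of an operation of the operad of \<open>T\<close>, given the images \<open>\<phi>\<close> of the
  edges and \<open>\<psi>\<close> of the vertices.  In \<open>node\<close>, \<open>zs\<close> lists the operations grafted onto the root
  vertex, together with their values.
\<close>

inductive tree_val ::
    "tree \<Rightarrow> ('c, 'o) opd \<Rightarrow> (nat \<Rightarrow> 'c) \<Rightarrow> (nat list \<times> nat \<Rightarrow> 'o) \<Rightarrow> nat list \<times> nat \<Rightarrow> 'o \<Rightarrow> bool"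
  for T P \<phi> \<psi> where
  unit: "e \<in> edges T \<Longrightarrow> tree_val T P \<phi> \<psi> ([e], e) (Unit P (\<phi> e))"
| node: "(set (map (\<lambda>z. snd (fst z)) zs), e) \<in> verts T \<Longrightarrow> distinct (map (\<lambda>z. snd (fst z)) zs) \<Longrightarrow>
    \<forall>z\<in>set zs. tree_val T P \<phi> \<psi> (fst z) (snd z) \<Longrightarrow>
    \<sigma> permutes {..<length (concat (map (\<lambda>z. fst (fst z)) zs))} \<Longrightarrow>
    tree_val T P \<phi> \<psi> (permute_list \<sigma> (concat (map (\<lambda>z. fst (fst z)) zs)), e)
      (Act P \<sigma> (Compose P (\<psi> (map (\<lambda>z. snd (fst z)) zs, e)) (map snd zs)))"

lemma mset_concat_permute:
  assumes "\<sigma> permutes {..<length Ls}" "list_all2 (\<lambda>\<tau> L. \<tau> permutes {..<length L}) \<tau>s Ls"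
  shows "mset (concat (permute_list \<sigma> (map2 permute_list \<tau>s Ls))) = mset (concat Ls)"
proof -
  have l: "length \<tau>s = length Ls" using assms(2) by (rule list_all2_lengthD)
  have 1: "map mset (map2 permute_list \<tau>s Ls) = map mset Ls"
    using l assms(2) by (auto intro!: nth_equalityI simp: list_all2_conv_all_nth)
  have 2: "mset (concat xs) = sum_mset (image_mset mset (mset xs))" for xs :: "'a list list"
    unfolding mset_concat by (simp add: sum_mset_sum_list flip: mset_map)
  have "mset (permute_list \<sigma> (map2 permute_list \<tau>s Ls)) = mset (map2 permute_list \<tau>s Ls)"
    by (rule mset_permute_list) (use assms(1) l in simp)
  then have "mset (concat (permute_list \<sigma> (map2 permute_list \<tau>s Ls))) = mset (concat (map2 permute_list \<tau>s Ls))"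
    by (simp only: 2)
  also have "\<dots> = mset (concat Ls)" unfolding mset_concat 1 ..
  finally show ?thesis .
qed

lemma operad_equivariance:
  assumes P: "symmetric_operad P" and c: "composable P p qs" and \<sigma>: "\<sigma> permutes {..<length qs}"
    and \<tau>s: "list_all2 (\<lambda>\<tau> q. \<tau> permutes {..<length (Inputs P q)}) \<tau>s qs"
  shows "\<exists>\<rho>. \<rho> permutes {..<length (concat (map (Inputs P) qs))} \<and>
    Compose P (Act P \<sigma> p) (permute_list \<sigma> (map2 (Act P) \<tau>s qs)) = Act P \<rho> (Compose P p qs) \<and>
    (\<forall>Ls :: nat list list. map length Ls = map (\<lambda>q. length (Inputs P q)) qs \<longrightarrow>
      permute_list \<rho> (concat Ls) = concat (permute_list \<sigma> (map2 permute_list \<tau>s Ls)))"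
proof -
  let ?l = "input_labels P qs"
  have l: "length ?l = length qs" "\<And>i. i < length qs \<Longrightarrow> length (?l ! i) = length (Inputs P (qs ! i))"
    by (auto simp: input_labels_def)
  have \<tau>l: "list_all2 (\<lambda>\<tau> L. \<tau> permutes {..<length L}) \<tau>s ?l"
    using \<tau>s l by (auto simp: list_all2_conv_all_nth)
  have "mset (concat (permute_list \<sigma> (map2 permute_list \<tau>s ?l))) = mset (concat ?l)"
    by (rule mset_concat_permute) (use \<sigma> l \<tau>l in auto)
  then obtain \<rho> where \<rho>: "\<rho> permutes {..<length (concat ?l)}"
    "permute_list \<rho> (concat ?l) = concat (permute_list \<sigma> (map2 permute_list \<tau>s ?l))"
    by (rule mset_eq_permutation)
  have "map length ?l = map length (map (Inputs P) qs)" using l by (auto intro!: nth_equalityI)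
  then have len: "length (concat ?l) = length (concat (map (Inputs P) qs))" by (simp add: length_concat)
  have "Compose P (Act P \<sigma> p) (permute_list \<sigma> (map2 (Act P) \<tau>s qs)) = Act P \<rho> (Compose P p qs)"
    using P c \<sigma> \<tau>s \<rho> unfolding symmetric_operad_def by blast
  moreover have "permute_list \<rho> (concat Ls) = concat (permute_list \<sigma> (map2 permute_list \<tau>s Ls))"
    if L: "map length Ls = map (\<lambda>q. length (Inputs P q)) qs" for Ls :: "nat list list"
  proof -
    have ll: "length Ls = length qs" using L by (metis length_map)
    have li: "length (Ls ! i) = length (Inputs P (qs ! i))" if "i < length qs" for i
      using arg_cong[OF L, of "\<lambda>l. l ! i"] that ll by simp
    show ?thesis
    proof (rule permute_transport[OF _ _ _ _ \<rho>])
      show "map length Ls = map length ?l" using ll li l by (auto intro!: nth_equalityI)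
      show "?l = map (\<lambda>i. map (Pair i) [0..<length (Ls ! i)]) [0..<length Ls]"
        using ll li by (auto simp: input_labels_def)
      show "\<sigma> permutes {..<length Ls}" using \<sigma> ll by simp
      show "list_all2 (\<lambda>\<tau> L. \<tau> permutes {..<length L}) \<tau>s Ls"
        using \<tau>s ll li by (auto simp: list_all2_conv_all_nth)
    qed
  qed
  ultimately show ?thesis using \<rho>(1) len by (intro exI[of _ \<rho>]) simp
qed

lemma split_list_like:
  "length xs = length (concat Ls) \<Longrightarrow> \<exists>xss. concat xss = xs \<and> map length xss = map length Ls"
proof (induction Ls arbitrary: xs)
  case (Cons L Ls)
  then have "length (drop (length L) xs) = length (concat Ls)" by simp
  from Cons.IH[OF this] obtain xss where "concat xss = drop (length L) xs" "map length xss = map length Ls"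
    by blast
  then show ?case using Cons.prems by (intro exI[of _ "take (length L) xs # xss"]) simp
qed simp

lemma concat_grafts: "concat (map (\<lambda>ys. concat (map f ys)) zss) = concat (map f (concat zss))"
  by (induction zss) auto

lemma distinct_concat_grafts:
  "list_all2 (\<lambda>L c. distinct L \<and> (\<forall>x\<in>set L. A x c)) Ls cs \<Longrightarrow> distinct cs \<Longrightarrow>
   (\<And>x c c'. A x c \<Longrightarrow> A x c' \<Longrightarrow> c \<in> set cs \<Longrightarrow> c' \<in> set cs \<Longrightarrow> c = c') \<Longrightarrow> distinct (concat Ls)"
proof (induction rule: list_all2_induct)
  case (Cons L Ls c cs)
  have "set L \<inter> set (concat Ls) = {}"
  proof (rule ccontr)
    assume "\<not> ?thesis"
    then obtain x L' where x: "x \<in> set L" "x \<in> set L'" "L' \<in> set Ls" by auto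
    then obtain c' where "c' \<in> set cs" "A x c'"
      using Cons(2) unfolding list_all2_conv_all_nth by (metis in_set_conv_nth)
    then show False using x Cons(1) Cons.prems by auto
  qed
  then show ?case using Cons by auto
qed simp

definition tree_step :: "tree \<Rightarrow> (nat \<times> nat) set" where
  "tree_step T = {(a, b). \<exists>I. (I, b) \<in> verts T \<and> a \<in> I}"

context
  fixes T :: tree
  assumes T: "is_tree T"
begin

lemma tree_step_det: "(a, b) \<in> tree_step T \<Longrightarrow> (a, c) \<in> tree_step T \<Longrightarrow> b = c"
  using T unfolding is_tree_def tree_step_def
  by (smt (verit, best) IntI case_prodD emptyE fst_conv mem_Collect_eq snd_conv)

lemma tree_step_root: "(root T, b) \<notin> tree_step T"
  using T unfolding is_tree_def tree_step_def by blast

lemma tree_acyclic: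
  assumes "e \<in> edges T" shows "(e, e) \<notin> (tree_step T)\<^sup>+"
proof -
  have "(e, root T) \<in> (tree_step T)\<^sup>*"
    using T assms unfolding is_tree_def tree_step_def by blast
  then show ?thesis
  proof (induction rule: converse_rtrancl_induct)
    case base show ?case using tree_step_root by (meson tranclD)
  next
    case (step e e')
    show ?case
    proof
      assume "(e, e) \<in> (tree_step T)\<^sup>+"
      then obtain x where "(e, x) \<in> tree_step T" "(x, e) \<in> (tree_step T)\<^sup>*" by (meson tranclD)
      then have "(e', e) \<in> (tree_step T)\<^sup>*" using step(1) tree_step_det by blast
      then show False using step(1,3) by (meson rtrancl_into_trancl1)
    qed
  qed
qed

lemma tree_chain: "(x, a) \<in> (tree_step T)\<^sup>* \<Longrightarrow> (x, b) \<in> (tree_step T)\<^sup>* \<Longrightarrow>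
    (a, b) \<in> (tree_step T)\<^sup>* \<or> (b, a) \<in> (tree_step T)\<^sup>*"
proof (induction rule: converse_rtrancl_induct)
  case (step x y)
  show ?case
  proof (cases "x = b")
    case True then show ?thesis using step(1,2) by (meson converse_rtrancl_into_rtrancl)
  next
    case False
    then obtain z where "(x, z) \<in> tree_step T" "(z, b) \<in> (tree_step T)\<^sup>*"
      using step(4) by (meson converse_rtranclE)
    then show ?thesis using step tree_step_det by blast
  qed
qed simp

lemma tree_siblings:
  assumes "(I, e) \<in> verts T" "c \<in> I" "c' \<in> I" "(x, c) \<in> (tree_step T)\<^sup>*" "(x, c') \<in> (tree_step T)\<^sup>*"
  shows "c = c'"
proof -
  have e: "e \<in> edges T" using T assms(1) unfolding is_tree_def by blast
  have s: "(c, e) \<in> tree_step T" "(c', e) \<in> tree_step T" using assms(1-3) by (auto simp: tree_step_def)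
  have *: "a = b" if ab: "(a, b) \<in> (tree_step T)\<^sup>*" "(a, e) \<in> tree_step T" "(b, e) \<in> tree_step T" for a b
  proof (rule ccontr)
    assume "a \<noteq> b"
    then obtain y where "(a, y) \<in> tree_step T" "(y, b) \<in> (tree_step T)\<^sup>*"
      using ab(1) by (meson converse_rtranclE)
    then have "(e, b) \<in> (tree_step T)\<^sup>*" using ab(2) tree_step_det by blast
    then show False using ab(3) tree_acyclic[OF e] by (meson rtrancl_into_trancl1)
  qed
  show ?thesis using tree_chain[OF assms(4,5)] *[OF _ s] *[OF _ s(2,1)] by auto
qed

context
  fixes P :: "('c, 'o) opd" and \<phi> :: "nat \<Rightarrow> 'c" and \<psi> :: "nat list \<times> nat \<Rightarrow> 'o"
  assumes P: "symmetric_operad P"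
    and \<phi>: "\<And>e. e \<in> edges T \<Longrightarrow> \<phi> e \<in> Colours P"
    and \<psi>: "\<And>es e. (set es, e) \<in> verts T \<Longrightarrow> distinct es \<Longrightarrow>
        \<psi> (es, e) \<in> Ops P \<and> Inputs P (\<psi> (es, e)) = map \<phi> es \<and> Output P (\<psi> (es, e)) = \<phi> e"
    and \<psi>_act: "\<And>es e \<sigma>. (set es, e) \<in> verts T \<Longrightarrow> distinct es \<Longrightarrow> \<sigma> permutes {..<length es} \<Longrightarrow>
        \<psi> (permute_list \<sigma> es, e) = Act P \<sigma> (\<psi> (es, e))"
begin

lemma P_unit: "c \<in> Colours P \<Longrightarrow> Unit P c \<in> Ops P \<and> Inputs P (Unit P c) = [c] \<and> Output P (Unit P c) = c"
  using P unfolding symmetric_operad_def by blast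
lemma P_compose: "composable P p qs \<Longrightarrow> Compose P p qs \<in> Ops P \<and>
    Inputs P (Compose P p qs) = concat (map (Inputs P) qs) \<and> Output P (Compose P p qs) = Output P p"
  using P unfolding symmetric_operad_def by blast
lemma P_act: "p \<in> Ops P \<Longrightarrow> \<sigma> permutes {..<length (Inputs P p)} \<Longrightarrow> Act P \<sigma> p \<in> Ops P \<and>
    Inputs P (Act P \<sigma> p) = permute_list \<sigma> (Inputs P p) \<and> Output P (Act P \<sigma> p) = Output P p"
  using P unfolding symmetric_operad_def by blast
lemma P_unit_right: "p \<in> Ops P \<Longrightarrow> Compose P p (map (Unit P) (Inputs P p)) = p"
  using P unfolding symmetric_operad_def by blast
lemma P_unit_left: "p \<in> Ops P \<Longrightarrow> Compose P (Unit P (Output P p)) [p] = p"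
  using P unfolding symmetric_operad_def by blast
lemma P_assoc: "composable P p qs \<Longrightarrow> list_all2 (composable P) qs rss \<Longrightarrow>
    Compose P (Compose P p qs) (concat rss) = Compose P p (map2 (Compose P) qs rss)"
  using P unfolding symmetric_operad_def by blast
lemma P_act_id: "p \<in> Ops P \<Longrightarrow> Act P id p = p"
  using P unfolding symmetric_operad_def by blast
lemma P_act_comp: "p \<in> Ops P \<Longrightarrow> \<sigma> permutes {..<length (Inputs P p)} \<Longrightarrow>
    \<tau> permutes {..<length (Inputs P p)} \<Longrightarrow> Act P (\<sigma> \<circ> \<tau>) p = Act P \<tau> (Act P \<sigma> p)"
  using P unfolding symmetric_operad_def by blast

abbreviation val :: "nat list \<times> nat \<Rightarrow> 'o \<Rightarrow> bool" where "val \<equiv> tree_val T P \<phi> \<psi>"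

lemma node_composable:
  assumes "(set (map (\<lambda>z. snd (fst z)) zs), e) \<in> verts T" "distinct (map (\<lambda>z. snd (fst z)) zs)"
    "\<forall>z\<in>set zs. snd z \<in> Ops P \<and> Output P (snd z) = \<phi> (snd (fst z))"
  shows "composable P (\<psi> (map (\<lambda>z. snd (fst z)) zs, e)) (map snd zs)"
  using \<psi>[OF assms(1,2)] assms(3) unfolding composable_def by auto

lemma val_wf: "val q p \<Longrightarrow> p \<in> Ops P \<and> Inputs P p = map \<phi> (fst q) \<and> Output P p = \<phi> (snd q)"
proof (induction rule: tree_val.induct)
  case (unit e) then show ?case using P_unit \<phi> by auto
next
  case (node zs e \<sigma>)
  have w: "\<forall>z\<in>set zs. snd z \<in> Ops P \<and> Output P (snd z) = \<phi> (snd (fst z))" using node(4) by blast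
  note c = P_compose[OF node_composable[OF node(1,2) w]]
  let ?C = "Compose P (\<psi> (map (\<lambda>z. snd (fst z)) zs, e)) (map snd zs)"
  have C: "?C \<in> Ops P" "Inputs P ?C = concat (map (Inputs P) (map snd zs))" "Output P ?C = \<phi> e"
    using c node(4) \<psi>[OF node(1,2)] by auto
  have eq: "map (Inputs P) (map snd zs) = map (map \<phi>) (map (\<lambda>z. fst (fst z)) zs)" using node(4) by auto
  have I: "Inputs P ?C = map \<phi> (concat (map (\<lambda>z. fst (fst z)) zs))"
    unfolding C(2) map_concat by (simp only: eq)
  then show ?case using P_act[OF C(1), of \<sigma>] node(3) C(3) permute_list_map[OF node(3), of \<phi>] by simp
qed

lemma val_act:
  assumes "val q p" "\<tau> permutes {..<length (fst q)}"
  shows "val (permute_list \<tau> (fst q), snd q) (Act P \<tau> p)"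
  using assms
proof (cases rule: tree_val.cases)
  case (unit e)
  then have "\<tau> permutes {0}" using assms(2) by (simp add: lessThan_Suc)
  then have "\<tau> = id" by simp
  then show ?thesis using assms(1) P_act_id val_wf[OF assms(1)] by simp
next
  case (node zs e \<sigma>)
  let ?L = "concat (map (\<lambda>z. fst (fst z)) zs)"
  let ?C = "Compose P (\<psi> (map (\<lambda>z. snd (fst z)) zs, e)) (map snd zs)"
  have \<tau>: "\<tau> permutes {..<length ?L}" using assms(2) node(1) by simp
  have "val (permute_list id ?L, e) (Act P id ?C)"
    by (rule tree_val.node) (use node permutes_id in auto)
  then have wf: "Act P id ?C \<in> Ops P" "Inputs P (Act P id ?C) = map \<phi> ?L" using val_wf by fastforce+
  have c: "composable P (\<psi> (map (\<lambda>z. snd (fst z)) zs, e)) (map snd zs)"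
    by (rule node_composable) (use node val_wf in auto)
  then have i: "Act P id ?C = ?C" using P_compose P_act_id by blast
  have "val (permute_list (\<sigma> \<circ> \<tau>) ?L, e) (Act P (\<sigma> \<circ> \<tau>) ?C)"
    by (rule tree_val.node) (use node \<tau> permutes_compose in auto)
  moreover have "Act P (\<sigma> \<circ> \<tau>) ?C = Act P \<tau> (Act P \<sigma> ?C)"
    by (rule P_act_comp) (use wf i node \<tau> in auto)
  moreover have "permute_list (\<sigma> \<circ> \<tau>) ?L = permute_list \<tau> (permute_list \<sigma> ?L)"
    by (rule permute_list_compose[OF \<tau>])
  ultimately show ?thesis using node(1,2) by simp
qed

lemma val_node':
  assumes "(set (map (\<lambda>z. snd (fst z)) zs), e) \<in> verts T" "distinct (map (\<lambda>z. snd (fst z)) zs)"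
    "\<forall>z\<in>set zs. val (fst z) (snd z)"
  shows "val (concat (map (\<lambda>z. fst (fst z)) zs), e)
      (Compose P (\<psi> (map (\<lambda>z. snd (fst z)) zs, e)) (map snd zs))"
proof -
  have c: "composable P (\<psi> (map (\<lambda>z. snd (fst z)) zs, e)) (map snd zs)"
    by (rule node_composable) (use assms val_wf in auto)
  show ?thesis using tree_val.node[OF assms permutes_id] P_act_id P_compose[OF c] by simp
qed

lemma val_compose:
  assumes "val q p" "map (\<lambda>z. snd (fst z)) zs = fst q" "\<forall>z\<in>set zs. val (fst z) (snd z)"
  shows "val (concat (map (\<lambda>z. fst (fst z)) zs), snd q) (Compose P p (map snd zs))"
  using assms
proof (induction arbitrary: zs rule: tree_val.induct)
  case (unit e)
  then obtain z where z: "zs = [z]" "snd (fst z) = e" by auto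
  then have "fst z = (fst (fst z), e)" by (simp add: prod_eq_iff)
  then show ?case using unit z val_wf[of "fst z" "snd z"] P_unit_left[of "snd z"] by simp
next
  case (node zs0 e \<sigma>)
  let ?cs = "map (\<lambda>z. snd (fst z)) zs0" and ?L = "concat (map (\<lambda>z. fst (fst z)) zs0)"
  let ?C = "Compose P (\<psi> (?cs, e)) (map snd zs0)"
  have len: "length zs = length ?L" using arg_cong[OF node.prems(1), of length] by simp
  define zsL where "zsL = permute_list (inv \<sigma>) zs"
  have \<sigma>: "\<sigma> permutes {..<length zs}" "inv \<sigma> permutes {..<length zs}"
    using node(3) len by (auto intro: permutes_inv)
  have zs: "zs = permute_list \<sigma> zsL"
    unfolding zsL_def using permute_list_compose[OF \<sigma>(1), of "inv \<sigma>"] permutes_inv_o(2)[OF \<sigma>(1)] by simp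
  have "map (\<lambda>z. snd (fst z)) zsL = permute_list (inv \<sigma>) (permute_list \<sigma> ?L)"
    unfolding zsL_def using permute_list_map[OF \<sigma>(2), of "\<lambda>z. snd (fst z)"] node.prems(1) by simp
  also have "\<dots> = ?L"
    using permute_list_compose[of "inv \<sigma>" ?L \<sigma>] \<sigma>(2) len permutes_inv_o(1)[OF \<sigma>(1)] by simp
  finally have sL: "map (\<lambda>z. snd (fst z)) zsL = ?L" .
  have setL: "set zsL = set zs" unfolding zsL_def using \<sigma>(2) by simp
  have lenL: "length zsL = length ?L" using len by (simp add: zsL_def)
  obtain zss where zss: "concat zss = zsL" "map length zss = map length (map (\<lambda>z. fst (fst z)) zs0)"
    using split_list_like[OF lenL] by blast
  have lz: "length zss = length zs0" using zss(2) by (metis length_map)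
  have lzi: "length (zss ! i) = length (fst (fst (zs0 ! i)))" if "i < length zs0" for i
    using arg_cong[OF zss(2), of "\<lambda>l. l ! i"] that lz by simp
  have "map (map (\<lambda>z. snd (fst z))) zss = map (\<lambda>z. fst (fst z)) zs0"
  proof (rule iffD1[OF concat_eq_concat_iff])
    show "concat (map (map (\<lambda>z. snd (fst z))) zss) = ?L" using sL zss(1) by (simp add: flip: map_concat)
  qed (use lz lzi in \<open>auto simp: set_zip\<close>)
  then have ss: "map (\<lambda>z. snd (fst z)) (zss ! i) = fst (fst (zs0 ! i))" if "i < length zs0" for i
    using that lz by (auto dest: arg_cong[of _ _ "\<lambda>l. l ! i"])
  define h where "h z0 ys = ((concat (map (\<lambda>z. fst (fst z)) ys), snd (fst z0)), Compose P (snd z0) (map snd ys))"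
    for z0 :: "(nat list \<times> nat) \<times> 'o" and ys :: "((nat list \<times> nat) \<times> 'o) list"
  define zs1 where "zs1 = map2 h zs0 zss"
  have cs1: "map (\<lambda>z. snd (fst z)) zs1 = ?cs"
    using lz by (auto simp: zs1_def h_def intro!: nth_equalityI)
  have inL: "z \<in> set zs" if "z \<in> set (zss ! i)" "i < length zs0" for z i
    using that lz zss(1) setL by (metis UN_I nth_mem set_concat)
  have val1: "\<forall>z\<in>set zs1. val (fst z) (snd z)"
  proof
    fix z assume "z \<in> set zs1"
    then obtain i where i: "i < length zs0" "z = h (zs0 ! i) (zss ! i)"
      using lz by (auto simp: zs1_def set_zip)
    have "zs0 ! i \<in> set zs0" using i(1) by simp
    with node(4) have "\<And>ys. map (\<lambda>z. snd (fst z)) ys = fst (fst (zs0 ! i)) \<Longrightarrow> \<forall>z\<in>set ys. val (fst z) (snd z) \<Longrightarrow>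
        val (concat (map (\<lambda>z. fst (fst z)) ys), snd (fst (zs0 ! i))) (Compose P (snd (zs0 ! i)) (map snd ys))"
      by blast
    from this[OF ss[OF i(1)]] show "val (fst z) (snd z)"
      using node.prems(2) inL[OF _ i(1)] by (simp add: i(2) h_def)
  qed
  have wf0: "\<forall>z\<in>set zs0. snd z \<in> Ops P \<and> Output P (snd z) = \<phi> (snd (fst z))"
    using node(4) val_wf by auto
  have c0: "composable P (\<psi> (?cs, e)) (map snd zs0)" by (rule node_composable[OF node(1,2) wf0])
  have C: "?C \<in> Ops P" "Inputs P ?C = map \<phi> ?L"
  proof -
    have "val (?L, e) ?C" by (rule val_node') (use node(1,2,4) in auto)
    then show "?C \<in> Ops P" "Inputs P ?C = map \<phi> ?L" using val_wf by fastforce+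
  qed
  have wfz: "snd z \<in> Ops P" "Inputs P (snd z) = map \<phi> (fst (fst z))" "Output P (snd z) = \<phi> (snd (fst z))"
    if "z \<in> set zs" for z using val_wf[of "fst z" "snd z"] node.prems(2) that by blast+
  have a: "list_all2 (composable P) (map snd zs0) (map (map snd) zss)"
  proof (rule list_all2_all_nthI)
    fix i assume "i < length (map snd zs0)"
    then have i: "i < length zs0" "zs0 ! i \<in> set zs0" by auto
    have "Inputs P (snd (zs0 ! i)) = map \<phi> (fst (fst (zs0 ! i)))" using val_wf node(4) i(2) by blast
    also have "\<dots> = map (Output P) (map snd (zss ! i))"
      using wfz(3)[OF inL[OF _ i(1)]] by (simp flip: ss[OF i(1)])
    finally show "composable P (map snd zs0 ! i) (map (map snd) zss ! i)"
      using i lz wf0 wfz(1)[OF inL[OF _ i(1)]] by (auto simp: composable_def)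
  qed (use lz in simp)
  have "map snd zs1 = map2 (Compose P) (map snd zs0) (map (map snd) zss)"
    using lz by (auto simp: zs1_def h_def intro!: nth_equalityI)
  then have "Compose P (\<psi> (?cs, e)) (map snd zs1) = Compose P ?C (map snd zsL)"
    using P_assoc[OF c0 a] zss(1) by (simp flip: map_concat)
  moreover have "map (\<lambda>z. fst (fst z)) zs1 = map (\<lambda>ys. concat (map (\<lambda>z. fst (fst z)) ys)) zss"
    using lz by (auto simp: zs1_def h_def intro!: nth_equalityI)
  then have "concat (map (\<lambda>z. fst (fst z)) zs1) = concat (map (\<lambda>z. fst (fst z)) zsL)"
    unfolding zss(1)[symmetric] by (simp only: concat_grafts)
  moreover have "val (concat (map (\<lambda>z. fst (fst z)) zs1), e) (Compose P (\<psi> (?cs, e)) (map snd zs1))"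
    using val_node'[of zs1 e] node(1,2) val1 unfolding cs1 by blast
  ultimately have v: "val (concat (map (\<lambda>z. fst (fst z)) zsL), e) (Compose P ?C (map snd zsL))" by simp
  have cC: "composable P ?C (map snd zsL)"
    unfolding composable_def using C wfz setL sL[symmetric] by (auto simp: comp_def)
  let ?ids = "replicate (length zsL) id"
  have \<sigma>L: "\<sigma> permutes {..<length (map snd zsL)}" using \<sigma>(1) by (simp add: zsL_def)
  have idsp: "list_all2 (\<lambda>\<tau> q. \<tau> permutes {..<length (Inputs P q)}) ?ids (map snd zsL)"
    by (auto simp: list_all2_conv_all_nth permutes_id)
  obtain \<rho> where \<rho>: "\<rho> permutes {..<length (concat (map (Inputs P) (map snd zsL)))}"
    "Compose P (Act P \<sigma> ?C) (permute_list \<sigma> (map2 (Act P) ?ids (map snd zsL))) = Act P \<rho> (Compose P ?C (map snd zsL))"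
    "\<forall>Ls :: nat list list. map length Ls = map (\<lambda>q. length (Inputs P q)) (map snd zsL) \<longrightarrow>
      permute_list \<rho> (concat Ls) = concat (permute_list \<sigma> (map2 permute_list ?ids Ls))"
    using operad_equivariance[OF P cC \<sigma>L idsp] by blast
  have lens: "map length (map (\<lambda>z. fst (fst z)) zsL) = map (\<lambda>q. length (Inputs P q)) (map snd zsL)"
    using wfz(2) setL by auto
  have "map2 permute_list ?ids (map (\<lambda>z. fst (fst z)) zsL) = map (\<lambda>z. fst (fst z)) zsL"
    by (auto intro!: nth_equalityI)
  then have "permute_list \<rho> (concat (map (\<lambda>z. fst (fst z)) zsL)) = concat (permute_list \<sigma> (map (\<lambda>z. fst (fst z)) zsL))"
    using \<rho>(3)[rule_format, OF lens] by simp
  also have "permute_list \<sigma> (map (\<lambda>z. fst (fst z)) zsL) = map (\<lambda>z. fst (fst z)) zs"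
    using permute_list_map[of \<sigma> zsL] \<sigma>L zs by simp
  finally have r1: "permute_list \<rho> (concat (map (\<lambda>z. fst (fst z)) zsL)) = concat (map (\<lambda>z. fst (fst z)) zs)" .
  have "map2 (Act P) ?ids (map snd zsL) = map snd zsL"
  proof (intro nth_equalityI)
    fix i assume "i < length (map2 (Act P) ?ids (map snd zsL))"
    then have i: "i < length zsL" by simp
    then have "zsL ! i \<in> set zs" using setL nth_mem by blast
    then show "map2 (Act P) ?ids (map snd zsL) ! i = map snd zsL ! i" using i wfz(1) P_act_id by simp
  qed simp
  moreover have "permute_list \<sigma> (map snd zsL) = map snd zs"
    using permute_list_map[of \<sigma> zsL] \<sigma>L zs by simp
  ultimately have r2: "Compose P (Act P \<sigma> ?C) (map snd zs) = Act P \<rho> (Compose P ?C (map snd zsL))"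
    using \<rho>(2) by simp
  have "length (concat (map (Inputs P) (map snd zsL))) = length (concat (map (\<lambda>z. fst (fst z)) zsL))"
    using arg_cong[OF lens, of sum_list] by (simp add: length_concat comp_def)
  then have "\<rho> permutes {..<length (concat (map (\<lambda>z. fst (fst z)) zsL))}" using \<rho>(1) by simp
  from val_act[OF v, simplified, OF this[simplified]]
  show ?case using r1 r2 by simp
qed

lemma val_above: "val q p \<Longrightarrow> distinct (fst q) \<and> (\<forall>x\<in>set (fst q). (x, snd q) \<in> (tree_step T)\<^sup>*)"
proof (induction rule: tree_val.induct)
  case (node zs e \<sigma>)
  have "distinct (concat (map (\<lambda>z. fst (fst z)) zs))"
  proof (rule distinct_concat_grafts[of "\<lambda>x c. (x, c) \<in> (tree_step T)\<^sup>*"])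
    show "list_all2 (\<lambda>L c. distinct L \<and> (\<forall>x\<in>set L. (x, c) \<in> (tree_step T)\<^sup>*))
        (map (\<lambda>z. fst (fst z)) zs) (map (\<lambda>z. snd (fst z)) zs)"
      using node(4) by (auto simp: list_all2_conv_all_nth)
  qed (use node(2) tree_siblings[OF node(1)] in auto)
  moreover have "(x, e) \<in> (tree_step T)\<^sup>*" if "z \<in> set zs" "x \<in> set (fst (fst z))" for x z
  proof -
    have "(snd (fst z), e) \<in> tree_step T" using node(1) that(1) by (auto simp: tree_step_def)
    then show ?thesis using node(4) that by (meson rtrancl.rtrancl_into_rtrancl)
  qed
  ultimately show ?case using node(3) by auto
qed auto

lemma permute_distinct_eq:
  assumes "distinct L" "\<sigma> permutes {..<length L}" "\<tau> permutes {..<length L}" "permute_list \<sigma> L = permute_list \<tau> L"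
  shows "\<sigma> = \<tau>"
proof
  fix i
  show "\<sigma> i = \<tau> i"
  proof (cases "i < length L")
    case True
    then have "L ! \<sigma> i = L ! \<tau> i" using assms by (metis permute_list_nth)
    moreover have "\<sigma> i < length L" "\<tau> i < length L"
      using True permutes_in_image[OF assms(2)] permutes_in_image[OF assms(3)] by auto
    ultimately show ?thesis using assms(1) by (simp add: nth_eq_iff_index_eq)
  next
    case False then show ?thesis using assms(2,3) by (simp add: permutes_def)
  qed
qed

lemma val_unit_node:
  assumes "(set (map (\<lambda>z. snd (fst z)) zs), e) \<in> verts T" "\<forall>z\<in>set zs. val (fst z) (snd z)"
    "\<sigma> permutes {..<length (concat (map (\<lambda>z. fst (fst z)) zs))}"
  shows "permute_list \<sigma> (concat (map (\<lambda>z. fst (fst z)) zs)) \<noteq> [e]"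
proof
  assume "permute_list \<sigma> (concat (map (\<lambda>z. fst (fst z)) zs)) = [e]"
  then have "e \<in> set (concat (map (\<lambda>z. fst (fst z)) zs))" using assms(3) by (metis list.set_intros(1) set_permute_list)
  then obtain z where z: "z \<in> set zs" "e \<in> set (fst (fst z))" by auto
  then have "(e, snd (fst z)) \<in> (tree_step T)\<^sup>*" using assms(2) val_above by blast
  moreover have "(snd (fst z), e) \<in> tree_step T" using assms(1) z(1) by (auto simp: tree_step_def)
  ultimately have "(e, e) \<in> (tree_step T)\<^sup>+" by (rule rtrancl_into_trancl1)
  moreover have "e \<in> edges T" using T assms(1) unfolding is_tree_def by blast
  ultimately show False using tree_acyclic by blast
qed

lemma val_unique: "val q p \<Longrightarrow> val q p' \<Longrightarrow> p = p'"
proof (induction arbitrary: p' rule: tree_val.induct)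
  case (unit e)
  from unit(2) show ?case
  proof (cases rule: tree_val.cases)
    case (node zs \<sigma>) then show ?thesis using val_unit_node by metis
  qed simp
next
  case (node zs e \<sigma>)
  let ?cs = "map (\<lambda>z. snd (fst z)) zs" and ?L = "concat (map (\<lambda>z. fst (fst z)) zs)"
  let ?C = "Compose P (\<psi> (?cs, e)) (map snd zs)"
  have vz: "\<forall>z\<in>set zs. val (fst z) (snd z)" using node(4) by blast
  note IH = node(4)
  from node(5) show ?case
  proof (cases rule: tree_val.cases)
    case unit then show ?thesis using val_unit_node[OF node(1) vz node(3)] by simp
  next
    case (node zs' \<sigma>')
    note n' = this
    let ?cs' = "map (\<lambda>z. snd (fst z)) zs'" and ?L' = "concat (map (\<lambda>z. fst (fst z)) zs')"
    have "\<forall>v\<in>verts T. \<forall>w\<in>verts T. snd v = snd w \<longrightarrow> v = w" using T unfolding is_tree_def by blast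
    from this[rule_format, OF n'(3) \<open>(set ?cs, e) \<in> verts T\<close>] have "set ?cs' = set ?cs" by simp
    then have "mset ?cs' = mset ?cs"
      using set_eq_iff_mset_eq_distinct[OF n'(4) \<open>distinct ?cs\<close>] by blast
    then obtain \<pi> where \<pi>: "\<pi> permutes {..<length ?cs}" "permute_list \<pi> ?cs = ?cs'"
      by (rule mset_eq_permutation)
    have lz: "length zs' = length zs" using arg_cong[OF \<pi>(2), of length] by simp
    have \<pi>l: "\<pi> j < length zs" if "j < length zs" for j
      using permutes_in_image[OF \<pi>(1)] that by simp
    have cj: "snd (fst (zs' ! j)) = snd (fst (zs ! \<pi> j))" if "j < length zs" for j
      using arg_cong[OF \<pi>(2), of "\<lambda>l. l ! j"] that lz \<pi>l[OF that] permute_list_nth[OF \<pi>(1)] by simp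
    have setL: "set ?L = set ?L'"
      using arg_cong[OF n'(1), of set]
      unfolding set_permute_list[OF n'(6)] set_permute_list[OF \<open>\<sigma> permutes {..<length ?L}\<close>] .
    have part: "set (fst (fst (ys ! i))) = {x \<in> set ?L. (x, snd (fst (ys ! i))) \<in> (tree_step T)\<^sup>*}"
      if ys: "ys = zs \<or> ys = zs'" and i: "i < length ys" for ys i
    proof -
      have v: "(set (map (\<lambda>z. snd (fst z)) ys), e) \<in> verts T" and vy: "\<forall>z\<in>set ys. val (fst z) (snd z)"
        and d: "distinct (map (\<lambda>z. snd (fst z)) ys)"
        using ys n'(3-5) \<open>(set ?cs, e) \<in> verts T\<close> \<open>distinct ?cs\<close> vz by blast+
      have L: "set ?L = set (concat (map (\<lambda>z. fst (fst z)) ys))" using ys setL by auto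
      have "set (fst (fst (ys ! i))) \<subseteq> {x \<in> set ?L. (x, snd (fst (ys ! i))) \<in> (tree_step T)\<^sup>*}"
        unfolding L using val_above vy i by fastforce
      moreover have "x \<in> set (fst (fst (ys ! i)))"
        if x: "x \<in> set ?L" "(x, snd (fst (ys ! i))) \<in> (tree_step T)\<^sup>*" for x
      proof -
        from x(1) obtain y where "y \<in> set ys" "x \<in> set (fst (fst y))" unfolding L by auto
        then obtain k where k: "k < length ys" "x \<in> set (fst (fst (ys ! k)))" by (metis in_set_conv_nth)
        then have "(x, snd (fst (ys ! k))) \<in> (tree_step T)\<^sup>*" using val_above vy by (meson nth_mem)
        then have "snd (fst (ys ! k)) = snd (fst (ys ! i))"
          using tree_siblings[OF v] x(2) k(1) i by auto
        then have "k = i" using d k(1) i by (simp add: distinct_conv_nth) metis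
        then show ?thesis using k(2) by simp
      qed
      ultimately show ?thesis by blast
    qed
    have "\<exists>\<tau>. \<tau> permutes {..<length (fst (fst (zs ! i)))} \<and>
        (\<forall>j<length zs. \<pi> j = i \<longrightarrow> fst (fst (zs' ! j)) = permute_list \<tau> (fst (fst (zs ! i))) \<and>
           snd (zs' ! j) = Act P \<tau> (snd (zs ! i)))" if i: "i < length zs" for i
    proof -
      define j where "j = inv \<pi> i"
      have "inv \<pi> permutes {..<length zs}" using \<pi>(1) permutes_inv by auto
      then have j: "j < length zs" using permutes_in_image i by (fastforce simp: j_def)
      have \<pi>j: "\<pi> j = i" using permutes_inverses(1)[OF \<pi>(1)] by (simp add: j_def)
      have uj: "k = j" if "\<pi> k = i" for k using permutes_inj[OF \<pi>(1)] \<pi>j that by (metis injD)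
      let ?z = "zs ! i" and ?z' = "zs' ! j"
      have vi: "val (fst ?z) (snd ?z)" "val (fst ?z') (snd ?z')" using vz n'(5) i j lz by auto
      have sn: "snd (fst ?z') = snd (fst ?z)" using cj[OF j] \<pi>j by simp
      have "set (fst (fst ?z')) = set (fst (fst ?z))" using part[of zs i] part[of zs' j] i j lz sn by simp
      then have "mset (fst (fst ?z')) = mset (fst (fst ?z))"
        using val_above[OF vi(1)] val_above[OF vi(2)] set_eq_iff_mset_eq_distinct by blast
      then obtain \<tau> where \<tau>: "\<tau> permutes {..<length (fst (fst ?z))}" "permute_list \<tau> (fst (fst ?z)) = fst (fst ?z')"
        by (rule mset_eq_permutation)
      have e: "fst ?z' = (permute_list \<tau> (fst (fst ?z)), snd (fst ?z))" using \<tau>(2) sn by (simp add: prod_eq_iff)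
      have \<tau>i: "inv \<tau> permutes {..<length (fst (fst ?z))}" using permutes_inv[OF \<tau>(1)] .
      have "permute_list (inv \<tau>) (fst (fst ?z')) = fst (fst ?z)"
        using permute_list_compose[OF \<tau>i, of \<tau>] \<tau>(2) permutes_inv_o(1)[OF \<tau>(1)] by simp
      moreover have "inv \<tau> permutes {..<length (fst (fst ?z'))}" using \<tau>i e by simp
      ultimately have "val (fst ?z) (Act P (inv \<tau>) (snd ?z'))" using val_act[OF vi(2)] sn by (metis prod.collapse)
      then have a: "snd ?z = Act P (inv \<tau>) (snd ?z')" using IH i by (meson nth_mem)
      have w: "snd ?z' \<in> Ops P" "length (Inputs P (snd ?z')) = length (fst (fst ?z))"
        using val_wf[OF vi(2)] e by auto
      have "Act P \<tau> (snd ?z) = Act P (inv \<tau> \<circ> \<tau>) (snd ?z')"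
        unfolding a by (rule P_act_comp[symmetric]) (use w \<tau> \<tau>i in auto)
      also have "\<dots> = snd ?z'" using permutes_inv_o(2)[OF \<tau>(1)] P_act_id[OF w(1)] by simp
      finally show ?thesis using \<tau> uj e by (intro exI[of _ \<tau>]) auto
    qed
    then obtain t where t: "\<And>i. i < length zs \<Longrightarrow> t i permutes {..<length (fst (fst (zs ! i)))}"
      "\<And>j. j < length zs \<Longrightarrow> fst (fst (zs' ! j)) = permute_list (t (\<pi> j)) (fst (fst (zs ! \<pi> j)))"
      "\<And>j. j < length zs \<Longrightarrow> snd (zs' ! j) = Act P (t (\<pi> j)) (snd (zs ! \<pi> j))"
      using \<pi>l by metis
    let ?\<tau>s = "map t [0..<length zs]"
    have wfz: "\<forall>z\<in>set zs. snd z \<in> Ops P \<and> Output P (snd z) = \<phi> (snd (fst z))" using vz val_wf by auto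
    have c: "composable P (\<psi> (?cs, e)) (map snd zs)"
      by (rule node_composable) (use \<open>(set ?cs, e) \<in> verts T\<close> \<open>distinct ?cs\<close> wfz in auto)
    have \<pi>': "\<pi> permutes {..<length (map snd zs)}" using \<pi>(1) by simp
    have \<tau>p: "list_all2 (\<lambda>\<tau> q. \<tau> permutes {..<length (Inputs P q)}) ?\<tau>s (map snd zs)"
    proof (rule list_all2_all_nthI)
      fix i assume "i < length ?\<tau>s"
      then have i: "i < length zs" by simp
      then have "Inputs P (snd (zs ! i)) = map \<phi> (fst (fst (zs ! i)))" using val_wf vz nth_mem by blast
      then show "(?\<tau>s ! i) permutes {..<length (Inputs P (map snd zs ! i))}" using t(1)[OF i] i by simp
    qed simp
    obtain \<rho> where \<rho>: "\<rho> permutes {..<length (concat (map (Inputs P) (map snd zs)))}"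
      "Compose P (Act P \<pi> (\<psi> (?cs, e))) (permute_list \<pi> (map2 (Act P) ?\<tau>s (map snd zs))) = Act P \<rho> ?C"
      "\<forall>Ls :: nat list list. map length Ls = map (\<lambda>q. length (Inputs P q)) (map snd zs) \<longrightarrow>
        permute_list \<rho> (concat Ls) = concat (permute_list \<pi> (map2 permute_list ?\<tau>s Ls))"
      using operad_equivariance[OF P c \<pi>' \<tau>p] by blast
    have lens: "map length (map (\<lambda>z. fst (fst z)) zs) = map (\<lambda>q. length (Inputs P q)) (map snd zs)"
      using vz val_wf by auto
    have "permute_list \<pi> (map2 permute_list ?\<tau>s (map (\<lambda>z. fst (fst z)) zs)) = map (\<lambda>z. fst (fst z)) zs'"
      using \<pi>(1) lz \<pi>l t(2) by (intro nth_equalityI) (auto simp: permute_list_nth)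
    then have L': "?L' = permute_list \<rho> ?L" using \<rho>(3)[rule_format, OF lens] by simp
    have "permute_list \<pi> (map2 (Act P) ?\<tau>s (map snd zs)) = map snd zs'"
      using \<pi>(1) lz \<pi>l t(3) by (intro nth_equalityI) (auto simp: permute_list_nth)
    then have C': "Compose P (\<psi> (?cs', e)) (map snd zs') = Act P \<rho> ?C"
      using \<rho>(2) \<psi>_act[OF \<open>(set ?cs, e) \<in> verts T\<close> \<open>distinct ?cs\<close> \<pi>(1)] \<pi>(2) by simp
    have len: "length (concat (map (Inputs P) (map snd zs))) = length ?L"
      using arg_cong[OF lens, of sum_list] by (simp add: length_concat comp_def)
    have v: "val (?L, e) ?C" by (rule val_node') (use \<open>(set ?cs, e) \<in> verts T\<close> \<open>distinct ?cs\<close> vz in auto)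
    have \<rho>L: "\<rho> permutes {..<length ?L}" "\<sigma>' permutes {..<length ?L}" using \<rho>(1) len n'(6) L' by simp_all
    have "permute_list (\<rho> \<circ> \<sigma>') ?L = permute_list \<sigma> ?L"
      using permute_list_compose[OF \<rho>L(2)] n'(1) L' by simp
    then have "\<rho> \<circ> \<sigma>' = \<sigma>"
      using val_above[OF v] \<open>\<sigma> permutes {..<length ?L}\<close> permutes_compose[OF \<rho>L(2,1)]
      by (intro permute_distinct_eq[of ?L]) auto
    moreover have "Act P (\<rho> \<circ> \<sigma>') ?C = Act P \<sigma>' (Act P \<rho> ?C)"
      by (rule P_act_comp) (use val_wf[OF v] \<rho>L in auto)
    ultimately show ?thesis using n'(2) C' by simp
  qed
qed

lemma val_total: "q \<in> tree_ops T \<Longrightarrow> \<exists>p. val q p"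
proof (induction rule: tree_ops.induct)
  case (unit e) then show ?case using tree_val.unit by blast
next
  case (vert es e)
  have "\<forall>c\<in>set es. c \<in> edges T" using T vert(1) unfolding is_tree_def by blast
  then have "val (concat (map (\<lambda>z. fst (fst z)) (map (\<lambda>c. (([c], c), Unit P (\<phi> c))) es)), e)
     (Compose P (\<psi> (map (\<lambda>z. snd (fst z)) (map (\<lambda>c. (([c], c), Unit P (\<phi> c))) es), e))
       (map snd (map (\<lambda>c. (([c], c), Unit P (\<phi> c))) es)))"
    by (intro val_node') (use vert in \<open>auto simp: comp_def intro: tree_val.unit\<close>)
  then show ?case by (auto simp: comp_def)
next
  case (compose qs e)
  then obtain p where p: "val (map snd qs, e) p" by blast
  obtain r where r: "\<And>q. q \<in> set qs \<Longrightarrow> val q (r q)" using compose(3) by metis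
  have "val (concat (map (\<lambda>z. fst (fst z)) (map (\<lambda>q. (q, r q)) qs)), snd (map snd qs, e))
      (Compose P p (map snd (map (\<lambda>q. (q, r q)) qs)))"
    by (rule val_compose[OF p]) (use r in \<open>auto simp: comp_def\<close>)
  then show ?case by (auto simp: comp_def)
next
  case (act es e \<sigma>) then show ?case using val_act by fastforce
qed

lemma val_vert:
  assumes "(set es, e) \<in> verts T" "distinct es" shows "val (es, e) (\<psi> (es, e))"
proof -
  have "\<forall>c\<in>set es. c \<in> edges T" using T assms(1) unfolding is_tree_def by blast
  then have "val (concat (map (\<lambda>z. fst (fst z)) (map (\<lambda>c. (([c], c), Unit P (\<phi> c))) es)), e)
     (Compose P (\<psi> (map (\<lambda>z. snd (fst z)) (map (\<lambda>c. (([c], c), Unit P (\<phi> c))) es), e))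
       (map snd (map (\<lambda>c. (([c], c), Unit P (\<phi> c))) es)))"
    by (intro val_node') (use assms in \<open>auto simp: comp_def intro: tree_val.unit\<close>)
  then show ?thesis using \<psi>[OF assms] P_unit_right[of "\<psi> (es, e)"] by (simp add: comp_def)
qed

theorem tree_operad_free:
  "\<exists>F. operad_map (tree_operad T) P \<phi> F \<and>
     (\<forall>es e. (set es, e) \<in> verts T \<longrightarrow> distinct es \<longrightarrow> F (es, e) = \<psi> (es, e)) \<and>
     (\<forall>G. operad_map (tree_operad T) P \<phi> G \<longrightarrow>
        (\<forall>es e. (set es, e) \<in> verts T \<longrightarrow> distinct es \<longrightarrow> G (es, e) = \<psi> (es, e)) \<longrightarrow>
        (\<forall>q\<in>tree_ops T. G q = F q))"
proof -
  define F where "F q = (THE p. val q p)" for q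
  have FI: "F q = p" if "val q p" for q p
    unfolding F_def using that val_unique by blast
  have F: "val q (F q)" if "q \<in> tree_ops T" for q
    using val_total[OF that] FI by blast
  let ?Q = "tree_operad T"
  have c: "map snd qs = fst p \<and> p \<in> tree_ops T \<and> set qs \<subseteq> tree_ops T" if "composable ?Q p qs" for p qs
    using that by (auto simp: composable_def tree_operad_def)
  have comp: "F (concat (map fst qs), snd p) = Compose P (F p) (map F qs)" if "composable ?Q p qs" for p qs
  proof (rule FI)
    have "val (concat (map (\<lambda>z. fst (fst z)) (map (\<lambda>q. (q, F q)) qs)), snd p)
        (Compose P (F p) (map snd (map (\<lambda>q. (q, F q)) qs)))"
      by (rule val_compose) (use c[OF that] F in \<open>auto simp: comp_def\<close>)
    then show "val (concat (map fst qs), snd p) (Compose P (F p) (map F qs))" by (simp add: comp_def)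
  qed
  have map: "operad_map ?Q P \<phi> F"
    unfolding operad_map_def
  proof (intro conjI ballI allI impI)
    fix p qs assume "composable ?Q p qs"
    then show "F (Compose ?Q p qs) = Compose P (F p) (map F qs)"
      using comp by (simp add: tree_operad_def)
  qed (use \<phi> val_wf[OF F] FI[OF tree_val.unit] FI[OF val_act[OF F]] in \<open>auto simp: tree_operad_def\<close>)
  have uniq: "G q = F q" if G: "operad_map ?Q P \<phi> G"
    and v: "\<And>es e. (set es, e) \<in> verts T \<Longrightarrow> distinct es \<Longrightarrow> G (es, e) = \<psi> (es, e)" and q: "q \<in> tree_ops T" for G q
    using q
  proof (induction rule: tree_ops.induct)
    case (unit e)
    then show ?case using G FI[OF tree_val.unit[OF unit]] unfolding operad_map_def by (auto simp: tree_operad_def)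
  next
    case (vert es e) then show ?case using v FI[OF val_vert] by simp
  next
    case (compose qs e)
    then have "composable ?Q (map snd qs, e) qs" by (auto simp: composable_def tree_operad_def)
    then have "G (Compose ?Q (map snd qs, e) qs) = Compose P (G (map snd qs, e)) (map G qs)"
      "F (Compose ?Q (map snd qs, e) qs) = Compose P (F (map snd qs, e)) (map F qs)"
      using G map unfolding operad_map_def by blast+
    moreover have "map G qs = map F qs" using compose(3) by simp
    ultimately show ?case using compose(2) by (simp add: tree_operad_def)
  next
    case (act es e \<sigma>)
    then have "(es, e) \<in> Ops ?Q" "\<sigma> permutes {..<length (Inputs ?Q (es, e))}" by (auto simp: tree_operad_def)
    then have "G (Act ?Q \<sigma> (es, e)) = Act P \<sigma> (G (es, e))" "F (Act ?Q \<sigma> (es, e)) = Act P \<sigma> (F (es, e))"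
      using G map unfolding operad_map_def by blast+
    then show ?case using act(3) by (simp add: tree_operad_def)
  qed
  show ?thesis using map uniq FI[OF val_vert] by (intro exI[of _ F]) blast
qed

end
end


section \<open>\<open>\<Omega>\<close>, its faces and its horns are well defined\<close>

subsection \<open>The categories \<open>\<Delta>\<close> and \<open>\<Omega>\<close>\<close>

theorem category_Delta: "category Delta"
  unfolding category_def Delta_def
  by (auto simp: compose_def mono_on_def fun_eq_iff restrict_def PiE_iff extensional_def)

lemma presheaf_representable: "category C \<Longrightarrow> c \<in> Ob C \<Longrightarrow> presheaf C (representable C c)"
  unfolding presheaf_def representable_def category_def by simp

lemma operad_map_cong:
  assumes "symmetric_operad P" "operad_map P Q f g"
    "\<And>c. c \<in> Colours P \<Longrightarrow> f' c = f c" "\<And>p. p \<in> Ops P \<Longrightarrow> g' p = g p"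
  shows "operad_map P Q f' g'"
proof -
  have c: "set (Inputs P p) \<subseteq> Colours P" "Output P p \<in> Colours P" if "p \<in> Ops P" for p
    using assms(1) that unfolding symmetric_operad_def by blast+
  have u: "Unit P x \<in> Ops P" if "x \<in> Colours P" for x
    using assms(1) that unfolding symmetric_operad_def by blast
  have cp: "Compose P p qs \<in> Ops P" if "composable P p qs" for p qs
    using assms(1) that unfolding symmetric_operad_def by blast
  have a: "Act P \<sigma> p \<in> Ops P" if "p \<in> Ops P" "\<sigma> permutes {..<length (Inputs P p)}" for p \<sigma>
    using assms(1) that unfolding symmetric_operad_def by blast
  have m: "map f' (Inputs P p) = map f (Inputs P p)" if "p \<in> Ops P" for p
    using c(1)[OF that] assms(3) by auto
  have q: "map g' qs = map g qs" "p \<in> Ops P" if "composable P p qs" for p qs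
    using that assms(4) unfolding composable_def by auto
  show ?thesis using assms(2) unfolding operad_map_def
    by (auto simp: assms(3,4) c u cp a m q)
qed

lemma operad_map_compose:
  assumes "operad_map P Q f g" "operad_map Q R f' g'"
  shows "operad_map P R (f' \<circ> f) (g' \<circ> g)"
proof -
  have c: "composable Q (g p) (map g qs)" if "composable P p qs" for p qs
  proof -
    have p: "p \<in> Ops P" "set qs \<subseteq> Ops P" "map (Output P) qs = Inputs P p"
      using that unfolding composable_def by auto
    have "map (Output Q) (map g qs) = map f (map (Output P) qs)"
      using assms(1) p(2) unfolding operad_map_def by auto
    then show ?thesis using assms(1) p unfolding operad_map_def composable_def by auto
  qed
  have ops: "p \<in> Ops P" if "composable P p qs" for p qs using that unfolding composable_def by auto
  have cQ: "\<And>p qs. composable Q p qs \<Longrightarrow> g' (Compose Q p qs) = Compose R (g' p) (map g' qs)"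
    and cP: "\<And>p qs. composable P p qs \<Longrightarrow> g (Compose P p qs) = Compose Q (g p) (map g qs)"
    using assms unfolding operad_map_def by blast+
  have aQ: "\<And>p \<sigma>. p \<in> Ops Q \<Longrightarrow> \<sigma> permutes {..<length (Inputs Q p)} \<Longrightarrow> g' (Act Q \<sigma> p) = Act R \<sigma> (g' p)"
    and aP: "\<And>p \<sigma>. p \<in> Ops P \<Longrightarrow> \<sigma> permutes {..<length (Inputs P p)} \<Longrightarrow> g (Act P \<sigma> p) = Act Q \<sigma> (g p)"
    and gP: "\<And>p. p \<in> Ops P \<Longrightarrow> g p \<in> Ops Q \<and> Inputs Q (g p) = map f (Inputs P p) \<and> Output Q (g p) = f (Output P p)"
    and gQ: "\<And>p. p \<in> Ops Q \<Longrightarrow> g' p \<in> Ops R \<and> Inputs R (g' p) = map f' (Inputs Q p) \<and> Output R (g' p) = f' (Output Q p)"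
    and fP: "\<And>x. x \<in> Colours P \<Longrightarrow> f x \<in> Colours Q \<and> g (Unit P x) = Unit Q (f x)"
    and fQ: "\<And>x. x \<in> Colours Q \<Longrightarrow> f' x \<in> Colours R \<and> g' (Unit Q x) = Unit R (f' x)"
    using assms unfolding operad_map_def by blast+
  show ?thesis
    unfolding operad_map_def using c cP cQ aP aQ gP gQ fP fQ by simp
qed

lemma tree_operad_sel [simp]:
  "Colours (tree_operad T) = edges T" "Ops (tree_operad T) = tree_ops T"
  "Inputs (tree_operad T) = fst" "Output (tree_operad T) = snd"
  by (simp_all add: tree_operad_def)

lemma Omega_sel: "Ob Omega = {T. is_tree T}" "Id Omega T = (\<lambda>e\<in>edges T. e, \<lambda>p\<in>tree_ops T. p)"
  "Comp Omega R S T g f = (compose (edges R) (fst g) (fst f), compose (tree_ops R) (snd g) (snd f))"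
  "f \<in> Hom Omega S T \<longleftrightarrow> operad_map (tree_operad S) (tree_operad T) (fst f) (snd f) \<and>
     fst f \<in> extensional (edges S) \<and> snd f \<in> extensional (tree_ops S)"
  by (auto simp: Omega_def)

lemma Omega_hom_fun:
  assumes "f \<in> Hom Omega S T" shows "fst f \<in> edges S \<rightarrow> edges T" "snd f \<in> tree_ops S \<rightarrow> tree_ops T"
  using assms unfolding Omega_sel operad_map_def by auto

lemma Omega_comp:
  assumes "is_tree R" "f \<in> Hom Omega R S" "g \<in> Hom Omega S T"
  shows "Comp Omega R S T g f \<in> Hom Omega R T"
proof -
  have *: "operad_map (tree_operad R) (tree_operad T) (fst g \<circ> fst f) (snd g \<circ> snd f)"
    using assms(2,3) operad_map_compose unfolding Omega_sel by blast
  show ?thesis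
    unfolding Omega_sel using operad_map_cong[OF symmetric_operad_tree[OF assms(1)] *]
    by (simp add: compose_def)
qed

lemma Omega_assoc:
  assumes "f \<in> Hom Omega Q R"
  shows "Comp Omega Q S T h (Comp Omega Q R S g f) = Comp Omega Q R T (Comp Omega R S T h g) f"
proof -
  note e = Omega_hom_fun[OF assms]
  show ?thesis unfolding Omega_sel by (simp add: compose_assoc[OF e(1)] compose_assoc[OF e(2)])
qed

theorem category_Omega: "category Omega"
  unfolding category_def
proof (intro conjI ballI)
  fix T assume T: "T \<in> Ob Omega"
  have "operad_map (tree_operad T) (tree_operad T) (\<lambda>x. x) (\<lambda>x. x)"
    unfolding operad_map_def composable_def tree_operad_def
    by (auto simp: tree_ops.intros)
  from operad_map_cong[OF symmetric_operad_tree this] T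
  show "Id Omega T \<in> Hom Omega T T" unfolding Omega_sel by simp
next
  fix R S T f g assume "R \<in> Ob Omega" "f \<in> Hom Omega R S" "g \<in> Hom Omega S T"
  then show "Comp Omega R S T g f \<in> Hom Omega R T" using Omega_comp by (simp add: Omega_sel)
next
  fix S T f assume f: "f \<in> Hom Omega S T"
  note e = Omega_hom_fun[OF f]
  show "Comp Omega S S T f (Id Omega S) = f" "Comp Omega S T T (Id Omega T) f = f"
    using f e compose_Id[OF e(1)] compose_Id[OF e(2)] Id_compose[OF e(1)] Id_compose[OF e(2)]
    unfolding Omega_sel by (simp_all add: prod_eq_iff)
next
  fix Q R S T f g h assume "f \<in> Hom Omega Q R"
  then show "Comp Omega Q S T h (Comp Omega Q R S g f) = Comp Omega Q R T (Comp Omega R S T h g) f"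
    by (rule Omega_assoc)
qed

lemma hom_eq_edge_mor:
  assumes "f \<in> Hom Omega S T" shows "f = edge_mor S (fst f)"
proof (rule prod_eqI)
  have f: "fst f \<in> extensional (edges S)" "snd f \<in> extensional (tree_ops S)"
    and m: "\<And>p. p \<in> tree_ops S \<Longrightarrow> snd f p = (map (fst f) (fst p), fst f (snd p))"
    using assms unfolding Omega_sel operad_map_def by (auto simp: prod_eq_iff)
  show "fst f = fst (edge_mor S (fst f))"
    unfolding edge_mor_def fst_conv by (simp add: extensional_restrict[OF f(1)])
  show "snd f = snd (edge_mor S (fst f))"
    unfolding edge_mor_def snd_conv by (rule extensionalityI[OF f(2)]) (auto simp: m)
qed

lemma edge_mor_hom:
  assumes S: "is_tree S" and T: "is_tree T" and f: "\<And>e. e \<in> edges S \<Longrightarrow> f e \<in> edges T"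
    and v: "\<And>es e. (set es, e) \<in> verts S \<Longrightarrow> distinct es \<Longrightarrow> (map f es, f e) \<in> tree_ops T"
  shows "edge_mor S f \<in> Hom Omega S T"
proof -
  have ops: "(map f (fst p), f (snd p)) \<in> tree_ops T" if "p \<in> tree_ops S" for p
    using that
  proof (induction rule: tree_ops.induct)
    case (compose qs e)
    let ?qs = "map (\<lambda>q. (map f (fst q), f (snd q))) qs"
    have "(concat (map fst ?qs), f e) \<in> tree_ops T"
      by (rule tree_ops.compose) (use compose in \<open>auto simp: comp_def\<close>)
    then show ?case by (simp add: map_concat comp_def)
  next
    case (act es e \<sigma>)
    then have "(permute_list \<sigma> (map f es), f e) \<in> tree_ops T" by (intro tree_ops.act) auto
    then show ?case using permute_list_map[OF act(2), of f] by simp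
  qed (use f v in \<open>auto intro: tree_ops.unit\<close>)
  have "operad_map (tree_operad S) (tree_operad T) f (\<lambda>p. (map f (fst p), f (snd p)))"
    unfolding operad_map_def using f ops
    by (auto simp: tree_operad_def map_concat comp_def permute_list_map)
  from operad_map_cong[OF symmetric_operad_tree[OF S] this] show ?thesis
    unfolding Omega_sel edge_mor_def by simp
qed

lemma is_tree_linear: "is_tree (linear_tree n)"
proof -
  have "(e, n) \<in> {(a, b). \<exists>I. (I, b) \<in> {({k}, Suc k) | k. k < n} \<and> a \<in> I}\<^sup>*" if "e \<le> n" for e
    using that
  proof (induction rule: inc_induct)
    case (step m)
    then have "(m, Suc m) \<in> {(a, b). \<exists>I. (I, b) \<in> {({k}, Suc k) | k. k < n} \<and> a \<in> I}" by auto
    then show ?case using step(3) by (rule converse_rtrancl_into_rtrancl)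
  qed simp
  then show ?thesis unfolding is_tree_def linear_tree_def by auto
qed

lemma linear_ops: "b \<le> n \<Longrightarrow> a \<le> b \<Longrightarrow> ([a], b) \<in> tree_ops (linear_tree n)"
proof (induction b)
  case 0 then show ?case by (auto intro!: tree_ops.unit simp: linear_tree_def)
next
  case (Suc b)
  show ?case
  proof (cases "a = Suc b")
    case True then show ?thesis using Suc by (auto intro!: tree_ops.unit simp: linear_tree_def)
  next
    case False
    then have "([a], b) \<in> tree_ops (linear_tree n)" using Suc by simp
    moreover have "([b], Suc b) \<in> tree_ops (linear_tree n)"
      by (rule tree_ops.vert) (use Suc in \<open>auto simp: linear_tree_def\<close>)
    ultimately show ?thesis using tree_ops.compose[of "[([a], b)]" "Suc b" "linear_tree n"] by simp
  qed
qed

theorem linear_functor: "is_functor Delta Omega linear_tree (\<lambda>m n \<alpha>. edge_mor (linear_tree m) \<alpha>)"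
  unfolding is_functor_def
proof (intro conjI ballI)
  fix n show "linear_tree n \<in> Ob Omega" using is_tree_linear by (simp add: Omega_sel)
  have c: "set (fst p) \<subseteq> {..n}" "snd p \<le> n" if "p \<in> tree_ops (linear_tree n)" for p
    using tree_ops_colours[OF is_tree_linear that] by (auto simp: linear_tree_def)
  have "map (\<lambda>i\<in>{..n}. i) (fst p) = fst p" "(\<lambda>i\<in>{..n}. i) (snd p) = snd p"
    if "p \<in> tree_ops (linear_tree n)" for p
    using c[OF that] by (auto intro!: map_idI)
  then show "edge_mor (linear_tree n) (Id Delta n) = Id Omega (linear_tree n)"
    unfolding edge_mor_def Omega_sel Delta_def
    by (auto simp: linear_tree_def intro!: restrict_ext)
next
  fix m n \<alpha> assume "\<alpha> \<in> Hom Delta m n"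
  then have a: "\<And>i. i \<le> m \<Longrightarrow> \<alpha> i \<le> n" "\<And>i j. i \<le> j \<Longrightarrow> j \<le> m \<Longrightarrow> \<alpha> i \<le> \<alpha> j"
    by (auto simp: Delta_def mono_on_def)
  show "edge_mor (linear_tree m) \<alpha> \<in> Hom Omega (linear_tree m) (linear_tree n)"
  proof (rule edge_mor_hom[OF is_tree_linear is_tree_linear])
    fix es e assume "(set es, e) \<in> verts (linear_tree m)" "distinct es"
    then obtain k where k: "set es = {k}" "e = Suc k" "k < m" by (auto simp: linear_tree_def)
    then have "es = [k]" using \<open>distinct es\<close> by (metis distinct.simps(2) list.set_cases neq_Nil_conv
          set_ConsD singletonD singletonI list.set_intros(1,2))
    then show "(map \<alpha> es, \<alpha> e) \<in> tree_ops (linear_tree n)"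
      using k a(1)[of e] a(2)[of k e] by (auto intro: linear_ops)
  qed (use a in \<open>auto simp: linear_tree_def\<close>)
next
  fix k m n \<alpha> and \<beta> :: "nat \<Rightarrow> nat" assume "\<alpha> \<in> Hom Delta k m"
  then have a: "\<And>i. i \<le> k \<Longrightarrow> \<alpha> i \<le> m" "\<And>i j. i \<le> j \<Longrightarrow> j \<le> k \<Longrightarrow> \<alpha> i \<le> \<alpha> j"
    by (auto simp: Delta_def mono_on_def)
  have "edge_mor (linear_tree k) \<alpha> \<in> Hom Omega (linear_tree k) (linear_tree m)"
  proof (rule edge_mor_hom[OF is_tree_linear is_tree_linear])
    fix es e assume "(set es, e) \<in> verts (linear_tree k)" "distinct es"
    then obtain i where k: "set es = {i}" "e = Suc i" "i < k" by (auto simp: linear_tree_def)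
    then have "es = [i]" using \<open>distinct es\<close> by (metis distinct.simps(2) list.set_cases neq_Nil_conv
          set_ConsD singletonD singletonI list.set_intros(1,2))
    then show "(map \<alpha> es, \<alpha> e) \<in> tree_ops (linear_tree m)"
      using k a(1)[of e] a(2)[of i e] by (auto intro: linear_ops)
  qed (use a in \<open>auto simp: linear_tree_def\<close>)
  from Omega_hom_fun(2)[OF this]
  have im: "p \<in> tree_ops (linear_tree k) \<Longrightarrow> (map \<alpha> (fst p), \<alpha> (snd p)) \<in> tree_ops (linear_tree m)" for p
    by (fastforce simp: edge_mor_def Pi_iff)
  have c: "set (fst p) \<subseteq> {..k}" "snd p \<le> k" if "p \<in> tree_ops (linear_tree k)" for p
    using tree_ops_colours[OF is_tree_linear that] by (auto simp: linear_tree_def)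
  have m: "map (compose {..k} \<beta> \<alpha>) (fst p) = map \<beta> (map \<alpha> (fst p))" "compose {..k} \<beta> \<alpha> (snd p) = \<beta> (\<alpha> (snd p))"
    if "p \<in> tree_ops (linear_tree k)" for p
    using c[OF that] by (auto simp: compose_def)
  have D: "Comp Delta k m n \<beta> \<alpha> = compose {..k} \<beta> \<alpha>" by (simp add: Delta_def)
  show "edge_mor (linear_tree k) (Comp Delta k m n \<beta> \<alpha>) =
      Comp Omega (linear_tree k) (linear_tree m) (linear_tree n)
        (edge_mor (linear_tree m) \<beta>) (edge_mor (linear_tree k) \<alpha>)"
    unfolding edge_mor_def Omega_sel D fst_conv snd_conv
  proof (rule arg_cong2[where f = Pair])
    show "(\<lambda>e\<in>edges (linear_tree k). compose {..k} \<beta> \<alpha> e) =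
        compose (edges (linear_tree k)) (\<lambda>e\<in>edges (linear_tree m). \<beta> e) (\<lambda>e\<in>edges (linear_tree k). \<alpha> e)"
      using a(1) by (auto simp: compose_def linear_tree_def)
    show "(\<lambda>p\<in>tree_ops (linear_tree k). (map (compose {..k} \<beta> \<alpha>) (fst p), compose {..k} \<beta> \<alpha> (snd p))) =
        compose (tree_ops (linear_tree k)) (\<lambda>p\<in>tree_ops (linear_tree m). (map \<beta> (fst p), \<beta> (snd p)))
          (\<lambda>p\<in>tree_ops (linear_tree k). (map \<alpha> (fst p), \<alpha> (snd p)))"
      unfolding compose_def[of "tree_ops (linear_tree k)"]
      by (rule restrict_ext) (simp add: im m)
  qed
qed

subsection \<open>Faces and horns are well defined\<close>

lemma is_treeD:
  assumes "is_tree T"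
  shows "finite (edges T)" "root T \<in> edges T"
    "(I, e) \<in> verts T \<Longrightarrow> I \<subseteq> edges T" "(I, e) \<in> verts T \<Longrightarrow> e \<in> edges T" "(I, e) \<in> verts T \<Longrightarrow> root T \<notin> I"
    "(I, e) \<in> verts T \<Longrightarrow> (J, e) \<in> verts T \<Longrightarrow> I = J"
    "(I, e) \<in> verts T \<Longrightarrow> (J, f) \<in> verts T \<Longrightarrow> x \<in> I \<Longrightarrow> x \<in> J \<Longrightarrow> I = J \<and> e = f"
    "e \<in> edges T \<Longrightarrow> (e, root T) \<in> (tree_step T)\<^sup>*"
proof -
  note t = assms[unfolded is_tree_def]
  show "finite (edges T)" "root T \<in> edges T" using t by blast+
  show "(I, e) \<in> verts T \<Longrightarrow> I \<subseteq> edges T" "(I, e) \<in> verts T \<Longrightarrow> e \<in> edges T" "(I, e) \<in> verts T \<Longrightarrow> root T \<notin> I"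
    using t by blast+
  have 1: "\<forall>v\<in>verts T. \<forall>w\<in>verts T. snd v = snd w \<longrightarrow> v = w" using t by blast
  show "(I, e) \<in> verts T \<Longrightarrow> (J, e) \<in> verts T \<Longrightarrow> I = J" using 1 by fastforce
  have 2: "\<forall>v\<in>verts T. \<forall>w\<in>verts T. fst v \<inter> fst w \<noteq> {} \<longrightarrow> v = w" using t by blast
  show "(I, e) \<in> verts T \<Longrightarrow> (J, f) \<in> verts T \<Longrightarrow> x \<in> I \<Longrightarrow> x \<in> J \<Longrightarrow> I = J \<and> e = f"
    using 2[rule_format, of "(I, e)" "(J, f)"] by auto
  show "e \<in> edges T \<Longrightarrow> (e, root T) \<in> (tree_step T)\<^sup>*" using t unfolding tree_step_def by blast
qed

lemma is_treeI:
  assumes "finite (edges T)" "root T \<in> edges T"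
    "\<And>I e. (I, e) \<in> verts T \<Longrightarrow> I \<subseteq> edges T \<and> e \<in> edges T \<and> root T \<notin> I"
    "\<And>I J e. (I, e) \<in> verts T \<Longrightarrow> (J, e) \<in> verts T \<Longrightarrow> I = J"
    "\<And>I J e f x. (I, e) \<in> verts T \<Longrightarrow> (J, f) \<in> verts T \<Longrightarrow> x \<in> I \<Longrightarrow> x \<in> J \<Longrightarrow> I = J \<and> e = f"
    "\<And>e. e \<in> edges T \<Longrightarrow> (e, root T) \<in> (tree_step T)\<^sup>*"
  shows "is_tree T"
  unfolding is_tree_def
proof (intro conjI ballI impI)
  fix v w assume "v \<in> verts T" "w \<in> verts T" "fst v \<inter> fst w \<noteq> {}"
  then show "v = w" using assms(5)[of "fst v" "snd v" "fst w" "snd w"] by (cases v, cases w) auto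
next
  fix v w assume "v \<in> verts T" "w \<in> verts T" "snd v = snd w"
  then show "v = w" using assms(4)[of "fst v" "snd v" "fst w"] by (cases v, cases w) auto
next
  fix e assume "e \<in> edges T"
  then show "(e, root T) \<in> {(a, b). \<exists>I. (I, b) \<in> verts T \<and> a \<in> I}\<^sup>*"
    using assms(6) unfolding tree_step_def by blast
qed (use assms(1-3) in auto)

lemma inner_edge_iff: "e \<in> inner_edges T \<longleftrightarrow> e \<in> edges T \<and> e \<noteq> root T \<and> (\<exists>I. (I, e) \<in> verts T)"
  unfolding inner_edges_def leaves_def by force

lemma tree_step_iff: "(a, b) \<in> tree_step T \<longleftrightarrow> (\<exists>I. (I, b) \<in> verts T \<and> a \<in> I)"
  by (simp add: tree_step_def)

lemma inner_edge_input:
  assumes "is_tree T" "e \<in> edges T" "e \<noteq> root T"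
  obtains J f where "(J, f) \<in> verts T" "e \<in> J"
  using is_treeD(8)[OF assms(1,2)] assms(3) by (metis converse_rtranclE tree_step_iff)

lemma output_notin_inputs:
  assumes "is_tree T" "(I, e) \<in> verts T" shows "e \<notin> I"
  using tree_acyclic[OF assms(1) is_treeD(4)[OF assms]] assms(2) by (meson r_into_trancl tree_step_iff)

lemma is_tree_contract:
  assumes T: "is_tree T" and e: "e \<in> inner_edges T"
  shows "is_tree (contract T e)" "face_map T (Inner e) \<in> Hom Omega (contract T e) T"
proof -
  note t = is_treeD[OF T]
  obtain I where I: "(I, e) \<in> verts T" and er: "e \<in> edges T" "e \<noteq> root T" using e inner_edge_iff by auto
  obtain J f where J: "(J, f) \<in> verts T" "e \<in> J" using inner_edge_input[OF T er] .
  have fe: "f \<noteq> e" using output_notin_inputs[OF T J(1)] J(2) by auto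
  have IJ: "I \<inter> J = {}" using t(7)[OF I J(1)] fe by auto
  have w: "(K, x) \<in> verts T \<Longrightarrow> e \<in> K \<Longrightarrow> K = J \<and> x = f" for K x using t(7)[OF _ J(1) _ J(2)] .
  have V: "verts (contract T e) = {v \<in> verts T. e \<notin> incident v} \<union> {(J - {e} \<union> I, f)}"
  proof -
    have "{(fst w - {e} \<union> fst v, snd w) | v w. v \<in> verts T \<and> w \<in> verts T \<and> snd v = e \<and> e \<in> fst w} =
        {(J - {e} \<union> I, f)}"
    proof (intro equalityI subsetI)
      fix x assume "x \<in> {(fst w - {e} \<union> fst v, snd w) | v w. v \<in> verts T \<and> w \<in> verts T \<and> snd v = e \<and> e \<in> fst w}"
      then obtain v w' where vw: "x = (fst w' - {e} \<union> fst v, snd w')" "v \<in> verts T" "w' \<in> verts T" "snd v = e" "e \<in> fst w'"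
        by blast
      have "fst v = I" using vw(2,4) t(6)[OF I, of "fst v"] by (cases v) auto
      moreover have "fst w' = J \<and> snd w' = f" using vw(3,5) w[of "fst w'" "snd w'"] by simp
      ultimately show "x \<in> {(J - {e} \<union> I, f)}" using vw(1) by simp
    next
      fix x assume "x \<in> {(J - {e} \<union> I, f)}"
      then show "x \<in> {(fst w - {e} \<union> fst v, snd w) | v w. v \<in> verts T \<and> w \<in> verts T \<and> snd v = e \<and> e \<in> fst w}"
        using I J by (intro CollectI exI[of _ "(I, e)"] exI[of _ "(J, f)"]) auto
    qed
    then show ?thesis by (simp add: contract_def)
  qed
  have inc: "incident (K, x) = insert x K" for K x by (simp add: incident_def)
  have vE: "(K, x) \<in> verts (contract T e) \<longleftrightarrow>
      ((K, x) \<in> verts T \<and> e \<notin> K \<and> e \<noteq> x) \<or> (K = J - {e} \<union> I \<and> x = f)" for K x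
    unfolding V by (auto simp: inc)
  have EE: "edges (contract T e) = edges T - {e}" "root (contract T e) = root T" by (auto simp: contract_def)
  have eI: "e \<notin> I" using output_notin_inputs[OF T I] .
  show tc: "is_tree (contract T e)"
  proof (rule is_treeI)
    show "finite (edges (contract T e))" "root (contract T e) \<in> edges (contract T e)" using t er EE by auto
    show "K \<subseteq> edges (contract T e) \<and> x \<in> edges (contract T e) \<and> root (contract T e) \<notin> K"
      if "(K, x) \<in> verts (contract T e)" for K x
      using that t(3-5) I J fe eI unfolding vE EE by blast
    show "K = L" if "(K, x) \<in> verts (contract T e)" "(L, x) \<in> verts (contract T e)" for K L x
      using that t(6)[of _ x] J unfolding vE by metis
    show "K = L \<and> x = y" if kl: "(K, x) \<in> verts (contract T e)" "(L, y) \<in> verts (contract T e)" "z \<in> K" "z \<in> L"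
      for K L x y z
    proof -
      have no: "False" if "(K, x) \<in> verts T" "e \<notin> K" "e \<noteq> x" "z \<in> K" "z \<in> J - {e} \<union> I" for K x
        using t(7)[OF that(1) I, of z] t(7)[OF that(1) J(1), of z] that J(2) by auto
      consider "(K, x) \<in> verts T" "(L, y) \<in> verts T"
        | "(K, x) \<in> verts T" "e \<notin> K" "e \<noteq> x" "L = J - {e} \<union> I"
        | "(L, y) \<in> verts T" "e \<notin> L" "e \<noteq> y" "K = J - {e} \<union> I"
        | "K = J - {e} \<union> I \<and> x = f" "L = J - {e} \<union> I \<and> y = f"
        using kl(1,2) unfolding vE by blast
      then show ?thesis
      proof cases
        case 1 then show ?thesis using t(7) kl(3,4) by blast
      next
        case 2 then show ?thesis using no[of K x] kl(3,4) by blast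
      next
        case 3 then show ?thesis using no[of L y] kl(3,4) by blast
      qed simp
    qed
    have up: "(x \<noteq> e \<longrightarrow> (x, root T) \<in> (tree_step (contract T e))\<^sup>*) \<and>
        (x = e \<longrightarrow> (f, root T) \<in> (tree_step (contract T e))\<^sup>*)"
      if "(x, root T) \<in> (tree_step T)\<^sup>*" for x
      using that
    proof (induction rule: converse_rtrancl_induct)
      case base show ?case using er by simp
    next
      case (step x y)
      then obtain K where K: "(K, y) \<in> verts T" "x \<in> K" by (auto simp: tree_step_iff)
      show ?case
      proof (cases "x = e")
        case True then have "y = f" using w K by blast
        then show ?thesis using step.IH fe True by simp
      next
        case xe: False
        have "\<exists>z. (x, z) \<in> tree_step (contract T e) \<and> (z, root T) \<in> (tree_step (contract T e))\<^sup>*"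
        proof (cases "y = e")
          case True
          then have "K = I" using t(6) K(1) I by blast
          then show ?thesis using True step.IH K(2) by (intro exI[of _ f]) (auto simp: tree_step_iff vE)
        next
          case False
          then have "(x, y) \<in> tree_step (contract T e)"
            using K xe w unfolding tree_step_iff vE by (cases "e \<in> K") blast+
          then show ?thesis using False step.IH by blast
        qed
        then show ?thesis using xe by (meson converse_rtrancl_into_rtrancl)
      qed
    qed
    show "(x, root (contract T e)) \<in> (tree_step (contract T e))\<^sup>*" if "x \<in> edges (contract T e)" for x
      using up[OF t(8)[of x]] that EE by auto
  qed
  show "face_map T (Inner e) \<in> Hom Omega (contract T e) T"
    unfolding face_map_def face_tree.simps
  proof (rule edge_mor_hom[OF tc T])
    fix es x assume "(set es, x) \<in> verts (contract T e)" and d: "distinct es"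
    then consider "(set es, x) \<in> verts T" | "set es = J - {e} \<union> I" "x = f" unfolding vE by blast
    then show "(map (\<lambda>e. e) es, x) \<in> tree_ops T"
    proof cases
      case 1 then show ?thesis using d by (simp add: tree_ops.vert)
    next
      case 2
      have fin: "finite I" "finite (J - {e})" using finite_subset[OF t(3)[OF I] t(1)] finite_subset[OF t(3)[OF J(1)] t(1)] by auto
      obtain xs js where l: "set xs = I" "distinct xs" "set js = J - {e}" "distinct js"
        using finite_distinct_list[OF fin(1)] finite_distinct_list[OF fin(2)] by blast
      have v: "(xs, e) \<in> tree_ops T" by (rule tree_ops.vert) (use l I in auto)
      have "(e # js, f) \<in> tree_ops T"
        by (rule tree_ops.vert) (use l J in \<open>auto simp: insert_absorb\<close>)
      then have "(concat (map fst ((xs, e) # map (\<lambda>j. ([j], j)) js)), f) \<in> tree_ops T"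
        by (intro tree_ops.compose) (use l v J t(3) in \<open>auto simp: comp_def intro!: tree_ops.unit\<close>)
      then have o: "(xs @ js, f) \<in> tree_ops T" by (simp add: comp_def)
      have "distinct (xs @ js)" "set (xs @ js) = set es" using l IJ 2 by auto
      then have "mset es = mset (xs @ js)" using d set_eq_iff_mset_eq_distinct by blast
      then obtain \<sigma> where "\<sigma> permutes {..<length (xs @ js)}" "permute_list \<sigma> (xs @ js) = es"
        by (rule mset_eq_permutation)
      then show ?thesis using tree_ops.act[OF o] 2 by auto
    qed
  qed (use EE in auto)
qed

lemma is_tree_prune:
  assumes T: "is_tree T" and v: "v \<in> outer_verts T"
  shows "is_tree (prune T v)" "face_map T (Outer v) \<in> Hom Omega (prune T v) T"
proof -
  note t = is_treeD[OF T]
  obtain I x where vI: "v = (I, x)" "(I, x) \<in> verts T" using v unfolding outer_verts_def by (cases v) auto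
  obtain a where a: "insert x I \<inter> inner_edges T = {a}"
    using v unfolding outer_verts_def vI(1) incident_def by (auto simp: card_1_singleton_iff)
  have ai: "a \<in> inner_edges T" using a by auto
  have vE: "(K, y) \<in> verts (prune T v) \<longleftrightarrow> (K, y) \<in> verts T \<and> (K, y) \<noteq> (I, x)" for K y
    by (auto simp: prune_def vI)
  have EE: "edges (prune T v) = edges T - (insert x I - {a})"
    using a by (auto simp: prune_def vI incident_def)
  have sub: "edges (prune T v) \<subseteq> edges T" using EE by auto
  have nr: "x = root T \<or> a = x"
  proof (cases "x = root T")
    case False
    then have "x \<in> inner_edges T" using vI(2) t(4) by (auto simp: inner_edge_iff)
    then show ?thesis using a by auto
  qed simp
  have R: "root (prune T v) = (if x = root T then a else root T)"
    using a by (cases "x = root T") (simp_all add: prune_def vI incident_def)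
  have ax: "x = root T \<Longrightarrow> a \<in> I" using a ai by (auto simp: inner_edge_iff)
  have outp: "y \<in> edges (prune T v)" if y: "(K, y) \<in> verts T" "(K, y) \<noteq> (I, x)" for K y
  proof -
    have yx: "y \<noteq> x" using y vI t(6) by blast
    have "y = a" if "y \<in> I"
    proof -
      have "y \<noteq> root T" using t(5)[OF vI(2)] that by auto
      then have "y \<in> inner_edges T" using y(1) t(4) by (auto simp: inner_edge_iff)
      then show ?thesis using a that by auto
    qed
    then show ?thesis using t(4)[OF y(1)] yx EE by auto
  qed
  show tp: "is_tree (prune T v)"
  proof (rule is_treeI)
    show "finite (edges (prune T v))" using t(1) sub finite_subset by blast
    show "root (prune T v) \<in> edges (prune T v)"
      using nr ai t(2) t(5)[OF vI(2)] unfolding R EE by (auto simp: inner_edge_iff)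
    show "K \<subseteq> edges (prune T v) \<and> y \<in> edges (prune T v) \<and> root (prune T v) \<notin> K"
      if "(K, y) \<in> verts (prune T v)" for K y
    proof -
      from that have K: "(K, y) \<in> verts T" "(K, y) \<noteq> (I, x)" using vE by auto
      have KI: "z \<notin> I" if "z \<in> K" for z using t(7)[OF K(1) vI(2) that] K(2) by auto
      have "z \<in> edges (prune T v)" if "z \<in> K" for z
        using KI[OF that] t(3)[OF K(1)] t(5)[OF K(1)] that nr unfolding EE by auto
      moreover have "root (prune T v) \<notin> K" using KI ax t(5)[OF K(1)] unfolding R by auto
      ultimately show ?thesis using outp[OF K] by auto
    qed
    show "K = L" if "(K, y) \<in> verts (prune T v)" "(L, y) \<in> verts (prune T v)" for K L y
      using t(6)[of K y L] that unfolding vE by simp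
    show "K = L \<and> y = z" if "(K, y) \<in> verts (prune T v)" "(L, z) \<in> verts (prune T v)" "b \<in> K" "b \<in> L"
      for K L y z b using t(7)[of K y L z b] that unfolding vE by simp
    have "b \<in> edges (prune T v) \<longrightarrow> (b, root (prune T v)) \<in> (tree_step (prune T v))\<^sup>*"
      if "(b, root T) \<in> (tree_step T)\<^sup>*" for b
      using that
    proof (induction rule: converse_rtrancl_induct)
      case base
      show ?case
      proof
        assume "root T \<in> edges (prune T v)"
        then have "x \<noteq> root T" using ai unfolding EE by (auto simp: inner_edge_iff)
        then show "(root T, root (prune T v)) \<in> (tree_step (prune T v))\<^sup>*" using R by simp
      qed
    next
      case (step b c)
      then obtain K where K: "(K, c) \<in> verts T" "b \<in> K" by (auto simp: tree_step_iff)
      show ?case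
      proof
        assume b: "b \<in> edges (prune T v)"
        show "(b, root (prune T v)) \<in> (tree_step (prune T v))\<^sup>*"
        proof (cases "(K, c) = (I, x)")
          case True
          then have "b = a" using b K(2) unfolding EE by auto
          then have "x = root T" using nr True K output_notin_inputs[OF T vI(2)] by auto
          then show ?thesis using R \<open>b = a\<close> by simp
        next
          case False
          then have "(b, c) \<in> tree_step (prune T v)" using K by (auto simp: tree_step_iff vE)
          then show ?thesis using step.IH outp[OF K(1) False] by (meson converse_rtrancl_into_rtrancl)
        qed
      qed
    qed
    then show "(b, root (prune T v)) \<in> (tree_step (prune T v))\<^sup>*" if "b \<in> edges (prune T v)" for b
      using that t(8) sub by blast
  qed
  show "face_map T (Outer v) \<in> Hom Omega (prune T v) T"
    unfolding face_map_def face_tree.simps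
    by (rule edge_mor_hom[OF tp T]) (use sub vE in \<open>auto intro: tree_ops.vert\<close>)
qed

theorem face_map_hom:
  assumes "is_tree T" "d \<in> faces T"
  shows "is_tree (face_tree T d)" "face_map T d \<in> Hom Omega (face_tree T d) T"
  using assms is_tree_contract is_tree_prune unfolding faces_def by auto

lemma horn_cell:
  "x \<in> Cell (horn T d) S \<longleftrightarrow> (\<exists>d'\<in>faces T - {d}. \<exists>\<alpha>\<in>Hom Omega S (face_tree T d').
     x = Comp Omega S (face_tree T d') T (face_map T d') \<alpha>)"
  by (auto simp: horn_def)

theorem horn_subpresheaf:
  assumes T: "is_tree T"
  shows "presheaf Omega (horn T d)" "presheaf_map Omega (horn T d) (representable Omega T) (\<lambda>S x. x)"
proof -
  have cat: "\<And>a b c f g. is_tree a \<Longrightarrow> f \<in> Hom Omega a b \<Longrightarrow> g \<in> Hom Omega b c \<Longrightarrow> Comp Omega a b c g f \<in> Hom Omega a c"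
    using Omega_comp by blast
  have as: "Comp Omega Q S T h (Comp Omega Q R S g f) = Comp Omega Q R T (Comp Omega R S T h g) f"
    if "is_tree Q" "is_tree R" "is_tree S" "f \<in> Hom Omega Q R" "g \<in> Hom Omega R S" "h \<in> Hom Omega S T" for Q R S f g h
    using Omega_assoc[OF that(4)] .
  have sub: "x \<in> Hom Omega S T" if "x \<in> Cell (horn T d) S" "is_tree S" for x S
    using that face_map_hom[OF T] cat unfolding horn_cell by blast
  have restr: "Restr (horn T d) = Restr (representable Omega T)" by (simp add: horn_def)
  have closed: "Restr (horn T d) R S f x \<in> Cell (horn T d) R"
    if R: "is_tree R" "is_tree S" and f: "f \<in> Hom Omega R S" and x: "x \<in> Cell (horn T d) S" for R S f x
  proof -
    from x obtain d' \<alpha> where d: "d' \<in> faces T - {d}" "\<alpha> \<in> Hom Omega S (face_tree T d')"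
      "x = Comp Omega S (face_tree T d') T (face_map T d') \<alpha>" unfolding horn_cell by blast
    have "Restr (horn T d) R S f x =
        Comp Omega R (face_tree T d') T (face_map T d') (Comp Omega R S (face_tree T d') \<alpha> f)"
      unfolding restr d(3) representable_def using as[OF R _ f d(2)] face_map_hom[OF T] d(1) by simp
    then show ?thesis unfolding horn_cell using d cat[OF R(1) f d(2)] by blast
  qed
  have rep: "presheaf Omega (representable Omega T)"
    using presheaf_representable[OF category_Omega] T by (simp add: Omega_sel)
  have c: "Cell (representable Omega T) S = Hom Omega S T" for S by (simp add: representable_def)
  show "presheaf Omega (horn T d)"
    using rep closed sub unfolding presheaf_def c restr Omega_sel(1) by blast
  show "presheaf_map Omega (horn T d) (representable Omega T) (\<lambda>S x. x)"
    using sub unfolding presheaf_map_def c restr Omega_sel(1) by blast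
qed

lemma exists_top_vertex:
  assumes T: "is_tree T" and "verts T \<noteq> {}"
  obtains I e where "(I, e) \<in> verts T" "I \<inter> inner_edges T = {}"
proof -
  have "tree_step T \<subseteq> edges T \<times> edges T" using is_treeD(3,4)[OF T] by (fastforce simp: tree_step_iff)
  then have "finite (tree_step T)" using is_treeD(1)[OF T] finite_subset by blast
  moreover have "acyclic (tree_step T)"
    unfolding acyclic_def using tree_acyclic[OF T] is_treeD(3)[OF T] by (metis tranclD tree_step_iff subsetD)
  ultimately have "wf (tree_step T)" by (rule finite_acyclic_wf)
  moreover obtain e0 where "e0 \<in> snd ` verts T" using assms(2) by auto
  ultimately obtain e where e: "e \<in> snd ` verts T" "\<And>y. (y, e) \<in> tree_step T \<Longrightarrow> y \<notin> snd ` verts T"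
    by (rule wfE_min) blast
  then obtain I where I: "(I, e) \<in> verts T" by force
  have "I \<inter> inner_edges T = {}"
  proof (rule ccontr)
    assume "\<not> ?thesis"
    then obtain y J where "y \<in> I" "(J, y) \<in> verts T" by (auto simp: inner_edge_iff)
    then show False using e(2)[of y] I by (force simp: tree_step_iff)
  qed
  then show thesis using that I by blast
qed

text \<open>The map determined by the root vertex \<open>r\<close> lands in the horn \<open>\<Lambda>\<^sup>r[T]\<close>.\<close>

theorem unary_vertex_map_horn:
  assumes T: "is_tree T" and two: "card (verts T) \<ge> 2"
    and r: "r \<in> verts T" "snd r = root T" "card (fst r) = 1"
  shows "presheaf_map Omega (representable Omega (linear_tree 1)) (horn T (Outer r)) (unary_vertex_map T r)"
    and "Outer r \<in> faces T"
proof -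
  note t = is_treeD[OF T]
  obtain a where ra: "r = ({a}, root T)" using r by (cases r) (auto simp: card_1_singleton_iff)
  have ne: "verts T \<noteq> {}" using r by auto
  have r': "({a}, root T) \<in> verts T" using r(1) ra by simp
  have down: "z = a" if st: "(z, root T) \<in> tree_step T" for z
  proof -
    obtain I where I: "(I, root T) \<in> verts T" "z \<in> I" using st by (auto simp: tree_step_iff)
    show ?thesis using t(6)[OF I(1) r'] I(2) by simp
  qed
  have top: "\<exists>I e. (I, e) \<in> verts T \<and> (I, e) \<noteq> r \<and> I \<inter> inner_edges T = {}"
  proof -
    obtain v where v: "v \<in> verts T" "v \<noteq> r"
    proof -
      have "\<not> verts T \<subseteq> {r}"
      proof
        assume s: "verts T \<subseteq> {r}"
        show False using card_mono[OF _ s] two by simp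
      qed
      then show thesis using that by blast
    qed
    obtain I e where Ie: "(I, e) \<in> verts T" "I \<inter> inner_edges T = {}" using exists_top_vertex[OF T ne] .
    show ?thesis
    proof (cases "(I, e) = r")
      case True
      then have I: "I = {a}" using ra by simp
      obtain K y where K: "v = (K, y)" by (cases v)
      have yr: "y \<noteq> root T" using t(6)[OF _ r', of K] v ra K by auto
      have "(y, root T) \<in> (tree_step T)\<^sup>*" using t(8) t(4) v(1) K by blast
      then obtain z where z: "(y, z) \<in> (tree_step T)\<^sup>*" "(z, root T) \<in> tree_step T"
        using yr by (metis rtranclE)
      have "z = a" using down[OF z(2)] .
      have "a \<noteq> root T" "a \<in> edges T" using t(3)[OF r'] t(5)[OF r'] by auto
      have "\<exists>J. (J, a) \<in> verts T"
        using z(1) unfolding \<open>z = a\<close>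
      proof (cases rule: rtranclE)
        case base then show ?thesis using v(1) K by blast
      qed (auto simp: tree_step_iff)
      then have "a \<in> inner_edges T" using \<open>a \<noteq> root T\<close> \<open>a \<in> edges T\<close> by (simp add: inner_edge_iff)
      then show ?thesis using Ie(2) I by simp
    qed (use Ie in blast)
  qed
  then obtain I e where v: "(I, e) \<in> verts T" "(I, e) \<noteq> r" "I \<inter> inner_edges T = {}" by blast
  have er: "e \<noteq> root T" using t(6)[OF _ r', of I] v(1,2) ra by auto
  then have ei: "e \<in> inner_edges T" using v(1) t(4) by (auto simp: inner_edge_iff)
  have inc: "incident (I, e) \<inter> inner_edges T = {e}" using v(3) ei by (auto simp: incident_def)
  then have f: "Outer (I, e) \<in> faces T - {Outer r}" using v by (auto simp: faces_def outer_verts_def)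
  let ?P = "prune T (I, e)"
  have P: "is_tree ?P" "face_map T (Outer (I, e)) \<in> Hom Omega ?P T"
    using face_map_hom[OF T, of "Outer (I, e)"] f by auto
  have rP: "r \<in> verts ?P" using r(1) v(2) by (simp add: prune_def)
  then have aP: "a \<in> edges ?P" "root T \<in> edges ?P" using is_treeD(3,4)[OF P(1)] ra by auto
  let ?m = "\<lambda>k. if k = 0 then the_elem (fst r) else snd r"
  have m: "?m = (\<lambda>k::nat. if k = 0 then a else root T)" using ra by auto
  note L = is_tree_linear[of 1]
  have h: "edge_mor (linear_tree 1) ?m \<in> Hom Omega (linear_tree 1) ?P"
    unfolding m
  proof (rule edge_mor_hom[OF L P(1)])
    fix es x assume es: "(set es, x) \<in> verts (linear_tree 1)" "distinct es"
    then have s: "set es = {0}" "x = 1" by (auto simp: linear_tree_def)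
    have "length es = 1" using distinct_card[OF es(2)] s by simp
    then have "es = [0]" using s by (cases es) auto
    then show "(map (\<lambda>k. if k = 0 then a else root T) es, if x = 0 then a else root T) \<in> tree_ops ?P"
      using s(2) rP ra by (auto intro!: tree_ops.vert)
  qed (use aP in auto)
  have eq: "edge_mor (linear_tree 1) ?m = Comp Omega (linear_tree 1) ?P T (face_map T (Outer (I, e))) (edge_mor (linear_tree 1) ?m)"
  proof -
    have hh: "Comp Omega (linear_tree 1) ?P T (face_map T (Outer (I, e))) (edge_mor (linear_tree 1) ?m) \<in> Hom Omega (linear_tree 1) T"
      using Omega_comp[OF L h P(2)] .
    have "fst (Comp Omega (linear_tree 1) ?P T (face_map T (Outer (I, e))) (edge_mor (linear_tree 1) ?m)) =
        restrict ?m (edges (linear_tree 1))"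
      unfolding Omega_sel m face_map_def edge_mor_def using aP by (auto simp: compose_def)
    then have "Comp Omega (linear_tree 1) ?P T (face_map T (Outer (I, e))) (edge_mor (linear_tree 1) ?m) =
        edge_mor (linear_tree 1) (restrict ?m (edges (linear_tree 1)))"
      using hom_eq_edge_mor[OF hh] by simp
    also have "\<dots> = edge_mor (linear_tree 1) ?m"
      unfolding edge_mor_def using tree_ops_colours[OF L]
      by (auto intro!: restrict_ext map_cong simp: subset_iff)
    finally show ?thesis by simp
  qed
  have "edge_mor (linear_tree 1) ?m \<in> Cell (horn T (Outer r)) (linear_tree 1)"
    unfolding horn_cell using f h eq by (metis face_tree.simps(2))
  then have cell: "Restr (horn T (Outer r)) S (linear_tree 1) \<alpha> (edge_mor (linear_tree 1) ?m) \<in> Cell (horn T (Outer r)) S"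
    if "is_tree S" "\<alpha> \<in> Hom Omega S (linear_tree 1)" for S \<alpha>
    using horn_subpresheaf(1)[OF T, of "Outer r"] that L unfolding presheaf_def Omega_sel(1) by blast
  have hT: "edge_mor (linear_tree 1) ?m \<in> Hom Omega (linear_tree 1) T" using Omega_comp[OF L h P(2)] eq by simp
  show "presheaf_map Omega (representable Omega (linear_tree 1)) (horn T (Outer r)) (unary_vertex_map T r)"
    unfolding presheaf_map_def
  proof (intro conjI ballI)
    fix S x assume "S \<in> Ob Omega" "x \<in> Cell (representable Omega (linear_tree 1)) S"
    then show "unary_vertex_map T r S x \<in> Cell (horn T (Outer r)) S"
      using cell[of S x] by (simp add: Omega_sel(1) unary_vertex_map_def horn_def representable_def)
  next
    fix R S f x assume "R \<in> Ob Omega" "S \<in> Ob Omega" "f \<in> Hom Omega R S"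
      and "x \<in> Cell (representable Omega (linear_tree 1)) S"
    then show "unary_vertex_map T r R (Restr (representable Omega (linear_tree 1)) R S f x) =
        Restr (horn T (Outer r)) R S f (unary_vertex_map T r S x)"
      using Omega_assoc[OF \<open>f \<in> Hom Omega R S\<close>]
      by (simp add: unary_vertex_map_def horn_def representable_def)
  qed
  have "\<exists>J. (J, a) \<in> verts T"
  proof -
    have "(e, root T) \<in> (tree_step T)\<^sup>*" using t(8) t(4) v(1) by blast
    then obtain z where z: "(e, z) \<in> (tree_step T)\<^sup>*" "(z, root T) \<in> tree_step T"
      using er by (metis rtranclE)
    have "z = a" using down[OF z(2)] .
    show ?thesis
      using z(1) unfolding \<open>z = a\<close>
    proof (cases rule: rtranclE)
      case base then show ?thesis using v(1) by blast
    qed (auto simp: tree_step_iff)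
  qed
  moreover have "a \<noteq> root T" "a \<in> edges T" using t(3)[OF r'] t(5)[OF r'] by auto
  ultimately have "incident r \<inter> inner_edges T = {a}" using ra by (auto simp: incident_def inner_edge_iff)
  then show "Outer r \<in> faces T" using r(1) by (auto simp: faces_def outer_verts_def)
qed

end

theory Submission
  imports Defs
begin

text \<open>
  Let \<open>a\<close> and \<open>b\<close> be the input and the output of \<open>r\<close>, and let \<open>F\<close> be the forest above \<open>a\<close>, so that \<open>T\<close>
  is the join \<open>F \<star> \<Delta>[1]\<close>.  For \<open>k < n\<close> the inclusion of \<open>\<partial>F \<star> \<Delta>[n] \<union> F \<star> \<Lambda>\<^sup>k[n]\<close> into \<open>F \<star> \<Delta>[n]\<close> is the
  inclusion of an inner horn, even if \<open>k = 0\<close>.  As \<open>f(r)\<close> is invertible, it extends to a coherent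
  equivalence: a \<open>3\<close>-simplex \<open>Q\<close> of \<open>i\<^sup>*(X)\<close> on the vertices \<open>a, b, a, b\<close> whose edges \<open>01\<close> and \<open>23\<close>
  are \<open>f(r)\<close> and whose faces \<open>013\<close> and \<open>023\<close> are degenerate.  The inclusion of \<open>\<Delta>{0,1,3} \<union> \<Delta>{0,2,3}\<close> into \<open>\<Delta>[3]\<close> is a
  composite of left horn inclusions.  So the degenerate data defined by \<open>g\<close> on the join of \<open>F\<close> with
  this union, together with \<open>p(Q)\<close>, extend to a map \<open>F \<star> \<Delta>[3] \<rightarrow> Y\<close>, and those defined by \<open>f\<close>, together with \<open>Q\<close>, extend to
  a lift of its restriction to \<open>\<partial>F \<star> \<Delta>[3]\<close>.  Now \<open>f\<close> also gives a degenerate lift on \<open>F \<star> \<Delta>{1,3}\<close>;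
  filling horns at the vertex \<open>1\<close> extends it over \<open>F \<star> \<Delta>{1,2,3}\<close>, and the restriction to
  \<open>F \<star> \<Delta>{2,3} = T\<close> is the required lift.
\<close>

section \<open>The operations of a tree\<close>

text \<open>In the notation of the overview, the horn of the theorem is \<open>\<partial>F \<star>
  \<Delta>[1] \<union> F \<star> \<Delta>{1}\<close>, the case \<open>k = n = 1\<close>: its missing
  face \<open>F \<star> \<Delta>{0}\<close> is opposite to the root edge, so the horn is not inner.
  For \<open>k = 0\<close> a horn is inner because the vertex 0 is the edge \<open>a\<close>, which
  is the output of a vertex and not the root. So in the joins only horns at the least vertex of the
  simplex are filled, and \<open>Q\<close> is what reduces the problem to these.

  The shape of \<open>Q\<close> comes from the map (0,1,0,1) from [3] to [1]. It fails to be
  monotone only on the edge 12, where \<open>Q\<close> supplies an inverse of \<open>f(r)\<close>;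
  simplices without 1 or without 2 collapse to \<open>T\<close>, and the given data can be used
  there. The edge 13 collapses to the root edge, and \<open>f\<close> is defined on
  \<open>F \<star> \<Delta>{1}\<close>; this gives the degenerate lift on
  \<open>F \<star> \<Delta>{1,3}\<close>. In \<open>X\<close> only
  \<open>\<partial>F \<star> \<Delta>[3]\<close> can be treated at first, since \<open>f\<close> is
  not given on \<open>F \<star> \<Delta>{0}\<close>; in \<open>Y\<close> the map must exist on the
  whole join beforehand, as the later lifts have to lie over it.\<close>

definition above :: "tree \<Rightarrow> nat \<Rightarrow> nat \<Rightarrow> bool" where
  "above T x e \<longleftrightarrow> (x, e) \<in> (tree_step T)\<^sup>*"

text \<open>The leaves of a subtree with root \<open>e\<close>, in any order: an antichain with a
  member under every leaf above \<open>e\<close>. A branch ending in nullary vertices contains no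
  leaf and may be left uncut.\<close>

definition cut :: "tree \<Rightarrow> nat list \<Rightarrow> nat \<Rightarrow> bool" where
  "cut T es e \<longleftrightarrow> e \<in> edges T \<and> distinct es \<and> (\<forall>x\<in>set es. above T x e) \<and>
     (\<forall>x\<in>set es. \<forall>y\<in>set es. above T x y \<longrightarrow> x = y) \<and>
     (\<forall>l\<in>leaves T. above T l e \<longrightarrow> (\<exists>x\<in>set es. above T l x))"

lemma above_refl [simp]: "above T x x"
  by (simp add: above_def)

lemma above_trans [trans]: "above T x y \<Longrightarrow> above T y z \<Longrightarrow> above T x z"
  unfolding above_def by (rule rtrancl_trans)

lemma above_input: "(I, e) \<in> verts T \<Longrightarrow> x \<in> I \<Longrightarrow> above T x e"
  unfolding above_def using tree_step_iff by blast

lemma above_upE: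
  assumes "above T x e" "x \<noteq> e"
  obtains I y where "(I, e) \<in> verts T" "y \<in> I" "above T x y"
  using assms unfolding above_def by (metis rtranclE tree_step_iff)

lemma above_downE:
  assumes "above T x e" "x \<noteq> e"
  obtains I y where "(I, y) \<in> verts T" "x \<in> I" "above T y e"
  using assms unfolding above_def by (metis converse_rtranclE tree_step_iff)

lemma leaves_iff: "l \<in> leaves T \<longleftrightarrow> l \<in> edges T \<and> (\<forall>I. (I, l) \<notin> verts T)"
  unfolding leaves_def by force

lemma above_leaf: "above T x l \<Longrightarrow> l \<in> leaves T \<Longrightarrow> x = l"
  by (metis above_upE leaves_iff)

context
  fixes T :: tree
  assumes T: "is_tree T"
begin

lemma above_edges: "above T x e \<Longrightarrow> e \<in> edges T \<Longrightarrow> x \<in> edges T"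
  by (metis above_downE is_treeD(3)[OF T] subsetD)

lemma above_root: "e \<in> edges T \<Longrightarrow> above T e (root T)"
  using is_treeD(8)[OF T] by (simp add: above_def)

lemma above_antisym:
  assumes "above T x y" "above T y x" shows "x = y"
proof (rule ccontr)
  assume "x \<noteq> y"
  then have "(x, y) \<in> (tree_step T)\<^sup>+" "(y, x) \<in> (tree_step T)\<^sup>+"
    using assms unfolding above_def by (auto dest: rtranclD)
  then have "(x, x) \<in> (tree_step T)\<^sup>+" by (rule trancl_trans)
  moreover have "x \<in> edges T"
    using above_downE[OF assms(1) \<open>x \<noteq> y\<close>] is_treeD(3)[OF T] by blast
  ultimately show False using tree_acyclic[OF T] by blast
qed

lemma root_above: "above T (root T) e \<Longrightarrow> e = root T"
  by (metis above_downE is_treeD(5)[OF T])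

lemma above_linear: "above T x a \<Longrightarrow> above T x b \<Longrightarrow> above T a b \<or> above T b a"
  unfolding above_def by (rule tree_chain[OF T])

lemma above_below_input:
  assumes "(I, e) \<in> verts T" "x \<in> I" "above T x z" "x \<noteq> z" shows "above T e z"
  using assms is_treeD(7)[OF T] by (metis above_downE)

lemma inputs_antichain:
  assumes "(I, e) \<in> verts T" "x \<in> I" "y \<in> I" "above T z x" "above T z y" shows "x = y"
  using tree_siblings[OF T assms(1-3)] assms(4,5) unfolding above_def by blast

lemma input_neq: "(I, e) \<in> verts T \<Longrightarrow> x \<in> I \<Longrightarrow> x \<noteq> e"
  using output_notin_inputs[OF T] by blast

lemma not_above_input: "(I, e) \<in> verts T \<Longrightarrow> x \<in> I \<Longrightarrow> \<not> above T e x"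
  using above_antisym above_input input_neq by blast

text \<open>Induction from the top of the tree down to the root: \<open>tree_step T\<close> is
  finite and acyclic, hence well-founded, with the inputs of a vertex as predecessors of its
  output.\<close>

lemma above_tree_induct [consumes 1, case_names step]:
  assumes "e \<in> edges T"
    and step: "\<And>e. e \<in> edges T \<Longrightarrow> (\<And>I y. (I, e) \<in> verts T \<Longrightarrow> y \<in> I \<Longrightarrow> P y) \<Longrightarrow> P e"
  shows "P e"
proof -
  have "tree_step T \<subseteq> edges T \<times> edges T" using is_treeD(3,4)[OF T] by (fastforce simp: tree_step_iff)
  then have "finite (tree_step T)" using is_treeD(1)[OF T] finite_subset by blast
  moreover have "acyclic (tree_step T)"
    unfolding acyclic_def using tree_acyclic[OF T] is_treeD(3)[OF T] by (metis tranclD tree_step_iff subsetD)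
  ultimately have "wf (tree_step T)" by (rule finite_acyclic_wf)
  then have "e \<in> edges T \<longrightarrow> P e"
  proof (induction e rule: wf_induct_rule)
    case (less e)
    show ?case
    proof
      assume e: "e \<in> edges T"
      show "P e"
        by (rule step[OF e]) (use less is_treeD(3)[OF T] in \<open>auto simp: tree_step_iff\<close>)
    qed
  qed
  then show ?thesis using assms(1) by blast
qed

text \<open>Grafted cuts do not interfere: the edges below a given edge form a chain, so an edge
  above the outputs of two grafted operations makes these outputs comparable, hence equal.\<close>

lemma cut_compose:
  assumes "cut T (map snd qs) e" "\<And>q. q \<in> set qs \<Longrightarrow> cut T (fst q) (snd q)"
  shows "cut T (concat (map fst qs)) e"
  unfolding cut_def
proof (intro conjI ballI impI)
  have q: "above T x (snd q)" if "q \<in> set qs" "x \<in> set (fst q)" for x q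
    using assms(2)[OF that(1)] that(2) by (simp add: cut_def)
  have e: "above T (snd q) e" if "q \<in> set qs" for q using assms(1) that by (auto simp: cut_def)
  have same: "q = q'" if "q \<in> set qs" "q' \<in> set qs" "above T x (snd q)" "above T x (snd q')" for q q' x
  proof -
    have "snd q = snd q'"
      using above_linear[OF that(3,4)] assms(1) that(1,2) by (fastforce simp: cut_def)
    then show ?thesis using assms(1) that(1,2) by (auto simp: cut_def distinct_map inj_on_def)
  qed
  show "e \<in> edges T" using assms(1) by (simp add: cut_def)
  show "distinct (concat (map fst qs))"
  proof (rule distinct_concat_grafts[of "\<lambda>x c. above T x c"])
    show "list_all2 (\<lambda>L c. distinct L \<and> (\<forall>x\<in>set L. above T x c)) (map fst qs) (map snd qs)"
      using assms(2) by (auto simp: list_all2_conv_all_nth cut_def)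
    show "distinct (map snd qs)" using assms(1) by (simp add: cut_def)
    show "c = c'" if "above T x c" "above T x c'" "c \<in> set (map snd qs)" "c' \<in> set (map snd qs)" for x c c'
      using same that by auto
  qed
  show "above T x e" if x: "x \<in> set (concat (map fst qs))" for x
  proof -
    obtain a where "a \<in> set qs" "x \<in> set (fst a)" using x by auto
    then show ?thesis using q e above_trans by blast
  qed
  show "x = y" if xy: "x \<in> set (concat (map fst qs))" "y \<in> set (concat (map fst qs))" "above T x y" for x y
  proof -
    obtain a b where ab: "a \<in> set qs" "x \<in> set (fst a)" "b \<in> set qs" "y \<in> set (fst b)" using xy(1,2) by auto
    have "above T x (snd b)" using q[OF ab(3,4)] xy(3) above_trans by blast
    then have "a = b" using same ab q by blast
    then show ?thesis using assms(2)[OF ab(1)] ab xy(3) unfolding cut_def by blast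
  qed
  show "\<exists>x\<in>set (concat (map fst qs)). above T l x" if l: "l \<in> leaves T" "above T l e" for l
  proof -
    obtain q where "q \<in> set qs" "above T l (snd q)" using assms(1) l unfolding cut_def by auto
    then show ?thesis using assms(2) l(1) unfolding cut_def by fastforce
  qed
qed

lemma cut_set: "cut T es e \<Longrightarrow> distinct es' \<Longrightarrow> set es' = set es \<Longrightarrow> cut T es' e"
  by (simp add: cut_def)

lemma cut_vertex:
  assumes "(set es, e) \<in> verts T" "distinct es" shows "cut T es e"
  unfolding cut_def
proof (intro conjI ballI impI)
  show "\<exists>x\<in>set es. above T l x" if "l \<in> leaves T" "above T l e" for l
  proof -
    have "l \<noteq> e" using that(1) assms(1) by (auto simp: leaves_iff)
    then show ?thesis using that above_upE is_treeD(6)[OF T assms(1)] by metis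
  qed
  show "x = y" if "x \<in> set es" "y \<in> set es" "above T x y" for x y
    using inputs_antichain[OF assms(1) that(1,2) above_refl that(3)] .
qed (use assms is_treeD(4)[OF T] above_input in auto)

lemma op_imp_cut: "p \<in> tree_ops T \<Longrightarrow> cut T (fst p) (snd p)"
proof (induction rule: tree_ops.induct)
  case (compose qs e) then show ?case using cut_compose by auto
next
  case (act es e \<sigma>) then show ?case using cut_set[of es e "permute_list \<sigma> es"] by (simp add: cut_def)
qed (use cut_vertex in \<open>auto simp: cut_def\<close>)

lemma op_perm:
  assumes "(es, e) \<in> tree_ops T" "distinct es" "distinct es'" "set es' = set es"
  shows "(es', e) \<in> tree_ops T"
proof -
  have "mset es' = mset es" using assms set_eq_iff_mset_eq_distinct by blast
  then obtain \<sigma> where "\<sigma> permutes {..<length es}" "permute_list \<sigma> es = es'" by (rule mset_eq_permutation)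
  then show ?thesis using tree_ops.act[OF assms(1)] by auto
qed

text \<open>The cut is distributed over the inputs of the vertex with output \<open>e\<close>; each
  part is a cut one level higher, and the parts are grafted back onto that vertex.\<close>

lemma cut_imp_op:
  assumes "e \<in> edges T" "cut T es e" shows "(es, e) \<in> tree_ops T"
  using assms
proof (induction e arbitrary: es rule: above_tree_induct)
  case (step e)
  note c = step(3)[unfolded cut_def]
  show ?case
  proof (cases "e \<in> set es")
    case True
    then have "set es = {e}" using c by auto
    moreover have "length es = 1" using c distinct_card[of es] \<open>set es = {e}\<close> by simp
    ultimately have "es = [e]" by (cases es) auto
    then show ?thesis using step(1) by (simp add: tree_ops.unit)
  next
    case False
    \<comment> \<open>A leaf \<open>e\<close> would lie above some member of the cut, which in turn
      lies above \<open>e\<close> and so equals \<open>e\<close>.\<close>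
    have "e \<notin> leaves T"
    proof
      assume "e \<in> leaves T"
      then obtain x where "x \<in> set es" "above T e x" using c above_refl by blast
      then show False using False c above_antisym by blast
    qed
    then obtain I where I: "(I, e) \<in> verts T" using step(1) by (auto simp: leaves_iff)
    have "finite I" using is_treeD(1,3)[OF T] I finite_subset by blast
    then obtain ys where ys: "set ys = I" "distinct ys" using finite_distinct_list by blast
    let ?q = "\<lambda>y. (filter (\<lambda>x. above T x y) es, y)"
    have q: "cut T (fst (?q y)) y" if "y \<in> I" for y
      unfolding cut_def
    proof (intro conjI ballI impI)
      show "y \<in> edges T" using I that is_treeD(3)[OF T] by blast
      show "\<exists>x\<in>set (fst (?q y)). above T l x" if l: "l \<in> leaves T" "above T l y" for l
      proof -
        have "above T l e" using l(2) above_input[OF I \<open>y \<in> I\<close>] above_trans by blast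
        then obtain x where x: "x \<in> set es" "above T l x" using c l(1) by blast
        have "x \<noteq> e" using False x by auto
        then obtain z where z: "z \<in> I" "above T x z" using c x(1) I above_upE is_treeD(6)[OF T] by metis
        then have "z = y" using inputs_antichain[OF I _ \<open>y \<in> I\<close>] x(2) l(2) above_trans by blast
        then show ?thesis using x z by auto
      qed
    qed (use c in auto)
    let ?qs = "map ?q ys"
    have o: "(ys, e) \<in> tree_ops T" by (rule tree_ops.vert) (use I ys in auto)
    have op: "(concat (map fst ?qs), e) \<in> tree_ops T"
      by (rule tree_ops.compose) (use o q step(2)[OF I] ys in \<open>auto simp: comp_def\<close>)
    have eq: "set (concat (map fst ?qs)) = set es"
    proof (intro equalityI subsetI)
      fix x assume x: "x \<in> set es"
      then have "x \<noteq> e" using False by auto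
      then obtain z where z: "z \<in> I" "above T x z" using c x(1) I above_upE is_treeD(6)[OF T] by metis
      then show "x \<in> set (concat (map fst ?qs))" using x ys by auto
    qed auto
    have "distinct (concat (map fst ?qs))"
      using op_imp_cut[OF op] by (simp only: cut_def fst_conv)
    then show ?thesis using op_perm[OF op _ _ eq[symmetric]] c by simp
  qed
qed

text \<open>This trades the inductive generation of operations for conditions on the order of the
  edges, through which membership in hom sets is tested from here on.\<close>

theorem op_iff_cut: "(es, e) \<in> tree_ops T \<longleftrightarrow> cut T es e"
  using op_imp_cut[of "(es, e)"] cut_imp_op by (auto simp: cut_def)

text \<open>The vertex found here is the one to prune when a cell uses no edge strictly above
  \<open>e\<close>.\<close>

lemma exists_top_above:
  assumes "(J, e) \<in> verts T"
  obtains I x where "(I, x) \<in> verts T" "above T x e" "I \<subseteq> leaves T"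
proof -
  have "e \<in> edges T" using assms is_treeD(4)[OF T] by blast
  then have "(\<exists>J. (J, e) \<in> verts T) \<longrightarrow> (\<exists>I x. (I, x) \<in> verts T \<and> above T x e \<and> I \<subseteq> leaves T)"
  proof (induction rule: above_tree_induct)
    case (step e)
    show ?case
    proof (intro impI, elim exE)
      fix J assume J: "(J, e) \<in> verts T"
      show "\<exists>I x. (I, x) \<in> verts T \<and> above T x e \<and> I \<subseteq> leaves T"
      proof (cases "J \<subseteq> leaves T")
        case True then show ?thesis using J by (intro exI[of _ J] exI[of _ e]) simp
      next
        case False
        then obtain y where y: "y \<in> J" "y \<notin> leaves T" by blast
        then have "\<exists>K. (K, y) \<in> verts T" using is_treeD(3)[OF T J] by (auto simp: leaves_iff)
        then obtain I x where "(I, x) \<in> verts T" "above T x y" "I \<subseteq> leaves T" using step(2)[OF J y(1)] by blast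
        then show ?thesis using above_trans above_input[OF J y(1)] by blast
      qed
    qed
  qed
  then show thesis using that assms by blast
qed

end


section \<open>Faces as subsets of the hom sets\<close>

text \<open>
  Morphisms being pairs of extensional functions, a subtree \<open>U\<close> of \<open>W\<close> gives an inclusion of sets
  \<open>Hom Omega S U \<subseteq> Hom Omega S W\<close>, and the cells of a horn are a union of such sets.
\<close>

definition restricts :: "tree \<Rightarrow> tree \<Rightarrow> bool" where
  "restricts U W \<longleftrightarrow> edges U \<subseteq> edges W \<and> tree_ops U \<subseteq> tree_ops W"

text \<open>
  A face \<open>U\<close> of \<open>W\<close> with a leaf \<open>l\<close> contains no operation whose output lies below \<open>l\<close> unless one of its
  inputs does, too.
\<close>

definition escapes :: "tree \<Rightarrow> tree \<Rightarrow> (nat \<Rightarrow> nat) \<Rightarrow> nat \<Rightarrow> bool" where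
  "escapes W S \<phi> l \<longleftrightarrow> (\<exists>(J, z)\<in>verts S. above W l (\<phi> z) \<and> (\<forall>j\<in>J. \<not> above W l (\<phi> j)))"

lemma escapes_cong:
  assumes S: "is_tree S" and "\<And>z. z \<in> edges S \<Longrightarrow> above V l (\<phi> z) \<longleftrightarrow> above W l' (\<psi> z)"
  shows "escapes V S \<phi> l \<longleftrightarrow> escapes W S \<psi> l'"
proof -
  have "(case v of (J, z) \<Rightarrow> above V l (\<phi> z) \<and> (\<forall>j\<in>J. \<not> above V l (\<phi> j))) \<longleftrightarrow>
        (case v of (J, z) \<Rightarrow> above W l' (\<psi> z) \<and> (\<forall>j\<in>J. \<not> above W l' (\<psi> j)))" if v: "v \<in> verts S" for v
  proof -
    obtain J z where Jz: "v = (J, z)" by (cases v)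
    have "z \<in> edges S" "J \<subseteq> edges S" using is_treeD(3,4)[OF S] v Jz by auto
    then show ?thesis using assms(2) Jz by auto
  qed
  then show ?thesis unfolding escapes_def by (intro bex_cong) auto
qed

lemma not_escapesD:
  "\<not> escapes W S \<phi> l \<Longrightarrow> (J, z) \<in> verts S \<Longrightarrow> above W l (\<phi> z) \<Longrightarrow> \<exists>j\<in>J. above W l (\<phi> j)"
  unfolding escapes_def by fastforce

lemma restricts_refl: "restricts U U"
  by (simp add: restricts_def)

lemma restricts_trans: "restricts U V \<Longrightarrow> restricts V W \<Longrightarrow> restricts U W"
  by (auto simp: restricts_def)

lemma restricts_hom:
  assumes "is_tree S" "restricts U W" "\<alpha> \<in> Hom Omega S U" shows "\<alpha> \<in> Hom Omega S W"
proof -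
  have "operad_map (tree_operad S) (tree_operad W) (fst \<alpha>) (snd \<alpha>)"
    using assms(2,3) unfolding Omega_sel operad_map_def restricts_def
    by (auto simp: tree_operad_def)
  then show ?thesis using assms(3) by (simp add: Omega_sel)
qed

lemma face_restricts:
  assumes "is_tree T" "d \<in> faces T" shows "restricts (face_tree T d) T"
proof -
  note f = face_map_hom[OF assms]
  have "fst (face_map T d) \<in> edges (face_tree T d) \<rightarrow> edges T" "snd (face_map T d) \<in> tree_ops (face_tree T d) \<rightarrow> tree_ops T"
    using Omega_hom_fun[OF f(2)] .
  then show ?thesis unfolding face_map_def edge_mor_def restricts_def by (auto simp: Pi_iff)
qed

lemma comp_inclusion:
  assumes S: "is_tree S" and U: "is_tree U" and \<alpha>: "\<alpha> \<in> Hom Omega S U"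
  shows "Comp Omega S U T (edge_mor U (\<lambda>e. e)) \<alpha> = \<alpha>"
proof -
  have e: "fst \<alpha> \<in> extensional (edges S)" "snd \<alpha> \<in> extensional (tree_ops S)" using \<alpha> unfolding Omega_sel by auto
  have "compose (edges S) (restrict (\<lambda>e. e) (edges U)) (fst \<alpha>) = fst \<alpha>"
    by (rule extensionalityI[OF _ e(1)]) (use Omega_hom_fun(1)[OF \<alpha>] in \<open>auto simp: compose_def\<close>)
  moreover have "compose (tree_ops S) (restrict (\<lambda>p. (map (\<lambda>e. e) (fst p), snd p)) (tree_ops U)) (snd \<alpha>) = snd \<alpha>"
    by (rule extensionalityI[OF _ e(2)]) (use Omega_hom_fun(2)[OF \<alpha>] in \<open>auto simp: compose_def\<close>)
  ultimately show ?thesis unfolding Omega_sel edge_mor_def by simp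
qed

lemma horn_cell_iff:
  assumes "is_tree T" "is_tree S"
  shows "\<alpha> \<in> Cell (horn T d) S \<longleftrightarrow> (\<exists>d'\<in>faces T - {d}. \<alpha> \<in> Hom Omega S (face_tree T d'))"
  unfolding horn_cell face_map_def using comp_inclusion[OF assms(2)] face_map_hom(1)[OF assms(1)]
  by (metis (no_types, lifting) DiffD1)

lemma hom_edge:
  assumes "\<alpha> \<in> Hom Omega S T" "e \<in> edges S" shows "fst \<alpha> e \<in> edges T"
  using Omega_hom_fun(1)[OF assms(1)] assms(2) by auto

lemma hom_vertex_op:
  assumes S: "is_tree S" and \<alpha>: "\<alpha> \<in> Hom Omega S T" and v: "(set es, e) \<in> verts S" "distinct es"
  shows "(map (fst \<alpha>) es, fst \<alpha> e) \<in> tree_ops T"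
proof -
  have o: "(es, e) \<in> tree_ops S" by (rule tree_ops.vert[OF v])
  have "snd \<alpha> (es, e) = (map (fst \<alpha>) es, fst \<alpha> e)"
    using arg_cong[OF hom_eq_edge_mor[OF \<alpha>], of snd] o by (simp add: edge_mor_def)
  then show ?thesis using Omega_hom_fun(2)[OF \<alpha>] o by force
qed

lemma vertex_inputs_list:
  assumes "is_tree S" "(J, z) \<in> verts S" obtains es where "set es = J" "distinct es"
  using finite_distinct_list[of J] finite_subset[OF is_treeD(3)[OF assms] is_treeD(1)[OF assms(1)]] by blast

lemma hom_vertex:
  assumes S: "is_tree S" and T: "is_tree T" and \<alpha>: "\<alpha> \<in> Hom Omega S T" and v: "(J, z) \<in> verts S"
  shows "j \<in> J \<Longrightarrow> above T (fst \<alpha> j) (fst \<alpha> z)"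
    and "i \<in> J \<Longrightarrow> j \<in> J \<Longrightarrow> above T (fst \<alpha> i) (fst \<alpha> j) \<Longrightarrow> i = j"
    and "l \<in> leaves T \<Longrightarrow> above T l (fst \<alpha> z) \<Longrightarrow> \<exists>j\<in>J. above T l (fst \<alpha> j)"
proof -
  obtain es where es: "set es = J" "distinct es" using vertex_inputs_list[OF S v] .
  have "(map (fst \<alpha>) es, fst \<alpha> z) \<in> tree_ops T" using hom_vertex_op[OF S \<alpha> _ es(2)] v es(1) by simp
  then have c: "cut T (map (fst \<alpha>) es) (fst \<alpha> z)" using op_iff_cut[OF T] by blast
  show "j \<in> J \<Longrightarrow> above T (fst \<alpha> j) (fst \<alpha> z)" using c es by (simp add: cut_def)
  show "l \<in> leaves T \<Longrightarrow> above T l (fst \<alpha> z) \<Longrightarrow> \<exists>j\<in>J. above T l (fst \<alpha> j)" using c es by (simp add: cut_def)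
  show "i \<in> J \<Longrightarrow> j \<in> J \<Longrightarrow> above T (fst \<alpha> i) (fst \<alpha> j) \<Longrightarrow> i = j"
    using c es unfolding cut_def by (auto simp: distinct_map inj_on_def)
qed

lemma hom_above:
  assumes S: "is_tree S" and T: "is_tree T" and \<alpha>: "\<alpha> \<in> Hom Omega S T" and "above S x y"
  shows "above T (fst \<alpha> x) (fst \<alpha> y)"
  using assms(4) unfolding above_def
proof (induction rule: rtrancl_induct)
  case (step y z)
  then show ?case using hom_vertex(1)[OF S T \<alpha>] unfolding above_def tree_step_iff
    by (meson rtrancl_trans)
qed simp

lemma edge_mor_homI:
  assumes S: "is_tree S" and T: "is_tree T" and e: "\<And>e. e \<in> edges S \<Longrightarrow> f e \<in> edges T"
    and v: "\<And>J z. (J, z) \<in> verts S \<Longrightarrow> inj_on f J \<and> (\<forall>j\<in>J. above T (f j) (f z)) \<and>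
        (\<forall>i\<in>J. \<forall>j\<in>J. above T (f i) (f j) \<longrightarrow> f i = f j) \<and>
        (\<forall>l\<in>leaves T. above T l (f z) \<longrightarrow> (\<exists>j\<in>J. above T l (f j)))"
  shows "edge_mor S f \<in> Hom Omega S T"
proof (rule edge_mor_hom[OF S T e])
  fix es z assume "(set es, z) \<in> verts S" "distinct es"
  then show "(map f es, f z) \<in> tree_ops T"
    unfolding op_iff_cut[OF T] cut_def using v[of "set es" z] e is_treeD(4)[OF S]
    by (auto simp: distinct_map)
qed

text \<open>The order of a face is induced. For the converse direction one descends from a common
  bound \<open>z\<close> of \<open>x\<close> and \<open>y\<close>, at first the root: if they lay
  above different inputs of the vertex at \<open>z\<close>, these inputs would be incomparable in
  \<open>W\<close>, whereas \<open>x\<close> lies above both.\<close>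

lemma restricts_above:
  assumes U: "is_tree U" and W: "is_tree W" and UW: "restricts U W" and xy: "x \<in> edges U" "y \<in> edges U"
  shows "above U x y \<longleftrightarrow> above W x y"
proof
  have i: "edge_mor U (\<lambda>e. e) \<in> Hom Omega U W"
    by (rule edge_mor_hom[OF U W]) (use UW in \<open>auto simp: restricts_def intro: tree_ops.vert\<close>)
  have i1: "fst (edge_mor U (\<lambda>e. e)) e = e" if "e \<in> edges U" for e using that by (simp add: edge_mor_def)
  have up: "above W u v" if "above U u v" "u \<in> edges U" "v \<in> edges U" for u v
    using hom_above[OF U W i that(1)] that i1 by simp
  then show "above U x y \<Longrightarrow> above W x y" using xy by blast
  assume a: "above W x y"
  have "z \<in> edges U \<Longrightarrow> above U x z \<longrightarrow> above U y z \<longrightarrow> above U x y" for z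
  proof (induction z rule: above_tree_induct[OF U, consumes 1, case_names step])
    case (step z)
    show ?case
    proof (intro impI)
      assume z: "above U x z" "above U y z"
      show "above U x y"
      proof (cases "x = z \<or> y = z")
        case True
        then show ?thesis using z a up[OF z(2)] xy above_antisym[OF W] \<open>z \<in> edges U\<close> by auto
      next
        case False
        then obtain I x' where I: "(I, z) \<in> verts U" "x' \<in> I" "above U x x'" using z(1) above_upE by metis
        obtain y' where y': "y' \<in> I" "above U y y'"
          using z(2) False above_upE is_treeD(6)[OF U I(1)] by metis
        have e: "x' \<in> edges U" "y' \<in> edges U" using I y' is_treeD(3)[OF U] by blast+
        have "above W x x'" "above W y y'" using up I(3) y'(2) e xy by blast+
        then have "above W x' y' \<or> above W y' x'" using a above_linear[OF W] above_trans by blast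
        then have "x' = y'"
          using hom_vertex(2)[OF U W i I(1)] I(2) y'(1) e i1 by metis
        then show ?thesis using step(2)[OF I(1) y'(1)] I(3) y'(2) by blast
      qed
    qed
  qed
  then show "above U x y" using above_root[OF U] is_treeD(2)[OF U] xy by blast
qed

text \<open>Of the conditions on a cut, all but the covering of leaves concern the order only, which
  \<open>U\<close> inherits from \<open>W\<close>. What can fail in \<open>U\<close> is the covering
  of its leaves, and that is what \<open>escapes\<close> records.\<close>

theorem hom_restricts_iff:
  assumes U: "is_tree U" and W: "is_tree W" and UW: "restricts U W" and S: "is_tree S"
  shows "\<alpha> \<in> Hom Omega S U \<longleftrightarrow>
    \<alpha> \<in> Hom Omega S W \<and> fst \<alpha> ` edges S \<subseteq> edges U \<and> (\<forall>l\<in>leaves U. \<not> escapes W S (fst \<alpha>) l)"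
    (is "?L \<longleftrightarrow> ?R")
proof
  note ab = restricts_above[OF U W UW]
  have lU: "l \<in> edges U" if "l \<in> leaves U" for l using that by (simp add: leaves_def)
  {
    assume L: ?L
    have "\<not> escapes W S (fst \<alpha>) l" if l: "l \<in> leaves U" for l
    proof
      assume "escapes W S (fst \<alpha>) l"
      then obtain J z where v: "(J, z) \<in> verts S" "above W l (fst \<alpha> z)" "\<forall>j\<in>J. \<not> above W l (fst \<alpha> j)"
        by (auto simp: escapes_def)
      have z: "z \<in> edges S" "J \<subseteq> edges S" using is_treeD(3,4)[OF S v(1)] by auto
      then have "above U l (fst \<alpha> z)" using v(2) ab lU[OF l] hom_edge[OF L] by blast
      then obtain j where "j \<in> J" "above U l (fst \<alpha> j)" using hom_vertex(3)[OF S U L v(1) l] by blast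
      then show False using v(3) z ab lU[OF l] hom_edge[OF L] by blast
    qed
    then show ?R using restricts_hom[OF S UW L] hom_edge[OF L] by auto
  }
  assume R: ?R
  then have hW: "\<alpha> \<in> Hom Omega S W" and e: "\<And>x. x \<in> edges S \<Longrightarrow> fst \<alpha> x \<in> edges U" by auto
  have "edge_mor S (fst \<alpha>) \<in> Hom Omega S U"
  proof (rule edge_mor_homI[OF S U e])
    fix J z assume v: "(J, z) \<in> verts S"
    note h = hom_vertex[OF S W hW v]
    have z: "z \<in> edges S" "\<And>j. j \<in> J \<Longrightarrow> j \<in> edges S" using is_treeD(3,4)[OF S v] by auto
    show "inj_on (fst \<alpha>) J \<and> (\<forall>j\<in>J. above U (fst \<alpha> j) (fst \<alpha> z)) \<and>
        (\<forall>i\<in>J. \<forall>j\<in>J. above U (fst \<alpha> i) (fst \<alpha> j) \<longrightarrow> fst \<alpha> i = fst \<alpha> j) \<and>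
        (\<forall>l\<in>leaves U. above U l (fst \<alpha> z) \<longrightarrow> (\<exists>j\<in>J. above U l (fst \<alpha> j)))"
    proof (intro conjI ballI impI)
      show "inj_on (fst \<alpha>) J" using h(2) by (auto intro!: inj_onI)
      show "above U (fst \<alpha> j) (fst \<alpha> z)" if "j \<in> J" for j using h(1)[OF that] ab e z that by blast
      show "fst \<alpha> i = fst \<alpha> j" if "i \<in> J" "j \<in> J" "above U (fst \<alpha> i) (fst \<alpha> j)" for i j
        using h(2)[OF that(1,2)] that ab e z by blast
      show "\<exists>j\<in>J. above U l (fst \<alpha> j)" if l: "l \<in> leaves U" "above U l (fst \<alpha> z)" for l
      proof -
        have "above W l (fst \<alpha> z)" using l(2) ab[OF lU[OF l(1)] e[OF z(1)]] by simp
        then obtain j where "j \<in> J" "above W l (fst \<alpha> j)" using R l(1) not_escapesD[OF _ v] by meson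
        then show ?thesis using ab[OF lU[OF l(1)] e[OF z(2)]] by blast
      qed
    qed
  qed
  then show ?L using hom_eq_edge_mor[OF hW] by simp
qed

lemma hom_leaf_not_escapes:
  assumes "is_tree S" "is_tree U" "\<alpha> \<in> Hom Omega S U" "l \<in> leaves U"
  shows "\<not> escapes U S (fst \<alpha>) l"
  using hom_restricts_iff[OF assms(2,2) restricts_refl assms(1), of \<alpha>] assms(3,4) by blast

lemma restricts_escapes:
  assumes S: "is_tree S" and U: "is_tree U" and W: "is_tree W" and UW: "restricts U W"
    and \<alpha>: "\<alpha> \<in> Hom Omega S U" and l: "l \<in> edges U"
  shows "escapes U S (fst \<alpha>) l \<longleftrightarrow> escapes W S (fst \<alpha>) l"
  by (rule escapes_cong[OF S]) (rule restricts_above[OF U W UW l hom_edge[OF \<alpha>]])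

section \<open>Edges, leaves and cells of the elementary faces\<close>

lemma contract_edges:
  assumes T: "is_tree T" and e: "e \<in> inner_edges T"
  shows "edges (contract T e) = edges T - {e}" "leaves (contract T e) = leaves T" "root (contract T e) = root T"
proof -
  show E: "edges (contract T e) = edges T - {e}" "root (contract T e) = root T" by (simp_all add: contract_def)
  obtain I where I: "(I, e) \<in> verts T" and er: "e \<in> edges T" using e inner_edge_iff by auto
  have "(\<exists>K. (K, x) \<in> verts (contract T e)) \<longleftrightarrow> (\<exists>K. (K, x) \<in> verts T)" if "x \<noteq> e" for x
  proof
    assume "\<exists>K. (K, x) \<in> verts (contract T e)"
    then show "\<exists>K. (K, x) \<in> verts T" by (auto simp: contract_def) 
  next
    assume "\<exists>K. (K, x) \<in> verts T"
    then obtain K where K: "(K, x) \<in> verts T" by blast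
    show "\<exists>K. (K, x) \<in> verts (contract T e)"
    proof (cases "e \<in> K")
      case True
      then have "(K - {e} \<union> I, x) \<in> {(fst w - {e} \<union> fst v, snd w) | v w.
          v \<in> verts T \<and> w \<in> verts T \<and> snd v = e \<and> e \<in> fst w}"
        using K I by (intro CollectI exI[of _ "(I, e)"] exI[of _ "(K, x)"]) simp
      then show ?thesis by (auto simp: contract_def)
    next
      case False then show ?thesis using K that by (intro exI[of _ K]) (auto simp: contract_def incident_def)
    qed
  qed
  then show "leaves (contract T e) = leaves T" using I er unfolding leaves_iff set_eq_iff E by (metis Diff_iff singleton_iff)
qed

lemma prune_top_edges:
  assumes T: "is_tree T" and v: "(I, e) \<in> verts T" "I \<subseteq> leaves T" and e: "e \<noteq> root T"
  shows "(I, e) \<in> outer_verts T" "edges (prune T (I, e)) = edges T - I"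
    "leaves (prune T (I, e)) = insert e (leaves T - I)" "root (prune T (I, e)) = root T"
proof -
  have ei: "e \<in> inner_edges T" using v(1) e is_treeD(4)[OF T] by (auto simp: inner_edge_iff)
  have inc: "incident (I, e) \<inter> inner_edges T = {e}" using ei v(2) by (auto simp: incident_def inner_edges_def)
  then show "(I, e) \<in> outer_verts T" using v(1) by (simp add: outer_verts_def)
  have eI: "e \<notin> I" using output_notin_inputs[OF T v(1)] .
  have "incident (I, e) - inner_edges T = I" using inc eI by (auto simp: incident_def)
  then show E: "edges (prune T (I, e)) = edges T - I" by (simp add: prune_def)
  have "(K, x) \<in> verts (prune T (I, e)) \<longleftrightarrow> (K, x) \<in> verts T \<and> x \<noteq> e" for K x
    using is_treeD(6)[OF T v(1)] by (auto simp: prune_def)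
  then show "leaves (prune T (I, e)) = insert e (leaves T - I)"
    using is_treeD(4)[OF T v(1)] eI by (intro set_eqI) (auto simp: leaves_iff E)
  show "root (prune T (I, e)) = root T" using e by (simp add: prune_def)
qed

lemma prune_root_edges:
  assumes T: "is_tree T" and v: "({x}, root T) \<in> verts T" and x: "x \<notin> leaves T"
  shows "({x}, root T) \<in> outer_verts T" "edges (prune T ({x}, root T)) = edges T - {root T}"
    "leaves (prune T ({x}, root T)) = leaves T" "root (prune T ({x}, root T)) = x"
proof -
  have xr: "x \<noteq> root T" "x \<in> edges T" using is_treeD(3,5)[OF T v] by auto
  then have inc: "incident ({x}, root T) \<inter> inner_edges T = {x}"
    using x by (auto simp: incident_def inner_edges_def)
  then show "({x}, root T) \<in> outer_verts T" using v by (simp add: outer_verts_def)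
  have "incident ({x}, root T) - inner_edges T = {root T}"
    using xr x by (auto simp: incident_def inner_edges_def)
  then show E: "edges (prune T ({x}, root T)) = edges T - {root T}" by (simp add: prune_def)
  have "(K, y) \<in> verts (prune T ({x}, root T)) \<longleftrightarrow> (K, y) \<in> verts T \<and> y \<noteq> root T" for K y
    using is_treeD(6)[OF T v] by (auto simp: prune_def)
  then show "leaves (prune T ({x}, root T)) = leaves T"
    using v by (intro set_eqI) (auto simp: leaves_iff E)
  show "root (prune T ({x}, root T)) = x" using inc by (simp add: prune_def)
qed

text \<open>Away from the root the output of a vertex is already an inner edge, which leaves no room
  for inner inputs; so an outer vertex is a top vertex or the root vertex.\<close>

lemma faces_cases:
  assumes T: "is_tree T" and d: "d \<in> faces T"
  obtains (inner) e where "d = Inner e" "e \<in> inner_edges T"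
  | (top) I e where "d = Outer (I, e)" "(I, e) \<in> verts T" "I \<subseteq> leaves T" "e \<noteq> root T"
  | (root) I where "d = Outer (I, root T)" "(I, root T) \<in> verts T"
proof -
  consider (a) e where "d = Inner e" "e \<in> inner_edges T" | (b) I e where "d = Outer (I, e)" "(I, e) \<in> outer_verts T"
    using d unfolding faces_def by auto
  then show thesis
  proof cases
    case a then show ?thesis using inner by blast
  next
    case b
    then have v: "(I, e) \<in> verts T" "card (incident (I, e) \<inter> inner_edges T) = 1" by (auto simp: outer_verts_def)
    show ?thesis
    proof (cases "e = root T")
      case True then show ?thesis using root v b(1) by blast
    next
      case False
      then have "e \<in> inner_edges T" using v(1) is_treeD(4)[OF T] by (auto simp: inner_edge_iff)
      then have "incident (I, e) \<inter> inner_edges T = {e}"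
        using v(2) by (auto simp: card_1_singleton_iff incident_def)
      then have "I \<inter> inner_edges T = {}" using output_notin_inputs[OF T v(1)] by (auto simp: incident_def)
      then have "I \<subseteq> leaves T" using is_treeD(3,5)[OF T v(1)] by (auto simp: inner_edges_def)
      then show ?thesis using top b(1) v(1) False by blast
    qed
  qed
qed

context
  fixes S T :: tree
  assumes S: "is_tree S" and T: "is_tree T"
begin

text \<open>A contraction has the leaves of \<open>T\<close>, at which no cell escapes, so only the
  missing edge counts. The same holds for pruning a unary root vertex, while pruning a top vertex
  creates one new leaf, its output.\<close>

lemma hom_contract_iff:
  assumes e: "e \<in> inner_edges T"
  shows "\<alpha> \<in> Hom Omega S (contract T e) \<longleftrightarrow> \<alpha> \<in> Hom Omega S T \<and> e \<notin> fst \<alpha> ` edges S"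
proof -
  have f: "Inner e \<in> faces T" using e by (simp add: faces_def)
  note face_restricts[OF T f] face_map_hom(1)[OF T f]
  then have "\<alpha> \<in> Hom Omega S (contract T e) \<longleftrightarrow> \<alpha> \<in> Hom Omega S T \<and> fst \<alpha> ` edges S \<subseteq> edges T - {e} \<and>
      (\<forall>l\<in>leaves T. \<not> escapes T S (fst \<alpha>) l)"
    using hom_restricts_iff[OF _ T _ S] contract_edges[OF T e] by simp
  then show ?thesis using hom_leaf_not_escapes[OF S T] hom_edge by blast
qed

lemma hom_prune_top_iff:
  assumes v: "(I, e) \<in> verts T" "I \<subseteq> leaves T" and e: "e \<noteq> root T"
  shows "\<alpha> \<in> Hom Omega S (prune T (I, e)) \<longleftrightarrow>
    \<alpha> \<in> Hom Omega S T \<and> I \<inter> fst \<alpha> ` edges S = {} \<and> \<not> escapes T S (fst \<alpha>) e"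
proof -
  note p = prune_top_edges[OF T v e]
  have f: "Outer (I, e) \<in> faces T" using p(1) by (simp add: faces_def)
  note face_restricts[OF T f] face_map_hom(1)[OF T f]
  then have "\<alpha> \<in> Hom Omega S (prune T (I, e)) \<longleftrightarrow> \<alpha> \<in> Hom Omega S T \<and> fst \<alpha> ` edges S \<subseteq> edges T - I \<and>
      (\<forall>l\<in>insert e (leaves T - I). \<not> escapes T S (fst \<alpha>) l)"
    using hom_restricts_iff[OF _ T _ S] p by simp
  then show ?thesis using hom_leaf_not_escapes[OF S T] hom_edge by blast
qed

lemma hom_prune_root_iff:
  assumes v: "({x}, root T) \<in> verts T" and x: "x \<notin> leaves T"
  shows "\<alpha> \<in> Hom Omega S (prune T ({x}, root T)) \<longleftrightarrow> \<alpha> \<in> Hom Omega S T \<and> root T \<notin> fst \<alpha> ` edges S"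
proof -
  note p = prune_root_edges[OF T v x]
  have f: "Outer ({x}, root T) \<in> faces T" using p(1) by (simp add: faces_def)
  note face_restricts[OF T f] face_map_hom(1)[OF T f]
  then have "\<alpha> \<in> Hom Omega S (prune T ({x}, root T)) \<longleftrightarrow> \<alpha> \<in> Hom Omega S T \<and> fst \<alpha> ` edges S \<subseteq> edges T - {root T} \<and>
      (\<forall>l\<in>leaves T. \<not> escapes T S (fst \<alpha>) l)"
    using hom_restricts_iff[OF _ T _ S] p by simp
  then show ?thesis using hom_leaf_not_escapes[OF S T] hom_edge by blast
qed

end

text \<open>A face is recovered from its edges and leaves: its order is induced from
  \<open>W\<close>, every edge that is not a leaf carries a vertex, and the inputs of that vertex
  are the edges next above.\<close>

lemma restricts_tree_eq:
  assumes W: "is_tree W" and U: "is_tree U" "restricts U W" and V: "is_tree V" "restricts V W"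
    and E: "edges U = edges V" and L: "leaves U = leaves V"
  shows "U = V"
proof -
  have ab: "above A x y \<longleftrightarrow> above B x y"
    if "A \<in> {U, V}" "B \<in> {U, V}" "x \<in> edges A" "y \<in> edges A" for A B x y
    using that restricts_above[OF U(1) W U(2)] restricts_above[OF V(1) W V(2)] E by auto
  have *: "I \<subseteq> I'" if AB: "A \<in> {U, V}" "B \<in> {U, V}" and I: "(I, e) \<in> verts A" "(I', e) \<in> verts B" for A B I I' e
  proof
    fix x assume x: "x \<in> I"
    have tr: "is_tree A" "is_tree B" "edges A = edges B" using AB U V E by auto
    have e: "x \<in> edges A" "e \<in> edges A" using is_treeD(3,4)[OF tr(1) I(1)] x by auto
    have "above A x e" "x \<noteq> e" using above_input[OF I(1) x] input_neq[OF tr(1) I(1) x] by auto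
    then have "above B x e" using ab[OF AB e] by simp
    then obtain y where y: "y \<in> I'" "above B x y"
      using \<open>x \<noteq> e\<close> above_upE is_treeD(6)[OF tr(2) I(2)] by metis
    have ey: "y \<in> edges A" using is_treeD(3)[OF tr(2) I(2)] y(1) tr(3) by auto
    have "above A y e" "y \<noteq> e" using above_input[OF I(2) y(1)] input_neq[OF tr(2) I(2) y(1)] ab[OF AB ey e(2)] by auto
    then obtain x' where x': "x' \<in> I" "above A y x'"
      using above_upE is_treeD(6)[OF tr(1) I(1)] by metis
    have "above A x y" using y(2) ab[OF AB e(1) ey] by simp
    then have "x = x'" using inputs_antichain[OF tr(1) I(1) x x'(1) above_refl] x'(2) above_trans by blast
    then show "x \<in> I'" using above_antisym[OF tr(1)] \<open>above A x y\<close> x'(2) y(1) by blast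
  qed
  have "(I, e) \<in> verts B" if AB: "A \<in> {U, V}" "B \<in> {U, V}" and I: "(I, e) \<in> verts A" for A B I e
  proof -
    have "e \<in> edges A" "is_tree A" "edges A = edges B" "leaves A = leaves B" using AB I is_treeD(4) U V E L by auto
    then obtain I' where I': "(I', e) \<in> verts B" using I leaves_iff by blast
    have "I = I'" using *[OF AB I I'] *[OF AB(2,1) I' I] by blast
    then show ?thesis using I' by simp
  qed
  then have "verts U = verts V" by auto
  moreover have "above U (root V) (root U)" "above V (root U) (root V)"
    using above_root[OF U(1)] above_root[OF V(1)] is_treeD(2)[OF U(1)] is_treeD(2)[OF V(1)] E by auto
  then have "root U = root V"
    using ab[of U V "root V" "root U"] is_treeD(2)[OF U(1)] is_treeD(2)[OF V(1)] E above_antisym[OF V(1)] by auto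
  ultimately show ?thesis using E by (cases U, cases V) simp
qed

text \<open>The number of edges plus the number of vertices. Counting edges alone would not do:
  pruning a nullary vertex removes no edge, but turns its output into a leaf.\<close>

definition tree_size :: "tree \<Rightarrow> nat" where
  "tree_size U = card (edges U) + card (edges U - leaves U)"

lemma tree_size_less:
  assumes "is_tree V" "edges U \<subseteq> edges V" "leaves V \<inter> edges U \<subseteq> leaves U"
    and "edges U \<noteq> edges V \<or> leaves U \<noteq> leaves V"
  shows "tree_size U < tree_size V"
proof -
  have fin: "finite (edges V)" "finite (edges V - leaves V)" using is_treeD(1)[OF assms(1)] by auto
  have sub: "edges U - leaves U \<subseteq> edges V - leaves V" using assms(2,3) by auto
  note le = card_mono[OF fin(1) assms(2)] card_mono[OF fin(2) sub]
  show ?thesis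
  proof (cases "edges U = edges V")
    case False
    then have "card (edges U) < card (edges V)" using psubset_card_mono[OF fin(1)] assms(2) by blast
    then show ?thesis using le(2) by (simp add: tree_size_def)
  next
    case True
    have "leaves U \<subseteq> edges U" "leaves V \<subseteq> edges V" by (auto simp: leaves_def)
    then have "edges U - leaves U \<noteq> edges V - leaves V" using assms(4) True by blast
    then have "card (edges U - leaves U) < card (edges V - leaves V)"
      using psubset_card_mono[OF fin(2)] sub by blast
    then show ?thesis using le(1) by (simp add: tree_size_def)
  qed
qed

lemma finite_restricts:
  assumes "is_tree W" shows "finite {U. is_tree U \<and> restricts U W}"
proof (rule finite_surj)
  let ?A = "Pow (edges W) \<times> Pow (Pow (edges W) \<times> edges W) \<times> edges W"
  show "finite ?A" using is_treeD(1)[OF assms] by simp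
  show "{U. is_tree U \<and> restricts U W} \<subseteq> (\<lambda>(E, V, r). \<lparr>edges = E, verts = V, root = r\<rparr>) ` ?A"
  proof
    fix U assume "U \<in> {U. is_tree U \<and> restricts U W}"
    then have U: "is_tree U" "edges U \<subseteq> edges W" by (auto simp: restricts_def)
    then have "(edges U, verts U, root U) \<in> ?A" using is_treeD(2,3,4)[OF U(1)] by fastforce
    then show "U \<in> (\<lambda>(E, V, r). \<lparr>edges = E, verts = V, root = r\<rparr>) ` ?A" by (rule rev_image_eqI) simp
  qed
qed

section \<open>Extension along families of inner horns\<close>

text \<open>Composition in \<open>Omega\<close> does not depend on the middle and the target tree;
  without them a single formula serves cells of different trees.\<close>

definition precomp :: "tree \<Rightarrow> tree_mor \<Rightarrow> tree_mor \<Rightarrow> tree_mor" where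
  "precomp R \<alpha> \<beta> = (compose (edges R) (fst \<alpha>) (fst \<beta>), compose (tree_ops R) (snd \<alpha>) (snd \<beta>))"

lemma Comp_Omega: "Comp Omega R S T \<alpha> \<beta> = precomp R \<alpha> \<beta>"
  by (simp add: Omega_sel precomp_def)

text \<open>A subpresheaf without an ambient representable, so that unions and intersections of hom
  sets into different trees are those of plain sets.\<close>

definition sieve :: "(tree \<Rightarrow> tree_mor set) \<Rightarrow> bool" where
  "sieve A \<longleftrightarrow> (\<forall>R S \<alpha> \<beta>. is_tree R \<longrightarrow> is_tree S \<longrightarrow> \<beta> \<in> Hom Omega R S \<longrightarrow> \<alpha> \<in> A S \<longrightarrow> precomp R \<alpha> \<beta> \<in> A R)"

definition sieve_map :: "(tree \<Rightarrow> tree_mor set) \<Rightarrow> 'x dset \<Rightarrow> (tree \<Rightarrow> tree_mor \<Rightarrow> 'x) \<Rightarrow> bool" where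
  "sieve_map A X u \<longleftrightarrow> (\<forall>S \<alpha>. is_tree S \<longrightarrow> \<alpha> \<in> A S \<longrightarrow> u S \<alpha> \<in> Cell X S) \<and>
     (\<forall>R S \<alpha> \<beta>. is_tree R \<longrightarrow> is_tree S \<longrightarrow> \<beta> \<in> Hom Omega R S \<longrightarrow> \<alpha> \<in> A S \<longrightarrow>
        u R (precomp R \<alpha> \<beta>) = Restr X R S \<beta> (u S \<alpha>))"

abbreviation cells :: "tree \<Rightarrow> tree \<Rightarrow> tree_mor set" where
  "cells T \<equiv> (\<lambda>S. Hom Omega S T)"

lemma sieveD: "sieve A \<Longrightarrow> is_tree R \<Longrightarrow> is_tree S \<Longrightarrow> \<beta> \<in> Hom Omega R S \<Longrightarrow> \<alpha> \<in> A S \<Longrightarrow> precomp R \<alpha> \<beta> \<in> A R"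
  unfolding sieve_def by blast

lemma sieve_mapD:
  assumes "sieve_map A X u"
  shows "is_tree S \<Longrightarrow> \<alpha> \<in> A S \<Longrightarrow> u S \<alpha> \<in> Cell X S"
    and "is_tree R \<Longrightarrow> is_tree S \<Longrightarrow> \<beta> \<in> Hom Omega R S \<Longrightarrow> \<alpha> \<in> A S \<Longrightarrow> u R (precomp R \<alpha> \<beta>) = Restr X R S \<beta> (u S \<alpha>)"
  using assms unfolding sieve_map_def by blast+

lemma sieve_cells: "sieve (cells T)"
  unfolding sieve_def using Omega_comp unfolding Comp_Omega by blast

lemma sieve_Un: "sieve A \<Longrightarrow> sieve B \<Longrightarrow> sieve (\<lambda>S. A S \<union> B S)"
  unfolding sieve_def by blast

lemma sieve_UN: "(\<And>U. U \<in> G \<Longrightarrow> sieve (F U)) \<Longrightarrow> sieve (\<lambda>S. \<Union>U\<in>G. F U S)"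
  unfolding sieve_def by blast

lemma sieve_Int: "sieve A \<Longrightarrow> sieve B \<Longrightarrow> sieve (\<lambda>S. A S \<inter> B S)"
  unfolding sieve_def by blast

lemma sieve_map_subset: "sieve_map A X u \<Longrightarrow> (\<And>S. is_tree S \<Longrightarrow> B S \<subseteq> A S) \<Longrightarrow> sieve_map B X u"
  unfolding sieve_map_def by (meson subsetD)

lemma dendroidal_map_representable: "dendroidal_map (representable Omega T) X u \<longleftrightarrow> sieve_map (cells T) X u"
  unfolding presheaf_map_def sieve_map_def representable_def Omega_sel(1) Comp_Omega
    psh.select_convs mem_Collect_eq Ball_def by (rule conj_cong) blast+

lemma dendroidal_map_horn: "dendroidal_map (horn T d) X u \<longleftrightarrow> sieve_map (Cell (horn T d)) X u"
  unfolding presheaf_map_def sieve_map_def horn_def representable_def Omega_sel(1) Comp_Omega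
    psh.select_convs mem_Collect_eq Ball_def by (rule conj_cong) blast+

lemma dendroidal_mapD:
  assumes "dendroidal_map X Y p"
  shows "is_tree S \<Longrightarrow> x \<in> Cell X S \<Longrightarrow> p S x \<in> Cell Y S"
    and "is_tree R \<Longrightarrow> is_tree S \<Longrightarrow> \<beta> \<in> Hom Omega R S \<Longrightarrow> x \<in> Cell X S \<Longrightarrow> p R (Restr X R S \<beta> x) = Restr Y R S \<beta> (p S x)"
  using assms unfolding presheaf_map_def Omega_sel(1) by blast+

lemma dendroidal_setD:
  assumes "dendroidal_set X"
  shows "is_tree R \<Longrightarrow> is_tree S \<Longrightarrow> \<beta> \<in> Hom Omega R S \<Longrightarrow> x \<in> Cell X S \<Longrightarrow> Restr X R S \<beta> x \<in> Cell X R"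
    and "is_tree S \<Longrightarrow> x \<in> Cell X S \<Longrightarrow> Restr X S S (Id Omega S) x = x"
    and "is_tree Q \<Longrightarrow> is_tree R \<Longrightarrow> is_tree S \<Longrightarrow> \<alpha> \<in> Hom Omega Q R \<Longrightarrow> \<beta> \<in> Hom Omega R S \<Longrightarrow> x \<in> Cell X S \<Longrightarrow>
      Restr X Q S (precomp Q \<beta> \<alpha>) x = Restr X Q R \<alpha> (Restr X R S \<beta> x)"
proof -
  note x = assms[unfolded presheaf_def Omega_sel(1) Comp_Omega]
  show "is_tree R \<Longrightarrow> is_tree S \<Longrightarrow> \<beta> \<in> Hom Omega R S \<Longrightarrow> x \<in> Cell X S \<Longrightarrow> Restr X R S \<beta> x \<in> Cell X R"
    using x by blast
  show "is_tree S \<Longrightarrow> x \<in> Cell X S \<Longrightarrow> Restr X S S (Id Omega S) x = x" using x by blast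
  show "is_tree Q \<Longrightarrow> is_tree R \<Longrightarrow> is_tree S \<Longrightarrow> \<alpha> \<in> Hom Omega Q R \<Longrightarrow> \<beta> \<in> Hom Omega R S \<Longrightarrow> x \<in> Cell X S \<Longrightarrow>
      Restr X Q S (precomp Q \<beta> \<alpha>) x = Restr X Q R \<alpha> (Restr X R S \<beta> x)" using x by blast
qed

text \<open>By \<open>meet\<close>, attaching \<open>U\<close> to \<open>A\<close> is a pushout
  along the inner horn, so a filler on \<open>U\<close> and the map on \<open>A\<close>
  glue.\<close>

lemma extend_along_horn:
  assumes p: "inner_kan_fibration X Y p" and U: "is_tree U" and c: "c \<in> inner_edges U" and A: "sieve A"
    and meet: "\<And>S. is_tree S \<Longrightarrow> A S \<inter> Hom Omega S U = Cell (horn U (Inner c)) S"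
    and u: "sieve_map A X u" and v: "sieve_map (\<lambda>S. A S \<union> Hom Omega S U) Y v"
    and uv: "\<And>S \<alpha>. is_tree S \<Longrightarrow> \<alpha> \<in> A S \<Longrightarrow> p S (u S \<alpha>) = v S \<alpha>"
  obtains u' where "sieve_map (\<lambda>S. A S \<union> Hom Omega S U) X u'" "\<And>S \<alpha>. \<alpha> \<in> A S \<Longrightarrow> u' S \<alpha> = u S \<alpha>"
    "\<And>S \<alpha>. is_tree S \<Longrightarrow> \<alpha> \<in> A S \<union> Hom Omega S U \<Longrightarrow> p S (u' S \<alpha>) = v S \<alpha>"
proof -
  have "right_lifting Omega (horn U (Inner c)) (representable Omega U) (\<lambda>S x. x) X Y p"
    using p U c unfolding inner_kan_fibration_def by blast
  moreover have "dendroidal_map (horn U (Inner c)) X u"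
    unfolding dendroidal_map_horn using sieve_map_subset[OF u] meet by blast
  moreover have "dendroidal_map (representable Omega U) Y v"
    unfolding dendroidal_map_representable by (rule sieve_map_subset[OF v]) blast
  moreover have "\<forall>S\<in>Ob Omega. \<forall>x\<in>Cell (horn U (Inner c)) S. p S (u S x) = v S x"
    using uv meet unfolding Omega_sel(1) by blast
  ultimately obtain h where h: "dendroidal_map (representable Omega U) X h"
    "\<forall>S\<in>Ob Omega. \<forall>x\<in>Cell (representable Omega U) S. p S (h S x) = v S x"
    "\<forall>S\<in>Ob Omega. \<forall>x\<in>Cell (horn U (Inner c)) S. h S x = u S x"
    unfolding right_lifting_def by blast
  have hm: "sieve_map (cells U) X h" using h(1) by (simp add: dendroidal_map_representable)
  have hu: "h S \<alpha> = u S \<alpha>" if "is_tree S" "\<alpha> \<in> A S" "\<alpha> \<in> Hom Omega S U" for S \<alpha>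
    using h(3) meet[OF that(1)] that unfolding Omega_sel(1) by blast
  \<comment> \<open>On the overlap, which is the horn, the two clauses agree by
    \<open>hu\<close>.\<close>
  define u' where "u' S \<alpha> = (if \<alpha> \<in> A S then u S \<alpha> else h S \<alpha>)" for S \<alpha>
  show thesis
  proof (rule that[of u'])
    show "sieve_map (\<lambda>S. A S \<union> Hom Omega S U) X u'"
      unfolding sieve_map_def
    proof (intro conjI allI impI)
      fix S \<alpha> assume "is_tree S" "\<alpha> \<in> A S \<union> Hom Omega S U"
      then show "u' S \<alpha> \<in> Cell X S"
        using sieve_mapD(1)[OF u, of S \<alpha>] sieve_mapD(1)[OF hm, of S \<alpha>] by (auto simp: u'_def)
    next
      fix R S \<alpha> \<beta> assume RS: "is_tree R" "is_tree S" and \<beta>: "\<beta> \<in> Hom Omega R S" and \<alpha>: "\<alpha> \<in> A S \<union> Hom Omega S U"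
      show "u' R (precomp R \<alpha> \<beta>) = Restr X R S \<beta> (u' S \<alpha>)"
      proof (cases "\<alpha> \<in> A S")
        case True
        then show ?thesis using sieveD[OF A RS \<beta> True] sieve_mapD(2)[OF u RS \<beta> True] by (simp add: u'_def)
      next
        case False
        then have a: "\<alpha> \<in> Hom Omega S U" using \<alpha> by blast
        have "u' R (precomp R \<alpha> \<beta>) = h R (precomp R \<alpha> \<beta>)"
          using hu[OF RS(1), of "precomp R \<alpha> \<beta>"] sieveD[OF sieve_cells RS \<beta> a] by (auto simp: u'_def)
        then show ?thesis using sieve_mapD(2)[OF hm RS \<beta> a] False by (simp add: u'_def)
      qed
    qed
    show "u' S \<alpha> = u S \<alpha>" if "\<alpha> \<in> A S" for S \<alpha> using that by (simp add: u'_def)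
    show "p S (u' S \<alpha>) = v S \<alpha>" if "is_tree S" "\<alpha> \<in> A S \<union> Hom Omega S U" for S \<alpha>
      using that uv[of S \<alpha>] h(2) by (auto simp: u'_def Omega_sel(1) representable_def)
  qed
qed

text \<open>A member is attached after all those of smaller measure; then the part already present
  meets it exactly in its inner horn. \<open>faces\<close> puts the horn into that part,
  \<open>base\<close> and \<open>meet\<close> exclude anything more. \<open>Inner (c U)\<close> is
  exempt from \<open>faces\<close>, since it is created together with \<open>U\<close>.\<close>

theorem extend_along_faces:
  fixes m :: "tree \<Rightarrow> nat"
  assumes p: "inner_kan_fibration X Y p" and A: "sieve A" and G: "finite G"
    and tr: "\<And>U. U \<in> G \<Longrightarrow> is_tree U \<and> c U \<in> inner_edges U"
    and faces: "\<And>U d. U \<in> G \<Longrightarrow> d \<in> faces U - {Inner (c U)} \<Longrightarrow>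
      (\<forall>S. is_tree S \<longrightarrow> Hom Omega S (face_tree U d) \<subseteq> A S) \<or>
      (\<exists>V\<in>G. m V < m U \<and> (\<forall>S. is_tree S \<longrightarrow> Hom Omega S (face_tree U d) \<subseteq> Hom Omega S V))"
    and base: "\<And>U S \<alpha>. U \<in> G \<Longrightarrow> is_tree S \<Longrightarrow> \<alpha> \<in> A S \<Longrightarrow> \<alpha> \<in> Hom Omega S U \<Longrightarrow> \<alpha> \<in> Cell (horn U (Inner (c U))) S"
    and meet: "\<And>U V S \<alpha>. U \<in> G \<Longrightarrow> V \<in> G \<Longrightarrow> U \<noteq> V \<Longrightarrow> m V \<le> m U \<Longrightarrow> is_tree S \<Longrightarrow>
      \<alpha> \<in> Hom Omega S U \<Longrightarrow> \<alpha> \<in> Hom Omega S V \<Longrightarrow> \<alpha> \<in> Cell (horn U (Inner (c U))) S"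
    and u: "sieve_map A X u" and v: "sieve_map (\<lambda>S. A S \<union> (\<Union>U\<in>G. Hom Omega S U)) Y v"
    and uv: "\<And>S \<alpha>. is_tree S \<Longrightarrow> \<alpha> \<in> A S \<Longrightarrow> p S (u S \<alpha>) = v S \<alpha>"
  shows "\<exists>u'. sieve_map (\<lambda>S. A S \<union> (\<Union>U\<in>G. Hom Omega S U)) X u' \<and> (\<forall>S. \<forall>\<alpha>\<in>A S. u' S \<alpha> = u S \<alpha>) \<and>
    (\<forall>S. is_tree S \<longrightarrow> (\<forall>\<alpha>\<in>A S \<union> (\<Union>U\<in>G. Hom Omega S U). p S (u' S \<alpha>) = v S \<alpha>))"
  using G tr faces base meet v
proof (induction "card G" arbitrary: G)
  case 0
  then have "G = {}" by simp
  then show ?case using u uv by (intro exI[of _ u]) simp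
next
  case (Suc n)
  note G = Suc(3) and tr = Suc(4) and faces = Suc(5) and base = Suc(6) and meet = Suc(7) and v = Suc(8)
  \<comment> \<open>A member of greatest measure is attached last; the induction hypothesis handles
    the others.\<close>
  have "G \<noteq> {}" using Suc(2) by auto
  then have "Max (m ` G) \<in> m ` G" using G by (intro Max_in) auto
  then obtain U where "U \<in> G" "m U = Max (m ` G)" by auto
  then have U: "U \<in> G" "\<And>V. V \<in> G \<Longrightarrow> m V \<le> m U" using G by auto
  let ?G = "G - {U}"
  let ?A = "\<lambda>S. A S \<union> (\<Union>V\<in>?G. Hom Omega S V)"
  have "\<exists>u'. sieve_map ?A X u' \<and> (\<forall>S. \<forall>\<alpha>\<in>A S. u' S \<alpha> = u S \<alpha>) \<and>
      (\<forall>S. is_tree S \<longrightarrow> (\<forall>\<alpha>\<in>?A S. p S (u' S \<alpha>) = v S \<alpha>))"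
  proof (rule Suc(1))
    show "n = card ?G" using Suc(2) U(1) G by simp
    show "finite ?G" using G by simp
    show "\<And>V. V \<in> ?G \<Longrightarrow> is_tree V \<and> c V \<in> inner_edges V" using tr by blast
    show "(\<forall>S. is_tree S \<longrightarrow> Hom Omega S (face_tree V d) \<subseteq> A S) \<or>
        (\<exists>V'\<in>?G. m V' < m V \<and> (\<forall>S. is_tree S \<longrightarrow> Hom Omega S (face_tree V d) \<subseteq> Hom Omega S V'))"
      if "V \<in> ?G" "d \<in> faces V - {Inner (c V)}" for V d
      proof -
      have "V \<in> G" "m V \<le> m U" using that(1) U(2) by auto
      \<comment> \<open>The smaller member cannot be \<open>U\<close>, whose measure is
        maximal.\<close>
      then show ?thesis using faces[OF \<open>V \<in> G\<close> that(2)] by (metis DiffI leD singletonD)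
    qed
    show "\<alpha> \<in> Cell (horn V (Inner (c V))) S" if "V \<in> ?G" "is_tree S" "\<alpha> \<in> A S" "\<alpha> \<in> Hom Omega S V" for V S \<alpha>
      by (rule base[OF _ that(2-4)]) (use that(1) in simp)
    show "\<alpha> \<in> Cell (horn V (Inner (c V))) S"
      if "V \<in> ?G" "V' \<in> ?G" "V \<noteq> V'" "m V' \<le> m V" "is_tree S" "\<alpha> \<in> Hom Omega S V" "\<alpha> \<in> Hom Omega S V'" for V V' S \<alpha>
      by (rule meet[OF _ _ that(3-7)]) (use that(1,2) in simp_all)
    show "sieve_map ?A Y v" by (rule sieve_map_subset[OF v]) blast
  qed
  then obtain u' where u': "sieve_map ?A X u'" and u'1: "\<forall>S. \<forall>\<alpha>\<in>A S. u' S \<alpha> = u S \<alpha>"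
    and u'2: "\<forall>S. is_tree S \<longrightarrow> (\<forall>\<alpha>\<in>?A S. p S (u' S \<alpha>) = v S \<alpha>)" by (elim exE conjE)
  have eq: "A S \<union> (\<Union>V\<in>G. Hom Omega S V) = ?A S \<union> Hom Omega S U" for S using U(1) by blast
  have mt: "?A S \<inter> Hom Omega S U = Cell (horn U (Inner (c U))) S" if S: "is_tree S" for S
  proof (intro equalityI subsetI)
    fix \<alpha> assume "\<alpha> \<in> ?A S \<inter> Hom Omega S U"
    then consider "\<alpha> \<in> A S" "\<alpha> \<in> Hom Omega S U"
      | V where "V \<in> G" "U \<noteq> V" "\<alpha> \<in> Hom Omega S V" "\<alpha> \<in> Hom Omega S U" by blast
    then show "\<alpha> \<in> Cell (horn U (Inner (c U))) S"
    proof cases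
      case 1 then show ?thesis by (rule base[OF U(1) S])
    next
      case (2 V) show ?thesis by (rule meet[OF U(1) 2(1,2) U(2)[OF 2(1)] S 2(4,3)])
    qed
  next
    fix \<alpha> assume "\<alpha> \<in> Cell (horn U (Inner (c U))) S"
    then obtain d where d: "d \<in> faces U - {Inner (c U)}" "\<alpha> \<in> Hom Omega S (face_tree U d)"
      using horn_cell_iff[OF conjunct1[OF tr[OF U(1)]] S] by blast
    have "d \<in> faces U" "is_tree U" using d(1) tr[OF U(1)] by auto
    then have "\<alpha> \<in> Hom Omega S U" using restricts_hom[OF S face_restricts] d(2) by blast
    moreover have "\<alpha> \<in> ?A S" using faces[OF U(1) d(1)]
    proof
      assume "\<forall>S. is_tree S \<longrightarrow> Hom Omega S (face_tree U d) \<subseteq> A S"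
      then show ?thesis using d(2) S by blast
    next
      assume "\<exists>V\<in>G. m V < m U \<and> (\<forall>S. is_tree S \<longrightarrow> Hom Omega S (face_tree U d) \<subseteq> Hom Omega S V)"
      then obtain V where V: "V \<in> G" "m V < m U" "\<alpha> \<in> Hom Omega S V" using d(2) S by blast
      then have "V \<in> ?G" by auto
      then show ?thesis using V(3) by blast
    qed
    ultimately show "\<alpha> \<in> ?A S \<inter> Hom Omega S U" by blast
  qed
  have sv: "sieve ?A" by (intro sieve_Un sieve_UN A sieve_cells)
  have vU: "sieve_map (\<lambda>S. ?A S \<union> Hom Omega S U) Y v" using v unfolding eq .
  obtain u'' where u'': "sieve_map (\<lambda>S. ?A S \<union> Hom Omega S U) X u''" "\<And>S \<alpha>. \<alpha> \<in> ?A S \<Longrightarrow> u'' S \<alpha> = u' S \<alpha>"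
    "\<And>S \<alpha>. is_tree S \<Longrightarrow> \<alpha> \<in> ?A S \<union> Hom Omega S U \<Longrightarrow> p S (u'' S \<alpha>) = v S \<alpha>"
  proof (rule extend_along_horn[OF p conjunct1[OF tr[OF U(1)]] conjunct2[OF tr[OF U(1)]] sv mt u' vU])
    show "p S (u' S \<alpha>) = v S \<alpha>" if "is_tree S" "\<alpha> \<in> ?A S" for S \<alpha> using u'2 that by simp
  qed (assumption, rule that)
  show ?case unfolding eq
  proof (intro exI[of _ u''] conjI allI ballI impI)
    show "sieve_map (\<lambda>S. ?A S \<union> Hom Omega S U) X u''" by (rule u''(1))
    show "u'' S \<alpha> = u S \<alpha>" if "\<alpha> \<in> A S" for S \<alpha>
      using u''(2)[of \<alpha> S] u'1 that by simp
    show "p S (u'' S \<alpha>) = v S \<alpha>" if "is_tree S" "\<alpha> \<in> ?A S \<union> Hom Omega S U" for S \<alpha>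
      by (rule u''(3)[OF that])
  qed
qed

section \<open>Horns in the underlying simplicial set\<close>

lemma fst_edge_mor [simp]: "e \<in> edges S \<Longrightarrow> fst (edge_mor S f) e = f e"
  by (simp add: edge_mor_def)

lemma edge_mor_cong:
  assumes "is_tree S" "\<And>e. e \<in> edges S \<Longrightarrow> f e = g e" shows "edge_mor S f = edge_mor S g"
proof -
  have "map f (fst p) = map g (fst p) \<and> f (snd p) = g (snd p)" if "p \<in> tree_ops S" for p
    using tree_ops_colours[OF assms(1) that] assms(2) by auto
  then show ?thesis unfolding edge_mor_def using assms(2) by (auto intro!: restrict_ext)
qed

lemma edge_mor_id: "edge_mor S (\<lambda>e. e) = Id Omega S"
  by (simp add: edge_mor_def Omega_sel)

lemma precomp_edge_mor:
  assumes R: "is_tree R" and \<beta>: "\<beta> \<in> Hom Omega R S"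
  shows "precomp R (edge_mor S g) \<beta> = edge_mor R (\<lambda>e. g (fst \<beta> e))"
proof (rule prod_eqI)
  show "fst (precomp R (edge_mor S g) \<beta>) = fst (edge_mor R (\<lambda>e. g (fst \<beta> e)))"
    using hom_edge[OF \<beta>] by (auto simp: precomp_def edge_mor_def compose_def)
  have "snd \<beta> p = (map (fst \<beta>) (fst p), fst \<beta> (snd p))" if "p \<in> tree_ops R" for p
    using arg_cong[OF hom_eq_edge_mor[OF \<beta>], of snd] that by (simp add: edge_mor_def)
  moreover have "snd \<beta> p \<in> tree_ops S" if "p \<in> tree_ops R" for p
    using Omega_hom_fun(2)[OF \<beta>] that by blast
  ultimately show "snd (precomp R (edge_mor S g) \<beta>) = snd (edge_mor R (\<lambda>e. g (fst \<beta> e)))"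
    by (auto simp: precomp_def edge_mor_def compose_def intro!: restrict_ext)
qed

lemma fst_precomp: "e \<in> edges R \<Longrightarrow> fst (precomp R \<alpha> \<beta>) e = fst \<alpha> (fst \<beta> e)"
  by (simp add: precomp_def compose_def)

lemma linear_tree_sel [simp]: "edges (linear_tree n) = {..n}" "root (linear_tree n) = n"
  by (simp_all add: linear_tree_def)

lemma linear_tree_verts: "(I, e) \<in> verts (linear_tree n) \<longleftrightarrow> (\<exists>k<n. I = {k} \<and> e = Suc k)"
  by (auto simp: linear_tree_def)

lemma linear_tree_leaves: "leaves (linear_tree n) = {0}"
proof (rule set_eqI)
  fix e show "e \<in> leaves (linear_tree n) \<longleftrightarrow> e \<in> {0}"
    by (cases e) (auto simp: leaves_iff linear_tree_verts)
qed

lemma linear_tree_inner: "e \<in> inner_edges (linear_tree n) \<longleftrightarrow> 0 < e \<and> e < n"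
  by (auto simp: inner_edges_def linear_tree_leaves)

section \<open>Simplicial operators and inner horns of linear trees\<close>

definition mono_map :: "nat \<Rightarrow> nat \<Rightarrow> (nat \<Rightarrow> nat) \<Rightarrow> bool" where
  "mono_map m n f \<longleftrightarrow> (\<forall>i\<le>m. f i \<le> n) \<and> (\<forall>i j. i \<le> j \<longrightarrow> j \<le> m \<longrightarrow> f i \<le> f j)"

lemma mono_map_hom: "mono_map m n f \<Longrightarrow> edge_mor (linear_tree m) f \<in> Hom Omega (linear_tree m) (linear_tree n)"
proof (rule edge_mor_hom[OF is_tree_linear is_tree_linear])
  fix es e assume f: "mono_map m n f" and v: "(set es, e) \<in> verts (linear_tree m)" "distinct es"
  then obtain k where k: "k < m" "set es = {k}" "e = Suc k" by (auto simp: linear_tree_verts)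
  have "length es = 1" using distinct_card[OF v(2)] k by simp
  then have "es = [k]" using k by (cases es) auto
  then show "(map f es, f e) \<in> tree_ops (linear_tree n)"
    using f k linear_ops[of "f (Suc k)" n "f k"] by (simp add: mono_map_def)
qed (simp add: mono_map_def)

definition along :: "'x dset \<Rightarrow> nat \<Rightarrow> nat \<Rightarrow> (nat \<Rightarrow> nat) \<Rightarrow> 'x \<Rightarrow> 'x" where
  "along X m n f x = Restr X (linear_tree m) (linear_tree n) (edge_mor (linear_tree m) f) x"

text \<open>Here \<open>g\<close> is any function on edges and need not be a morphism of trees;
  \<open>\<pi>\<close> below yields a morphism only on certain cells.\<close>

definition push :: "tree \<Rightarrow> (nat \<Rightarrow> nat) \<Rightarrow> tree_mor \<Rightarrow> tree_mor" where
  "push S g \<alpha> = edge_mor S (\<lambda>e. g (fst \<alpha> e))"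

lemma push_push: "is_tree S \<Longrightarrow> push S g (push S f \<alpha>) = push S (\<lambda>i. g (f i)) \<alpha>"
  unfolding push_def by (rule edge_mor_cong) auto

lemma push_cong: "is_tree S \<Longrightarrow> (\<And>e. e \<in> edges S \<Longrightarrow> f (fst \<alpha> e) = g (fst \<alpha> e)) \<Longrightarrow> push S f \<alpha> = push S g \<alpha>"
  unfolding push_def by (rule edge_mor_cong) auto

lemma push_id: "\<alpha> \<in> Hom Omega S T \<Longrightarrow> push S (\<lambda>e. e) \<alpha> = \<alpha>"
  unfolding push_def using hom_eq_edge_mor by metis

lemma push_precomp:
  assumes "is_tree R" "\<beta> \<in> Hom Omega R S"
  shows "push R g (precomp R \<alpha> \<beta>) = precomp R (push S g \<alpha>) \<beta>"
  unfolding push_def precomp_edge_mor[OF assms] by (rule edge_mor_cong[OF assms(1)]) (simp add: fst_precomp)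

lemma push_hom:
  assumes "is_tree S" "\<alpha> \<in> Hom Omega S (linear_tree m)" "mono_map m n g"
  shows "push S g \<alpha> \<in> Hom Omega S (linear_tree n)"
  using Omega_comp[OF assms(1,2) mono_map_hom[OF assms(3)]]
  unfolding Comp_Omega precomp_edge_mor[OF assms(1,2)] push_def .

lemma along_cong: "(\<And>i. i \<le> m \<Longrightarrow> f i = g i) \<Longrightarrow> along X m n f x = along X m n g x"
  unfolding along_def using edge_mor_cong[OF is_tree_linear, of m f g] by simp

context
  fixes X :: "'x dset"
  assumes X: "dendroidal_set X"
begin

lemma along_cell: "mono_map m n f \<Longrightarrow> x \<in> Cell X (linear_tree n) \<Longrightarrow> along X m n f x \<in> Cell X (linear_tree m)"
  unfolding along_def by (rule dendroidal_setD(1)[OF X is_tree_linear is_tree_linear mono_map_hom])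

lemma along_along:
  assumes "mono_map k m f" "mono_map m n g" "x \<in> Cell X (linear_tree n)"
  shows "along X k m f (along X m n g x) = along X k n (\<lambda>i. g (f i)) x"
proof -
  note l = is_tree_linear
  have "precomp (linear_tree k) (edge_mor (linear_tree m) g) (edge_mor (linear_tree k) f) =
      edge_mor (linear_tree k) (\<lambda>i. g (f i))"
    unfolding precomp_edge_mor[OF l mono_map_hom[OF assms(1)]] by (rule edge_mor_cong[OF l]) simp
  then show ?thesis
    unfolding along_def using dendroidal_setD(3)[OF X l l l mono_map_hom[OF assms(1)] mono_map_hom[OF assms(2)] assms(3)]
    by simp
qed

lemma along_id: "x \<in> Cell X (linear_tree n) \<Longrightarrow> along X n n (\<lambda>i. i) x = x"
  unfolding along_def edge_mor_id by (rule dendroidal_setD(2)[OF X is_tree_linear])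

lemma restr_push:
  assumes "is_tree S" "\<alpha> \<in> Hom Omega S (linear_tree m)" "mono_map m n g" "x \<in> Cell X (linear_tree n)"
  shows "Restr X S (linear_tree n) (push S g \<alpha>) x = Restr X S (linear_tree m) \<alpha> (along X m n g x)"
  unfolding along_def push_def
  using dendroidal_setD(3)[OF X assms(1) is_tree_linear is_tree_linear assms(2) mono_map_hom[OF assms(3)] assms(4)]
  unfolding precomp_edge_mor[OF assms(1,2)] .

end

definition skip :: "nat \<Rightarrow> nat \<Rightarrow> nat" where
  "skip i j = (if j < i then j else Suc j)"

text \<open>A left inverse of \<open>skip i\<close>, meant for cells missing \<open>i\<close>. It is
  the codegeneracy identifying \<open>i - 1\<close> with \<open>i\<close>; for \<open>i = 0\<close>,
  truncated subtraction gives the one identifying 0 with 1.\<close>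

definition squeeze :: "nat \<Rightarrow> nat \<Rightarrow> nat" where
  "squeeze i j = (if j < i then j else j - 1)"

lemma mono_skip: "mono_map n (Suc n) (skip i)"
  by (auto simp: mono_map_def skip_def)

lemma mono_squeeze: "i \<le> Suc n \<Longrightarrow> mono_map (Suc n) n (squeeze i)"
  by (auto simp: mono_map_def squeeze_def)

lemma skip_squeeze: "j \<noteq> i \<Longrightarrow> skip i (squeeze i j) = j"
  by (auto simp: skip_def squeeze_def)

lemma squeeze_skip: "squeeze i (skip i j) = j"
  by (auto simp: skip_def squeeze_def)

lemma squeeze_squeeze:
  assumes "i < j" "t \<noteq> i" "t \<noteq> j"
  shows "skip (j - 1) (squeeze (j - 1) (squeeze i t)) = squeeze i t"
    and "skip i (squeeze i (squeeze j t)) = squeeze j t"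
    and "squeeze (j - 1) (squeeze i t) = squeeze i (squeeze j t)"
  using assms unfolding skip_def squeeze_def by presburger+

text \<open>Every elementary face of a linear tree omits one edge, the two outer faces included;
  this yields the usual description of a simplicial horn.\<close>

lemma linear_horn_iff:
  assumes n: "n \<ge> 2" and k: "0 < k" "k < n" and S: "is_tree S" and \<alpha>: "\<alpha> \<in> Hom Omega S (linear_tree n)"
  shows "\<alpha> \<in> Cell (horn (linear_tree n) (Inner k)) S \<longleftrightarrow> (\<exists>i\<le>n. i \<noteq> k \<and> i \<notin> fst \<alpha> ` edges S)" (is "?L \<longleftrightarrow> ?R")
proof
  let ?T = "linear_tree n"
  note T = is_tree_linear[of n]
  have rv: "({n - 1}, root ?T) \<in> verts ?T" "n - 1 \<notin> leaves ?T"
    using n by (auto simp: linear_tree_verts linear_tree_leaves)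
  have tv: "({0}, 1) \<in> verts ?T" "{0} \<subseteq> leaves ?T" "1 \<noteq> root ?T"
    using n by (auto simp: linear_tree_verts linear_tree_leaves)
  {
    assume ?L
    then obtain d where d: "d \<in> faces ?T" "d \<noteq> Inner k" "\<alpha> \<in> Hom Omega S (face_tree ?T d)"
      using horn_cell_iff[OF T S] by blast
    show ?R using T d(1)
    proof (cases rule: faces_cases)
      case (inner e)
      then have "\<alpha> \<in> Hom Omega S (contract ?T e)" using d(3) by simp
      then have "e \<notin> fst \<alpha> ` edges S" using hom_contract_iff[OF S T inner(2)] by blast
      then show ?thesis using inner d(2) by (intro exI[of _ e]) (auto simp: linear_tree_inner)
    next
      case (top I e)
      then have I: "I = {0}" by (auto simp: linear_tree_verts linear_tree_leaves)
      have "\<alpha> \<in> Hom Omega S (prune ?T (I, e))" using d(3) top(1) by simp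
      then have "0 \<notin> fst \<alpha> ` edges S" using hom_prune_top_iff[OF S T top(2-4)] I by blast
      then show ?thesis using k by (intro exI[of _ 0]) auto
    next
      case (root I)
      then have I: "I = {n - 1}" by (auto simp: linear_tree_verts)
      have "\<alpha> \<in> Hom Omega S (prune ?T ({n - 1}, root ?T))" using d(3) root(1) I by simp
      then have "n \<notin> fst \<alpha> ` edges S" using hom_prune_root_iff[OF S T rv] by simp
      then show ?thesis using k by (intro exI[of _ n]) auto
    qed
  }
  assume ?R
  then obtain i where i: "i \<le> n" "i \<noteq> k" "i \<notin> fst \<alpha> ` edges S" by blast
  have "\<exists>d\<in>faces ?T - {Inner k}. \<alpha> \<in> Hom Omega S (face_tree ?T d)"
  proof -
    consider "i = 0" | "i = n" | "0 < i" "i < n" using i(1) by linarith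
    then show ?thesis
    proof cases
      case 1
      \<comment> \<open>The only leaf is 0. An operation with output below 1 has an input below 0,
        and an input below 0 but different from 0 is below 1.\<close>
      have "\<not> escapes ?T S (fst \<alpha>) 1"
      proof
        assume "escapes ?T S (fst \<alpha>) 1"
        then obtain J z where v: "(J, z) \<in> verts S" "above ?T 1 (fst \<alpha> z)" "\<forall>j\<in>J. \<not> above ?T 1 (fst \<alpha> j)"
          by (auto simp: escapes_def)
        have "above ?T 0 (fst \<alpha> z)" using above_input[OF tv(1), of 0] v(2) above_trans by blast
        then obtain j where j: "j \<in> J" "above ?T 0 (fst \<alpha> j)"
          using hom_vertex(3)[OF S T \<alpha> v(1)] by (auto simp: linear_tree_leaves)
        have "j \<in> edges S" using is_treeD(3)[OF S v(1)] j(1) by blast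
        then have "0 \<noteq> fst \<alpha> j" using i(3) 1 by auto
        then have "above ?T 1 (fst \<alpha> j)" using above_below_input[OF T tv(1) _ j(2)] by simp
        then show False using v(3) j(1) by blast
      qed
      then have "\<alpha> \<in> Hom Omega S (prune ?T ({0}, 1))" using hom_prune_top_iff[OF S T tv] \<alpha> i(3) 1 by blast
      then show ?thesis using prune_top_edges(1)[OF T tv] by (intro bexI[of _ "Outer ({0}, 1)"]) (auto simp: faces_def)
    next
      case 2
      then have "\<alpha> \<in> Hom Omega S (prune ?T ({n - 1}, root ?T))" using hom_prune_root_iff[OF S T rv] \<alpha> i(3) by simp
      then show ?thesis using prune_root_edges(1)[OF T rv]
        by (intro bexI[of _ "Outer ({n - 1}, root ?T)"]) (auto simp: faces_def)
    next
      case 3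
      then have "i \<in> inner_edges ?T" by (simp add: linear_tree_inner)
      then show ?thesis using hom_contract_iff[OF S T] \<alpha> i by (intro bexI[of _ "Inner i"]) (auto simp: faces_def)
    qed
  qed
  then show ?L using horn_cell_iff[OF T S] by blast
qed

text \<open>The faces \<open>x i\<close> are assembled into a map on the horn. A cell missing both
  \<open>i\<close> and \<open>j\<close> factors through the common face, where \<open>compat\<close>
  makes the two values agree.\<close>

theorem linear_horn_filler:
  fixes X :: "'x dset"
  assumes X: "infinity_operad X" and n: "n = Suc (Suc m)" and k: "0 < k" "k < n"
    and x: "\<And>i. i \<le> n \<Longrightarrow> i \<noteq> k \<Longrightarrow> x i \<in> Cell X (linear_tree (Suc m))"
    and compat: "\<And>i j. i < j \<Longrightarrow> j \<le> n \<Longrightarrow> i \<noteq> k \<Longrightarrow> j \<noteq> k \<Longrightarrow>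
      along X m (Suc m) (skip i) (x j) = along X m (Suc m) (skip (j - 1)) (x i)"
  obtains y where "y \<in> Cell X (linear_tree n)" "\<And>i. i \<le> n \<Longrightarrow> i \<noteq> k \<Longrightarrow> along X (Suc m) n (skip i) y = x i"
proof -
  have D: "dendroidal_set X" and K: "inner_kan_fibration X terminal_psh (\<lambda>S x. ())"
    using X by (auto simp: infinity_operad_def)
  let ?T = "linear_tree n" and ?R = "linear_tree (Suc m)"
  note T = is_tree_linear[of n]
  have n2: "n \<ge> 2" using n by simp
  \<comment> \<open>The value at a cell missing \<open>i\<close>, which \<open>squeeze i\<close>
    regards as a cell of the \<open>i\<close>-th face.\<close>
  define val where "val S \<alpha> i = Restr X S ?R (push S (squeeze i) \<alpha>) (x i)" for S \<alpha> i
  have sq: "mono_map n (Suc m) (squeeze i)" if "i \<le> n" for i using mono_squeeze[of i "Suc m"] that n by simp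
  have indep: "val S \<alpha> i = val S \<alpha> j"
    if S: "is_tree S" and \<alpha>: "\<alpha> \<in> Hom Omega S ?T" and ij: "i < j" "j \<le> n" "i \<noteq> k" "j \<noteq> k"
      "i \<notin> fst \<alpha> ` edges S" "j \<notin> fst \<alpha> ` edges S" for S \<alpha> i j
  proof -
    have i: "i \<le> n" using ij by simp
    note pi = push_hom[OF S \<alpha> sq[OF i]] and pj = push_hom[OF S \<alpha> sq[OF ij(2)]]
    have sj: "mono_map (Suc m) m (squeeze (j - 1))" "mono_map (Suc m) m (squeeze i)"
      using ij n by (auto intro!: mono_squeeze)
    have a: "push S (squeeze i) \<alpha> = push S (skip (j - 1)) (push S (squeeze (j - 1)) (push S (squeeze i) \<alpha>))"
      unfolding push_push[OF S]
      by (rule push_cong[OF S]) (rule squeeze_squeeze(1)[OF ij(1), symmetric]; use ij(5,6) in blast)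
    have b: "push S (squeeze j) \<alpha> = push S (skip i) (push S (squeeze i) (push S (squeeze j) \<alpha>))"
      unfolding push_push[OF S]
      by (rule push_cong[OF S]) (rule squeeze_squeeze(2)[OF ij(1), symmetric]; use ij(5,6) in blast)
    have c: "push S (squeeze (j - 1)) (push S (squeeze i) \<alpha>) = push S (squeeze i) (push S (squeeze j) \<alpha>)"
      unfolding push_push[OF S]
      by (rule push_cong[OF S]) (rule squeeze_squeeze(3)[OF ij(1)]; use ij(5,6) in blast)
    have "val S \<alpha> i = Restr X S (linear_tree m) (push S (squeeze (j - 1)) (push S (squeeze i) \<alpha>))
        (along X m (Suc m) (skip (j - 1)) (x i))"
      unfolding val_def
      by (subst a, rule restr_push[OF D S push_hom[OF S pi sj(1)] mono_skip x[OF i ij(3)]])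
    moreover have "val S \<alpha> j = Restr X S (linear_tree m) (push S (squeeze i) (push S (squeeze j) \<alpha>))
        (along X m (Suc m) (skip i) (x j))"
      unfolding val_def
      by (subst b, rule restr_push[OF D S push_hom[OF S pj sj(2)] mono_skip x[OF ij(2,4)]])
    ultimately show ?thesis using c compat[OF ij(1-4)] by simp
  qed
  \<comment> \<open>\<open>LEAST\<close> only selects one missing vertex; by \<open>indep\<close>
    any other gives the same value.\<close>
  define u where "u S \<alpha> = val S \<alpha> (LEAST i. i \<le> n \<and> i \<noteq> k \<and> i \<notin> fst \<alpha> ` edges S)" for S \<alpha>
  have u: "u S \<alpha> = val S \<alpha> i" if S: "is_tree S" "\<alpha> \<in> Hom Omega S ?T" and i: "i \<le> n" "i \<noteq> k" "i \<notin> fst \<alpha> ` edges S" for S \<alpha> i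
  proof -
    let ?P = "\<lambda>i. i \<le> n \<and> i \<noteq> k \<and> i \<notin> fst \<alpha> ` edges S"
    have "?P (LEAST i. ?P i)" using LeastI[of ?P i] i by blast
    moreover have "(LEAST i. ?P i) \<le> i" using Least_le[of ?P i] i by blast
    ultimately show ?thesis unfolding u_def using indep[OF S, of "LEAST i. ?P i" i] i by (cases "(LEAST i. ?P i) = i") auto
  qed
  let ?H = "horn ?T (Inner k)"
  have hh: "\<alpha> \<in> Hom Omega S ?T \<and> (\<exists>i\<le>n. i \<noteq> k \<and> i \<notin> fst \<alpha> ` edges S)" if "is_tree S" "\<alpha> \<in> Cell ?H S" for S \<alpha>
  proof -
    have "\<alpha> \<in> Hom Omega S ?T"
      using horn_subpresheaf(2)[OF T] that unfolding presheaf_map_def representable_def Omega_sel(1) by auto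
    then show ?thesis using linear_horn_iff[OF n2 k that(1)] that(2) by blast
  qed
  have um: "dendroidal_map ?H X u"
    unfolding dendroidal_map_horn sieve_map_def
  proof (intro conjI allI impI)
    fix S \<alpha> assume S: "is_tree S" and \<alpha>: "\<alpha> \<in> Cell ?H S"
    then obtain i where i: "i \<le> n" "i \<noteq> k" "i \<notin> fst \<alpha> ` edges S" and h: "\<alpha> \<in> Hom Omega S ?T" using hh by blast
    show "u S \<alpha> \<in> Cell X S"
      unfolding u[OF S h i] val_def
      by (rule dendroidal_setD(1)[OF D S is_tree_linear push_hom[OF S h sq[OF i(1)]] x[OF i(1,2)]])
  next
    fix R S \<alpha> \<beta> assume RS: "is_tree R" "is_tree S" and \<beta>: "\<beta> \<in> Hom Omega R S" and \<alpha>: "\<alpha> \<in> Cell ?H S"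
    then obtain i where i: "i \<le> n" "i \<noteq> k" "i \<notin> fst \<alpha> ` edges S" and h: "\<alpha> \<in> Hom Omega S ?T" using hh by blast
    have h': "precomp R \<alpha> \<beta> \<in> Hom Omega R ?T" using Omega_comp[OF RS(1) \<beta> h] unfolding Comp_Omega .
    have i': "i \<notin> fst (precomp R \<alpha> \<beta>) ` edges R" using i(3) hom_edge[OF \<beta>] by (auto simp: fst_precomp)
    show "u R (precomp R \<alpha> \<beta>) = Restr X R S \<beta> (u S \<alpha>)"
      unfolding u[OF RS(2) h i] u[OF RS(1) h' i(1,2) i'] val_def push_precomp[OF RS(1) \<beta>]
      by (rule dendroidal_setD(3)[OF D RS is_tree_linear \<beta> push_hom[OF RS(2) h sq[OF i(1)]] x[OF i(1,2)]])
  qed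
  have "dendroidal_map (representable Omega ?T) terminal_psh (\<lambda>S x. ())"
    by (simp add: presheaf_map_def terminal_psh_def)
  moreover have "k \<in> inner_edges ?T" using k by (simp add: linear_tree_inner)
  ultimately obtain h where h: "sieve_map (cells ?T) X h" "\<forall>S\<in>Ob Omega. \<forall>\<alpha>\<in>Cell ?H S. h S \<alpha> = u S \<alpha>"
    using K um T unfolding inner_kan_fibration_def right_lifting_def dendroidal_map_representable by fast
  have id: "Id Omega ?T \<in> Hom Omega ?T ?T" using category_Omega T unfolding category_def Omega_sel(1) by blast
  show thesis
  proof (rule that[of "h ?T (Id Omega ?T)"])
    show "h ?T (Id Omega ?T) \<in> Cell X ?T" by (rule sieve_mapD(1)[OF h(1) T id])
    show "along X (Suc m) n (skip i) (h ?T (Id Omega ?T)) = x i" if i: "i \<le> n" "i \<noteq> k" for i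
    proof -
      let ?d = "edge_mor ?R (skip i)"
      have d: "?d \<in> Hom Omega ?R ?T" using mono_map_hom[OF mono_skip] n by simp
      have "precomp ?R (Id Omega ?T) ?d = edge_mor ?R (\<lambda>e. fst ?d e)"
        unfolding edge_mor_id[symmetric] by (rule precomp_edge_mor[OF is_tree_linear d])
      also have "\<dots> = ?d" using hom_eq_edge_mor[OF d] by simp
      finally have 1: "along X (Suc m) n (skip i) (h ?T (Id Omega ?T)) = h ?R ?d"
        unfolding along_def using sieve_mapD(2)[OF h(1) is_tree_linear T d id] by simp
      have i': "i \<notin> fst ?d ` edges ?R" by (auto simp: skip_def)
      then have "?d \<in> Cell ?H ?R" using linear_horn_iff[OF n2 k is_tree_linear d] i by blast
      then have "h ?R ?d = val ?R ?d i" using h(2) u[OF is_tree_linear d i i'] is_tree_linear by (simp add: Omega_sel(1))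
      moreover have "push ?R (squeeze i) ?d = edge_mor ?R (\<lambda>e. e)"
        unfolding push_def by (rule edge_mor_cong[OF is_tree_linear]) (simp add: squeeze_skip)
      ultimately show ?thesis using 1 dendroidal_setD(2)[OF D is_tree_linear x[OF i]]
        unfolding val_def edge_mor_id by simp
    qed
  qed
qed

text \<open>A list of vertices with repetitions gives a degenerate simplex.\<close>

definition face_of :: "'x dset \<Rightarrow> nat \<Rightarrow> nat list \<Rightarrow> 'x \<Rightarrow> 'x" where
  "face_of X n is x = along X (length is - 1) n (\<lambda>i. is ! i) x"

definition vertex_list :: "nat \<Rightarrow> nat list \<Rightarrow> bool" where
  "vertex_list n is \<longleftrightarrow> is \<noteq> [] \<and> sorted is \<and> (\<forall>i\<in>set is. i \<le> n)"

lemma vertex_list_mono: "vertex_list n is \<Longrightarrow> mono_map (length is - 1) n (\<lambda>i. is ! i)"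
proof -
  assume "vertex_list n is"
  then have "sorted is" "\<And>i. i < length is \<Longrightarrow> is ! i \<le> n" "0 < length is" by (auto simp: vertex_list_def)
  moreover have "i < length is" if "i \<le> length is - 1" for i using that \<open>0 < length is\<close> by linarith
  ultimately show ?thesis unfolding mono_map_def using sorted_nth_mono by blast
qed

lemma along_face_of:
  "along X m n f x = face_of X n (map f [0..<Suc m]) x"
proof -
  have "f i = map f [0..<Suc m] ! i" if "i \<le> m" for i
    using that by (subst nth_map) (auto simp del: upt_Suc)
  then have "along X m n f x = along X m n (\<lambda>i. map f [0..<Suc m] ! i) x" by (rule along_cong)
  then show ?thesis unfolding face_of_def by simp
qed

abbreviation simplices :: "'x dset \<Rightarrow> nat \<Rightarrow> 'x set" where
  "simplices X n \<equiv> Cell X (linear_tree n)"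

definition triangle :: "'x dset \<Rightarrow> 'x \<Rightarrow> 'x \<Rightarrow> 'x \<Rightarrow> bool" where
  "triangle X p q r \<longleftrightarrow> (\<exists>s\<in>simplices X 2. face_of X 2 [0, 1] s = p \<and> face_of X 2 [1, 2] s = q \<and> face_of X 2 [0, 2] s = r)"

text \<open>A path is related to all of its composites, which exist but are not unique. The empty
  path has every edge homotopic to the identity as a composite; with the identity alone, deleting a
  degenerate edge would change the set of composites.\<close>

fun composite :: "'x dset \<Rightarrow> 'x \<Rightarrow> 'x list \<Rightarrow> 'x \<Rightarrow> bool" where
  "composite X x [] e \<longleftrightarrow> triangle X (face_of X 0 [0, 0] x) (face_of X 0 [0, 0] x) e"
| "composite X x (u # us) e \<longleftrightarrow> (\<exists>e'. composite X (face_of X 1 [1] u) us e' \<and> triangle X u e' e)"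

section \<open>Composition of edges up to homotopy\<close>

context
  fixes X :: "'x dset"
  assumes X: "infinity_operad X"
begin

lemma XD: "dendroidal_set X"
  using X by (simp add: infinity_operad_def)

lemma face_cell:
  assumes "x \<in> simplices X n" "vertex_list n is" "length is = Suc m"
  shows "face_of X n is x \<in> simplices X m"
  using along_cell[OF XD vertex_list_mono[OF assms(2)] assms(1)] assms(3) by (simp add: face_of_def)

lemma face_face:
  assumes "x \<in> simplices X n" "vertex_list n is" "length is = Suc m" "vertex_list m js"
  shows "face_of X m js (face_of X n is x) = face_of X n (map (\<lambda>j. is ! j) js) x"
proof -
  have "js \<noteq> []" using assms(4) by (simp add: vertex_list_def)
  have "along X (length js - 1) m (\<lambda>j. js ! j) (along X m n (\<lambda>j. is ! j) x) =
      along X (length js - 1) n (\<lambda>j. is ! (js ! j)) x"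
    using along_along[OF XD vertex_list_mono[OF assms(4)] _ assms(1)] vertex_list_mono[OF assms(2)] assms(3) by simp
  also have "\<dots> = along X (length js - 1) n (\<lambda>j. map (\<lambda>j. is ! j) js ! j) x"
  proof (rule along_cong)
    fix i assume "i \<le> length js - 1"
    moreover have "0 < length js" using \<open>js \<noteq> []\<close> by simp
    ultimately have "i < length js" by linarith
    then show "is ! (js ! i) = map (\<lambda>j. is ! j) js ! i" by simp
  qed
  finally show ?thesis using assms(3) by (simp add: face_of_def)
qed

lemma face_id: "x \<in> simplices X n \<Longrightarrow> is = [0..<Suc n] \<Longrightarrow> face_of X n is x = x"
  using along_face_of[of X n n "\<lambda>i. i" x] along_id[OF XD, of x n] by (simp del: upt_Suc)

text \<open>The horn \<open>\<Lambda>\<^sup>1[2]\<close>. In the names of the next three lemmas the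
  digits are the dimension and the vertex of the horn.\<close>

lemma fill_2:
  assumes "e0 \<in> simplices X 1" "e2 \<in> simplices X 1" "face_of X 1 [0] e0 = face_of X 1 [1] e2"
  obtains y where "y \<in> simplices X 2" "face_of X 2 [1, 2] y = e0" "face_of X 2 [0, 1] y = e2"
proof -
  define x where "x = (\<lambda>i::nat. if i = 0 then e0 else e2)"
  obtain y where y: "y \<in> simplices X 2" "\<And>i. i \<le> 2 \<Longrightarrow> i \<noteq> 1 \<Longrightarrow> along X (Suc 0) 2 (skip i) y = x i"
  proof (rule linear_horn_filler[OF X, of 2 0 1 x])
    fix i j :: nat assume "i < j" "j \<le> 2" "i \<noteq> 1" "j \<noteq> 1"
    then have "i = 0" "j = 2" by auto
    then show "along X 0 (Suc 0) (skip i) (x j) = along X 0 (Suc 0) (skip (j - 1)) (x i)"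
      using assms(3) by (simp add: along_face_of skip_def x_def)
  qed (use assms in \<open>auto simp: x_def\<close>)
  show thesis
  proof (rule that[OF y(1)])
    show "face_of X 2 [1, 2] y = e0" "face_of X 2 [0, 1] y = e2"
      using y(2)[of 0] y(2)[of 2] by (simp_all add: along_face_of skip_def x_def numeral_eq_Suc)
  qed
qed

lemma fill_31:
  assumes "d0 \<in> simplices X 2" "d2 \<in> simplices X 2" "d3 \<in> simplices X 2"
    "face_of X 2 [0, 2] d0 = face_of X 2 [1, 2] d2" "face_of X 2 [0, 1] d0 = face_of X 2 [1, 2] d3"
    "face_of X 2 [0, 1] d2 = face_of X 2 [0, 1] d3"
  obtains y where "y \<in> simplices X 3" "face_of X 3 [1, 2, 3] y = d0" "face_of X 3 [0, 1, 3] y = d2"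
    "face_of X 3 [0, 1, 2] y = d3"
proof -
  define x where "x = (\<lambda>i::nat. if i = 0 then d0 else if i = 2 then d2 else d3)"
  obtain y where y: "y \<in> simplices X 3" "\<And>i. i \<le> 3 \<Longrightarrow> i \<noteq> 1 \<Longrightarrow> along X (Suc 1) 3 (skip i) y = x i"
  proof (rule linear_horn_filler[OF X, of 3 1 1 x])
    fix i j :: nat assume "i < j" "j \<le> 3" "i \<noteq> 1" "j \<noteq> 1"
    then consider "i = 0" "j = 2" | "i = 0" "j = 3" | "i = 2" "j = 3" by linarith
    then show "along X 1 (Suc 1) (skip i) (x j) = along X 1 (Suc 1) (skip (j - 1)) (x i)"
      using assms(4-6) by cases (simp_all add: along_face_of skip_def x_def numeral_eq_Suc)
  qed (use assms in \<open>auto simp: x_def numeral_eq_Suc\<close>)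
  show thesis
  proof (rule that[OF y(1)])
    show "face_of X 3 [1, 2, 3] y = d0" "face_of X 3 [0, 1, 3] y = d2" "face_of X 3 [0, 1, 2] y = d3"
      using y(2)[of 0] y(2)[of 2] y(2)[of 3] by (simp_all add: along_face_of skip_def x_def numeral_eq_Suc)
  qed
qed

lemma fill_32:
  assumes "d0 \<in> simplices X 2" "d1 \<in> simplices X 2" "d3 \<in> simplices X 2"
    "face_of X 2 [1, 2] d0 = face_of X 2 [1, 2] d1" "face_of X 2 [0, 1] d0 = face_of X 2 [1, 2] d3"
    "face_of X 2 [0, 1] d1 = face_of X 2 [0, 2] d3"
  obtains y where "y \<in> simplices X 3" "face_of X 3 [1, 2, 3] y = d0" "face_of X 3 [0, 2, 3] y = d1"
    "face_of X 3 [0, 1, 2] y = d3"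
proof -
  define x where "x = (\<lambda>i::nat. if i = 0 then d0 else if i = 1 then d1 else d3)"
  obtain y where y: "y \<in> simplices X 3" "\<And>i. i \<le> 3 \<Longrightarrow> i \<noteq> 2 \<Longrightarrow> along X (Suc 1) 3 (skip i) y = x i"
  proof (rule linear_horn_filler[OF X, of 3 1 2 x])
    fix i j :: nat assume "i < j" "j \<le> 3" "i \<noteq> 2" "j \<noteq> 2"
    then consider "i = 0" "j = 1" | "i = 0" "j = 3" | "i = 1" "j = 3" by linarith
    then show "along X 1 (Suc 1) (skip i) (x j) = along X 1 (Suc 1) (skip (j - 1)) (x i)"
      using assms(4-6) by cases (simp_all add: along_face_of skip_def x_def numeral_eq_Suc)
  qed (use assms in \<open>auto simp: x_def numeral_eq_Suc\<close>)
  show thesis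
  proof (rule that[OF y(1)])
    show "face_of X 3 [1, 2, 3] y = d0" "face_of X 3 [0, 2, 3] y = d1" "face_of X 3 [0, 1, 2] y = d3"
      using y(2)[of 0] y(2)[of 1] y(2)[of 3] by (simp_all add: along_face_of skip_def x_def numeral_eq_Suc)
  qed
qed

lemma fill_43:
  assumes "d0 \<in> simplices X 3" "d1 \<in> simplices X 3" "d2 \<in> simplices X 3" "d4 \<in> simplices X 3"
    "face_of X 3 [1, 2, 3] d0 = face_of X 3 [1, 2, 3] d1" "face_of X 3 [0, 2, 3] d0 = face_of X 3 [1, 2, 3] d2"
    "face_of X 3 [0, 1, 2] d0 = face_of X 3 [1, 2, 3] d4" "face_of X 3 [0, 2, 3] d1 = face_of X 3 [0, 2, 3] d2"
    "face_of X 3 [0, 1, 2] d1 = face_of X 3 [0, 2, 3] d4" "face_of X 3 [0, 1, 2] d2 = face_of X 3 [0, 1, 3] d4"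
  obtains y where "y \<in> simplices X 4" "face_of X 4 [0, 2, 3, 4] y = d1" "face_of X 4 [0, 1, 3, 4] y = d2"
proof -
  define x where "x = (\<lambda>i::nat. if i = 0 then d0 else if i = 1 then d1 else if i = 2 then d2 else d4)"
  obtain y where y: "y \<in> simplices X 4" "\<And>i. i \<le> 4 \<Longrightarrow> i \<noteq> 3 \<Longrightarrow> along X (Suc 2) 4 (skip i) y = x i"
  proof (rule linear_horn_filler[OF X, of 4 2 3 x])
    fix i j :: nat assume "i < j" "j \<le> 4" "i \<noteq> 3" "j \<noteq> 3"
    then consider "i = 0" "j = 1" | "i = 0" "j = 2" | "i = 0" "j = 4" | "i = 1" "j = 2" | "i = 1" "j = 4" | "i = 2" "j = 4"
      by linarith
    then show "along X 2 (Suc 2) (skip i) (x j) = along X 2 (Suc 2) (skip (j - 1)) (x i)"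
      using assms(5-10) by cases (simp_all add: along_face_of skip_def x_def numeral_eq_Suc)
  qed (use assms in \<open>auto simp: x_def numeral_eq_Suc\<close>)
  show thesis
  proof (rule that[OF y(1)])
    show "face_of X 4 [0, 2, 3, 4] y = d1" "face_of X 4 [0, 1, 3, 4] y = d2"
      using y(2)[of 1] y(2)[of 2] by (simp_all add: along_face_of skip_def x_def numeral_eq_Suc)
  qed
qed

lemma triangleE:
  assumes "triangle X p q r"
  obtains s where "s \<in> simplices X 2" "face_of X 2 [0, 1] s = p" "face_of X 2 [1, 2] s = q" "face_of X 2 [0, 2] s = r"
  using assms unfolding triangle_def by blast

lemma triangle_ends:
  assumes "triangle X p q r"
  shows "p \<in> simplices X 1" "q \<in> simplices X 1" "r \<in> simplices X 1"
    "face_of X 1 [0] r = face_of X 1 [0] p" "face_of X 1 [1] r = face_of X 1 [1] q" "face_of X 1 [0] q = face_of X 1 [1] p"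
proof -
  obtain s where s: "s \<in> simplices X 2" "face_of X 2 [0, 1] s = p" "face_of X 2 [1, 2] s = q" "face_of X 2 [0, 2] s = r"
    using assms by (rule triangleE)
  show "p \<in> simplices X 1" "q \<in> simplices X 1" "r \<in> simplices X 1"
    unfolding s(2-4)[symmetric] by (rule face_cell[OF s(1)]; simp add: vertex_list_def)+
  show "face_of X 1 [0] r = face_of X 1 [0] p" "face_of X 1 [1] r = face_of X 1 [1] q" "face_of X 1 [0] q = face_of X 1 [1] p"
    unfolding s(2-4)[symmetric] by (subst (1 2) face_face[OF s(1)]; simp add: vertex_list_def)+
qed

text \<open>Associativity: the faces 012, 123 and 013 form \<open>\<Lambda>\<^sup>1[3]\<close>, and
  the face 023 of a filler is the claim. \<open>triangle_right\<close> exchanges the roles of 023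
  and 013 and uses \<open>\<Lambda>\<^sup>2[3]\<close>.\<close>

lemma triangle_left:
  assumes "triangle X p q pq" "triangle X q r qr" "triangle X p qr t" shows "triangle X pq r t"
proof -
  obtain s3 where s3: "s3 \<in> simplices X 2" "face_of X 2 [0, 1] s3 = p" "face_of X 2 [1, 2] s3 = q" "face_of X 2 [0, 2] s3 = pq"
    using assms(1) by (rule triangleE)
  obtain s0 where s0: "s0 \<in> simplices X 2" "face_of X 2 [0, 1] s0 = q" "face_of X 2 [1, 2] s0 = r" "face_of X 2 [0, 2] s0 = qr"
    using assms(2) by (rule triangleE)
  obtain s2 where s2: "s2 \<in> simplices X 2" "face_of X 2 [0, 1] s2 = p" "face_of X 2 [1, 2] s2 = qr" "face_of X 2 [0, 2] s2 = t"
    using assms(3) by (rule triangleE)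
  obtain y where y: "y \<in> simplices X 3" "face_of X 3 [1, 2, 3] y = s0" "face_of X 3 [0, 1, 3] y = s2" "face_of X 3 [0, 1, 2] y = s3"
    by (rule fill_31[OF s0(1) s2(1) s3(1)]) (simp_all only: s0 s2 s3)
  let ?s = "face_of X 3 [0, 2, 3] y"
  have "face_of X 2 [0, 1] ?s = face_of X 2 [0, 2] s3" "face_of X 2 [1, 2] ?s = face_of X 2 [1, 2] s0"
    "face_of X 2 [0, 2] ?s = face_of X 2 [0, 2] s2" "?s \<in> simplices X 2"
    unfolding y(2-4)[symmetric] using y(1) by (simp_all add: face_face[where m=2] face_cell[where m=2] vertex_list_def)
  then show ?thesis unfolding triangle_def s0 s2 s3 by blast
qed

lemma triangle_right:
  assumes "triangle X p q pq" "triangle X q r qr" "triangle X pq r t" shows "triangle X p qr t"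
proof -
  obtain s3 where s3: "s3 \<in> simplices X 2" "face_of X 2 [0, 1] s3 = p" "face_of X 2 [1, 2] s3 = q" "face_of X 2 [0, 2] s3 = pq"
    using assms(1) by (rule triangleE)
  obtain s0 where s0: "s0 \<in> simplices X 2" "face_of X 2 [0, 1] s0 = q" "face_of X 2 [1, 2] s0 = r" "face_of X 2 [0, 2] s0 = qr"
    using assms(2) by (rule triangleE)
  obtain s1 where s1: "s1 \<in> simplices X 2" "face_of X 2 [0, 1] s1 = pq" "face_of X 2 [1, 2] s1 = r" "face_of X 2 [0, 2] s1 = t"
    using assms(3) by (rule triangleE)
  obtain y where y: "y \<in> simplices X 3" "face_of X 3 [1, 2, 3] y = s0" "face_of X 3 [0, 2, 3] y = s1" "face_of X 3 [0, 1, 2] y = s3"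
    by (rule fill_32[OF s0(1) s1(1) s3(1)]) (simp_all only: s0 s1 s3)
  let ?s = "face_of X 3 [0, 1, 3] y"
  have "face_of X 2 [0, 1] ?s = face_of X 2 [0, 1] s3" "face_of X 2 [1, 2] ?s = face_of X 2 [0, 2] s0"
    "face_of X 2 [0, 2] ?s = face_of X 2 [0, 2] s1" "?s \<in> simplices X 2"
    unfolding y(2-4)[symmetric] using y(1) by (simp_all add: face_face[where m=2] face_cell[where m=2] vertex_list_def)
  then show ?thesis unfolding triangle_def s0 s1 s3 by blast
qed

lemma triangle_degenerate:
  assumes e: "e \<in> simplices X 1"
  shows "triangle X (face_of X 0 [0, 0] (face_of X 1 [0] e)) e e"
    and "triangle X e (face_of X 0 [0, 0] (face_of X 1 [1] e)) e"
proof -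
  have i: "face_of X 1 [0, 1] e = e" by (rule face_id[OF e]) (simp add: upt_conv_Cons)
  have "face_of X 1 [0, 0, 1] e \<in> simplices X 2" "face_of X 1 [0, 1, 1] e \<in> simplices X 2"
    using e by (simp_all add: face_cell[where m=2] vertex_list_def)
  moreover have "face_of X 2 [0, 1] (face_of X 1 [0, 0, 1] e) = face_of X 0 [0, 0] (face_of X 1 [0] e)"
    "face_of X 2 [1, 2] (face_of X 1 [0, 0, 1] e) = e" "face_of X 2 [0, 2] (face_of X 1 [0, 0, 1] e) = e"
    "face_of X 2 [0, 1] (face_of X 1 [0, 1, 1] e) = e" "face_of X 2 [0, 2] (face_of X 1 [0, 1, 1] e) = e"
    "face_of X 2 [1, 2] (face_of X 1 [0, 1, 1] e) = face_of X 0 [0, 0] (face_of X 1 [1] e)"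
    using e by (simp_all add: face_face[where m=2] face_face[where m=0] vertex_list_def i i[simplified])
  ultimately show "triangle X (face_of X 0 [0, 0] (face_of X 1 [0] e)) e e"
    "triangle X e (face_of X 0 [0, 0] (face_of X 1 [1] e)) e"
    unfolding triangle_def by blast+
qed

end

section \<open>From isomorphisms of the category tau to coherent equivalences\<close>

lemma presheaf_pullback:
  assumes C: "presheaf D X" and F: "is_functor C D F\<^sub>0 F\<^sub>1" shows "presheaf C (pullback_psh F\<^sub>0 F\<^sub>1 X)"
  using C F unfolding presheaf_def is_functor_def pullback_psh_def by simp

lemma underlying_sset_sel:
  "Cell (underlying_sset X) n = simplices X n"
  "Restr (underlying_sset X) m n \<alpha> x = along X m n \<alpha> x"
  by (simp_all add: underlying_sset_def pullback_psh_def along_def)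

lemma underlying_sset_faces:
  "svertex (underlying_sset X) n i x = face_of X n [i] x"
  "sedge (underlying_sset X) n i j x = face_of X n [i, j] x"
  unfolding svertex_def sedge_def underlying_sset_sel face_of_def by (auto intro!: along_cong simp: nth_Cons')

context
  fixes X :: "'x dset"
  assumes X: "infinity_operad X"
begin

abbreviation US :: "'x sset" where "US \<equiv> underlying_sset X"

lemma sset: "presheaf Delta US"
  unfolding underlying_sset_def using presheaf_pullback[OF XD[OF X] linear_functor] .

lemma unit_edge:
  assumes z: "z \<in> simplices X 0"
  shows "face_of X 0 [0, 0] z \<in> simplices X 1" "face_of X 1 [0] (face_of X 0 [0, 0] z) = z"
    "face_of X 1 [1] (face_of X 0 [0, 0] z) = z"
  using face_id[OF X z, of "[0]"] face_cell[OF X z, of "[0, 0]"]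
    face_face[OF X z, of "[0, 0]" 1 "[0]"] face_face[OF X z, of "[0, 0]" 1 "[1]"]
  by (simp_all add: vertex_list_def)

lemma ends_cell:
  assumes u: "u \<in> simplices X 1"
  shows "face_of X 1 [0] u \<in> simplices X 0" "face_of X 1 [1] u \<in> simplices X 0"
  using face_cell[OF X u, of "[0]"] face_cell[OF X u, of "[1]"] by (simp_all add: vertex_list_def)

lemma composite_ends:
  "spath US x us y \<Longrightarrow> composite X x us e \<Longrightarrow> e \<in> simplices X 1 \<and> face_of X 1 [0] e = x \<and> face_of X 1 [1] e = y"
proof (induction us arbitrary: x e)
  case Nil
  then have x: "x \<in> simplices X 0" "x = y" and t: "triangle X (face_of X 0 [0, 0] x) (face_of X 0 [0, 0] x) e"
    by (auto simp: underlying_sset_sel)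
  then show ?case using triangle_ends(3,4,5)[OF X t] unit_edge[OF x(1)] by simp
next
  case (Cons u us)
  then obtain e' where e': "composite X (face_of X 1 [1] u) us e'" "triangle X u e' e" by auto
  have p: "spath US (face_of X 1 [1] u) us y" "face_of X 1 [0] u = x"
    using Cons.prems(1) by (simp_all add: underlying_sset_faces)
  show ?case using Cons.IH[OF p(1) e'(1)] triangle_ends(3,4,5)[OF X e'(2)] p(2) by auto
qed

lemma composite_closed:
  assumes "spath US x us y" "composite X x us e'" "triangle X (face_of X 0 [0, 0] x) e' e" shows "composite X x us e"
proof (cases us)
  case Nil
  then have t: "triangle X (face_of X 0 [0, 0] x) (face_of X 0 [0, 0] x) e'" using assms(2) by simp
  have "x \<in> simplices X 0" using assms(1) Nil by (auto simp: underlying_sset_sel)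
  note unit_edge[OF this]
  then have "triangle X (face_of X 0 [0, 0] x) (face_of X 0 [0, 0] x) (face_of X 0 [0, 0] x)"
    using triangle_degenerate(1)[OF X, of "face_of X 0 [0, 0] x"] by simp
  then show ?thesis using triangle_left[OF X _ t assms(3)] Nil by simp
next
  case (Cons u us')
  then obtain e'' where e'': "composite X (face_of X 1 [1] u) us' e''" "triangle X u e'' e'" using assms(2) by auto
  have "u \<in> simplices X 1" "face_of X 1 [0] u = x"
    using assms(1) Cons by (auto simp: underlying_sset_sel underlying_sset_faces)
  then have "triangle X (face_of X 0 [0, 0] x) u u" using triangle_degenerate(1)[OF X] by blast
  then show ?thesis using triangle_left[OF X _ e''(2) assms(3)] e''(1) Cons by auto
qed

lemma composite_append:
  assumes "spath US x us y" "\<And>e. composite X y vs e \<longleftrightarrow> composite X y vs' e"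
  shows "composite X x (us @ vs) e \<longleftrightarrow> composite X x (us @ vs') e"
  using assms(1)
proof (induction us arbitrary: x e)
  case Nil then show ?case using assms(2) by simp
next
  case (Cons u us)
  have "spath US (face_of X 1 [1] u) us y" using Cons.prems by (simp add: underlying_sset_faces)
  then show ?case using Cons.IH by simp
qed

text \<open>The set of composites is an invariant of the class of a path, so equalities in
  \<open>tau\<close> can be evaluated in \<open>X\<close> without constructing the homotopy category
  by hand.\<close>

lemma composite_tau_eq:
  "tau_eq US x y us vs \<Longrightarrow> composite X x us e \<longleftrightarrow> composite X x vs e"
proof (induction arbitrary: e rule: tau_eq.induct)
  case (degenerate z us vs)
  let ?d = "face_of X 0 [0, 0] z"
  have z: "z \<in> simplices X 0" using degenerate(1) by (simp add: underlying_sset_sel)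
  have d: "?d \<in> simplices X 1" "face_of X 1 [0] ?d = z" "face_of X 1 [1] ?d = z"
    by (rule unit_edge[OF z])+
  obtain a where a: "spath US x us a" "spath US a ([?d] @ vs) y"
    using degenerate(2) by (metis spath_append[OF sset] underlying_sset_faces(2))
  then have az: "a = z" and p: "spath US z vs y" using d by (simp_all add: underlying_sset_faces)
  have "composite X z ([?d] @ vs) e \<longleftrightarrow> composite X z vs e" for e
  proof
    assume "composite X z ([?d] @ vs) e"
    then show "composite X z vs e" using composite_closed[OF p] d(3) by auto
  next
    assume c: "composite X z vs e"
    then have "triangle X ?d e e" using composite_ends[OF p c] triangle_degenerate(1)[OF X, of e] by simp
    then show "composite X z ([?d] @ vs) e" using c d(3) by auto
  qed
  then show ?case using composite_append[OF a(1)] az unfolding underlying_sset_faces by blast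
next
  case (triangle s us vs)
  have s: "s \<in> simplices X 2" using triangle(1) by (simp add: underlying_sset_sel)
  let ?p = "face_of X 2 [0, 1] s" and ?q = "face_of X 2 [1, 2] s" and ?r = "face_of X 2 [0, 2] s"
  have t: "triangle X ?p ?q ?r" unfolding triangle_def using s by blast
  obtain a where a: "spath US x us a" "spath US a ([?p, ?q] @ vs) y"
    using triangle(2) by (metis spath_append[OF sset] underlying_sset_faces(2))
  then have p: "spath US (face_of X 1 [1] ?q) vs y" by (simp add: underlying_sset_faces)
  have qr: "face_of X 1 [1] ?q = face_of X 1 [1] ?r" using triangle_ends(5)[OF X t] by simp
  have "composite X a ([?p, ?q] @ vs) e \<longleftrightarrow> composite X a ([?r] @ vs) e" for e
  proof
    assume "composite X a ([?p, ?q] @ vs) e"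
    then obtain e' e'' where e: "composite X (face_of X 1 [1] ?q) vs e'" "triangle X ?q e' e''" "triangle X ?p e'' e"
      by auto
    then have "triangle X ?r e' e" using triangle_left[OF X t] by blast
    then show "composite X a ([?r] @ vs) e" using e(1) qr by auto
  next
    assume "composite X a ([?r] @ vs) e"
    then obtain e' where e: "composite X (face_of X 1 [1] ?q) vs e'" "triangle X ?r e' e" using qr by auto
    have "e' \<in> simplices X 1" "face_of X 1 [0] e' = face_of X 1 [1] ?q" using composite_ends[OF p e(1)] by auto
    then obtain s' where s': "s' \<in> simplices X 2" "face_of X 2 [1, 2] s' = e'" "face_of X 2 [0, 1] s' = ?q"
      using fill_2[OF X _ triangle_ends(2)[OF X t]] by metis
    then have t': "triangle X ?q e' (face_of X 2 [0, 2] s')" unfolding triangle_def by blast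
    then show "composite X a ([?p, ?q] @ vs) e" using triangle_right[OF X t t' e(2)] e(1) by auto
  qed
  then show ?case using composite_append[OF a(1)] unfolding underlying_sset_faces by blast
qed auto

text \<open>A path representing the inverse has a composite \<open>v\<close>, and the two relations
  of the isomorphism are evaluated on composites. The \<open>w\<close> obtained is homotopic to
  \<open>u\<close> but need not equal it; this is repaired in
  \<open>coherent_equivalence\<close>.\<close>

lemma isomorphism_inverses:
  assumes u: "u \<in> simplices X 1"
    and iso: "is_isomorphism (tau US) (svertex US 1 0 u) (svertex US 1 1 u) (tau_mor US u)"
  obtains v w where "triangle X u v (face_of X 0 [0, 0] (face_of X 1 [0] u))"
    "triangle X v w (face_of X 0 [0, 0] (face_of X 1 [1] u))"
proof -
  let ?a = "face_of X 1 [0] u" and ?b = "face_of X 1 [1] u"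
  have ab: "svertex US 1 0 u = ?a" "svertex US 1 1 u = ?b" by (simp_all add: underlying_sset_faces)
  have m: "tau_mor US u = tau_class US ?a ?b [u]" unfolding tau_mor_def ab ..
  have b: "?b \<in> simplices X 0" "?a \<in> simplices X 0" by (rule ends_cell[OF u])+
  then have pu: "spath US ?a [u] ?b" using u by (simp add: underlying_sset_sel underlying_sset_faces)
  obtain g where g: "g \<in> Hom (tau US) ?b ?a" "Comp (tau US) ?a ?b ?a g (tau_mor US u) = Id (tau US) ?a"
    "Comp (tau US) ?b ?a ?b (tau_mor US u) g = Id (tau US) ?b"
    using iso unfolding is_isomorphism_def ab by meson
  obtain us where us: "g = tau_class US ?b ?a us" "spath US ?b us ?a" using tau_HomE[OF sset g(1)] .
  have p: "spath US ?a ([u] @ us) ?a" "spath US ?b (us @ [u]) ?b" using pu us(2) spath_append[OF sset] by blast+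
  have 1: "tau_eq US ?a ?a ([u] @ us) []"
    using g(2) unfolding us(1) m tau_comp[OF sset pu us(2)] tau_Id[OF sset] tau_class_eq[OF sset p(1)] .
  have 2: "tau_eq US ?b ?b (us @ [u]) []"
    using g(3) unfolding us(1) m tau_comp[OF sset us(2) pu] tau_Id[OF sset] tau_class_eq[OF sset p(2)] .
  have id: "composite X z [] (face_of X 0 [0, 0] z)" if z: "z \<in> simplices X 0" for z
    using triangle_degenerate(1)[OF X unit_edge(1)[OF z]] unit_edge(2)[OF z] by simp
  have "composite X ?a ([u] @ us) (face_of X 0 [0, 0] ?a)" using composite_tau_eq[OF 1] id[OF b(2)] by blast
  then obtain v where v: "composite X ?b us v" "triangle X u v (face_of X 0 [0, 0] ?a)" by auto
  \<comment> \<open>Every path equals each of its composites in \<open>tau\<close>; this replaces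
    the unknown path \<open>us\<close> by the edge \<open>v\<close>.\<close>
  have reduce: "tau_eq US x y (us @ vs) ([e] @ vs)" if "spath US x us z" "composite X x us e" "spath US z vs y" for x us e z vs y
    using that
  proof (induction us arbitrary: x e)
    case Nil
    then have t: "triangle X (face_of X 0 [0, 0] x) (face_of X 0 [0, 0] x) e" and x: "x \<in> simplices X 0" "x = z"
      by (auto simp: underlying_sset_sel)
    let ?d = "face_of X 0 [0, 0] x"
    obtain s where s: "s \<in> simplices X 2" "face_of X 2 [0, 1] s = ?d" "face_of X 2 [1, 2] s = ?d" "face_of X 2 [0, 2] s = e"
      using t by (rule triangleE[OF X])
    have d: "spath US x [?d] x" using unit_edge[OF x(1)] x(1)
      by (simp add: underlying_sset_sel underlying_sset_faces)
    have dv: "spath US x ([?d] @ vs) y" using d Nil(3) x(2) spath_append[OF sset] by blast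
    have ddv: "spath US x ([?d] @ [?d] @ vs) y" using d dv spath_append[OF sset] by blast
    have "tau_eq US x y ([] @ [?d, ?d] @ vs) ([] @ [e] @ vs)"
      using tau_eq.triangle[of s US x "[]" vs y] ddv s unit_edge[OF x(1)] by (simp add: underlying_sset_sel underlying_sset_faces)
    moreover have "tau_eq US x y ([] @ [?d] @ [?d] @ vs) ([] @ [?d] @ vs)"
      using tau_eq.degenerate[of x US x "[]" "[?d] @ vs" y] ddv x(1) unit_edge[OF x(1)] by (simp add: underlying_sset_sel underlying_sset_faces)
    moreover have "tau_eq US x y ([] @ [?d] @ vs) ([] @ vs)"
      using tau_eq.degenerate[of x US x "[]" "vs" y] dv x(1) unit_edge[OF x(1)] by (simp add: underlying_sset_sel underlying_sset_faces)
    ultimately show ?case by simp (meson tau_eq.sym tau_eq.trans)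
  next
    case (Cons u us)
    then obtain e' where e': "composite X (face_of X 1 [1] u) us e'" "triangle X u e' e" by auto
    have p: "spath US (face_of X 1 [1] u) us z" "spath US x [u] (face_of X 1 [1] u)"
      using Cons.prems(1) spath_ends[OF sset] by (auto simp: underlying_sset_faces)
    have "tau_eq US (face_of X 1 [1] u) y (us @ vs) ([e'] @ vs)" by (rule Cons.IH[OF p(1) e'(1) Cons.prems(3)])
    then have 3: "tau_eq US x y ([u] @ us @ vs) ([u] @ [e'] @ vs)" using tau_eq_prepend[OF sset _ p(2)] by blast
    obtain s where s: "s \<in> simplices X 2" "face_of X 2 [0, 1] s = u" "face_of X 2 [1, 2] s = e'" "face_of X 2 [0, 2] s = e"
      using e'(2) by (rule triangleE[OF X])
    have "spath US x ([u] @ [e'] @ vs) y" using tau_eq_spath[OF sset 3] by blast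
    then have "tau_eq US x y ([] @ [u, e'] @ vs) ([] @ [e] @ vs)"
      using tau_eq.triangle[of s US x "[]" vs y] s by (simp add: underlying_sset_sel underlying_sset_faces)
    then show ?case using 3 by simp (meson tau_eq.trans)
  qed
  have "tau_eq US ?b ?b (us @ [u]) ([v] @ [u])" by (rule reduce[OF us(2) v(1) pu])
  then have "composite X ?b ([v] @ [u]) (face_of X 0 [0, 0] ?b)"
    using composite_tau_eq[OF 2] id[OF b(1)] composite_tau_eq by blast
  then obtain w where "triangle X v w (face_of X 0 [0, 0] ?b)" by auto
  then show thesis using that v(2) by blast
qed

text \<open>
  For \<open>u : a \<rightarrow> b\<close> the simplex \<open>Q\<close> is the face \<open>0124\<close> of a \<open>4\<close>-simplex \<open>\<Psi>\<close> on \<open>a, b, a, b, b\<close>, obtained by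
  filling the horn with the faces \<open>0123\<close>, \<open>0134\<close>, \<open>1234\<close>, which are fillers of inner horns themselves,
  and the degenerate face \<open>0234\<close>.
\<close>

lemma coherent_equivalence:
  assumes u: "u \<in> simplices X 1" and uv: "triangle X u v (face_of X 0 [0, 0] (face_of X 1 [0] u))"
    and vw: "triangle X v w (face_of X 0 [0, 0] (face_of X 1 [1] u))"
  obtains Q where "Q \<in> simplices X 3" "face_of X 3 [0, 1, 3] Q = face_of X 1 [0, 1, 1] u"
    "face_of X 3 [0, 2, 3] Q = face_of X 1 [0, 0, 1] u"
proof -
  obtain s1 where s1: "s1 \<in> simplices X 2" "face_of X 2 [0, 1] s1 = u" "face_of X 2 [1, 2] s1 = v"
    "face_of X 2 [0, 2] s1 = face_of X 0 [0, 0] (face_of X 1 [0] u)" using uv by (rule triangleE[OF X])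
  obtain s2 where s2: "s2 \<in> simplices X 2" "face_of X 2 [0, 1] s2 = v" "face_of X 2 [1, 2] s2 = w"
    "face_of X 2 [0, 2] s2 = face_of X 0 [0, 0] (face_of X 1 [1] u)" using vw by (rule triangleE[OF X])
  note e1 = triangle_ends[OF X uv] and e2 = triangle_ends[OF X vw]
  have w: "w \<in> simplices X 1" by (rule e2(2))
  have a: "face_of X 1 [0] u \<in> simplices X 0" "face_of X 1 [1] u \<in> simplices X 0"
    by (rule ends_cell[OF u])+
  have w0: "face_of X 1 [0] w = face_of X 1 [0] u" using e2(6) e1(5) unit_edge(3)[OF a(1)] by simp
  have w1: "face_of X 1 [1] w = face_of X 1 [1] u" using e2(5) unit_edge(3)[OF a(2)] by simp
  have id: "face_of X 1 [0, Suc 0] x = x" if "x \<in> simplices X 1" for x by (rule face_id[OF X that]) simp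
  have id2: "face_of X 2 [0, Suc 0, 2] x = x" if "x \<in> simplices X 2" for x
    by (rule face_id[OF X that]) (simp add: numeral_eq_Suc)
  have deg: "face_of X 1 [0, 0] u = face_of X 0 [0, 0] (face_of X 1 [0] u)"
    "face_of X 1 [1, 1] u = face_of X 0 [0, 0] (face_of X 1 [1] u)"
    "face_of X 1 [0, 0] w = face_of X 0 [0, 0] (face_of X 1 [0] u)"
    "face_of X 1 [1, 1] w = face_of X 0 [0, 0] (face_of X 1 [1] u)"
    using face_face[OF X w, of "[0]" 0 "[0,0]"] face_face[OF X w, of "[1]" 0 "[0,0]"]
      face_face[OF X u, of "[0]" 0 "[0,0]"] face_face[OF X u, of "[1]" 0 "[0,0]"] w0 w1 by (simp_all add: vertex_list_def)
  have wc: "face_of X 1 [0, 0, 1] w \<in> simplices X 2" "face_of X 1 [0, 1, 1] u \<in> simplices X 2" "face_of X 1 [1, 1, 1] u \<in> simplices X 2"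
    using w u by (simp_all add: face_cell[OF X, where m=2] vertex_list_def)
  note wf = face_face[OF X w[unfolded One_nat_def], where m=2] face_face[OF X u[unfolded One_nat_def], where m=2]
  obtain \<alpha> where \<alpha>: "\<alpha> \<in> simplices X 3" "face_of X 3 [1, 2, 3] \<alpha> = s2" "face_of X 3 [0, 2, 3] \<alpha> = face_of X 1 [0, 0, 1] w"
    "face_of X 3 [0, 1, 2] \<alpha> = s1"
    by (rule fill_32[OF X s2(1) wc(1) s1(1)])
      (use s1 s2 deg id[OF w] in \<open>simp_all add: wf vertex_list_def\<close>)
  \<comment> \<open>With edges \<open>u\<close>, identity and \<open>w\<close>, this face is a
    homotopy between \<open>u\<close> and \<open>w\<close>.\<close>
  let ?\<rho> = "face_of X 3 [0, 1, 3] \<alpha>"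
  have \<rho>: "?\<rho> \<in> simplices X 2" using \<alpha>(1) by (simp add: face_cell[OF X, where m=2] vertex_list_def)
  have \<rho>f: "face_of X 2 [0, 1] ?\<rho> = u" "face_of X 2 [1, 2] ?\<rho> = face_of X 1 [1, 1] u" "face_of X 2 [0, 2] ?\<rho> = w"
  proof -
    have "face_of X 2 [0, 1] ?\<rho> = face_of X 2 [0, 1] s1" "face_of X 2 [1, 2] ?\<rho> = face_of X 2 [0, 2] s2"
      "face_of X 2 [0, 2] ?\<rho> = face_of X 2 [0, 2] (face_of X 1 [0, 0, 1] w)"
      unfolding \<alpha>(2-4)[symmetric] using \<alpha>(1) by (simp_all add: face_face[OF X, where m=2] vertex_list_def)
    then show "face_of X 2 [0, 1] ?\<rho> = u" "face_of X 2 [1, 2] ?\<rho> = face_of X 1 [1, 1] u" "face_of X 2 [0, 2] ?\<rho> = w"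
      using s1 s2 deg id[OF w] by (simp_all add: wf vertex_list_def)
  qed
  obtain \<iota> where \<iota>: "\<iota> \<in> simplices X 3" "face_of X 3 [1, 2, 3] \<iota> = face_of X 1 [1, 1, 1] u"
    "face_of X 3 [0, 1, 3] \<iota> = face_of X 1 [0, 1, 1] u" "face_of X 3 [0, 1, 2] \<iota> = ?\<rho>"
    by (rule fill_31[OF X wc(3) wc(2) \<rho>])
      (use \<rho>f id[OF u] in \<open>simp_all add: wf vertex_list_def\<close>)
  \<comment> \<open>The same homotopy in the opposite direction, with edges \<open>w\<close>,
    identity and \<open>u\<close>.\<close>
  let ?\<kappa> = "face_of X 3 [0, 2, 3] \<iota>"
  have \<kappa>: "?\<kappa> \<in> simplices X 2" using \<iota>(1) by (simp add: face_cell[OF X, where m=2] vertex_list_def)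
  have \<kappa>f: "face_of X 2 [0, 1] ?\<kappa> = w" "face_of X 2 [1, 2] ?\<kappa> = face_of X 1 [1, 1] u" "face_of X 2 [0, 2] ?\<kappa> = u"
  proof -
    have "face_of X 2 [0, 1] ?\<kappa> = face_of X 2 [0, 2] ?\<rho>" "face_of X 2 [1, 2] ?\<kappa> = face_of X 2 [1, 2] (face_of X 1 [1, 1, 1] u)"
      "face_of X 2 [0, 2] ?\<kappa> = face_of X 2 [0, 2] (face_of X 1 [0, 1, 1] u)"
      unfolding \<iota>(2-4)[symmetric] using \<iota>(1) by (simp_all add: face_face[OF X, where m=2] vertex_list_def)
    then show "face_of X 2 [0, 1] ?\<kappa> = w" "face_of X 2 [1, 2] ?\<kappa> = face_of X 1 [1, 1] u" "face_of X 2 [0, 2] ?\<kappa> = u"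
      using \<rho>f id[OF u] by (simp_all add: wf vertex_list_def)
  qed
  obtain \<phi> where \<phi>: "\<phi> \<in> simplices X 3" "face_of X 3 [1, 2, 3] \<phi> = ?\<kappa>" "face_of X 3 [0, 2, 3] \<phi> = face_of X 1 [1, 1, 1] u"
    "face_of X 3 [0, 1, 2] \<phi> = s2"
    by (rule fill_32[OF X \<kappa> wc(3) s2(1)])
      (use s2 deg \<kappa>f in \<open>simp_all add: wf vertex_list_def\<close>)
  let ?\<mu> = "face_of X 2 [0, 0, 1, 2] ?\<kappa>"
  have \<mu>: "?\<mu> \<in> simplices X 3" using \<kappa> by (simp add: face_cell[OF X, where m=3] vertex_list_def)
  note \<kappa>ff = face_face[OF X \<kappa>, where m=3]
  have \<mu>f: "face_of X 3 [1, 2, 3] ?\<mu> = ?\<kappa>" "face_of X 3 [0, 2, 3] ?\<mu> = ?\<kappa>"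
    "face_of X 3 [0, 1, 2] ?\<mu> = face_of X 1 [0, 0, 1] w" "face_of X 3 [0, 1, 3] ?\<mu> = face_of X 1 [0, 0, 1] u"
  proof -
    show "face_of X 3 [1, 2, 3] ?\<mu> = ?\<kappa>" "face_of X 3 [0, 2, 3] ?\<mu> = ?\<kappa>"
      using id2[OF \<kappa>] \<kappa>ff[of "[0,0,1,2]" "[1,2,3]"] \<kappa>ff[of "[0,0,1,2]" "[0,2,3]"] by (simp_all add: vertex_list_def)
    show "face_of X 3 [0, 1, 2] ?\<mu> = face_of X 1 [0, 0, 1] w"
      using \<kappa>ff[of "[0,0,1,2]" "[0,1,2]"] face_face[OF X \<kappa>, of "[0,1]" 1 "[0,0,1]"] \<kappa>f by (simp add: vertex_list_def)
    show "face_of X 3 [0, 1, 3] ?\<mu> = face_of X 1 [0, 0, 1] u"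
      using \<kappa>ff[of "[0,0,1,2]" "[0,1,3]"] face_face[OF X \<kappa>, of "[0,2]" 1 "[0,0,1]"] \<kappa>f by (simp add: vertex_list_def)
  qed
  \<comment> \<open>The horn omits the face opposite to the vertex 3, which becomes
    \<open>Q\<close>: the edge 24 is \<open>u\<close>, whereas 23 is only \<open>w\<close>.\<close>
  obtain \<Psi> where \<Psi>: "\<Psi> \<in> simplices X 4" "face_of X 4 [0, 2, 3, 4] \<Psi> = ?\<mu>" "face_of X 4 [0, 1, 3, 4] \<Psi> = \<iota>"
    by (rule fill_43[OF X \<phi>(1) \<mu> \<iota>(1) \<alpha>(1)]) (simp_all only: \<phi> \<mu>f \<iota> \<alpha>)
  show thesis
  proof (rule that[of "face_of X 4 [0, 1, 2, 4] \<Psi>"])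
    show "face_of X 4 [0, 1, 2, 4] \<Psi> \<in> simplices X 3" using \<Psi>(1) by (simp add: face_cell[OF X, where m=3] vertex_list_def)
    have "face_of X 3 [0, 1, 3] (face_of X 4 [0, 1, 2, 4] \<Psi>) = face_of X 3 [0, 1, 3] \<iota>"
      "face_of X 3 [0, 2, 3] (face_of X 4 [0, 1, 2, 4] \<Psi>) = face_of X 3 [0, 1, 3] ?\<mu>"
      using \<Psi>(2,3) face_face[OF X \<Psi>(1), of "[0,1,2,4]" 3 "[0,1,3]"] face_face[OF X \<Psi>(1), of "[0,1,3,4]" 3 "[0,1,3]"]
        face_face[OF X \<Psi>(1), of "[0,1,2,4]" 3 "[0,2,3]"] face_face[OF X \<Psi>(1), of "[0,2,3,4]" 3 "[0,1,3]"]
      by (simp_all add: vertex_list_def)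
    then show "face_of X 3 [0, 1, 3] (face_of X 4 [0, 1, 2, 4] \<Psi>) = face_of X 1 [0, 1, 1] u"
      "face_of X 3 [0, 2, 3] (face_of X 4 [0, 1, 2, 4] \<Psi>) = face_of X 1 [0, 0, 1] u" using \<iota>(3) \<mu>f(4) by simp_all
  qed
qed

end

section \<open>Subdividing the root vertex\<close>

lemma restrictsI:
  assumes "is_tree U" "is_tree W" "edges U \<subseteq> edges W"
    and v: "\<And>es e. (set es, e) \<in> verts U \<Longrightarrow> distinct es \<Longrightarrow> (es, e) \<in> tree_ops W"
  shows "restricts U W"
proof -
  have "edge_mor U (\<lambda>e. e) \<in> Hom Omega U W" by (rule edge_mor_hom[OF assms(1,2)]) (use assms(3) v in auto)
  from Omega_hom_fun(2)[OF this] show ?thesis using assms(3) unfolding edge_mor_def restricts_def by (auto simp: Pi_iff)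
qed

lemma restricts_edges: "restricts U W \<Longrightarrow> e \<in> edges U \<Longrightarrow> e \<in> edges W"
  by (auto simp: restricts_def)

lemma above_top: "is_tree U \<Longrightarrow> (I, e) \<in> verts U \<Longrightarrow> I \<subseteq> leaves U \<Longrightarrow> above U x e \<Longrightarrow> x \<noteq> e \<Longrightarrow> x \<in> I"
  using above_upE above_leaf is_treeD(6) by (metis subsetD)

lemma unary_above: "is_tree U \<Longrightarrow> ({y}, e) \<in> verts U \<Longrightarrow> above U x e \<longleftrightarrow> x = e \<or> above U x y"
  using above_upE above_trans above_input is_treeD(6) by (metis above_refl singletonD singletonI)

text \<open>All inputs of the vertex at \<open>z\<close> lie above \<open>y\<close>, and
  \<open>y\<close> lies above one of them; an antichain with this property is
  \<open>{y}\<close>.\<close>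

lemma unary_vertexI:
  assumes U: "is_tree U" and yz: "above U y z" "y \<noteq> z"
    and le: "\<And>w. above U w z \<Longrightarrow> w \<noteq> z \<Longrightarrow> above U w y"
  shows "({y}, z) \<in> verts U"
proof -
  obtain I y' where I: "(I, z) \<in> verts U" "y' \<in> I" "above U y y'" using above_upE[OF yz] .
  have *: "w = y" if "w \<in> I" for w
  proof -
    have wy: "above U w y" by (rule le) (use above_input[OF I(1) that] input_neq[OF U I(1) that] in auto)
    then have "w = y'" using inputs_antichain[OF U I(1) that I(2) above_refl] I(3) above_trans by blast
    then show ?thesis using wy I(3) above_antisym[OF U] by blast
  qed
  then have "I = {y}" using I(2) by blast
  then show ?thesis using I(1) by simp
qed

lemma horn_cellI:
  assumes "is_tree U" "is_tree S" "d \<in> faces U" "d \<noteq> d'" "\<alpha> \<in> Hom Omega S (face_tree U d)"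
  shows "\<alpha> \<in> Cell (horn U d') S"
  using horn_cell_iff[OF assms(1,2)] assms(3-5) by blast

context
  fixes U S :: tree and \<alpha> :: tree_mor and c :: nat
  assumes U: "is_tree U" and S: "is_tree S" and \<alpha>: "\<alpha> \<in> Hom Omega S U"
begin

text \<open>The three lemmas of this context are the ways in which a cell of a face of the
  subdivided tree is shown to lie in an inner horn: it misses an inner edge, a top vertex or the
  root.\<close>

lemma in_horn_contract:
  assumes "e \<in> inner_edges U" "e \<noteq> c" "e \<notin> fst \<alpha> ` edges S" shows "\<alpha> \<in> Cell (horn U (Inner c)) S"
proof (rule horn_cellI[OF U S])
  show "\<alpha> \<in> Hom Omega S (face_tree U (Inner e))" using hom_contract_iff[OF S U assms(1), of \<alpha>] \<alpha> assms(3) by simp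
qed (use assms in \<open>auto simp: faces_def\<close>)

lemma in_horn_top:
  assumes "(I, e) \<in> verts U" "I \<subseteq> leaves U" "e \<noteq> root U" "I \<inter> fst \<alpha> ` edges S = {}" "\<not> escapes U S (fst \<alpha>) e"
  shows "\<alpha> \<in> Cell (horn U (Inner c)) S"
proof (rule horn_cellI[OF U S])
  show "\<alpha> \<in> Hom Omega S (face_tree U (Outer (I, e)))"
    using hom_prune_top_iff[OF S U assms(1-3), of \<alpha>] \<alpha> assms(4,5) by simp
qed (use prune_top_edges(1)[OF U assms(1-3)] in \<open>auto simp: faces_def\<close>)

lemma in_horn_root:
  assumes "({x}, root U) \<in> verts U" "x \<notin> leaves U" "root U \<notin> fst \<alpha> ` edges S"
  shows "\<alpha> \<in> Cell (horn U (Inner c)) S"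
proof (rule horn_cellI[OF U S])
  show "\<alpha> \<in> Hom Omega S (face_tree U (Outer ({x}, root U)))"
    using hom_prune_root_iff[OF S U assms(1,2), of \<alpha>] \<alpha> assms(3) by simp
qed (use prune_root_edges(1)[OF U assms(1,2)] in \<open>auto simp: faces_def\<close>)

end

text \<open>\<open>av\<close> makes \<open>a\<close> an inner edge of \<open>T\<close>, and later of
  \<open>W\<close>; this is what turns left horns into inner ones. \<open>c1\<close> and
  \<open>c2\<close> name the edges added by the subdivision.\<close>

locale unary_root =
  fixes T :: tree and a c1 c2 :: nat and I0 :: "nat set"
  assumes T: "is_tree T" and ra: "({a}, root T) \<in> verts T" and av: "(I0, a) \<in> verts T"
    and fresh: "c1 \<notin> edges T" "c2 \<notin> edges T" "c1 \<noteq> c2"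
begin

abbreviation "b \<equiv> root T"

text \<open>
  If \<open>F\<close> denotes the forest above the edge \<open>a\<close>, then \<open>W\<close> is the join \<open>F \<star> \<Delta>[3]\<close>, the edges
  \<open>a, c1, c2, b\<close> being the vertices \<open>0, 1, 2, 3\<close> of \<open>\<Delta>[3]\<close>, and \<open>L\<close> is \<open>\<Delta>[3]\<close> itself.
\<close>

definition W :: tree where
  "W = \<lparr>edges = edges T \<union> {c1, c2},
        verts = verts T - {({a}, b)} \<union> {({a}, c1), ({c1}, c2), ({c2}, b)}, root = b\<rparr>"

definition L :: tree where
  "L = \<lparr>edges = {a, c1, c2, b}, verts = {({a}, c1), ({c1}, c2), ({c2}, b)}, root = b\<rparr>"

lemma aT: "a \<in> edges T" "b \<in> edges T" "a \<noteq> b" "a \<noteq> c1" "a \<noteq> c2" "b \<noteq> c1" "b \<noteq> c2"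
  using is_treeD(2,3,5)[OF T] ra fresh by auto

lemma W_sel [simp]: "edges W = edges T \<union> {c1, c2}" "root W = b"
  by (simp_all add: W_def)

lemma W_verts: "(I, e) \<in> verts W \<longleftrightarrow> ((I, e) \<in> verts T \<and> e \<noteq> b) \<or> (I = {a} \<and> e = c1) \<or> (I = {c1} \<and> e = c2) \<or> (I = {c2} \<and> e = b)"
  using is_treeD(6)[OF T ra, of I] ra by (auto simp: W_def)

lemma W_tree: "is_tree W"
proof (rule is_treeI)
  show "finite (edges W)" "root W \<in> edges W" using is_treeD(1,2)[OF T] by auto
  show "I \<subseteq> edges W \<and> e \<in> edges W \<and> root W \<notin> I" if "(I, e) \<in> verts W" for I e
    using that aT is_treeD(3,4,5)[OF T, of I e] unfolding W_verts by auto
  show "I = J" if "(I, e) \<in> verts W" "(J, e) \<in> verts W" for I J e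
    using that aT fresh is_treeD(4)[OF T, of _ e] is_treeD(6)[OF T, of I e J] unfolding W_verts by blast
  show "I = J \<and> e = f" if v: "(I, e) \<in> verts W" "(J, f) \<in> verts W" "x \<in> I" "x \<in> J" for I J e f x
  proof -
    have 1: "K \<subseteq> edges T" "a \<notin> K" if "(K, y) \<in> verts T" "y \<noteq> b" for K y
      using is_treeD(3)[OF T that(1)] is_treeD(7)[OF T that(1) ra, of a] that(2) by auto
    consider "(I, e) \<in> verts T \<and> e \<noteq> b" "(J, f) \<in> verts T \<and> f \<noteq> b"
      | "(I, e) \<in> verts T \<and> e \<noteq> b" "J \<subseteq> {a, c1, c2}" | "I \<subseteq> {a, c1, c2}" "(J, f) \<in> verts T \<and> f \<noteq> b"
      | "(I, e) \<in> {({a}, c1), ({c1}, c2), ({c2}, b)}" "(J, f) \<in> {({a}, c1), ({c1}, c2), ({c2}, b)}"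
    proof -
      have "((K, y) \<in> verts T \<and> y \<noteq> b) \<or> (K \<subseteq> {a, c1, c2} \<and> (K, y) \<in> {({a}, c1), ({c1}, c2), ({c2}, b)})"
        if "(K, y) \<in> verts W" for K y using that unfolding W_verts by auto
      from this[OF v(1)] this[OF v(2)] show ?thesis using that by meson
    qed
    then show ?thesis
    proof cases
      case 1 then show ?thesis using is_treeD(7)[OF T _ _ v(3,4)] by blast
    next
      case 2 then show ?thesis using 1[of I e] v(3,4) fresh by blast
    next
      case 3 then show ?thesis using 1[of J f] v(3,4) fresh by blast
    next
      case 4 then show ?thesis using v(3,4) aT fresh by auto
    qed
  qed
  have s: "(a, c1) \<in> tree_step W" "(c1, c2) \<in> tree_step W" "(c2, b) \<in> tree_step W"
    by (auto simp: tree_step_iff W_verts)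
  have "(e, b) \<in> (tree_step T)\<^sup>* \<Longrightarrow> (e, b) \<in> (tree_step W)\<^sup>*" for e
  proof (induction rule: converse_rtrancl_induct)
    case (step y z)
    then obtain K where K: "(K, z) \<in> verts T" "y \<in> K" by (auto simp: tree_step_iff)
    show ?case
    proof (cases "z = b")
      case True
      then have "y = a" using K is_treeD(6)[OF T ra] by blast
      then show ?thesis using s by (meson converse_rtrancl_into_rtrancl rtrancl.rtrancl_refl)
    next
      case False
      then have "(y, z) \<in> tree_step W" using K by (auto simp: tree_step_iff W_verts)
      then show ?thesis using step(3) by (rule converse_rtrancl_into_rtrancl)
    qed
  qed simp
  then show "(e, root W) \<in> (tree_step W)\<^sup>*" if "e \<in> edges W" for e
    using that is_treeD(8)[OF T] s by (auto intro: converse_rtrancl_into_rtrancl)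
qed

lemma unary_op: "([x], y) \<in> tree_ops V \<Longrightarrow> (es, x) \<in> tree_ops V \<Longrightarrow> (es, y) \<in> tree_ops V"
  using tree_ops.compose[of "[(es, x)]" y V] by simp

lemma W_ops: "([a], c1) \<in> tree_ops W" "([c1], c2) \<in> tree_ops W" "([c2], b) \<in> tree_ops W"
  "([a], b) \<in> tree_ops W" "([a], c2) \<in> tree_ops W"
proof -
  show 1: "([a], c1) \<in> tree_ops W" "([c1], c2) \<in> tree_ops W" "([c2], b) \<in> tree_ops W"
    by (auto intro!: tree_ops.vert simp: W_verts)
  show 2: "([a], c2) \<in> tree_ops W" using unary_op[OF 1(2,1)] .
  show "([a], b) \<in> tree_ops W" using unary_op[OF 1(3) 2] .
qed

text \<open>This is the copy \<open>F \<star> \<Delta>{0,3}\<close> of \<open>T\<close>; the copy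
  over \<open>{2,3}\<close> is given by \<open>\<rho>\<close> below.\<close>

lemma T_restricts: "restricts T W"
proof (rule restrictsI[OF T W_tree])
  fix es e assume v: "(set es, e) \<in> verts T" "distinct es"
  show "(es, e) \<in> tree_ops W"
  proof (cases "e = b")
    case True
    then have s: "set es = {a}" using is_treeD(6)[OF T ra] v(1) by blast
    moreover have "length es = 1" using distinct_card[OF v(2)] s by simp
    ultimately have "es = [a]" by (cases es) auto
    then show ?thesis using W_ops(4) True by simp
  next
    case False then show ?thesis using v by (intro tree_ops.vert) (auto simp: W_verts)
  qed
qed auto

lemma above_T: "x \<in> edges T \<Longrightarrow> y \<in> edges T \<Longrightarrow> above T x y \<longleftrightarrow> above W x y"
  by (rule restricts_above[OF T W_tree T_restricts])

lemma W_leaves: "leaves W = leaves T"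
  using aT fresh ra is_treeD(4)[OF T] by (intro set_eqI) (auto simp: leaves_iff W_verts)

lemma W_chain:
  "above W x b \<longleftrightarrow> x \<in> edges W"
  "above W x c2 \<longleftrightarrow> x \<in> edges W - {b}"
  "above W x c1 \<longleftrightarrow> x \<in> edges W - {b, c2}"
  "above W x a \<longleftrightarrow> x \<in> edges W - {b, c2, c1}"
proof -
  have v: "({c2}, b) \<in> verts W" "({c1}, c2) \<in> verts W" "({a}, c1) \<in> verts W" by (auto simp: W_verts)
  note n = not_above_input[OF W_tree v(1)] not_above_input[OF W_tree v(2)] not_above_input[OF W_tree v(3)]
  note u = unary_above[OF W_tree v(1)] unary_above[OF W_tree v(2)] unary_above[OF W_tree v(3)]
  show 1: "above W x b \<longleftrightarrow> x \<in> edges W" for x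
    using above_root[OF W_tree] above_edges[OF W_tree] aT by auto
  show 2: "above W x c2 \<longleftrightarrow> x \<in> edges W - {b}" for x using 1[of x] u(1)[of x] n(1) by auto
  show 3: "above W x c1 \<longleftrightarrow> x \<in> edges W - {b, c2}" for x using 2[of x] u(2)[of x] n(2) aT by auto
  show "above W x a \<longleftrightarrow> x \<in> edges W - {b, c2, c1}" using 3[of x] u(3)[of x] n(3) aT by auto
qed

lemma chain_comparable:
  assumes "x \<in> {a, c1, c2, b}" "y \<in> edges W" shows "above W x y \<or> above W y x"
  using assms W_chain aT fresh by auto

lemma L_tree: "is_tree L" and L_leaves: "leaves L = {a}" and L_restricts: "restricts L W"
proof -
  have E: "edges L = {a, c1, c2, b}" "root L = b" by (simp_all add: L_def)
  have V: "(I, e) \<in> verts L \<longleftrightarrow> (I = {a} \<and> e = c1) \<or> (I = {c1} \<and> e = c2) \<or> (I = {c2} \<and> e = b)" for I e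
    by (auto simp: L_def)
  have s: "(a, c1) \<in> tree_step L" "(c1, c2) \<in> tree_step L" "(c2, b) \<in> tree_step L"
    by (auto simp: tree_step_iff V)
  show t: "is_tree L"
    by (rule is_treeI) (use aT fresh s in \<open>auto simp: E V intro: converse_rtrancl_into_rtrancl\<close>)
  show "leaves L = {a}" using aT fresh by (intro set_eqI) (auto simp: leaves_iff V E)
  show "restricts L W"
  proof (rule restrictsI[OF t W_tree])
    show "edges L \<subseteq> edges W" using aT by (auto simp: E)
    show "(es, e) \<in> tree_ops W" if "(set es, e) \<in> verts L" "distinct es" for es e
      by (rule tree_ops.vert[OF _ that(2)]) (use that(1) in \<open>unfold V W_verts, blast\<close>)
  qed
qed

lemma L_edges [simp]: "edges L = {a, c1, c2, b}"
  by (simp add: L_def)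

lemma L_hom_iff:
  assumes "is_tree S"
  shows "\<alpha> \<in> Hom Omega S L \<longleftrightarrow> \<alpha> \<in> Hom Omega S W \<and> fst \<alpha> ` edges S \<subseteq> {a, c1, c2, b} \<and> \<not> escapes W S (fst \<alpha>) a"
  using hom_restricts_iff[OF L_tree W_tree L_restricts assms] L_leaves by simp

text \<open>
  \<open>first_base\<close> is \<open>F \<star> (\<Delta>{0,1,3} \<union> \<Delta>{0,2,3}) \<union> \<Delta>[3]\<close>.  A further nondegenerate cell of \<open>F \<star> \<Delta>[3]\<close> involves the
  vertices \<open>1\<close> and \<open>2\<close>; the faces satisfying \<open>first_face\<close> are those which also contain the vertex \<open>0\<close>, and attaching
  such a face along its inner horn at the edge \<open>a\<close> adds its face without \<open>0\<close> as well.
\<close>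

definition first_base :: "tree \<Rightarrow> tree_mor set" where
  "first_base S = {\<alpha> \<in> Hom Omega S W. c1 \<notin> fst \<alpha> ` edges S \<or> c2 \<notin> fst \<alpha> ` edges S \<or> \<alpha> \<in> Hom Omega S L}"

text \<open>The common part of \<open>first_face\<close> and \<open>second_face\<close>. It suffices
  to determine the root and to make \<open>c1\<close> inner, and so to identify the faces of
  \<open>U\<close>.\<close>

definition spans :: "tree \<Rightarrow> bool" where
  "spans U \<longleftrightarrow> is_tree U \<and> restricts U W \<and> c1 \<in> edges U \<and> c2 \<in> edges U \<and> c1 \<notin> leaves U"

context
  fixes U :: tree
  assumes spans: "spans U"
begin

lemma span_tree: "is_tree U" "restricts U W" and span_edges: "c1 \<in> edges U" "c2 \<in> edges U"
  using spans by (auto simp: spans_def)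

lemma span_above: "x \<in> edges U \<Longrightarrow> y \<in> edges U \<Longrightarrow> above U x y \<longleftrightarrow> above W x y"
  by (rule restricts_above[OF span_tree(1) W_tree span_tree(2)])

lemma span_not_leaf: "c1 \<notin> leaves U" "c2 \<notin> leaves U"
proof -
  show "c1 \<notin> leaves U" using spans by (simp add: spans_def)
  have "above U c1 c2" using span_above span_edges W_chain aT by auto
  then show "c2 \<notin> leaves U" using above_leaf fresh by metis
qed

lemma span_root: "root U = (if b \<in> edges U then b else c2)"
proof -
  note r = is_treeD(2)[OF span_tree(1)]
  have R: "root U \<in> edges W" using restricts_edges[OF span_tree(2) r] .
  have top: "above W x (root U)" if "x \<in> edges U" for x
    using above_root[OF span_tree(1) that] span_above[OF that r] by simp
  show ?thesis
  proof (cases "b \<in> edges U")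
    case True
    then show ?thesis using top[OF True] root_above[OF W_tree, of "root U"] by simp
  next
    case False
    then have "root U \<noteq> b" using r by auto
    then have "above W (root U) c2" using R W_chain(2) by simp
    then show ?thesis using top[OF span_edges(2)] above_antisym[OF W_tree] False by simp
  qed
qed

text \<open>The chain has no side branches below \<open>c1\<close>, so the root vertex is unary, and
  pruning it is a face of \<open>U\<close>.\<close>

lemma span_root_vertex: obtains x where "({x}, root U) \<in> verts U" "x \<notin> leaves U" "root U \<noteq> b \<Longrightarrow> x = c1"
proof (cases "b \<in> edges U")
  case True
  have "({c2}, b) \<in> verts U"
  proof (rule unary_vertexI[OF span_tree(1)])
    show "above U c2 b" using span_above[OF span_edges(2) True] W_chain(1) by simp
    show "above U w c2" if w: "above U w b" "w \<noteq> b" for w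
    proof -
      have "w \<in> edges U" by (rule above_edges[OF span_tree(1) w(1) True])
      then show ?thesis using span_above[OF _ span_edges(2)] W_chain(2) w(2) restricts_edges[OF span_tree(2)] by auto
    qed
  qed (use aT in auto)
  then show ?thesis using that span_root True span_not_leaf(2) by simp
next
  case False
  have "({c1}, c2) \<in> verts U"
  proof (rule unary_vertexI[OF span_tree(1)])
    show "above U c1 c2" using span_above[OF span_edges] W_chain(2) aT by simp
    show "above U w c1" if w: "above U w c2" "w \<noteq> c2" for w
    proof -
      have e: "w \<in> edges U" by (rule above_edges[OF span_tree(1) w(1) span_edges(2)])
      then have "w \<noteq> b" using False by auto
      then show ?thesis using span_above[OF e span_edges(1)] W_chain(3) w(2) restricts_edges[OF span_tree(2) e] by auto
    qed
  qed (use fresh in auto)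
  then show ?thesis using that span_root False span_not_leaf(1) by simp
qed

lemma span_inner: "c1 \<in> inner_edges U" "b \<in> edges U \<Longrightarrow> c2 \<in> inner_edges U"
  using span_edges span_not_leaf span_root aT fresh by (auto simp: inner_edges_def)

end

section \<open>First stage: horns at the vertex 0\<close>

definition first_face :: "tree \<Rightarrow> bool" where
  "first_face U \<longleftrightarrow> is_tree U \<and> restricts U W \<and> a \<in> edges U \<and> c1 \<in> edges U \<and> c2 \<in> edges U \<and> a \<notin> leaves U"

lemma first_face_W: "first_face W"
  using W_tree restricts_refl[of W] aT av by (auto simp: first_face_def W_leaves leaves_iff)

context
  fixes U :: tree
  assumes first_face: "first_face U"
begin

lemma first_face_spans: "spans U"
proof -
  have U: "is_tree U" "restricts U W" "a \<in> edges U" "c1 \<in> edges U" "c2 \<in> edges U" using first_face by (auto simp: first_face_def)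
  have "above U a c1" using restricts_above[OF U(1) W_tree U(2-4)] W_chain aT by auto
  then have "c1 \<notin> leaves U" using above_leaf aT by metis
  then show ?thesis using U by (simp add: spans_def)
qed

lemmas first_face_tree = span_tree[OF first_face_spans]
lemmas first_face_above = span_above[OF first_face_spans]
lemmas first_face_root = span_root[OF first_face_spans]
lemmas first_face_root_vertex = span_root_vertex[OF first_face_spans]

lemma first_face_edges: "a \<in> edges U" "c1 \<in> edges U" "c2 \<in> edges U"
  using first_face by (auto simp: first_face_def)

lemma first_face_not_leaf: "a \<notin> leaves U" "c1 \<notin> leaves U" "c2 \<notin> leaves U"
  using first_face span_not_leaf[OF first_face_spans] by (auto simp: first_face_def)

lemma first_face_inner:
  "a \<in> inner_edges U" "c1 \<in> inner_edges U" "b \<in> edges U \<Longrightarrow> c2 \<in> inner_edges U"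
  using first_face_edges first_face_not_leaf first_face_root aT fresh span_inner[OF first_face_spans] by (auto simp: inner_edges_def)

text \<open>Faces leave the family in two ways, and both lead into the base: \<open>c1\<close> or
  \<open>c2\<close> is lost, or the vertex at \<open>a\<close> is pruned, after which nothing of
  \<open>F\<close> remains.\<close>

lemma first_face_faces:
  assumes d: "d \<in> faces U - {Inner a}"
  shows "(\<forall>S. is_tree S \<longrightarrow> Hom Omega S (face_tree U d) \<subseteq> first_base S) \<or>
    (first_face (face_tree U d) \<and> tree_size (face_tree U d) < tree_size U)"
proof -
  note U = first_face_tree(1)
  have df: "d \<in> faces U" using d by blast
  let ?V = "face_tree U d"
  have V: "is_tree ?V" "restricts ?V W"
    using face_map_hom(1)[OF U df] restricts_trans[OF face_restricts[OF U df] first_face_tree(2)] by auto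
  have VW: "\<alpha> \<in> Hom Omega S W" if "is_tree S" "\<alpha> \<in> Hom Omega S ?V" for S \<alpha>
    using restricts_hom[OF that(1) V(2) that(2)] .
  have miss: "Hom Omega S ?V \<subseteq> first_base S" if "is_tree S" "x \<in> {c1, c2}" "x \<notin> edges ?V" for S x
    using VW[OF that(1)] hom_edge[of _ S ?V] that(2,3) by (fastforce simp: first_base_def)
  show ?thesis using U df
  proof (cases rule: faces_cases)
    case (inner e)
    note E = contract_edges[OF U inner(2)]
    show ?thesis
    proof (cases "e \<in> {c1, c2}")
      case True
      then show ?thesis using miss[of _ e] inner(1) E by auto
    next
      case False
      then have "first_face ?V" using V inner(1) d E first_face_edges first_face_not_leaf by (auto simp: first_face_def)
      moreover have "tree_size ?V < tree_size U"
        by (rule tree_size_less[OF U]) (use inner E in \<open>auto simp: inner_edges_def\<close>)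
      ultimately show ?thesis by blast
    qed
  next
    case (top I e)
    note E = prune_top_edges[OF U top(2-4)]
    show ?thesis
    proof (cases "e = a")
      case True
      have "Hom Omega S ?V \<subseteq> first_base S" if S: "is_tree S" for S
      proof
        fix \<alpha> assume \<alpha>: "\<alpha> \<in> Hom Omega S ?V"
        have eV: "edges ?V \<subseteq> {a, c1, c2, b}"
        proof
          fix x assume "x \<in> edges ?V"
          then have x: "x \<in> edges U" "x \<notin> I" using E(2) top(1) by auto
          show "x \<in> {a, c1, c2, b}"
          proof (rule ccontr)
            assume "x \<notin> {a, c1, c2, b}"
            then have "above W x a" "x \<noteq> a" using W_chain(4) restricts_edges[OF first_face_tree(2) x(1)] by auto
            then have "above U x a" using first_face_above[OF x(1) first_face_edges(1)] by simp
            then show False using above_top[OF U top(2,3)] True \<open>x \<noteq> a\<close> x(2) by blast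
          qed
        qed
        have "a \<in> leaves ?V" using E(3) top(1) True by simp
        then have "\<not> escapes W S (fst \<alpha>) a" using hom_restricts_iff[OF V(1) W_tree V(2) S] \<alpha> by blast
        moreover have "fst \<alpha> ` edges S \<subseteq> edges ?V" using hom_edge[OF \<alpha>] by blast
        ultimately have "\<alpha> \<in> Hom Omega S L" using L_hom_iff[OF S] VW[OF S \<alpha>] eV by blast
        then show "\<alpha> \<in> first_base S" using VW[OF S \<alpha>] by (simp add: first_base_def)
      qed
      then show ?thesis by blast
    next
      case False
      have "first_face ?V" using V top(1,3) E False first_face_edges first_face_not_leaf by (auto simp: first_face_def)
      moreover have "e \<notin> leaves U" using top(2) by (simp add: leaves_iff) blast
      then have "tree_size ?V < tree_size U"
        by (intro tree_size_less[OF U]) (use top(1) E in auto)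
      ultimately show ?thesis by blast
    qed
  next
    case (root I)
    obtain x where x: "({x}, root U) \<in> verts U" "x \<notin> leaves U" by (rule first_face_root_vertex)
    have I: "I = {x}" using is_treeD(6)[OF U x(1) root(2)] by simp
    note E = prune_root_edges[OF U x]
    show ?thesis
    proof (cases "b \<in> edges U")
      case True
      then have "first_face ?V" using V root(1) I E first_face_edges first_face_not_leaf first_face_root aT by (auto simp: first_face_def)
      moreover have "tree_size ?V < tree_size U"
        by (rule tree_size_less[OF U]) (use root(1) I E is_treeD(2)[OF U] in auto)
      ultimately show ?thesis by blast
    next
      case False
      then have "c2 \<notin> edges ?V" using E root(1) I first_face_root by simp
      then show ?thesis using miss[of _ c2] by simp
    qed
  qed
qed

lemma first_face_base:
  assumes S: "is_tree S" and \<alpha>: "\<alpha> \<in> first_base S" "\<alpha> \<in> Hom Omega S U"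
  shows "\<alpha> \<in> Cell (horn U (Inner a)) S"
proof -
  note U = first_face_tree(1)
  have "c1 \<notin> fst \<alpha> ` edges S \<or> c2 \<notin> fst \<alpha> ` edges S \<or> \<alpha> \<in> Hom Omega S L" using \<alpha>(1) by (simp add: first_base_def)
  then consider "c1 \<notin> fst \<alpha> ` edges S" | "c2 \<notin> fst \<alpha> ` edges S" "b \<in> edges U" | "c2 \<notin> fst \<alpha> ` edges S" "b \<notin> edges U"
    | "\<alpha> \<in> Hom Omega S L" by blast
  then show ?thesis
  proof cases
    case 1 then show ?thesis using in_horn_contract[OF U S \<alpha>(2) first_face_inner(2)] aT by simp
  next
    case 2 then show ?thesis using in_horn_contract[OF U S \<alpha>(2) first_face_inner(3)] aT by simp
  next
    case 3
    obtain x where "({x}, root U) \<in> verts U" "x \<notin> leaves U" by (rule first_face_root_vertex)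
    then show ?thesis using in_horn_root[OF U S \<alpha>(2)] 3 first_face_root by simp
  next
    case 4
    \<comment> \<open>A cell of \<open>L\<close> has no edge in \<open>F\<close> and does not escape
      at \<open>a\<close>, so it survives the pruning of a top vertex above
      \<open>a\<close>.\<close>
    then have l: "fst \<alpha> ` edges S \<subseteq> {a, c1, c2, b}" "\<not> escapes W S (fst \<alpha>) a" using L_hom_iff[OF S] by auto
    obtain J where "(J, a) \<in> verts U" using first_face_not_leaf(1) first_face_edges(1) by (auto simp: leaves_iff)
    then obtain I e where I: "(I, e) \<in> verts U" "above U e a" "I \<subseteq> leaves U" using exists_top_above[OF U] by metis
    have e: "e \<in> edges U" using is_treeD(4)[OF U I(1)] .
    have ea: "above W e a" using I(2) first_face_above[OF e first_face_edges(1)] by simp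
    have "e \<noteq> root U" using ea W_chain(4) first_face_root by auto
    moreover have "I \<inter> fst \<alpha> ` edges S = {}"
    proof (rule ccontr)
      assume "\<not> ?thesis"
      then obtain x where x: "x \<in> I" "x \<in> {a, c1, c2, b}" using l(1) by blast
      have xU: "x \<in> edges U" using is_treeD(3)[OF U I(1)] x(1) by blast
      have "above U x e" "x \<noteq> e" using above_input[OF I(1) x(1)] input_neq[OF U I(1) x(1)] by auto
      then have "above W x e" using first_face_above[OF xU e] by simp
      then have "above W x a" using ea above_trans by blast
      then have "x = a" using x(2) W_chain(4) by auto
      then show False using x(1) I(3) first_face_not_leaf(1) by blast
    qed
    moreover have "\<not> escapes W S (fst \<alpha>) e"
    proof
      assume "escapes W S (fst \<alpha>) e"
      then obtain J z where v: "(J, z) \<in> verts S" "above W e (fst \<alpha> z)" "\<forall>j\<in>J. \<not> above W e (fst \<alpha> j)"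
        by (auto simp: escapes_def)
      have "z \<in> edges S" using is_treeD(4)[OF S v(1)] .
      then have "above W a (fst \<alpha> z)" using l(1) W_chain aT by auto
      then show False using not_escapesD[OF l(2) v(1)] v(3) ea above_trans by blast
    qed
    then have "\<not> escapes U S (fst \<alpha>) e" using restricts_escapes[OF S U W_tree first_face_tree(2) \<alpha>(2) e] by simp
    ultimately show ?thesis using in_horn_top[OF U S \<alpha>(2) I(1,3)] by simp
  qed
qed

text \<open>A common cell of \<open>U\<close> and \<open>V\<close> has to miss some part of
  \<open>U\<close> that \<open>V\<close> lacks. The work lies in turning this into an elementary
  face other than the contraction of \<open>a\<close>, in particular when the missing edge is a
  leaf.\<close>

lemma first_face_meet:
  assumes V: "first_face V" "U \<noteq> V" "tree_size V \<le> tree_size U"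
    and S: "is_tree S" and \<alpha>: "\<alpha> \<in> Hom Omega S U" "\<alpha> \<in> Hom Omega S V"
  shows "\<alpha> \<in> Cell (horn U (Inner a)) S"
proof -
  note U = first_face_tree(1)
  have V': "is_tree V" "restricts V W" "a \<in> edges V" "c1 \<in> edges V" "c2 \<in> edges V" using V(1) by (auto simp: first_face_def)
  obtain r where r: "({r}, root U) \<in> verts U" "r \<notin> leaves U" by (rule first_face_root_vertex)
  \<comment> \<open>Faces are determined by their edges and leaves, and \<open>U\<close> is not the
    smaller one; so \<open>V\<close> lacks an edge of \<open>U\<close>, or \<open>V\<close> has a
    leaf which is an edge but not a leaf of \<open>U\<close>.\<close>
  have "\<not> (edges U \<subseteq> edges V \<and> leaves V \<inter> edges U \<subseteq> leaves U)"
    using tree_size_less[OF V'(1), of U] restricts_tree_eq[OF W_tree U first_face_tree(2) V'(1,2)] V(2,3) by (meson leD)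
  then consider (root) "root U \<notin> fst \<alpha> ` edges S"
    | (edge) t where "root U \<in> fst \<alpha> ` edges S" "t \<in> edges U" "t \<notin> edges V"
    | (leaf) l where "edges U \<subseteq> edges V" "l \<in> leaves V" "l \<in> edges U" "l \<notin> leaves U" by blast
  then show ?thesis
  proof cases
    case root
    show ?thesis by (rule in_horn_root[OF U S \<alpha>(1) r root])
  next
    case (edge t)
    have t: "t \<notin> fst \<alpha> ` edges S" using edge(3) hom_edge[OF \<alpha>(2)] by blast
    have tr: "t \<noteq> root U" using t edge(1) by blast
    show ?thesis
    proof (cases "t \<in> leaves U")
      case False
      then have "t \<in> inner_edges U" using edge(2) tr by (simp add: inner_edges_def)
      moreover have "t \<noteq> a" using V'(3) edge(3) by blast
      ultimately show ?thesis using in_horn_contract[OF U S \<alpha>(1) _ _ t] by simp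
    next
      case True
      obtain I e where I: "(I, e) \<in> verts U" "t \<in> I"
        using above_downE[OF above_root[OF U edge(2)] tr] by metis
      have er: "e \<noteq> root U" using is_treeD(6)[OF U r(1)] I r(2) True by blast
      have te: "above U t e" by (rule above_input[OF I])
      \<comment> \<open>The leaf \<open>t\<close> is not in the image, so an image edge below
        \<open>t\<close> is even below \<open>e\<close>. As every operation has to cover the leaf
        \<open>t\<close>, the cell does not escape at \<open>e\<close>.\<close>
      have below: "above U e (fst \<alpha> j)" if "above U t (fst \<alpha> j)" "j \<in> edges S" for j
        using above_below_input[OF U I that(1)] t that(2) by blast
      have cover: "\<exists>j\<in>J. above U e (fst \<alpha> j)" if "(J, z) \<in> verts S" "above U e (fst \<alpha> z)" for J z
        using hom_vertex(3)[OF S U \<alpha>(1) that(1) True] te that(2) above_trans below is_treeD(3)[OF S that(1)] by blast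
      have rS: "fst \<alpha> (root S) = root U"
      proof -
        obtain s where "s \<in> edges S" "fst \<alpha> s = root U" using edge(1) by auto
        then show ?thesis using hom_above[OF S U \<alpha>(1) above_root[OF S]] root_above[OF U] by metis
      qed
      \<comment> \<open>The image contains no edge strictly above \<open>e\<close>: on the way from
        \<open>s\<close> to the root, whose image is not above \<open>e\<close>, the operation
        passing \<open>e\<close> would have two comparable inputs. Hence a top vertex over
        \<open>e\<close> can be pruned.\<close>
      have na: "fst \<alpha> s = e" if s: "s \<in> edges S" "above U (fst \<alpha> s) e" for s
      proof -
        have "(s, root S) \<in> (tree_step S)\<^sup>*" using is_treeD(8)[OF S s(1)] .
        then have "above U (fst \<alpha> s) e \<longrightarrow> fst \<alpha> s = e"
        proof (induction rule: converse_rtrancl_induct)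
          case base then show ?case using rS root_above[OF U] er by metis
        next
          case (step s s')
          then obtain J where J: "(J, s') \<in> verts S" "s \<in> J" by (auto simp: tree_step_iff)
          show ?case
          proof
            assume ab: "above U (fst \<alpha> s) e"
            have "above U (fst \<alpha> s) (fst \<alpha> s')" by (rule hom_vertex(1)[OF S U \<alpha>(1) J])
            then have "above U e (fst \<alpha> s')" using above_linear[OF U ab] step(3) by (metis above_refl)
            then obtain j where j: "j \<in> J" "above U e (fst \<alpha> j)" using cover[OF J(1)] by blast
            then have "s = j" using hom_vertex(2)[OF S U \<alpha>(1) J(1) J(2) j(1)] ab above_trans by blast
            then show "fst \<alpha> s = e" using ab j(2) above_antisym[OF U] by blast
          qed
        qed
        then show ?thesis using s(2) by blast
      qed
      obtain I' e' where I': "(I', e') \<in> verts U" "above U e' e" "I' \<subseteq> leaves U" using exists_top_above[OF U I(1)] .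
      have "e' \<noteq> root U" using I'(2) root_above[OF U] er by blast
      moreover have "I' \<inter> fst \<alpha> ` edges S = {}"
      proof (rule ccontr)
        assume "\<not> ?thesis"
        then obtain s where s: "s \<in> edges S" "fst \<alpha> s \<in> I'" by blast
        have x: "above U (fst \<alpha> s) e'" "fst \<alpha> s \<noteq> e'" using above_input[OF I'(1) s(2)] input_neq[OF U I'(1) s(2)] by auto
        then have "fst \<alpha> s = e" using na[OF s(1)] I'(2) above_trans by blast
        then show False using x I'(2) above_antisym[OF U] by blast
      qed
      moreover have "\<not> escapes U S (fst \<alpha>) e'"
      proof
        assume "escapes U S (fst \<alpha>) e'"
        then obtain J z where v: "(J, z) \<in> verts S" "above U e' (fst \<alpha> z)" "\<forall>j\<in>J. \<not> above U e' (fst \<alpha> j)"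
          by (auto simp: escapes_def)
        have "z \<in> edges S" using is_treeD(4)[OF S v(1)] .
        then have "above U e (fst \<alpha> z)" using above_linear[OF U I'(2) v(2)] na by (metis above_refl)
        then show False using cover[OF v(1)] v(3) I'(2) above_trans by blast
      qed
      ultimately show ?thesis using in_horn_top[OF U S \<alpha>(1) I'(1,3)] by simp
    qed
  next
    case (leaf l)
    obtain I where I: "(I, l) \<in> verts U" using leaf(3,4) by (auto simp: leaves_iff)
    \<comment> \<open>An input of this vertex would be an edge of \<open>V\<close> above the leaf
      \<open>l\<close>. So the vertex is nullary, and the cell lies in the face pruning it, since as
      a cell of \<open>V\<close> it does not escape at \<open>l\<close>.\<close>
    have "I = {}"
    proof (rule ccontr)
      assume "I \<noteq> {}"
      then obtain x where x: "x \<in> I" by blast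
      have xl: "above U x l" "x \<noteq> l" using above_input[OF I x] input_neq[OF U I x] by auto
      have e: "x \<in> edges U" using is_treeD(3)[OF U I] x by blast
      then have "above V x l"
        using xl(1) first_face_above[OF e leaf(3)] restricts_above[OF V'(1) W_tree V'(2), of x l] leaf(1,3) by blast
      then show False using above_leaf leaf(2) xl(2) by blast
    qed
    then have "l \<noteq> root U" using is_treeD(6)[OF U r(1)] I by blast
    have lV: "l \<in> edges V" using leaf(1,3) by blast
    have "\<not> escapes V S (fst \<alpha>) l" by (rule hom_leaf_not_escapes[OF S V'(1) \<alpha>(2) leaf(2)])
    then have "\<not> escapes U S (fst \<alpha>) l"
      using restricts_escapes[OF S U W_tree first_face_tree(2) \<alpha>(1) leaf(3)] restricts_escapes[OF S V'(1) W_tree V'(2) \<alpha>(2) lV] by simp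
    then show ?thesis using in_horn_top[OF U S \<alpha>(1) I] \<open>I = {}\<close> \<open>l \<noteq> root U\<close> by simp
  qed
qed

end


text \<open>
  \<open>\<pi>\<close> is induced by the map \<open>(0, 1, 0, 1)\<close> from \<open>[3]\<close> to \<open>[1]\<close>, which is monotone only where the vertex \<open>1\<close>
  or the vertex \<open>2\<close> is missing, \<open>\<rho>\<close> by the inclusion \<open>(2, 3)\<close> of \<open>[1]\<close>; \<open>\<kappa>\<close> identifies \<open>L\<close> with the
  standard linear tree.
\<close>

definition \<pi> :: "nat \<Rightarrow> nat" where
  "\<pi> x = (if x = c2 then a else if x = c1 then b else x)"

definition \<rho> :: "nat \<Rightarrow> nat" where
  "\<rho> x = (if x = a then c2 else x)"

definition \<kappa> :: "nat \<Rightarrow> nat" where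
  "\<kappa> x = (if x = a then 0 else if x = c1 then 1 else if x = c2 then 2 else 3)"

section \<open>The collapse of the join onto the tree and its section\<close>

lemma pi_edges: "x \<in> edges W \<Longrightarrow> \<pi> x \<in> edges T"
  using aT by (auto simp: \<pi>_def)

lemma pi_rho: "x \<in> edges T \<Longrightarrow> \<pi> (\<rho> x) = x"
  using fresh by (auto simp: \<pi>_def \<rho>_def)

lemma above_a_T: "x \<in> edges T \<Longrightarrow> x \<noteq> b \<Longrightarrow> above T x a"
  using above_T[of x a] aT W_chain(4) fresh by auto

lemma above_pi:
  assumes e: "e \<in> edges T" "e \<noteq> b" and x: "x \<in> edges W"
  shows "above W e x \<longleftrightarrow> above T e (\<pi> x)"
proof -
  consider "x = c1" | "x = c2" | "x \<in> edges T" "x \<noteq> c1" "x \<noteq> c2" using x fresh by auto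
  then show ?thesis
  proof cases
    case 1 then show ?thesis using e fresh W_chain(3)[of e] above_root[OF T e(1)] by (auto simp: \<pi>_def)
  next
    case 2 then show ?thesis using e fresh W_chain(2)[of e] above_a_T[OF e] by (auto simp: \<pi>_def)
  next
    case 3 then show ?thesis using above_T[OF e(1) 3(1)] by (simp add: \<pi>_def)
  qed
qed

text \<open>Along the chain \<open>\<pi>\<close> destroys a single relation: \<open>c1\<close> above
  \<open>c2\<close> would become \<open>b\<close> above \<open>a\<close>. This pair is excluded by
  \<open>miss\<close>.\<close>

lemma pi_mono:
  assumes xy: "above W x y" "x \<in> edges W" "y \<in> edges W"
    and miss: "(x \<noteq> c1 \<and> y \<noteq> c1) \<or> (x \<noteq> c2 \<and> y \<noteq> c2)"
  shows "above T (\<pi> x) (\<pi> y)"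
proof (cases "\<pi> x = b")
  case False
  then have px: "\<pi> x \<in> edges T" "\<pi> x \<noteq> b" using pi_edges xy(2) by auto
  show ?thesis
  proof (cases "x = c2")
    case True
    have "y \<in> {c2, b, c1}"
    proof (rule ccontr)
      assume "y \<notin> {c2, b, c1}"
      then have "above W y a" using xy(3) W_chain(4) by blast
      then have "above W c2 a" using xy(1) True above_trans by blast
      then show False using W_chain(4) by auto
    qed
    then have "y = c2 \<or> y = b" using miss True by auto
    then show ?thesis using True above_root[OF T aT(1)] aT by (auto simp: \<pi>_def)
  next
    case False
    then have "\<pi> x = x" using \<open>\<pi> x \<noteq> b\<close> by (auto simp: \<pi>_def split: if_splits)
    then show ?thesis using above_pi[OF px xy(3)] xy(1) by simp
  qed
next
  case True
  then have x: "x = b \<or> x = c1" by (auto simp: \<pi>_def aT split: if_splits)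
  have "\<pi> y = b"
  proof -
    have "y \<in> {c1, c2, b}"
    proof (rule ccontr)
      assume "y \<notin> {c1, c2, b}"
      then have "above W y a" using xy(3) W_chain(4) by blast
      then have "above W x a" using xy(1) above_trans by blast
      then show False using W_chain(4) x by auto
    qed
    moreover have "y \<noteq> c2"
      using x xy(1) W_chain(2) miss by auto
    ultimately show ?thesis using aT fresh by (auto simp: \<pi>_def)
  qed
  then show ?thesis using True by simp
qed

text \<open>Different inputs of a vertex have incomparable images, whereas edges of the chain are
  comparable with everything. So these images lie in \<open>F\<close>, where \<open>\<pi>\<close> is
  the identity.\<close>

lemma push_pi_hom:
  assumes S: "is_tree S" and \<alpha>: "\<alpha> \<in> Hom Omega S W"
    and miss: "c1 \<notin> fst \<alpha> ` edges S \<or> c2 \<notin> fst \<alpha> ` edges S"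
  shows "push S \<pi> \<alpha> \<in> Hom Omega S T"
  unfolding push_def
proof (rule edge_mor_homI[OF S T])
  fix e assume "e \<in> edges S" then show "\<pi> (fst \<alpha> e) \<in> edges T" using pi_edges hom_edge[OF \<alpha>] by blast
next
  fix J z assume v: "(J, z) \<in> verts S"
  note h = hom_vertex[OF S W_tree \<alpha> v]
  have e: "z \<in> edges S" "\<And>j. j \<in> J \<Longrightarrow> j \<in> edges S" using is_treeD(3,4)[OF S v] by auto
  have eW: "fst \<alpha> j \<in> edges W" if "j \<in> edges S" for j by (rule hom_edge[OF \<alpha> that])
  have mono: "above T (\<pi> (fst \<alpha> x)) (\<pi> (fst \<alpha> y))"
    if "x \<in> edges S" "y \<in> edges S" "above W (fst \<alpha> x) (fst \<alpha> y)" for x y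
    by (rule pi_mono[OF that(3) eW[OF that(1)] eW[OF that(2)]]) (use miss that(1,2) in auto)
  have anti: "i = j" if ij: "i \<in> J" "j \<in> J" "above T (\<pi> (fst \<alpha> i)) (\<pi> (fst \<alpha> j))" for i j
  proof (rule ccontr)
    assume n: "i \<noteq> j"
    have nc: "\<not> above W (fst \<alpha> i) (fst \<alpha> j)" "\<not> above W (fst \<alpha> j) (fst \<alpha> i)" using h(2) ij n by blast+
    have "fst \<alpha> i \<notin> {a, c1, c2, b}" using chain_comparable[OF _ eW[OF e(2)[OF ij(2)]]] nc by blast
    then have "fst \<alpha> i \<in> edges T" "fst \<alpha> i \<noteq> b" "\<pi> (fst \<alpha> i) = fst \<alpha> i"
      using eW[OF e(2)[OF ij(1)]] by (auto simp: \<pi>_def)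
    then show False using above_pi[OF _ _ eW[OF e(2)[OF ij(2)]]] ij(3) nc(1) by simp
  qed
  show "inj_on (\<lambda>e. \<pi> (fst \<alpha> e)) J \<and> (\<forall>j\<in>J. above T (\<pi> (fst \<alpha> j)) (\<pi> (fst \<alpha> z))) \<and>
      (\<forall>i\<in>J. \<forall>j\<in>J. above T (\<pi> (fst \<alpha> i)) (\<pi> (fst \<alpha> j)) \<longrightarrow> \<pi> (fst \<alpha> i) = \<pi> (fst \<alpha> j)) \<and>
      (\<forall>l\<in>leaves T. above T l (\<pi> (fst \<alpha> z)) \<longrightarrow> (\<exists>j\<in>J. above T l (\<pi> (fst \<alpha> j))))"
  proof (intro conjI ballI impI)
    show "inj_on (\<lambda>e. \<pi> (fst \<alpha> e)) J" using anti by (intro inj_onI) (metis above_refl)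
    show "above T (\<pi> (fst \<alpha> j)) (\<pi> (fst \<alpha> z))" if "j \<in> J" for j using mono[OF e(2)[OF that] e(1) h(1)[OF that]] .
    show "\<pi> (fst \<alpha> i) = \<pi> (fst \<alpha> j)" if "i \<in> J" "j \<in> J" "above T (\<pi> (fst \<alpha> i)) (\<pi> (fst \<alpha> j))" for i j
      using anti[OF that] by simp
    show "\<exists>j\<in>J. above T l (\<pi> (fst \<alpha> j))" if l: "l \<in> leaves T" "above T l (\<pi> (fst \<alpha> z))" for l
    proof -
      have lT: "l \<in> edges T" "l \<noteq> b" using l(1) ra by (auto simp: leaves_iff)
      have "above W l (fst \<alpha> z)" using above_pi[OF lT eW[OF e(1)]] l(2) by simp
      then obtain j where "j \<in> J" "above W l (fst \<alpha> j)" using h(3) l(1) W_leaves by blast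
      then show ?thesis using above_pi[OF lT eW[OF e(2)]] by blast
    qed
  qed
qed

lemma rho_hom: "edge_mor T \<rho> \<in> Hom Omega T W"
proof (rule edge_mor_hom[OF T W_tree])
  show "\<rho> e \<in> edges W" if "e \<in> edges T" for e using that by (auto simp: \<rho>_def)
  fix es e assume v: "(set es, e) \<in> verts T" "distinct es"
  show "(map \<rho> es, \<rho> e) \<in> tree_ops W"
  proof (cases "e = b")
    case True
    then have s: "set es = {a}" using is_treeD(6)[OF T ra, of "set es"] v(1) by simp
    moreover have "length es = 1" using distinct_card[OF v(2)] s by simp
    ultimately have "es = [a]" by (cases es) auto
    then show ?thesis using W_ops(3) True aT by (simp add: \<rho>_def)
  next
    case False
    then have "(set es, e) \<in> verts W" using v(1) by (simp add: W_verts)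
    then have o: "(es, e) \<in> tree_ops W" using v(2) by (rule tree_ops.vert)
    have "a \<notin> set es" using is_treeD(7)[OF T v(1) ra, of a] False by blast
    then have "map \<rho> es = es" by (auto simp: \<rho>_def intro: map_idI)
    then show ?thesis using o unary_op[OF W_ops(5)] by (auto simp: \<rho>_def)
  qed
qed

lemma push_rho:
  assumes S: "is_tree S" and \<alpha>: "\<alpha> \<in> Hom Omega S T"
  shows "push S \<rho> \<alpha> \<in> Hom Omega S W" "push S \<pi> (push S \<rho> \<alpha>) = \<alpha>"
    "a \<notin> fst (push S \<rho> \<alpha>) ` edges S" "c1 \<notin> fst (push S \<rho> \<alpha>) ` edges S"
proof -
  show "push S \<rho> \<alpha> \<in> Hom Omega S W"
    using Omega_comp[OF S \<alpha> rho_hom] unfolding Comp_Omega precomp_edge_mor[OF S \<alpha>] push_def .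
  have "push S (\<lambda>x. \<pi> (\<rho> x)) \<alpha> = push S (\<lambda>x. x) \<alpha>" by (rule push_cong[OF S]) (use pi_rho hom_edge[OF \<alpha>] in blast)
  then show "push S \<pi> (push S \<rho> \<alpha>) = \<alpha>" unfolding push_push[OF S] push_id[OF \<alpha>] .
  show "a \<notin> fst (push S \<rho> \<alpha>) ` edges S" "c1 \<notin> fst (push S \<rho> \<alpha>) ` edges S"
    using hom_edge[OF \<alpha>] fresh aT by (auto simp: push_def \<rho>_def)
qed

lemma L_kappa: "edge_mor L \<kappa> \<in> Hom Omega L (linear_tree 3)"
proof (rule edge_mor_hom[OF L_tree is_tree_linear])
  show "\<kappa> e \<in> edges (linear_tree 3)" for e by (auto simp: \<kappa>_def)
  fix es e assume v: "(set es, e) \<in> verts L" "distinct es"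
  then obtain x where x: "set es = {x}" "x = a \<and> e = c1 \<or> x = c1 \<and> e = c2 \<or> x = c2 \<and> e = b" by (auto simp: L_def)
  have "length es = 1" using distinct_card[OF v(2)] x by simp
  then have "es = [x]" using x(1) by (cases es) auto
  then show "(map \<kappa> es, \<kappa> e) \<in> tree_ops (linear_tree 3)"
    using x(2) linear_ops[of "\<kappa> e" 3 "\<kappa> x"] aT fresh by (auto simp: \<kappa>_def)
qed

lemma push_kappa:
  assumes "is_tree S" "\<alpha> \<in> Hom Omega S L" shows "push S \<kappa> \<alpha> \<in> Hom Omega S (linear_tree 3)"
  using Omega_comp[OF assms L_kappa] unfolding Comp_Omega precomp_edge_mor[OF assms] push_def .

text \<open>The boundary \<open>\<partial>F \<star> \<Delta>[3]\<close>, and likewise \<open>\<partial>F \<star> \<Delta>[1]\<close> when \<open>V = T\<close>.\<close>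

definition misses_face :: "tree \<Rightarrow> tree \<Rightarrow> (nat \<Rightarrow> nat) \<Rightarrow> bool" where
  "misses_face V S \<phi> \<longleftrightarrow> (\<exists>e\<in>inner_edges T - {a}. e \<notin> \<phi> ` edges S) \<or>
     (\<exists>(I, e)\<in>verts T. I \<subseteq> leaves T \<and> e \<noteq> b \<and> I \<inter> \<phi> ` edges S = {} \<and> \<not> escapes V S \<phi> e)"

definition boundary :: "tree \<Rightarrow> tree_mor set" where
  "boundary S = {\<alpha> \<in> Hom Omega S W. misses_face W S (fst \<alpha>)}"

section \<open>The boundary of the forest and the outer horn\<close>

lemma misses_faceE:
  assumes "misses_face V S \<phi>"
  obtains (inner) e where "e \<in> inner_edges T" "e \<noteq> a" "e \<notin> \<phi> ` edges S"
  | (top) I e where "(I, e) \<in> verts T" "I \<subseteq> leaves T" "e \<noteq> b" "I \<inter> \<phi> ` edges S = {}" "\<not> escapes V S \<phi> e"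
  using assms unfolding misses_face_def by blast

lemma misses_faceI_inner: "e \<in> inner_edges T \<Longrightarrow> e \<noteq> a \<Longrightarrow> e \<notin> \<phi> ` edges S \<Longrightarrow> misses_face V S \<phi>"
  and misses_faceI_top: "(I, e) \<in> verts T \<Longrightarrow> I \<subseteq> leaves T \<Longrightarrow> e \<noteq> b \<Longrightarrow> I \<inter> \<phi> ` edges S = {} \<Longrightarrow>
    \<not> escapes V S \<phi> e \<Longrightarrow> misses_face V S \<phi>"
  unfolding misses_face_def by blast+

text \<open>The faces of \<open>W\<close> that cut into the forest and keep the chain; their union
  is \<open>\<partial>F \<star> \<Delta>[3]\<close>.\<close>

definition FW :: "face set" where
  "FW = Inner ` (inner_edges T - {a}) \<union> {Outer (I, e) | I e. (I, e) \<in> verts T \<and> I \<subseteq> leaves T \<and> e \<noteq> b}"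

lemma inner_T_W: "e \<in> inner_edges T \<Longrightarrow> e \<in> inner_edges W"
  by (auto simp: inner_edge_iff W_verts)

lemma FW_faces: "FW \<subseteq> faces W - {Inner a}"
  using inner_T_W prune_top_edges(1)[OF W_tree] by (auto simp: FW_def faces_def W_verts W_leaves)

lemma boundary_iff:
  assumes S: "is_tree S"
  shows "\<alpha> \<in> boundary S \<longleftrightarrow> (\<exists>d\<in>FW. \<alpha> \<in> Hom Omega S (face_tree W d))"
proof
  assume "\<alpha> \<in> boundary S"
  then have h: "\<alpha> \<in> Hom Omega S W" "misses_face W S (fst \<alpha>)" by (auto simp: boundary_def)
  from h(2) show "\<exists>d\<in>FW. \<alpha> \<in> Hom Omega S (face_tree W d)"
  proof (cases rule: misses_faceE)
    case (inner e)
    then have "\<alpha> \<in> Hom Omega S (face_tree W (Inner e))" using hom_contract_iff[OF S W_tree inner_T_W, of e \<alpha>] h(1) by simp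
    moreover have "Inner e \<in> FW" using inner by (simp add: FW_def)
    ultimately show ?thesis by blast
  next
    case (top I e)
    then have "(I, e) \<in> verts W" "I \<subseteq> leaves W" "e \<noteq> root W" by (auto simp: W_verts W_leaves)
    then have "\<alpha> \<in> Hom Omega S (face_tree W (Outer (I, e)))" using hom_prune_top_iff[OF S W_tree, of I e \<alpha>] h(1) top by simp
    moreover have "Outer (I, e) \<in> FW" using top by (simp add: FW_def)
    ultimately show ?thesis by blast
  qed
next
  assume "\<exists>d\<in>FW. \<alpha> \<in> Hom Omega S (face_tree W d)"
  then obtain d where d: "d \<in> FW" "\<alpha> \<in> Hom Omega S (face_tree W d)" by blast
  then consider (inner) e where "d = Inner e" "e \<in> inner_edges T" "e \<noteq> a"
    | (top) I e where "d = Outer (I, e)" "(I, e) \<in> verts T" "I \<subseteq> leaves T" "e \<noteq> b" by (auto simp: FW_def)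
  then show "\<alpha> \<in> boundary S"
  proof cases
    case inner
    then show ?thesis
      using d(2) hom_contract_iff[OF S W_tree inner_T_W[OF inner(2)], of \<alpha>] misses_faceI_inner[OF inner(2,3)]
      by (simp add: boundary_def)
  next
    case top
    then have "(I, e) \<in> verts W" "I \<subseteq> leaves W" "e \<noteq> root W" by (auto simp: W_verts W_leaves)
    then show ?thesis
      using d(2) top(1) hom_prune_top_iff[OF S W_tree, of I e \<alpha>] misses_faceI_top[OF top(2-4)]
      by (simp add: boundary_def)
  qed
qed

lemma boundary_hom: "\<alpha> \<in> boundary S \<Longrightarrow> \<alpha> \<in> Hom Omega S W"
  by (simp add: boundary_def)

lemma sieve_boundary: "sieve boundary"
  unfolding sieve_def
proof (intro allI impI)
  fix R S \<alpha> \<beta> assume RS: "is_tree R" "is_tree S" and \<beta>: "\<beta> \<in> Hom Omega R S" and "\<alpha> \<in> boundary S"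
  then obtain d where "d \<in> FW" "\<alpha> \<in> Hom Omega S (face_tree W d)" using boundary_iff by blast
  then show "precomp R \<alpha> \<beta> \<in> boundary R"
    using boundary_iff[OF RS(1)] sieveD[OF sieve_cells RS \<beta>] by blast
qed

lemma miss_precomp:
  assumes "\<beta> \<in> Hom Omega R S" "x \<notin> fst \<alpha> ` edges S" shows "x \<notin> fst (precomp R \<alpha> \<beta>) ` edges R"
  using assms(2) hom_edge[OF assms(1)] by (auto simp: fst_precomp)

lemma sieve_first_base: "sieve first_base"
  unfolding sieve_def
proof (intro allI impI)
  fix R S \<alpha> \<beta> assume RS: "is_tree R" "is_tree S" and \<beta>: "\<beta> \<in> Hom Omega R S" and \<alpha>: "\<alpha> \<in> first_base S"
  then have "precomp R \<alpha> \<beta> \<in> Hom Omega R W" using sieveD[OF sieve_cells RS \<beta>] by (simp add: first_base_def)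
  moreover have "c1 \<notin> fst (precomp R \<alpha> \<beta>) ` edges R \<or> c2 \<notin> fst (precomp R \<alpha> \<beta>) ` edges R \<or> precomp R \<alpha> \<beta> \<in> Hom Omega R L"
    using \<alpha> sieveD[OF sieve_cells RS \<beta>, of \<alpha> L] miss_precomp[OF \<beta>] unfolding first_base_def by blast
  ultimately show "precomp R \<alpha> \<beta> \<in> first_base R" by (simp add: first_base_def)
qed

lemma escapes_pi:
  assumes S: "is_tree S" and \<alpha>: "\<alpha> \<in> Hom Omega S W" and e: "e \<in> edges T" "e \<noteq> b"
  shows "escapes T S (fst (push S \<pi> \<alpha>)) e \<longleftrightarrow> escapes W S (fst \<alpha>) e"
  by (rule escapes_cong[OF S]) (use above_pi[OF e hom_edge[OF \<alpha>]] in \<open>simp add: push_def\<close>)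

text \<open>\<open>\<pi>\<close> fixes the edges of the forest and sends no other edge there; by
  \<open>above_pi\<close> it also preserves which edges lie below them, and the condition speaks of
  nothing else.\<close>

lemma misses_face_pi:
  assumes S: "is_tree S" and \<alpha>: "\<alpha> \<in> Hom Omega S W"
  shows "misses_face T S (fst (push S \<pi> \<alpha>)) \<longleftrightarrow> misses_face W S (fst \<alpha>)"
proof -
  have im: "x \<in> fst (push S \<pi> \<alpha>) ` edges S \<longleftrightarrow> x \<in> fst \<alpha> ` edges S" if "x \<in> edges T" "x \<noteq> a" "x \<noteq> b" for x
  proof -
    have "\<pi> y = x \<longleftrightarrow> y = x" if "y \<in> edges W" for y using \<open>x \<in> edges T\<close> \<open>x \<noteq> a\<close> \<open>x \<noteq> b\<close> fresh that by (auto simp: \<pi>_def)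
    then show ?thesis using hom_edge[OF \<alpha>] by (force simp: push_def image_iff)
  qed
  have "e \<in> edges T \<and> e \<noteq> b" if "e \<in> inner_edges T" for e using that by (simp add: inner_edge_iff)
  then have 1: "(\<exists>e\<in>inner_edges T - {a}. e \<notin> fst (push S \<pi> \<alpha>) ` edges S) \<longleftrightarrow> (\<exists>e\<in>inner_edges T - {a}. e \<notin> fst \<alpha> ` edges S)"
    using im by (metis Diff_iff singletonI)
  have 2: "(case v of (I, e) \<Rightarrow> I \<subseteq> leaves T \<and> e \<noteq> b \<and> I \<inter> fst (push S \<pi> \<alpha>) ` edges S = {} \<and> \<not> escapes T S (fst (push S \<pi> \<alpha>)) e) \<longleftrightarrow>
      (case v of (I, e) \<Rightarrow> I \<subseteq> leaves T \<and> e \<noteq> b \<and> I \<inter> fst \<alpha> ` edges S = {} \<and> \<not> escapes W S (fst \<alpha>) e)"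
    if v: "v \<in> verts T" for v
  proof -
    obtain I e where Ie: "v = (I, e)" by (cases v)
    have "I \<inter> fst (push S \<pi> \<alpha>) ` edges S = {} \<longleftrightarrow> I \<inter> fst \<alpha> ` edges S = {}" if "I \<subseteq> leaves T"
    proof -
      have "x \<in> edges T \<and> x \<noteq> a \<and> x \<noteq> b" if "x \<in> I" for x
        using that \<open>I \<subseteq> leaves T\<close> av ra by (auto simp: leaves_iff)
      then show ?thesis using im by blast
    qed
    then show ?thesis using escapes_pi[OF S \<alpha>, of e] is_treeD(4)[OF T] v Ie by auto
  qed
  show ?thesis unfolding misses_face_def 1 by (intro arg_cong2[where f = "(\<or>)"] bex_cong HOL.refl 2)
qed

text \<open>The contraction of \<open>a\<close> is \<open>F \<star> \<Delta>{1}\<close>, and the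
  other faces in the horn make up \<open>\<partial>F \<star> \<Delta>[1]\<close>.\<close>

lemma horn_T_iff:
  assumes S: "is_tree S"
  shows "\<alpha> \<in> Cell (horn T (Outer ({a}, b))) S \<longleftrightarrow>
    \<alpha> \<in> Hom Omega S T \<and> (a \<notin> fst \<alpha> ` edges S \<or> misses_face T S (fst \<alpha>))"
proof -
  have ai: "a \<in> inner_edges T" using aT av by (auto simp: inner_edge_iff)
  show ?thesis
  proof
    assume "\<alpha> \<in> Cell (horn T (Outer ({a}, b))) S"
    then obtain d where d: "d \<in> faces T" "d \<noteq> Outer ({a}, b)" "\<alpha> \<in> Hom Omega S (face_tree T d)"
      using horn_cell_iff[OF T S] by blast
    show "\<alpha> \<in> Hom Omega S T \<and> (a \<notin> fst \<alpha> ` edges S \<or> misses_face T S (fst \<alpha>))"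
      using T d(1)
    proof (cases rule: faces_cases)
      case (inner e)
      then show ?thesis using d(3) hom_contract_iff[OF S T inner(2), of \<alpha>] misses_faceI_inner[OF inner(2)] by auto
    next
      case (top I e)
      then show ?thesis using d(3) hom_prune_top_iff[OF S T top(2-4), of \<alpha>] misses_faceI_top[OF top(2-4)] by auto
    next
      case (root I)
      then show ?thesis using d(2) is_treeD(6)[OF T ra] by blast
    qed
  next
    assume h: "\<alpha> \<in> Hom Omega S T \<and> (a \<notin> fst \<alpha> ` edges S \<or> misses_face T S (fst \<alpha>))"
    then consider "a \<notin> fst \<alpha> ` edges S" | "misses_face T S (fst \<alpha>)" by blast
    then show "\<alpha> \<in> Cell (horn T (Outer ({a}, b))) S"
    proof cases
      case 1
      then have "\<alpha> \<in> Hom Omega S (face_tree T (Inner a))" using hom_contract_iff[OF S T ai, of \<alpha>] h by simp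
      then show ?thesis using ai by (intro horn_cellI[OF T S, of "Inner a"]) (auto simp: faces_def)
    next
      case 2
      then show ?thesis
      proof (cases rule: misses_faceE)
        case (inner e)
        then have "\<alpha> \<in> Hom Omega S (face_tree T (Inner e))" using hom_contract_iff[OF S T inner(1), of \<alpha>] h by simp
        then show ?thesis using inner by (intro horn_cellI[OF T S, of "Inner e"]) (auto simp: faces_def)
      next
        case (top I e)
        then have "\<alpha> \<in> Hom Omega S (face_tree T (Outer (I, e)))" using hom_prune_top_iff[OF S T top(1-3), of \<alpha>] h by simp
        then show ?thesis using prune_top_edges(1)[OF T top(1-3)] top(3)
          by (intro horn_cellI[OF T S, of "Outer (I, e)"]) (auto simp: faces_def)
      qed
    qed
  qed
qed

text \<open>These are the cells at which \<open>f\<close> can be evaluated after the collapse. In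
  \<open>F \<star> \<Delta>{1,3}\<close> both edges that \<open>\<pi>\<close> sends to
  \<open>a\<close> are missing, so the image lies in the contraction of \<open>a\<close>.\<close>

lemma push_pi_horn:
  assumes S: "is_tree S" and \<alpha>: "\<alpha> \<in> Hom Omega S W" and miss: "c1 \<notin> fst \<alpha> ` edges S \<or> c2 \<notin> fst \<alpha> ` edges S"
    and "\<alpha> \<in> boundary S \<or> (a \<notin> fst \<alpha> ` edges S \<and> c2 \<notin> fst \<alpha> ` edges S)"
  shows "push S \<pi> \<alpha> \<in> Cell (horn T (Outer ({a}, b))) S"
proof -
  have "a \<notin> fst (push S \<pi> \<alpha>) ` edges S" if "a \<notin> fst \<alpha> ` edges S" "c2 \<notin> fst \<alpha> ` edges S"
    using that aT by (auto simp: push_def \<pi>_def image_iff split: if_splits)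
  then show ?thesis
    using horn_T_iff[OF S] push_pi_hom[OF S \<alpha> miss] misses_face_pi[OF S \<alpha>] assms(4) unfolding boundary_def by blast
qed


text \<open>
  \<open>second_base\<close> is \<open>\<partial>F \<star> \<Delta>[3] \<union> F \<star> \<Delta>{1,3}\<close>, and the faces satisfying \<open>second_face\<close> are \<open>F \<star> \<Delta>{1,2}\<close> and \<open>F \<star> \<Delta>{1,2,3}\<close>.
\<close>

definition second_base :: "tree \<Rightarrow> tree_mor set" where
  "second_base S = boundary S \<union> {\<alpha> \<in> Hom Omega S W. a \<notin> fst \<alpha> ` edges S \<and> c2 \<notin> fst \<alpha> ` edges S}"

definition second_face :: "tree \<Rightarrow> bool" where
  "second_face U \<longleftrightarrow> is_tree U \<and> restricts U W \<and> edges U \<in> {edges W - {a}, edges W - {a, b}} \<and> leaves U = leaves T"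

section \<open>Second stage: horns at the vertex 1\<close>

lemma I0_edges: "x \<in> I0 \<Longrightarrow> x \<in> edges T \<and> x \<noteq> a \<and> x \<noteq> b"
  using is_treeD(3,5)[OF T av] input_neq[OF T av] by auto

lemma vertex_edges:
  assumes "(I, e) \<in> verts T" "e \<noteq> b" "x \<in> I" shows "x \<in> edges T" "x \<noteq> a" "x \<noteq> b"
  using is_treeD(3,5)[OF T assms(1)] is_treeD(7)[OF T assms(1) ra assms(3)] assms(2,3) by auto

lemma above_W_T:
  assumes "above W x e" "x \<noteq> e" "e \<in> edges T" "e \<noteq> b" "x \<in> edges W"
  shows "x \<in> edges T" "above T x e"
proof -
  have "x \<notin> {c1, c2, b}"
  proof
    assume "x \<in> {c1, c2, b}"
    then have "above W e x" using assms(3,4) W_chain(1-3)[of e] fresh by auto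
    then show False using assms(1,2) above_antisym[OF W_tree] by blast
  qed
  then show "x \<in> edges T" using assms(5) by auto
  then show "above T x e" using above_T assms(1,3) by blast
qed

context
  fixes U :: tree
  assumes second_face: "second_face U"
begin

lemma second_face_spans: "spans U"
  using second_face aT fresh by (auto simp: second_face_def spans_def leaves_iff)

lemmas second_face_tree = span_tree[OF second_face_spans]
lemmas second_face_above = span_above[OF second_face_spans]
lemmas second_face_root = span_root[OF second_face_spans]
lemmas second_face_root_vertex = span_root_vertex[OF second_face_spans]

lemma second_face_sel: "leaves U = leaves T" "a \<notin> edges U" "x \<in> edges W \<Longrightarrow> x \<noteq> a \<Longrightarrow> x \<noteq> b \<Longrightarrow> x \<in> edges U"
  using second_face by (auto simp: second_face_def)

text \<open>No cell of \<open>U\<close> uses \<open>a\<close>, and \<open>c1\<close> is the edge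
  directly below \<open>a\<close>; so for the edges of such a cell, lying below \<open>a\<close>
  means lying below \<open>c1\<close>.\<close>

lemma second_face_escapes:
  assumes S: "is_tree S" and \<alpha>: "\<alpha> \<in> Hom Omega S U"
  shows "escapes W S (fst \<alpha>) a \<longleftrightarrow> escapes U S (fst \<alpha>) c1"
proof -
  have v: "({a}, c1) \<in> verts W" by (simp add: W_verts)
  have *: "above W a (fst \<alpha> z) \<longleftrightarrow> above U c1 (fst \<alpha> z)" if "z \<in> edges S" for z
  proof -
    have e: "fst \<alpha> z \<in> edges U" by (rule hom_edge[OF \<alpha> that])
    then have "fst \<alpha> z \<noteq> a" using second_face_sel(2) by blast
    then have "above W a (fst \<alpha> z) \<longleftrightarrow> above W c1 (fst \<alpha> z)"
      using above_below_input[OF W_tree v, of a "fst \<alpha> z"] above_input[OF v, of a] above_trans by blast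
    then show ?thesis using second_face_above[OF span_edges(1)[OF second_face_spans] e] by simp
  qed
  show ?thesis by (rule escapes_cong[OF S *])
qed

text \<open>A top vertex of \<open>U\<close> comes from one of \<open>T\<close>, with
  \<open>c1\<close> taking the place of \<open>a\<close> as output; so pruning it cuts into the
  forest.\<close>

lemma second_face_top:
  assumes v: "(I, e) \<in> verts U" "I \<subseteq> leaves U" "e \<noteq> root U" and S: "is_tree S"
    and \<alpha>: "\<alpha> \<in> Hom Omega S U" "I \<inter> fst \<alpha> ` edges S = {}" "\<not> escapes U S (fst \<alpha>) e"
  shows "\<alpha> \<in> boundary S"
proof -
  note U = second_face_tree(1)
  have eU: "e \<in> edges U" by (rule is_treeD(4)[OF U v(1)])
  have eW: "e \<in> edges W" by (rule restricts_edges[OF second_face_tree(2) eU])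
  have \<alpha>W: "\<alpha> \<in> Hom Omega S W" by (rule restricts_hom[OF S second_face_tree(2) \<alpha>(1)])
  have eb: "e \<noteq> b" using v(3) eU second_face_root by auto
  have "e \<noteq> c2"
  proof
    assume e: "e = c2"
    have "above U c1 c2" using second_face_above[OF span_edges[OF second_face_spans]] W_chain(2) aT by simp
    then have "c1 \<in> I" using above_top[OF U v(1,2)] e fresh by blast
    then show False using v(2) span_not_leaf(1)[OF second_face_spans] by blast
  qed
  then consider "e = c1" | "e \<in> edges T" "e \<noteq> a" "e \<noteq> b" using eW eU eb second_face_sel(2) by auto
  then obtain I' e' where v': "(I', e') \<in> verts T" "e' \<noteq> b"
    and up: "\<And>x. x \<in> I' \<Longrightarrow> above W x e \<and> x \<noteq> e" and esc: "\<not> escapes W S (fst \<alpha>) e'"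
  proof cases
    case 1
    have "above W x c1 \<and> x \<noteq> c1" if "x \<in> I0" for x using W_chain(3) I0_edges[OF that] fresh by auto
    moreover have "\<not> escapes W S (fst \<alpha>) a" using second_face_escapes[OF S \<alpha>(1)] \<alpha>(3) 1 by simp
    ultimately show ?thesis using that[OF av aT(3)] 1 by blast
  next
    case 2
    have "e \<notin> leaves U" using v(1) by (auto simp: leaves_iff)
    then have "e \<notin> leaves T" using second_face_sel(1) by simp
    then obtain I' where I': "(I', e) \<in> verts T" using 2(1) by (auto simp: leaves_iff)
    have "above W x e \<and> x \<noteq> e" if "x \<in> I'" for x
      using above_T[of x e] above_input[OF I' that] is_treeD(3)[OF T I'] that 2(1) input_neq[OF T I' that] by blast
    moreover have "\<not> escapes W S (fst \<alpha>) e" using restricts_escapes[OF S U W_tree second_face_tree(2) \<alpha>(1) eU] \<alpha>(3) by simp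
    ultimately show ?thesis using that[OF I' 2(3)] by blast
  qed
  have sub: "I' \<subseteq> I"
  proof
    fix x assume x: "x \<in> I'"
    note xe = vertex_edges[OF v' x]
    have xU: "x \<in> edges U" using second_face_sel(3)[of x] xe by simp
    have "above U x e" "x \<noteq> e" using second_face_above[OF xU eU] up[OF x] by simp_all
    then show "x \<in> I" using above_top[OF U v(1,2)] by blast
  qed
  have "misses_face W S (fst \<alpha>)"
    by (rule misses_faceI_top[OF v'(1) _ v'(2) _ esc]) (use sub v(2) \<alpha>(2) second_face_sel(1) in auto)
  then show ?thesis using \<alpha>W by (simp add: boundary_def)
qed

text \<open>Apart from the contraction of \<open>c1\<close>, a face cuts into \<open>F\<close>,
  loses \<open>c2\<close>, or removes \<open>b\<close> from \<open>F \<star> \<Delta>{1,2,3}\<close>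
  and leaves \<open>F \<star> \<Delta>{1,2}\<close>.\<close>

lemma second_face_faces:
  assumes d: "d \<in> faces U - {Inner c1}"
  shows "(\<forall>S. is_tree S \<longrightarrow> Hom Omega S (face_tree U d) \<subseteq> second_base S) \<or>
    (second_face (face_tree U d) \<and> tree_size (face_tree U d) < tree_size U)"
proof -
  note U = second_face_tree(1)
  have df: "d \<in> faces U" using d by blast
  let ?V = "face_tree U d"
  have V: "is_tree ?V" "restricts ?V W"
    using face_map_hom(1)[OF U df] restricts_trans[OF face_restricts[OF U df] second_face_tree(2)] by auto
  have miss: "Hom Omega S ?V \<subseteq> second_base S" if S: "is_tree S" and x: "c2 \<notin> edges ?V" for S
  proof
    fix \<alpha> assume \<alpha>: "\<alpha> \<in> Hom Omega S ?V"
    have "\<alpha> \<in> Hom Omega S W" by (rule restricts_hom[OF S V(2) \<alpha>])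
    moreover have "a \<notin> edges ?V" using face_restricts[OF U df] second_face_sel(2) by (auto simp: restricts_def)
    ultimately show "\<alpha> \<in> second_base S" using x hom_edge[OF \<alpha>] by (auto simp: second_base_def)
  qed
  show ?thesis using U df
  proof (cases rule: faces_cases)
    case (inner e)
    note E = contract_edges[OF U inner(2)]
    show ?thesis
    proof (cases "e = c2")
      case True
      then show ?thesis using miss inner(1) E by simp
    next
      case False
      have e: "e \<in> edges U" "e \<notin> leaves U" "e \<noteq> root U" using inner(2) by (auto simp: inner_edges_def)
      have "e \<noteq> b" "e \<noteq> a" using e second_face_root second_face_sel(2) by auto
      moreover have "e \<noteq> c1" using d inner(1) by blast
      ultimately have eT: "e \<in> edges T" using restricts_edges[OF second_face_tree(2) e(1)] False by simp
      then have "e \<in> inner_edges T" using e(2) second_face_sel(1) \<open>e \<noteq> b\<close> by (simp add: inner_edges_def)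
      have "Hom Omega S ?V \<subseteq> second_base S" if S: "is_tree S" for S
      proof
        fix \<alpha> assume \<alpha>: "\<alpha> \<in> Hom Omega S ?V"
        have "e \<notin> fst \<alpha> ` edges S" using \<alpha> inner(1) hom_contract_iff[OF S U inner(2), of \<alpha>] by simp
        then have "misses_face W S (fst \<alpha>)" using misses_faceI_inner[OF \<open>e \<in> inner_edges T\<close> \<open>e \<noteq> a\<close>] by blast
        then show "\<alpha> \<in> second_base S" using restricts_hom[OF S V(2) \<alpha>] by (simp add: second_base_def boundary_def)
      qed
      then show ?thesis by blast
    qed
  next
    case (top I e)
    have "Hom Omega S ?V \<subseteq> second_base S" if S: "is_tree S" for S
    proof
      fix \<alpha> assume "\<alpha> \<in> Hom Omega S ?V"
      then have "\<alpha> \<in> Hom Omega S U" "I \<inter> fst \<alpha> ` edges S = {}" "\<not> escapes U S (fst \<alpha>) e"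
        using top(1) hom_prune_top_iff[OF S U top(2-4), of \<alpha>] by simp_all
      then show "\<alpha> \<in> second_base S" using second_face_top[OF top(2-4) S] by (simp add: second_base_def)
    qed
    then show ?thesis by blast
  next
    case (root I)
    obtain x where x: "({x}, root U) \<in> verts U" "x \<notin> leaves U" by (rule second_face_root_vertex)
    have I: "I = {x}" using is_treeD(6)[OF U x(1) root(2)] by simp
    note E = prune_root_edges[OF U x]
    show ?thesis
    proof (cases "b \<in> edges U")
      case True
      then have "edges U = edges W - {a}" using second_face by (auto simp: second_face_def)
      then have "second_face ?V" using V root(1) I E second_face_sel(1) second_face_root True by (auto simp: second_face_def)
      moreover have "tree_size ?V < tree_size U"
        by (rule tree_size_less[OF U]) (use root(1) I E is_treeD(2)[OF U] in auto)
      ultimately show ?thesis by blast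
    next
      case False
      then have "c2 \<notin> edges ?V" using E root(1) I second_face_root by simp
      then show ?thesis using miss by simp
    qed
  qed
qed

lemma second_face_base:
  assumes S: "is_tree S" and \<alpha>: "\<alpha> \<in> second_base S" "\<alpha> \<in> Hom Omega S U"
  shows "\<alpha> \<in> Cell (horn U (Inner c1)) S"
proof -
  note U = second_face_tree(1)
  consider "c2 \<notin> fst \<alpha> ` edges S" | "misses_face W S (fst \<alpha>)"
    using \<alpha>(1) by (auto simp: second_base_def boundary_def)
  then show ?thesis
  proof cases
    case 1
    show ?thesis
    proof (cases "b \<in> edges U")
      case True
      then show ?thesis using in_horn_contract[OF U S \<alpha>(2) span_inner(2)[OF second_face_spans True] _ 1] fresh by simp
    next
      case False
      obtain x where "({x}, root U) \<in> verts U" "x \<notin> leaves U" by (rule second_face_root_vertex)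
      then show ?thesis using in_horn_root[OF U S \<alpha>(2)] 1 False second_face_root by simp
    qed
  next
    case 2
    then show ?thesis
    proof (cases rule: misses_faceE)
      case (inner e)
      have "e \<in> edges T" "e \<noteq> b" "e \<notin> leaves T" using inner(1) by (auto simp: inner_edges_def)
      then have "e \<in> inner_edges U" "e \<noteq> c1"
        using second_face_sel(1) second_face_sel(3)[of e] inner(2) second_face_root fresh by (auto simp: inner_edges_def)
      then show ?thesis using in_horn_contract[OF U S \<alpha>(2) _ _ inner(3)] by simp
    next
      case (top I e)
      have eT: "e \<in> edges T" by (rule is_treeD(4)[OF T top(1)])
      \<comment> \<open>The output of the corresponding vertex in \<open>U\<close>: it is
        \<open>c1\<close> if \<open>e = a\<close>, and \<open>e\<close> itself otherwise.\<close>
      obtain e0 where e0: "e0 \<in> edges U" "e0 \<noteq> root U" "e0 \<notin> leaves U"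
        and up: "\<And>x. x \<in> edges U \<Longrightarrow> above W x e0 \<Longrightarrow> x \<noteq> e0 \<Longrightarrow> x \<in> I" and esc: "\<not> escapes U S (fst \<alpha>) e0"
      proof (cases "e = a")
        case True
        have "x \<in> I" if x: "x \<in> edges U" "above W x c1" "x \<noteq> c1" for x
        proof -
          have "x \<in> edges T" "x \<noteq> b" "x \<noteq> a" using x W_chain(3)[of x] second_face_sel(2) by auto
          then show ?thesis using above_top[OF T top(1,2)] above_a_T True by blast
        qed
        moreover have "\<not> escapes U S (fst \<alpha>) c1" using second_face_escapes[OF S \<alpha>(2)] top(5) True by simp
        moreover have "c1 \<noteq> root U" using second_face_root aT fresh by auto
        ultimately show ?thesis using that span_edges(1)[OF second_face_spans] span_not_leaf(1)[OF second_face_spans] by blast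
      next
        case False
        have eU: "e \<in> edges U" using second_face_sel(3)[of e] eT False top(3) by simp
        have "x \<in> I" if x: "x \<in> edges U" "above W x e" "x \<noteq> e" for x
          using above_W_T(2)[OF x(2,3) eT top(3) restricts_edges[OF second_face_tree(2) x(1)]] above_top[OF T top(1,2)] x(3) by blast
        moreover have "\<not> escapes U S (fst \<alpha>) e" using restricts_escapes[OF S U W_tree second_face_tree(2) \<alpha>(2) eU] top(5) by simp
        moreover have "e \<noteq> root U" using second_face_root eT top(3) fresh by auto
        moreover have "e \<notin> leaves T" using top(1) by (auto simp: leaves_iff)
        then have "e \<notin> leaves U" using second_face_sel(1) by simp
        ultimately show ?thesis using that eU by blast
      qed
      obtain I' where I': "(I', e0) \<in> verts U" using e0(1,3) by (auto simp: leaves_iff)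
      have "I' \<subseteq> I"
      proof
        fix x assume x: "x \<in> I'"
        have xU: "x \<in> edges U" using is_treeD(3)[OF U I'] x by blast
        show "x \<in> I" using up[OF xU] second_face_above[OF xU e0(1)] above_input[OF I' x] input_neq[OF U I' x] by simp
      qed
      then have "I' \<subseteq> leaves U" "I' \<inter> fst \<alpha> ` edges S = {}" using top(2,4) second_face_sel(1) by auto
      then show ?thesis using in_horn_top[OF U S \<alpha>(2) I' _ e0(2) _ esc] by simp
    qed
  qed
qed

text \<open>Two different members can only differ in \<open>b\<close>, which is the root of the
  larger one, so a common cell misses the root of \<open>U\<close>.\<close>

lemma second_face_meet:
  assumes V: "second_face V" "U \<noteq> V" "tree_size V \<le> tree_size U" and S: "is_tree S" and \<alpha>: "\<alpha> \<in> Hom Omega S U" "\<alpha> \<in> Hom Omega S V"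
  shows "\<alpha> \<in> Cell (horn U (Inner c1)) S"
proof -
  note U = second_face_tree(1)
  have V': "is_tree V" "restricts V W" "edges V \<in> {edges W - {a}, edges W - {a, b}}" "leaves V = leaves U"
    using V(1) second_face_sel(1) by (auto simp: second_face_def)
  have E: "edges U \<in> {edges W - {a}, edges W - {a, b}}" using second_face by (simp add: second_face_def)
  have ne: "edges U \<noteq> edges V"
    using restricts_tree_eq[OF W_tree U second_face_tree(2) V'(1,2)] V'(4) V(2) by auto
  have "\<not> edges U \<subseteq> edges V" using tree_size_less[OF V'(1), of U] V'(4) V(3) ne by auto
  then have b: "b \<in> edges U" "b \<notin> edges V" using E V'(3) ne by auto
  then have "root U \<notin> fst \<alpha> ` edges S" using hom_edge[OF \<alpha>(2)] second_face_root by auto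
  moreover obtain x where "({x}, root U) \<in> verts U" "x \<notin> leaves U" by (rule second_face_root_vertex)
  ultimately show ?thesis using in_horn_root[OF U S \<alpha>(1)] by blast
qed

end

text \<open>The definition is generic in \<open>Z\<close> because it serves twice: in
  \<open>X\<close> on the boundary, with \<open>k\<close> defined on the outer horn, and in
  \<open>Y\<close> on the whole join, with \<open>k\<close> defined on \<open>T\<close>.\<close>

definition base_map :: "'z dset \<Rightarrow> 'z \<Rightarrow> (tree \<Rightarrow> tree_mor \<Rightarrow> 'z) \<Rightarrow> tree \<Rightarrow> tree_mor \<Rightarrow> 'z" where
  "base_map Z q k S \<alpha> =
     (if \<alpha> \<in> Hom Omega S L then Restr Z S (linear_tree 3) (push S \<kappa> \<alpha>) q else k S (push S \<pi> \<alpha>))"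

text \<open>An edge in the simplicial sense: the 1-simplex from \<open>a\<close> to \<open>b\<close>
  given by the root vertex.\<close>

definition root_edge :: tree_mor where
  "root_edge = edge_mor (linear_tree 1) (\<lambda>i. if i = 0 then a else b)"

context
  fixes Z :: "'z dset" and q :: 'z and K N :: "tree \<Rightarrow> tree_mor set" and k :: "tree \<Rightarrow> tree_mor \<Rightarrow> 'z"
  assumes Z: "dendroidal_set Z" and q: "q \<in> simplices Z 3" and k: "sieve_map K Z k"
    and re: "root_edge \<in> K (linear_tree 1)"
    and q1: "face_of Z 3 [0, 1, 3] q = face_of Z 1 [0, 1, 1] (k (linear_tree 1) root_edge)"
    and q2: "face_of Z 3 [0, 2, 3] q = face_of Z 1 [0, 0, 1] (k (linear_tree 1) root_edge)"
    and N: "sieve N" "\<And>S. N S \<subseteq> Hom Omega S W"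
    and NK: "\<And>S \<alpha>. is_tree S \<Longrightarrow> \<alpha> \<in> N S \<Longrightarrow> c1 \<notin> fst \<alpha> ` edges S \<or> c2 \<notin> fst \<alpha> ` edges S \<Longrightarrow> push S \<pi> \<alpha> \<in> K S"
begin

text \<open>A cell missing the vertex \<open>i\<close> sees only the \<open>i\<close>-th face of
  \<open>q\<close>. This face is the degeneracy of the root edge along \<open>g\<close>, and
  \<open>val\<close> identifies the resulting map of edges with \<open>\<pi>\<close>.\<close>

lemma base_map_degenerate:
  assumes S: "is_tree S" and \<alpha>: "\<alpha> \<in> Hom Omega S L" and i: "i \<le> 3" and g: "mono_map 2 1 g"
    and qi: "along Z 2 3 (skip i) q = along Z 2 1 g (k (linear_tree 1) root_edge)"
    and val: "\<And>x. x \<in> fst \<alpha> ` edges S \<Longrightarrow> \<kappa> x \<noteq> i \<and> (if g (squeeze i (\<kappa> x)) = 0 then a else b) = \<pi> x"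
  shows "Restr Z S (linear_tree 3) (push S \<kappa> \<alpha>) q = k S (push S \<pi> \<alpha>)"
proof -
  let ?u = "k (linear_tree 1) root_edge"
  note l = is_tree_linear
  have u: "?u \<in> simplices Z 1" by (rule sieve_mapD(1)[OF k l re])
  have sq: "mono_map 3 2 (squeeze i)" using mono_squeeze[of i 2] i by (simp add: numeral_eq_Suc)
  have sk: "mono_map 2 3 (skip i)" using mono_skip[of 2 i] by (simp add: numeral_eq_Suc)
  let ?\<gamma> = "push S (squeeze i) (push S \<kappa> \<alpha>)"
  have \<gamma>: "?\<gamma> \<in> Hom Omega S (linear_tree 2)" by (rule push_hom[OF S push_kappa[OF S \<alpha>] sq])
  have g\<gamma>: "push S g ?\<gamma> \<in> Hom Omega S (linear_tree 1)" by (rule push_hom[OF S \<gamma> g])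
  have "push S \<kappa> \<alpha> = push S (skip i) ?\<gamma>"
    unfolding push_push[OF S]
  proof (rule push_cong[OF S])
    fix e assume "e \<in> edges S"
    then have "\<kappa> (fst \<alpha> e) \<noteq> i" using val by blast
    then show "\<kappa> (fst \<alpha> e) = skip i (squeeze i (\<kappa> (fst \<alpha> e)))" by (rule skip_squeeze[symmetric])
  qed
  then have "Restr Z S (linear_tree 3) (push S \<kappa> \<alpha>) q = Restr Z S (linear_tree 2) ?\<gamma> (along Z 2 1 g ?u)"
    using restr_push[OF Z S \<gamma> sk q] qi by simp
  also have "\<dots> = Restr Z S (linear_tree 1) (push S g ?\<gamma>) ?u" by (rule restr_push[OF Z S \<gamma> g u, symmetric])
  also have "\<dots> = k S (precomp S root_edge (push S g ?\<gamma>))" by (rule sieve_mapD(2)[OF k S l g\<gamma> re, symmetric])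
  also have "precomp S root_edge (push S g ?\<gamma>) = push S (\<lambda>i. if i = 0 then a else b) (push S g ?\<gamma>)"
    by (simp only: root_edge_def precomp_edge_mor[OF S g\<gamma>] push_def[of S "\<lambda>i. if i = 0 then a else b"])
  also have "\<dots> = push S \<pi> \<alpha>"
    unfolding push_push[OF S] by (rule push_cong[OF S]) (use val in blast)
  finally show ?thesis .
qed

text \<open>Consistency of the two clauses of \<open>base_map\<close>: a cell of \<open>L\<close>
  missing \<open>c1\<close> sees the face 023 of \<open>q\<close>, one missing \<open>c2\<close> the
  face 013, and both faces are prescribed.\<close>

lemma base_map_miss:
  assumes S: "is_tree S" and \<alpha>: "\<alpha> \<in> N S" and miss: "c1 \<notin> fst \<alpha> ` edges S \<or> c2 \<notin> fst \<alpha> ` edges S"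
  shows "base_map Z q k S \<alpha> = k S (push S \<pi> \<alpha>)"
proof (cases "\<alpha> \<in> Hom Omega S L")
  case True
  have im: "x \<in> {a, c1, c2, b}" if "x \<in> fst \<alpha> ` edges S" for x using hom_edge[OF True] that by auto
  have g: "mono_map 2 1 (\<lambda>i. [0, 1, 1] ! i)" "mono_map 2 1 (\<lambda>i. [0, 0, 1] ! i)"
    using vertex_list_mono[of 1 "[0, 1, 1]"] vertex_list_mono[of 1 "[0, 0, 1]"]
    by (simp_all add: vertex_list_def numeral_eq_Suc)
  have al: "along Z 2 3 (skip 1) q = face_of Z 3 [0, 2, 3] q" "along Z 2 3 (skip 2) q = face_of Z 3 [0, 1, 3] q"
    by (simp_all add: along_face_of skip_def numeral_eq_Suc)
  have "Restr Z S (linear_tree 3) (push S \<kappa> \<alpha>) q = k S (push S \<pi> \<alpha>)"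
  proof (cases "c1 \<in> fst \<alpha> ` edges S")
    case False
    show ?thesis
    proof (rule base_map_degenerate[OF S True _ g(2)])
      show "along Z 2 3 (skip 1) q = along Z 2 1 (\<lambda>i. [0, 0, 1] ! i) (k (linear_tree 1) root_edge)"
        unfolding al q2 by (simp add: face_of_def numeral_eq_Suc)
      show "\<kappa> x \<noteq> 1 \<and> (if [0, 0, 1] ! squeeze 1 (\<kappa> x) = (0::nat) then a else b) = \<pi> x" if "x \<in> fst \<alpha> ` edges S" for x
        using im[OF that] that False aT fresh by (auto simp: \<kappa>_def \<pi>_def squeeze_def)
    qed simp
  next
    case c1: True
    then have "c2 \<notin> fst \<alpha> ` edges S" using miss by blast
    show ?thesis
    proof (rule base_map_degenerate[OF S True _ g(1)])
      show "along Z 2 3 (skip 2) q = along Z 2 1 (\<lambda>i. [0, 1, 1] ! i) (k (linear_tree 1) root_edge)"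
        unfolding al q1 by (simp add: face_of_def numeral_eq_Suc)
      show "\<kappa> x \<noteq> 2 \<and> (if [0, 1, 1] ! squeeze 2 (\<kappa> x) = (0::nat) then a else b) = \<pi> x" if "x \<in> fst \<alpha> ` edges S" for x
        using im[OF that] that \<open>c2 \<notin> fst \<alpha> ` edges S\<close> aT fresh by (auto simp: \<kappa>_def \<pi>_def squeeze_def)
    qed simp
  qed
  then show ?thesis using True by (simp add: base_map_def)
qed (simp add: base_map_def)

lemma base_map_sieve_map: "sieve_map (\<lambda>S. first_base S \<inter> N S) Z (base_map Z q k)"
  unfolding sieve_map_def
proof (intro conjI allI impI)
  note l = is_tree_linear
  fix S \<alpha> assume S: "is_tree S" and "\<alpha> \<in> first_base S \<inter> N S"
  then have \<alpha>: "\<alpha> \<in> N S" "c1 \<notin> fst \<alpha> ` edges S \<or> c2 \<notin> fst \<alpha> ` edges S \<or> \<alpha> \<in> Hom Omega S L" by (auto simp: first_base_def)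
  show "base_map Z q k S \<alpha> \<in> Cell Z S"
  proof (cases "\<alpha> \<in> Hom Omega S L")
    case True
    then show ?thesis using dendroidal_setD(1)[OF Z S l push_kappa[OF S True] q] by (simp add: base_map_def)
  next
    case False
    then have m: "c1 \<notin> fst \<alpha> ` edges S \<or> c2 \<notin> fst \<alpha> ` edges S" using \<alpha>(2) by blast
    show ?thesis unfolding base_map_miss[OF S \<alpha>(1) m] by (rule sieve_mapD(1)[OF k S NK[OF S \<alpha>(1) m]])
  qed
next
  note l = is_tree_linear
  fix R S \<alpha> \<beta> assume RS: "is_tree R" "is_tree S" and \<beta>: "\<beta> \<in> Hom Omega R S" and "\<alpha> \<in> first_base S \<inter> N S"
  then have \<alpha>: "\<alpha> \<in> N S" "c1 \<notin> fst \<alpha> ` edges S \<or> c2 \<notin> fst \<alpha> ` edges S \<or> \<alpha> \<in> Hom Omega S L" by (auto simp: first_base_def)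
  show "base_map Z q k R (precomp R \<alpha> \<beta>) = Restr Z R S \<beta> (base_map Z q k S \<alpha>)"
  proof (cases "\<alpha> \<in> Hom Omega S L")
    case True
    have "precomp R \<alpha> \<beta> \<in> Hom Omega R L" by (rule sieveD[OF sieve_cells RS \<beta> True])
    then show ?thesis
      using True dendroidal_setD(3)[OF Z RS l \<beta> push_kappa[OF RS(2) True] q]
      by (simp add: base_map_def push_precomp[OF RS(1) \<beta>])
  next
    case False
    then have m: "c1 \<notin> fst \<alpha> ` edges S \<or> c2 \<notin> fst \<alpha> ` edges S" using \<alpha>(2) by blast
    then have m': "c1 \<notin> fst (precomp R \<alpha> \<beta>) ` edges R \<or> c2 \<notin> fst (precomp R \<alpha> \<beta>) ` edges R"
      using miss_precomp[OF \<beta>] by blast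
    show ?thesis
      unfolding base_map_miss[OF RS(2) \<alpha>(1) m] base_map_miss[OF RS(1) sieveD[OF N(1) RS \<beta> \<alpha>(1)] m'] push_precomp[OF RS(1) \<beta>]
      by (rule sieve_mapD(2)[OF k RS \<beta> NK[OF RS(2) \<alpha>(1) m]])
  qed
qed

end


section \<open>The two extensions and the lifting theorem\<close>

lemma second_face_contract: "second_face (contract W a)"
proof -
  have i: "a \<in> inner_edges W" using aT av by (auto simp: inner_edge_iff W_verts)
  have f: "Inner a \<in> faces W" using i by (simp add: faces_def)
  show ?thesis
    using face_map_hom(1)[OF W_tree f] face_restricts[OF W_tree f] contract_edges[OF W_tree i] W_leaves
    by (simp add: second_face_def)
qed

text \<open>Applied twice: with \<open>N\<close> all cells of \<open>W\<close>, to build the map to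
  \<open>Y\<close>, and with \<open>N\<close> the boundary, to lift it to \<open>X\<close>. By
  \<open>gen\<close>, the cells of \<open>N\<close> outside the base come from members of the family
  contained in \<open>N\<close>.\<close>

lemma extend_first_faces:
  assumes p: "inner_kan_fibration X Y p" and N: "sieve N"
    and gen: "\<And>S \<alpha>. is_tree S \<Longrightarrow> \<alpha> \<in> N S \<Longrightarrow>
      \<alpha> \<in> first_base S \<or> (\<exists>U. first_face U \<and> (\<forall>S. is_tree S \<longrightarrow> Hom Omega S U \<subseteq> N S) \<and> \<alpha> \<in> Hom Omega S U)"
    and u: "sieve_map (\<lambda>S. first_base S \<inter> N S) X u" and v: "sieve_map N Y v"
    and uv: "\<And>S \<alpha>. is_tree S \<Longrightarrow> \<alpha> \<in> first_base S \<inter> N S \<Longrightarrow> p S (u S \<alpha>) = v S \<alpha>"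
  obtains u' where "sieve_map N X u'" "\<And>S \<alpha>. \<alpha> \<in> first_base S \<inter> N S \<Longrightarrow> u' S \<alpha> = u S \<alpha>"
    "\<And>S \<alpha>. is_tree S \<Longrightarrow> \<alpha> \<in> N S \<Longrightarrow> p S (u' S \<alpha>) = v S \<alpha>"
proof -
  let ?B = "\<lambda>S. first_base S \<inter> N S"
  let ?G = "{U. first_face U \<and> (\<forall>S. is_tree S \<longrightarrow> Hom Omega S U \<subseteq> N S)}"
  let ?A = "\<lambda>S. ?B S \<union> (\<Union>U\<in>?G. Hom Omega S U)"
  have "finite ?G" by (rule finite_subset[OF _ finite_restricts[OF W_tree]]) (auto simp: first_face_def)
  have "\<exists>u'. sieve_map ?A X u' \<and> (\<forall>S. \<forall>\<alpha>\<in>?B S. u' S \<alpha> = u S \<alpha>) \<and>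
      (\<forall>S. is_tree S \<longrightarrow> (\<forall>\<alpha>\<in>?A S. p S (u' S \<alpha>) = v S \<alpha>))"
  proof (rule extend_along_faces[OF p sieve_Int[OF sieve_first_base N] \<open>finite ?G\<close>, where c = "\<lambda>U. a" and m = tree_size])
    show "is_tree U \<and> a \<in> inner_edges U" if "U \<in> ?G" for U using that first_face_tree first_face_inner by blast
    show "(\<forall>S. is_tree S \<longrightarrow> Hom Omega S (face_tree U d) \<subseteq> ?B S) \<or>
      (\<exists>V\<in>?G. tree_size V < tree_size U \<and> (\<forall>S. is_tree S \<longrightarrow> Hom Omega S (face_tree U d) \<subseteq> Hom Omega S V))"
      if "U \<in> ?G" "d \<in> faces U - {Inner a}" for U d
    proof -
      have U: "first_face U" "\<And>S. is_tree S \<Longrightarrow> Hom Omega S U \<subseteq> N S" using that(1) by auto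
      have "Hom Omega S (face_tree U d) \<subseteq> N S" if S: "is_tree S" for S
        using U(2)[OF S] restricts_hom[OF S face_restricts[OF first_face_tree(1)[OF U(1)]], of d] \<open>d \<in> faces U - {Inner a}\<close> by blast
      then show ?thesis using first_face_faces[OF U(1) that(2)] by auto
    qed
    show "\<alpha> \<in> Cell (horn U (Inner a)) S" if "U \<in> ?G" "is_tree S" "\<alpha> \<in> ?B S" "\<alpha> \<in> Hom Omega S U" for U S \<alpha>
      by (rule first_face_base[OF _ that(2) _ that(4)]) (use that(1,3) in simp_all)
    show "\<alpha> \<in> Cell (horn U (Inner a)) S"
      if "U \<in> ?G" "V \<in> ?G" "U \<noteq> V" "tree_size V \<le> tree_size U" "is_tree S" "\<alpha> \<in> Hom Omega S U" "\<alpha> \<in> Hom Omega S V" for U V S \<alpha>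
      by (rule first_face_meet[OF _ _ that(3-7)]) (use that(1,2) in simp_all)
    show "sieve_map ?B X u" by (rule u)
    show "sieve_map ?A Y v" by (rule sieve_map_subset[OF v]) blast
    show "p S (u S \<alpha>) = v S \<alpha>" if "is_tree S" "\<alpha> \<in> ?B S" for S \<alpha> by (rule uv[OF that])
  qed
  then obtain u' where u': "sieve_map ?A X u'" "\<forall>S. \<forall>\<alpha>\<in>?B S. u' S \<alpha> = u S \<alpha>"
    "\<forall>S. is_tree S \<longrightarrow> (\<forall>\<alpha>\<in>?A S. p S (u' S \<alpha>) = v S \<alpha>)" by (elim exE conjE)
  have NA: "N S \<subseteq> ?A S" if S: "is_tree S" for S using gen[OF S] by blast
  show thesis
  proof (rule that[of u'])
    show "sieve_map N X u'" by (rule sieve_map_subset[OF u'(1) NA])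
    show "u' S \<alpha> = u S \<alpha>" if "\<alpha> \<in> ?B S" for S \<alpha> using u'(2) that by blast
    show "p S (u' S \<alpha>) = v S \<alpha>" if "is_tree S" "\<alpha> \<in> N S" for S \<alpha>
      by (rule u'(3)[rule_format, OF that(1) subsetD[OF NA[OF that(1)] that(2)]])
  qed
qed

text \<open>Every face of \<open>W\<close> that cuts into the forest is itself a member of the
  family or lies in the base, by \<open>first_face_faces\<close> for \<open>W\<close>.\<close>

lemma boundary_generated:
  assumes S: "is_tree S" and \<alpha>: "\<alpha> \<in> boundary S"
  shows "\<alpha> \<in> first_base S \<or> (\<exists>U. first_face U \<and> (\<forall>S. is_tree S \<longrightarrow> Hom Omega S U \<subseteq> boundary S) \<and> \<alpha> \<in> Hom Omega S U)"
proof -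
  obtain d where d: "d \<in> FW" "\<alpha> \<in> Hom Omega S (face_tree W d)" using boundary_iff[OF S] \<alpha> by blast
  have sub: "Hom Omega S (face_tree W d) \<subseteq> boundary S" if "is_tree S" for S
    using boundary_iff[OF that] d(1) by blast
  have "d \<in> faces W - {Inner a}" using d(1) FW_faces by blast
  from first_face_faces[OF first_face_W this] show ?thesis
  proof
    assume "\<forall>S. is_tree S \<longrightarrow> Hom Omega S (face_tree W d) \<subseteq> first_base S"
    then show ?thesis using d(2) S by blast
  next
    assume "first_face (face_tree W d) \<and> tree_size (face_tree W d) < tree_size W"
    then show ?thesis using d(2) sub by blast
  qed
qed

lemma extend_second_base:
  assumes p: "inner_kan_fibration X Y p"
    and u: "sieve_map second_base X u" and v: "sieve_map (cells W) Y v"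
    and uv: "\<And>S \<alpha>. is_tree S \<Longrightarrow> \<alpha> \<in> second_base S \<Longrightarrow> p S (u S \<alpha>) = v S \<alpha>"
  obtains u' where "sieve_map (cells (contract W a)) X u'"
    "\<And>S \<alpha>. \<alpha> \<in> second_base S \<Longrightarrow> \<alpha> \<in> Hom Omega S (contract W a) \<Longrightarrow> u' S \<alpha> = u S \<alpha>"
    "\<And>S \<alpha>. is_tree S \<Longrightarrow> \<alpha> \<in> Hom Omega S (contract W a) \<Longrightarrow> p S (u' S \<alpha>) = v S \<alpha>"
proof -
  let ?G = "{U. second_face U}"
  let ?A = "\<lambda>S. second_base S \<union> (\<Union>U\<in>?G. Hom Omega S U)"
  have "finite ?G" by (rule finite_subset[OF _ finite_restricts[OF W_tree]]) (auto simp: second_face_def)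
  have sv: "sieve second_base"
  proof -
    have "precomp R \<alpha> \<beta> \<in> second_base R"
      if RS: "is_tree R" "is_tree S" and \<beta>: "\<beta> \<in> Hom Omega R S" and \<alpha>: "\<alpha> \<in> second_base S" for R S \<alpha> \<beta>
      using \<alpha> sieveD[OF sieve_boundary RS \<beta>, of \<alpha>] sieveD[OF sieve_cells RS \<beta>, of \<alpha> W] miss_precomp[OF \<beta>]
      unfolding second_base_def by blast
    then show ?thesis unfolding sieve_def by blast
  qed
  have "\<exists>u'. sieve_map ?A X u' \<and> (\<forall>S. \<forall>\<alpha>\<in>second_base S. u' S \<alpha> = u S \<alpha>) \<and>
      (\<forall>S. is_tree S \<longrightarrow> (\<forall>\<alpha>\<in>?A S. p S (u' S \<alpha>) = v S \<alpha>))"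
  proof (rule extend_along_faces[OF p sv \<open>finite ?G\<close>, where c = "\<lambda>U. c1" and m = tree_size])
    show "is_tree U \<and> c1 \<in> inner_edges U" if "U \<in> ?G" for U
      using that second_face_tree(1) span_inner(1)[OF second_face_spans] by blast
    show "(\<forall>S. is_tree S \<longrightarrow> Hom Omega S (face_tree U d) \<subseteq> second_base S) \<or>
      (\<exists>V\<in>?G. tree_size V < tree_size U \<and> (\<forall>S. is_tree S \<longrightarrow> Hom Omega S (face_tree U d) \<subseteq> Hom Omega S V))"
      if "U \<in> ?G" "d \<in> faces U - {Inner c1}" for U d
      using second_face_faces[OF _ that(2)] that(1) by auto
    show "\<alpha> \<in> Cell (horn U (Inner c1)) S" if "U \<in> ?G" "is_tree S" "\<alpha> \<in> second_base S" "\<alpha> \<in> Hom Omega S U" for U S \<alpha>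
      by (rule second_face_base[OF _ that(2-4)]) (use that(1) in simp)
    show "\<alpha> \<in> Cell (horn U (Inner c1)) S"
      if "U \<in> ?G" "V \<in> ?G" "U \<noteq> V" "tree_size V \<le> tree_size U" "is_tree S" "\<alpha> \<in> Hom Omega S U" "\<alpha> \<in> Hom Omega S V" for U V S \<alpha>
      by (rule second_face_meet[OF _ _ that(3-7)]) (use that(1,2) in simp_all)
    show "sieve_map second_base X u" by (rule u)
    show "sieve_map ?A Y v"
    proof (rule sieve_map_subset[OF v])
      fix S assume S: "is_tree S"
      show "?A S \<subseteq> Hom Omega S W" using restricts_hom[OF S second_face_tree(2)] boundary_hom by (auto simp: second_base_def)
    qed
    show "p S (u S \<alpha>) = v S \<alpha>" if "is_tree S" "\<alpha> \<in> second_base S" for S \<alpha> by (rule uv[OF that])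
  qed
  then obtain u' where u': "sieve_map ?A X u'" "\<forall>S. \<forall>\<alpha>\<in>second_base S. u' S \<alpha> = u S \<alpha>"
    "\<forall>S. is_tree S \<longrightarrow> (\<forall>\<alpha>\<in>?A S. p S (u' S \<alpha>) = v S \<alpha>)" by (elim exE conjE)
  have cA: "Hom Omega S (contract W a) \<subseteq> ?A S" for S using second_face_contract by blast
  show thesis
  proof (rule that[of u'])
    show "sieve_map (cells (contract W a)) X u'" by (rule sieve_map_subset[OF u'(1) cA])
    show "u' S \<alpha> = u S \<alpha>" if "\<alpha> \<in> second_base S" for S \<alpha> using u'(2) that by blast
    show "p S (u' S \<alpha>) = v S \<alpha>" if "is_tree S" "\<alpha> \<in> Hom Omega S (contract W a)" for S \<alpha>
      by (rule u'(3)[rule_format, OF that(1) subsetD[OF cA that(2)]])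
  qed
qed

theorem special_outer_horn:
  assumes X: "infinity_operad X" and Y: "infinity_operad Y" and p: "inner_kan_fibration X Y p"
    and f: "sieve_map (Cell (horn T (Outer ({a}, b)))) X f" and g: "sieve_map (cells T) Y g"
    and pf: "\<And>S \<alpha>. is_tree S \<Longrightarrow> \<alpha> \<in> Cell (horn T (Outer ({a}, b))) S \<Longrightarrow> p S (f S \<alpha>) = g S \<alpha>"
    and re: "root_edge \<in> Cell (horn T (Outer ({a}, b))) (linear_tree 1)"
    and q: "q \<in> simplices X 3"
    and q1: "face_of X 3 [0, 1, 3] q = face_of X 1 [0, 1, 1] (f (linear_tree 1) root_edge)"
    and q2: "face_of X 3 [0, 2, 3] q = face_of X 1 [0, 0, 1] (f (linear_tree 1) root_edge)"
  shows "\<exists>h. sieve_map (cells T) X h \<and> (\<forall>S. is_tree S \<longrightarrow> (\<forall>\<alpha>\<in>Hom Omega S T. p S (h S \<alpha>) = g S \<alpha>)) \<and>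
    (\<forall>S. is_tree S \<longrightarrow> (\<forall>\<alpha>\<in>Cell (horn T (Outer ({a}, b))) S. h S \<alpha> = f S \<alpha>))"
proof -
  let ?H = "Cell (horn T (Outer ({a}, b)))"
  note l = is_tree_linear
  have XD': "dendroidal_set X" and YD: "dendroidal_set Y" using X Y by (simp_all add: infinity_operad_def)
  have pm: "dendroidal_map X Y p" using p by (simp add: inner_kan_fibration_def)
  have HT: "\<alpha> \<in> Hom Omega S T" if "is_tree S" "\<alpha> \<in> ?H S" for S \<alpha> using horn_T_iff[OF that(1)] that(2) by blast
  let ?u = "f (linear_tree 1) root_edge" and ?q = "p (linear_tree 3) q"
  have u: "?u \<in> simplices X 1" by (rule sieve_mapD(1)[OF f l re])
  have along_p: "p (linear_tree m) (face_of X n is x) = face_of Y n is (p (linear_tree n) x)"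
    if "x \<in> simplices X n" "vertex_list n is" "length is = Suc m" for x m n "is"
    using dendroidal_mapD(2)[OF pm l l mono_map_hom[OF vertex_list_mono[OF that(2)]] that(1)] that(3)
    by (simp add: face_of_def along_def)
  have pu: "p (linear_tree 1) ?u = g (linear_tree 1) root_edge" by (rule pf[OF l re])
  have pq: "?q \<in> simplices Y 3" by (rule dendroidal_mapD(1)[OF pm l q])
  have pq1: "face_of Y 3 [0, 1, 3] ?q = face_of Y 1 [0, 1, 1] (g (linear_tree 1) root_edge)"
    "face_of Y 3 [0, 2, 3] ?q = face_of Y 1 [0, 0, 1] (g (linear_tree 1) root_edge)"
    unfolding pu[symmetric]
    using along_p[OF q, of "[0, 1, 3]" 2] along_p[OF q, of "[0, 2, 3]" 2]
      along_p[OF u, of "[0, 1, 1]" 2] along_p[OF u, of "[0, 0, 1]" 2] q1 q2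
    by (simp_all add: vertex_list_def)
  have hornX: "push S \<pi> \<alpha> \<in> ?H S"
    if "is_tree S" "\<alpha> \<in> boundary S" "c1 \<notin> fst \<alpha> ` edges S \<or> c2 \<notin> fst \<alpha> ` edges S" for S \<alpha>
    using push_pi_horn[OF that(1) boundary_hom[OF that(2)] that(3)] that(2) by blast
  have bW: "boundary S \<subseteq> Hom Omega S W" for S using boundary_hom by blast
  have bX: "sieve_map (\<lambda>S. first_base S \<inter> boundary S) X (base_map X q f)"
    by (rule base_map_sieve_map[OF XD' q f re q1 q2 sieve_boundary bW]) (rule hornX)
  have bXm: "base_map X q f S \<alpha> = f S (push S \<pi> \<alpha>)"
    if "is_tree S" "\<alpha> \<in> boundary S" "c1 \<notin> fst \<alpha> ` edges S \<or> c2 \<notin> fst \<alpha> ` edges S" for S \<alpha>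
    by (rule base_map_miss[OF XD' q f re q1 q2 sieve_boundary bW _ that]) (rule hornX)
  have reT: "root_edge \<in> cells T (linear_tree 1)" by (rule HT[OF l re])
  have bY: "sieve_map (\<lambda>S. first_base S \<inter> Hom Omega S W) Y (base_map Y ?q g)"
    by (rule base_map_sieve_map[OF YD pq g reT pq1 sieve_cells order_refl]) (rule push_pi_hom)
  have bYm: "base_map Y ?q g S \<alpha> = g S (push S \<pi> \<alpha>)"
    if "is_tree S" "\<alpha> \<in> Hom Omega S W" "c1 \<notin> fst \<alpha> ` edges S \<or> c2 \<notin> fst \<alpha> ` edges S" for S \<alpha>
    by (rule base_map_miss[OF YD pq g reT pq1 sieve_cells order_refl _ that]) (rule push_pi_hom)
  have bWi: "first_base S \<inter> Hom Omega S W = first_base S" for S by (auto simp: first_base_def)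
  \<comment> \<open>Lifting against the map to the terminal dendroidal set is mere
    extension.\<close>
  obtain v where v1: "sieve_map (cells W) Y v"
    and v2: "\<And>S \<alpha>. \<alpha> \<in> first_base S \<inter> Hom Omega S W \<Longrightarrow> v S \<alpha> = base_map Y ?q g S \<alpha>"
  proof (rule extend_first_faces[OF _ sieve_cells _ bY])
    show "inner_kan_fibration Y terminal_psh (\<lambda>S x. ())" using Y by (simp add: infinity_operad_def)
    show "\<alpha> \<in> first_base S \<or> (\<exists>U. first_face U \<and> (\<forall>S. is_tree S \<longrightarrow> Hom Omega S U \<subseteq> Hom Omega S W) \<and> \<alpha> \<in> Hom Omega S U)"
      if "\<alpha> \<in> Hom Omega S W" for S \<alpha> using that first_face_W by blast
    show "sieve_map (cells W) terminal_psh (\<lambda>S \<alpha>. ())" by (simp add: sieve_map_def terminal_psh_def)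
  qed (rule HOL.refl, rule that)
  note v = v1 v2[unfolded bWi]
  \<comment> \<open>All that matters about \<open>v\<close> beyond the base map: on cells missing 1
    or 2 it is \<open>g\<close> after the collapse, whatever the fillers are elsewhere.\<close>
  have vm: "v S \<alpha> = g S (push S \<pi> \<alpha>)"
    if "is_tree S" "\<alpha> \<in> Hom Omega S W" "c1 \<notin> fst \<alpha> ` edges S \<or> c2 \<notin> fst \<alpha> ` edges S" for S \<alpha>
  proof -
    have "\<alpha> \<in> first_base S" using that(2,3) unfolding first_base_def by blast
    then show ?thesis using v(2) bYm[OF that] by simp
  qed
  have comm: "p S (base_map X q f S \<alpha>) = v S \<alpha>" if S: "is_tree S" and \<alpha>: "\<alpha> \<in> first_base S \<inter> boundary S" for S \<alpha>
  proof (cases "\<alpha> \<in> Hom Omega S L")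
    case True
    then show ?thesis
      using v(2)[of \<alpha> S] \<alpha> dendroidal_mapD(2)[OF pm S l push_kappa[OF S True] q] by (simp add: base_map_def)
  next
    case False
    then have m: "c1 \<notin> fst \<alpha> ` edges S \<or> c2 \<notin> fst \<alpha> ` edges S" using \<alpha> by (auto simp: first_base_def)
    have "\<alpha> \<in> boundary S" using \<alpha> by blast
    then show ?thesis using bXm[OF S _ m] vm[OF S boundary_hom m] pf[OF S hornX[OF S _ m]] by simp
  qed
  have vb: "sieve_map boundary Y v" by (rule sieve_map_subset[OF v(1) bW])
  obtain u1 where u1: "sieve_map boundary X u1" "\<And>S \<alpha>. \<alpha> \<in> first_base S \<inter> boundary S \<Longrightarrow> u1 S \<alpha> = base_map X q f S \<alpha>"
    "\<And>S \<alpha>. is_tree S \<Longrightarrow> \<alpha> \<in> boundary S \<Longrightarrow> p S (u1 S \<alpha>) = v S \<alpha>"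
    by (rule extend_first_faces[OF p sieve_boundary _ bX vb])
      (rule boundary_generated, assumption, assumption, rule comm, assumption, assumption, rule that)
  have u1m: "u1 S \<alpha> = f S (push S \<pi> \<alpha>)"
    if "is_tree S" "\<alpha> \<in> boundary S" "c1 \<notin> fst \<alpha> ` edges S \<or> c2 \<notin> fst \<alpha> ` edges S" for S \<alpha>
  proof -
    have "\<alpha> \<in> first_base S \<inter> boundary S" using that(2,3) boundary_hom[OF that(2)] unfolding first_base_def by blast
    then show ?thesis using u1(2) bXm[OF that] by simp
  qed
  \<comment> \<open>By \<open>u1m\<close> the clauses agree where both apply, so \<open>u2\<close>
    is compatible with restriction on the union of the two parts.\<close>
  define u2 where "u2 S \<alpha> = (if \<alpha> \<in> boundary S then u1 S \<alpha> else f S (push S \<pi> \<alpha>))" for S \<alpha>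
  have u2m: "u2 S \<alpha> = f S (push S \<pi> \<alpha>)"
    if "is_tree S" "c1 \<notin> fst \<alpha> ` edges S \<or> c2 \<notin> fst \<alpha> ` edges S" for S \<alpha>
    using u1m[OF that(1) _ that(2)] by (simp add: u2_def)
  have second_base_cases: "\<alpha> \<in> boundary S \<or> (\<alpha> \<in> Hom Omega S W \<and> a \<notin> fst \<alpha> ` edges S \<and> c2 \<notin> fst \<alpha> ` edges S \<and> \<alpha> \<notin> boundary S)"
    if "\<alpha> \<in> second_base S" for S \<alpha> using that unfolding second_base_def by blast
  have u2s: "sieve_map second_base X u2"
    unfolding sieve_map_def
  proof (intro conjI allI impI)
    fix S \<alpha> assume S: "is_tree S" and \<alpha>: "\<alpha> \<in> second_base S"
    from second_base_cases[OF \<alpha>] show "u2 S \<alpha> \<in> Cell X S"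
    proof (elim disjE conjE)
      assume "\<alpha> \<in> boundary S"
      then show ?thesis using sieve_mapD(1)[OF u1(1) S] by (simp add: u2_def)
    next
      assume m: "\<alpha> \<in> Hom Omega S W" "a \<notin> fst \<alpha> ` edges S" "c2 \<notin> fst \<alpha> ` edges S" "\<alpha> \<notin> boundary S"
      then show ?thesis using sieve_mapD(1)[OF f S push_pi_horn[OF S m(1)]] by (simp add: u2_def)
    qed
  next
    fix R S \<alpha> \<beta> assume RS: "is_tree R" "is_tree S" and \<beta>: "\<beta> \<in> Hom Omega R S" and \<alpha>: "\<alpha> \<in> second_base S"
    from second_base_cases[OF \<alpha>] show "u2 R (precomp R \<alpha> \<beta>) = Restr X R S \<beta> (u2 S \<alpha>)"
    proof (elim disjE conjE)
      assume "\<alpha> \<in> boundary S"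
      then show ?thesis using sieve_mapD(2)[OF u1(1) RS \<beta>] sieveD[OF sieve_boundary RS \<beta>] by (simp add: u2_def)
    next
      assume m: "\<alpha> \<in> Hom Omega S W" "a \<notin> fst \<alpha> ` edges S" "c2 \<notin> fst \<alpha> ` edges S" "\<alpha> \<notin> boundary S"
      have "u2 R (precomp R \<alpha> \<beta>) = f R (push R \<pi> (precomp R \<alpha> \<beta>))"
        by (rule u2m[OF RS(1)]) (use miss_precomp[OF \<beta> m(3)] in blast)
      also have "\<dots> = f R (precomp R (push S \<pi> \<alpha>) \<beta>)" by (simp add: push_precomp[OF RS(1) \<beta>])
      also have "\<dots> = Restr X R S \<beta> (f S (push S \<pi> \<alpha>))"
        by (rule sieve_mapD(2)[OF f RS \<beta> push_pi_horn[OF RS(2) m(1)]]) (use m in blast)+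
      finally show ?thesis using u2m[OF RS(2)] m(3) by simp
    qed
  qed
  have u2v: "p S (u2 S \<alpha>) = v S \<alpha>" if S: "is_tree S" and \<alpha>: "\<alpha> \<in> second_base S" for S \<alpha>
    using second_base_cases[OF \<alpha>]
  proof (elim disjE conjE)
    assume "\<alpha> \<in> boundary S"
    then show ?thesis using u1(3)[OF S] by (simp add: u2_def)
  next
    assume m: "\<alpha> \<in> Hom Omega S W" "a \<notin> fst \<alpha> ` edges S" "c2 \<notin> fst \<alpha> ` edges S" "\<alpha> \<notin> boundary S"
    then show ?thesis using pf[OF S push_pi_horn[OF S m(1)]] vm[OF S m(1)] by (simp add: u2_def)
  qed
  obtain u3 where u3: "sieve_map (cells (contract W a)) X u3"
    "\<And>S \<alpha>. \<alpha> \<in> second_base S \<Longrightarrow> \<alpha> \<in> Hom Omega S (contract W a) \<Longrightarrow> u3 S \<alpha> = u2 S \<alpha>"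
    "\<And>S \<alpha>. is_tree S \<Longrightarrow> \<alpha> \<in> Hom Omega S (contract W a) \<Longrightarrow> p S (u3 S \<alpha>) = v S \<alpha>"
    by (rule extend_second_base[OF p u2s v(1)]) (rule u2v, assumption, assumption, rule that)
  have ai: "a \<in> inner_edges W" using aT av by (auto simp: inner_edge_iff W_verts)
  have rho: "push S \<rho> \<alpha> \<in> Hom Omega S (contract W a)" if "is_tree S" "\<alpha> \<in> Hom Omega S T" for S \<alpha>
    using hom_contract_iff[OF that(1) W_tree ai] push_rho[OF that] by blast
  \<comment> \<open>The cells \<open>push S \<rho> \<alpha>\<close> miss 0 and 1 and collapse back
    to \<open>\<alpha>\<close>. The former puts them into \<open>F \<star> \<Delta>{1,2,3}\<close>,
    where \<open>u3\<close> lives; the latter makes \<open>vm\<close> return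
    \<open>g\<close>.\<close>
  define h where "h S \<alpha> = u3 S (push S \<rho> \<alpha>)" for S \<alpha>
  show ?thesis
  proof (intro exI[of _ h] conjI allI impI ballI)
    show "sieve_map (cells T) X h"
      unfolding sieve_map_def
    proof (intro conjI allI impI)
      show "h S \<alpha> \<in> Cell X S" if "is_tree S" "\<alpha> \<in> Hom Omega S T" for S \<alpha>
        unfolding h_def by (rule sieve_mapD(1)[OF u3(1) that(1) rho[OF that]])
      show "h R (precomp R \<alpha> \<beta>) = Restr X R S \<beta> (h S \<alpha>)"
        if "is_tree R" "is_tree S" "\<beta> \<in> Hom Omega R S" "\<alpha> \<in> Hom Omega S T" for R S \<alpha> \<beta>
        unfolding h_def push_precomp[OF that(1,3)] by (rule sieve_mapD(2)[OF u3(1) that(1-3) rho[OF that(2,4)]])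
    qed
    show "p S (h S \<alpha>) = g S \<alpha>" if S: "is_tree S" "\<alpha> \<in> Hom Omega S T" for S \<alpha>
      using u3(3)[OF S(1) rho[OF S]] vm[OF S(1) push_rho(1)[OF S]] push_rho[OF S] by (simp add: h_def)
    show "h S \<alpha> = f S \<alpha>" if S: "is_tree S" and \<alpha>: "\<alpha> \<in> ?H S" for S \<alpha>
    proof -
      have T': "\<alpha> \<in> Hom Omega S T" by (rule HT[OF S \<alpha>])
      note r = push_rho[OF S T']
      have "a \<notin> fst \<alpha> ` edges S \<or> misses_face T S (fst \<alpha>)" using horn_T_iff[OF S, of \<alpha>] \<alpha> by blast
      \<comment> \<open>Cells of the horn without \<open>a\<close> go to
        \<open>F \<star> \<Delta>{3}\<close>, those missing a face of the forest to
        \<open>\<partial>F \<star> \<Delta>{2,3}\<close>; on both, \<open>u3\<close> is still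
        \<open>f\<close> after the collapse.\<close>
      then have "push S \<rho> \<alpha> \<in> second_base S"
      proof
        assume "a \<notin> fst \<alpha> ` edges S"
        then have "c2 \<notin> fst (push S \<rho> \<alpha>) ` edges S"
          using hom_edge[OF T'] fresh by (auto simp: push_def \<rho>_def image_iff split: if_splits)
        then show ?thesis using r(1,3) by (simp add: second_base_def)
      next
        assume "misses_face T S (fst \<alpha>)"
        then show ?thesis using misses_face_pi[OF S r(1)] r(1,2) by (simp add: second_base_def boundary_def)
      qed
      then show ?thesis using u3(2)[OF _ rho[OF S T']] u2m[OF S] r(2,4) by (simp add: h_def)
    qed
  qed
qed

end

theorem theorem4p2:
  fixes T :: tree and r :: vert
    and X :: "'x dset" and Y :: "'y dset"
    and p :: "tree \<Rightarrow> 'x \<Rightarrow> 'y"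
    and f :: "tree \<Rightarrow> tree_mor \<Rightarrow> 'x"
    and g :: "tree \<Rightarrow> tree_mor \<Rightarrow> 'y"
  assumes "is_tree T" and "card (verts T) \<ge> 2"
    and "r \<in> verts T" and "snd r = root T" and "card (fst r) = 1"
    and "infinity_operad X" and "infinity_operad Y" and "inner_kan_fibration X Y p"
    and "dendroidal_map (horn T (Outer r)) X f"
    and "dendroidal_map (representable Omega T) Y g"
    and "\<forall>S\<in>Ob Omega. \<forall>x\<in>Cell (horn T (Outer r)) S. p S (f S x) = g S x"
    and "weakly_invertible X (\<lambda>S \<alpha>. f S (unary_vertex_map T r S \<alpha>))"
  shows "\<exists>h. dendroidal_map (representable Omega T) X h \<and>
           (\<forall>S\<in>Ob Omega. \<forall>x\<in>Cell (representable Omega T) S. p S (h S x) = g S x) \<and>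
           (\<forall>S\<in>Ob Omega. \<forall>x\<in>Cell (horn T (Outer r)) S. h S x = f S x)"
proof -
  note T = assms(1)
  obtain a where r: "r = ({a}, root T)" using assms(4,5) by (cases r) (auto simp: card_1_singleton_iff)
  have ra: "({a}, root T) \<in> verts T" using assms(3) r by simp
  \<comment> \<open>The only edge at \<open>r\<close> that can be inner is \<open>a\<close>. As
    \<open>r\<close> is an outer vertex, by the presence of a second vertex, \<open>a\<close> is
    inner and therefore the output of a vertex.\<close>
  have "Outer r \<in> faces T" by (rule unary_vertex_map_horn(2)[OF assms(1-5)])
  then have "card (incident r \<inter> inner_edges T) = 1" by (auto simp: faces_def outer_verts_def)
  moreover have "incident r \<inter> inner_edges T \<subseteq> {a}" using r by (auto simp: incident_def inner_edges_def)
  ultimately have "a \<in> inner_edges T" by (auto simp: card_1_singleton_iff)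
  then obtain I0 where av: "(I0, a) \<in> verts T" by (auto simp: inner_edge_iff)
  obtain c1 where c1: "c1 \<notin> edges T" using ex_new_if_finite[OF infinite_UNIV_nat is_treeD(1)[OF T]] by blast
  obtain c2 where c2: "c2 \<notin> insert c1 (edges T)"
    using ex_new_if_finite[OF infinite_UNIV_nat, of "insert c1 (edges T)"] is_treeD(1)[OF T] by blast
  interpret unary_root T a c1 c2 I0
    by unfold_locales (use T ra av c1 c2 in auto)
  let ?L = "linear_tree 1"
  note l = is_tree_linear[of 1]
  have id: "Id Omega ?L \<in> Hom Omega ?L ?L" using category_Omega l unfolding category_def Omega_sel(1) by blast
  \<comment> \<open>By the Yoneda lemma the 1-simplex \<open>f(r)\<close> is the value of
    \<open>f\<close> at \<open>root_edge\<close>.\<close>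
  have "unary_vertex_map T r ?L (Id Omega ?L) = precomp ?L root_edge (Id Omega ?L)"
    unfolding unary_vertex_map_def Comp_Omega root_edge_def r fst_conv snd_conv the_elem_eq ..
  also have "\<dots> = root_edge"
    unfolding root_edge_def precomp_edge_mor[OF l id] by (rule edge_mor_cong[OF l]) (simp add: Omega_sel)
  finally have uv: "unary_vertex_map T r ?L (Id Omega ?L) = root_edge" .
  have re: "root_edge \<in> Cell (horn T (Outer ({a}, root T))) ?L"
  proof -
    have "Id Omega ?L \<in> Cell (representable Omega ?L) ?L" "?L \<in> Ob Omega"
      using id l by (simp_all add: representable_def Omega_sel(1))
    then have "unary_vertex_map T r ?L (Id Omega ?L) \<in> Cell (horn T (Outer r)) ?L"
      using unary_vertex_map_horn(1)[OF assms(1-5)] unfolding presheaf_map_def by blast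
    then show ?thesis unfolding uv unfolding r .
  qed
  have f: "sieve_map (Cell (horn T (Outer ({a}, root T)))) X f" using assms(9) r by (simp add: dendroidal_map_horn)
  have g: "sieve_map (cells T) Y g" using assms(10) by (simp add: dendroidal_map_representable)
  have u: "f ?L root_edge \<in> simplices X 1" by (rule sieve_mapD(1)[OF f l re])
  have iso: "is_isomorphism (tau (underlying_sset X)) (svertex (underlying_sset X) 1 0 (f ?L root_edge))
      (svertex (underlying_sset X) 1 1 (f ?L root_edge)) (tau_mor (underlying_sset X) (f ?L root_edge))"
    using assms(12) unfolding weakly_invertible_def Let_def uv .
  obtain v w where "triangle X (f ?L root_edge) v (face_of X 0 [0, 0] (face_of X 1 [0] (f ?L root_edge)))"
    "triangle X v w (face_of X 0 [0, 0] (face_of X 1 [1] (f ?L root_edge)))"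
    by (rule isomorphism_inverses[OF assms(6) u iso])
  then obtain q where q: "q \<in> simplices X 3"
    "face_of X 3 [0, 1, 3] q = face_of X 1 [0, 1, 1] (f ?L root_edge)"
    "face_of X 3 [0, 2, 3] q = face_of X 1 [0, 0, 1] (f ?L root_edge)"
    using coherent_equivalence[OF assms(6) u] by metis
  have pf: "p S (f S \<alpha>) = g S \<alpha>" if "is_tree S" "\<alpha> \<in> Cell (horn T (Outer ({a}, root T))) S" for S \<alpha>
    using assms(11) that r by (simp add: Omega_sel(1))
  have "\<exists>h. sieve_map (cells T) X h \<and> (\<forall>S. is_tree S \<longrightarrow> (\<forall>\<alpha>\<in>Hom Omega S T. p S (h S \<alpha>) = g S \<alpha>)) \<and>
      (\<forall>S. is_tree S \<longrightarrow> (\<forall>\<alpha>\<in>Cell (horn T (Outer ({a}, root T))) S. h S \<alpha> = f S \<alpha>))"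
    by (rule special_outer_horn[OF assms(6-8) f g _ re q]) (rule pf)
  then obtain h where "sieve_map (cells T) X h" "\<forall>S. is_tree S \<longrightarrow> (\<forall>\<alpha>\<in>Hom Omega S T. p S (h S \<alpha>) = g S \<alpha>)"
    "\<forall>S. is_tree S \<longrightarrow> (\<forall>\<alpha>\<in>Cell (horn T (Outer ({a}, root T))) S. h S \<alpha> = f S \<alpha>)"
    by (elim exE conjE)
  then show ?thesis
    unfolding dendroidal_map_representable r by (intro exI[of _ h]) (simp add: Omega_sel(1) representable_def)
qed

end
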